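(* Let $\mathfrak g$ be a simple finite-dimensional complex Lie algebra with dual Coxeter number $g$, and $\ell\in\mathbb N$. From the fields $(\psi^a(z))$ and $(B^a(z))$ on $H=L(V_0,\ell)\otimes\mathcal F_{NS}^{\mathfrak g}$ one generates $S^a(z)$ and $X^a=B^a-S^a$, and a vertex operator superalgebra on $H$, with Virasoro vector $$\omega=\frac12\sum_a\psi^a_{-3/2}\psi^a_{-1/2}\Omega+\frac1{2(\ell+g)}\sum_a(X^a_{-1})^2\Omega,$$ and central charge $$c=2\|\omega\|^2=\frac{\dim\mathfrak g}2+\frac{\ell\dim\mathfrak g}{\ell+g}=\frac32\cdot\frac{\ell+\frac13g}{\ell+g}\dim(\mathfrak g).$$
   Context: Lie algebra data. $\mathfrak g$ has a basis $(X_a)_{1\le a\le\dim\mathfrak g}$ with $[X_a,X_b]=i\sum_c\Gamma_{ab}^cX_c$, $\Gamma_{ab}^c\in\mathbb R$ totally antisymmetric, normalized so that $\sum_aX_a^2$ is exactly the Casimir (highest root of squared length 2); then $\sum_{a,c}\Gamma_{ac}^b\Gamma_{ac}^d=2g\,\delta_{bd}$. $\widehat{\mathfrak g}_+$ is spanned by $X^a_n$ ($n\in\mathbb Z$) and a central $\mathcal L$, with $[X_m^a,X_n^b]=i\sum_c\Gamma_{ab}^cX^c_{m+n}+m\,\delta_{ab}\delta_{m+n,0}\mathcal L$, $(X_n^a)^\star=X_{-n}^a$. $L(V_0,\ell)$ is its irreducible unitary highest weight representation with $\mathcal L=\ell$ and trivial one-dimensional lowest energy subspace. $\widehat{\mathfrak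 g}_-$ is generated by $\psi^a_m$, $m\in\mathbb Z+\frac12$, with $[\psi^a_m,\psi^b_n]_+=\delta_{ab}\delta_{m+n,0}$, $(\psi^a_m)^\star=\psi^a_{-m}$; $\mathcal F_{NS}^{\mathfrak g}$ is its irreducible unitary representation generated by a unit vector annihilated by $\psi^a_m$, $m>0$. On $H$, $X^a_n$ acts on the first factor, $\psi^a_m$ on the second; $\Omega$ is the tensor product of the two unit vacuum vectors. Fields and locality. A field on a prehilbert space $H$ is $A(z)=\sum_{n\in\mathbb Z}A(n)z^{-n-1}\in(\mathrm{End}\,H)[[z,z^{-1}]]$. Two fields $A,B$ are local with sign $\varepsilon\in\mathbb Z_2$ if there is $N\in\mathbb N$ such that for all $c,d\in H$ there is $X\in(z-w)^{-N}\mathbb C[z^{\pm1},w^{\pm1}]$ with $X(z,w)=(A(z)B(w)c,d)$ for $|z|>|w|$ and $X(z,w)=(-1)^\varepsilon(B(w)A(z)c,d)$ for $|w|>|z|$. With $[X,Y]_\varepsilon=XY-(-1)^\varepsilon YX$, one defines $A_nB(w)=\sum_m(A_nB)(m)w^{-m-1}$ by $(A_nB)(m)=\sum_{p=0}^n(-1)^p\binom np[A(n-p),B(m+p)]_\varepsilon$ if $n\ge0$ and $(A_nB)(m)=\sum_{p\ge0}\binom{p-n-1}p\big(A(n-p)B(m+p)-(-1)^{\varepsilon+n}B(m+n-p)A(p)\big)$ if $n<0$. Fields here: $\psi^a(z)=\sum_n\psi^a_{n+1/2}z^{-n-1}$, $X^a(z)=\sum_nX^a_nz^{-n-1}$, $S^c(z)=\sum_nS^c_nz^{-n-1}=-\frac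 i2\sum_{a,b}\Gamma_{ab}^c\,\psi^a_{-1}\psi^b(z)$ (operation $A_{-1}B$ on fields), $B^a=X^a+S^a$. "Generates": $\mathcal S$ is the linear span of the smallest set of fields containing $\mathrm{Id}$ and the given fields and stable under $(A,B)\mapsto A_nB$ ($n\in\mathbb Z$) and $A\mapsto A'$ (and, by linearity, extended to linear combinations); $V:H\to\mathcal S$ is the inverse of the linear bijection $\mathcal S\to H$, $A\mapsto A(z)\Omega|_{z=0}$. A vertex operator superalgebra is $(H,V,\Omega,\omega)$ with $H=H_{\bar0}\oplus H_{\bar1}$ a prehilbert superspace, $V:H\to(\mathrm{End}\,H)[[z,z^{-1}]]$ linear ($V(a)(z)$ written $V(a,z)$), $\Omega,\omega\in H$, such that, with $\mathcal S_\varepsilon=V(H_\varepsilon)$, $\mathcal S=\mathcal S_{\bar0}\oplus\mathcal S_{\bar1}$: (1) for all $A\in\mathcal S$, $n\in\mathbb N$: $A(n)\Omega=0$; $V(a,z)\Omega|_{z=0}=a$; $V(\Omega,z)=\mathrm{Id}$. (2) $\{A(n):A\in\mathcal S,n\in\mathbb Z\}$ acts irreducibly on $H$. (3) for $A\in\mathcal S_{\varepsilon_1}$, $B\in\mathcal S_{\varepsilon_2}$: $A,B$ are local with sign $\varepsilon_1\varepsilon_2$, and $A_nB\in\mathcal S_{\varepsilon_1+\varepsilon_2}$. (4) $V(\omega,z)=\sum_nL_nz^{-n-2}$ with $L_0\Omega=L_{-1}\Omega=0$, $\omega=L_{-2}\Omega$, and $[L_m,L_n]=(m-n)L_{m+n}+\frac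 c{12}m(m^2-1)\delta_{m+n,0}$, $c=2\|\omega\|^2$ (the central charge). (5) $L_0$ decomposes $H$ into $\bigoplus_{n\in\frac12\mathbb N}H_n$ ($L_0=n$ on $H_n$), $\dim H_n<\infty$, $H_n\perp H_m$ for $n\ne m$, $H_\varepsilon=\bigoplus_{n\in\mathbb N+\varepsilon/2}H_n$, $\Omega\in H_0$, $\omega\in H_2$, and $[L_0,V(a,z)]=zV'(a,z)+\alpha V(a,z)$ for $a\in H_\alpha$. (6) $[L_{-1},V(a,z)]=V'(a,z)=V(L_{-1}a,z)\in\mathcal S$. *)

theory Defs
  imports
    "HOL-Analysis.Analysis"
    "HOL-Library.Function_Algebras"
    "HOL-Library.Groups_Big_Fun"
    "HOL-Library.Z2"
begin

section \<open>Complex vector spaces and prehilbert spaces\<close>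

class complex_vector = ab_group_add +
  fixes cscale :: "complex \<Rightarrow> 'a \<Rightarrow> 'a"  (infixr \<open>*\<^sub>C\<close> 75)
  assumes cscale_add_right: "c *\<^sub>C (x + y) = c *\<^sub>C x + c *\<^sub>C y"
    and cscale_add_left: "(c + d) *\<^sub>C x = c *\<^sub>C x + d *\<^sub>C x"
    and cscale_cscale: "c *\<^sub>C (d *\<^sub>C x) = (c * d) *\<^sub>C x"
    and cscale_one: "1 *\<^sub>C x = x"

global_interpretation complex_vector: vector_space "cscale :: complex \<Rightarrow> 'a \<Rightarrow> 'a::complex_vector"
  by standard (simp_all add: cscale_add_right cscale_add_left cscale_cscale cscale_one)

abbreviation clinear :: "('a::complex_vector \<Rightarrow> 'b::complex_vector) \<Rightarrow> bool"
  where "clinear \<equiv> Vector_Spaces.linear cscale cscale"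

abbreviation cspan :: "'a::complex_vector set \<Rightarrow> 'a set"
  where "cspan \<equiv> complex_vector.span"

abbreviation csubspace :: "'a::complex_vector set \<Rightarrow> bool"
  where "csubspace \<equiv> complex_vector.subspace"

instantiation "fun" :: (type, complex_vector) complex_vector
begin

definition cscale_fun :: "complex \<Rightarrow> ('a \<Rightarrow> 'b) \<Rightarrow> 'a \<Rightarrow> 'b"
  where "cscale_fun c f = (\<lambda>x. c *\<^sub>C f x)"

instance
  by standard
    (simp_all add: cscale_fun_def plus_fun_def fun_eq_iff
      cscale_add_right cscale_add_left cscale_cscale cscale_one)

end

text \<open>The inner product is linear in the first and antilinear in the second argument.\<close>

class complex_prehilbert = complex_vector +
  fixes cinner :: "'a \<Rightarrow> 'a \<Rightarrow> complex"
  assumes cinner_add_left: "cinner (x + y) z = cinner x z + cinner y z"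
    and cinner_cscale_left: "cinner (c *\<^sub>C x) y = c * cinner x y"
    and cinner_commute: "cinner y x = cnj (cinner x y)"
    and cinner_nonneg: "0 \<le> Re (cinner x x)"
    and cinner_eq_zero_iff: "cinner x x = 0 \<longleftrightarrow> x = 0"

definition acts_irreducibly :: "('h::complex_vector \<Rightarrow> 'h) set \<Rightarrow> bool"
  where "acts_irreducibly \<T> \<longleftrightarrow> (UNIV :: 'h set) \<noteq> {0} \<and>
    (\<forall>W. csubspace W \<and> (\<forall>T\<in>\<T>. T ` W \<subseteq> W) \<longrightarrow> W = {0} \<or> W = UNIV)"

text \<open>
  The algebraic tensor product of prehilbert spaces: multiplicativity of the inner product
  together with spanning determines it up to a unique unitary isomorphism.
\<close>

locale prehilbert_tensor =
  fixes tens :: "'v::complex_prehilbert \<Rightarrow> 'f::complex_prehilbert \<Rightarrow> 'h::complex_prehilbert"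
  assumes linear_left: "clinear (\<lambda>v. tens v f)"
    and linear_right: "clinear (\<lambda>f. tens v f)"
    and cinner_tens: "cinner (tens v f) (tens v' f') = cinner v v' * cinner f f'"
    and span_tens: "cspan {tens v f | v f. True} = UNIV"

definition tensor_op ::
    "('v::complex_prehilbert \<Rightarrow> 'f::complex_prehilbert \<Rightarrow> 'h::complex_prehilbert)
      \<Rightarrow> ('v \<Rightarrow> 'v) \<Rightarrow> ('f \<Rightarrow> 'f) \<Rightarrow> 'h \<Rightarrow> 'h"
  where "tensor_op tens S T = (THE U. clinear U \<and> (\<forall>v f. U (tens v f) = tens (S v) (T f)))"

section \<open>Simple Lie algebras, roots and the dual Coxeter number\<close>

locale lie_algebra =
  fixes br :: "'g::complex_vector \<Rightarrow> 'g \<Rightarrow> 'g"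
  assumes br_linear_left: "clinear (\<lambda>x. br x y)"
    and br_linear_right: "clinear (\<lambda>y. br x y)"
    and br_self: "br x x = 0"
    and jacobi: "br x (br y z) + br y (br z x) + br z (br x y) = 0"

definition lie_ideal :: "('g::complex_vector \<Rightarrow> 'g \<Rightarrow> 'g) \<Rightarrow> 'g set \<Rightarrow> bool"
  where "lie_ideal br I \<longleftrightarrow> csubspace I \<and> (\<forall>x. \<forall>y\<in>I. br x y \<in> I)"

locale simple_lie_algebra = lie_algebra br
  for br :: "'g::complex_vector \<Rightarrow> 'g \<Rightarrow> 'g" +
  assumes nonabelian: "\<exists>x y. br x y \<noteq> 0"
    and no_proper_ideal: "lie_ideal br I \<Longrightarrow> I = {0} \<or> I = UNIV"

definition invariant_form ::
    "('g::complex_vector \<Rightarrow> 'g \<Rightarrow> 'g) \<Rightarrow> ('g \<Rightarrow> 'g \<Rightarrow> complex) \<Rightarrow> bool"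
  where "invariant_form br \<kappa> \<longleftrightarrow>
    (\<forall>y. Vector_Spaces.linear cscale (*) (\<lambda>x. \<kappa> x y)) \<and>
    (\<forall>x y. \<kappa> x y = \<kappa> y x) \<and>
    (\<forall>x. (\<forall>y. \<kappa> x y = 0) \<longrightarrow> x = 0) \<and>
    (\<forall>x y z. \<kappa> (br x y) z = \<kappa> x (br y z))"

definition cartan_subalgebra :: "('g::complex_vector \<Rightarrow> 'g \<Rightarrow> 'g) \<Rightarrow> 'g set \<Rightarrow> bool"
  where "cartan_subalgebra br \<hh> \<longleftrightarrow> csubspace \<hh> \<and>
    (\<forall>x\<in>\<hh>. \<forall>y\<in>\<hh>. br x y = 0) \<and>
    (\<forall>y. (\<forall>x\<in>\<hh>. br x y = 0) \<longrightarrow> y \<in> \<hh>) \<and>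
    (\<forall>x\<in>\<hh>. cspan {y. \<exists>c. br x y = c *\<^sub>C y} = UNIV)"

text \<open>
  A linear functional on \<^term>\<open>\<hh>\<close> is represented by an element of \<^term>\<open>\<hh>\<close> through the
  invariant form \<^term>\<open>\<kappa>\<close>, which is nondegenerate on \<^term>\<open>\<hh>\<close>; in particular roots are
  elements of \<^term>\<open>\<hh>\<close>, and the square of the length of a root \<^term>\<open>\<alpha>\<close> is \<^term>\<open>\<kappa> \<alpha> \<alpha>\<close>.
\<close>

definition roots ::
    "('g::complex_vector \<Rightarrow> 'g \<Rightarrow> 'g) \<Rightarrow> ('g \<Rightarrow> 'g \<Rightarrow> complex) \<Rightarrow> 'g set \<Rightarrow> 'g set"
  where "roots br \<kappa> \<hh> =
    {\<alpha> \<in> \<hh>. \<alpha> \<noteq> 0 \<and> (\<exists>y. y \<noteq> 0 \<and> (\<forall>x\<in>\<hh>. br x y = \<kappa> \<alpha> x *\<^sub>C y))}"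

definition positive_system :: "'g::complex_vector set \<Rightarrow> 'g set \<Rightarrow> bool"
  where "positive_system \<Phi> P \<longleftrightarrow> P \<subseteq> \<Phi> \<and>
    (\<forall>\<alpha>\<in>\<Phi>. (\<alpha> \<in> P) \<noteq> (- \<alpha> \<in> P)) \<and>
    (\<forall>\<alpha>\<in>P. \<forall>\<beta>\<in>P. \<alpha> + \<beta> \<in> \<Phi> \<longrightarrow> \<alpha> + \<beta> \<in> P)"

definition highest_root :: "'g::complex_vector set \<Rightarrow> 'g set \<Rightarrow> 'g \<Rightarrow> bool"
  where "highest_root \<Phi> P \<theta> \<longleftrightarrow> \<theta> \<in> P \<and> (\<forall>\<alpha>\<in>P. \<theta> + \<alpha> \<notin> \<Phi>)"

text \<open>The value of half the sum of the positive roots on the coroot of \<^term>\<open>\<theta>\<close>, plus one.\<close>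

definition dual_coxeter_number ::
    "('g::complex_vector \<Rightarrow> 'g \<Rightarrow> complex) \<Rightarrow> 'g set \<Rightarrow> 'g \<Rightarrow> complex"
  where "dual_coxeter_number \<kappa> P \<theta> =
    1 + 2 * \<kappa> ((1/2) *\<^sub>C (\<Sum>\<alpha>\<in>P. \<alpha>)) \<theta> / \<kappa> \<theta> \<theta>"

text \<open>
  A basis that is orthonormal for the invariant form normalised by \<open>\<kappa> \<theta> \<theta> = 2\<close> is its own dual
  basis, so that the sum of the squares of its elements is the Casimir element of that form.
\<close>

definition normalized_basis ::
    "('g::complex_vector \<Rightarrow> 'g \<Rightarrow> 'g) \<Rightarrow> ('g \<Rightarrow> 'g \<Rightarrow> complex) \<Rightarrow> 'g \<Rightarrow>
      ('i::finite \<Rightarrow> 'g) \<Rightarrow> ('i \<Rightarrow> 'i \<Rightarrow> 'i \<Rightarrow> real) \<Rightarrow> bool"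
  where "normalized_basis br \<kappa> \<theta> x \<Gamma> \<longleftrightarrow>
    inj x \<and> \<not> complex_vector.dependent (range x) \<and> cspan (range x) = UNIV \<and>
    (\<forall>a b. br (x a) (x b) = \<i> *\<^sub>C (\<Sum>c\<in>UNIV. complex_of_real (\<Gamma> a b c) *\<^sub>C x c)) \<and>
    (\<forall>a b c. \<Gamma> a b c = - \<Gamma> b a c \<and> \<Gamma> a b c = - \<Gamma> a c b) \<and>
    \<kappa> \<theta> \<theta> = 2 \<and>
    (\<forall>a b. \<kappa> (x a) (x b) = (if a = b then 1 else 0))"

section \<open>Bosons and fermions\<close>

locale affine_vacuum_representation =
  fixes \<Gamma> :: "'i::finite \<Rightarrow> 'i \<Rightarrow> 'i \<Rightarrow> real"
    and level :: nat
    and X :: "'i \<Rightarrow> int \<Rightarrow> 'v::complex_prehilbert \<Rightarrow> 'v"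
    and vac :: 'v
  assumes X_linear: "clinear (X a n)"
    and X_commutator:
      "X a m (X b n v) - X b n (X a m v) =
        \<i> *\<^sub>C (\<Sum>c\<in>UNIV. complex_of_real (\<Gamma> a b c) *\<^sub>C X c (m + n) v)
        + (if a = b \<and> m + n = 0 then of_int m * of_nat level else 0) *\<^sub>C v"
    and X_adjoint: "cinner (X a n u) v = cinner u (X a (- n) v)"
    and X_irreducible: "acts_irreducibly {X a n | a n. True}"
    and lowest_energy: "{v. \<forall>a. \<forall>n>0. X a n v = 0} = cspan {vac}"
    and trivial: "X a 0 vac = 0"
    and vac_unit: "cinner vac vac = 1"

definition half_integers :: "rat set"
  where "half_integers = {r. r - 1/2 \<in> \<int>}"

text \<open>The operators \<^term>\<open>\<psi> a m\<close> are only meaningful for \<^term>\<open>m \<in> half_integers\<close>.\<close>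

locale neveu_schwarz_fermions =
  fixes \<psi> :: "'i::finite \<Rightarrow> rat \<Rightarrow> 'f::complex_prehilbert \<Rightarrow> 'f"
    and vac :: 'f
  assumes psi_linear: "m \<in> half_integers \<Longrightarrow> clinear (\<psi> a m)"
    and psi_anticommutator:
      "m \<in> half_integers \<Longrightarrow> n \<in> half_integers \<Longrightarrow>
        \<psi> a m (\<psi> b n v) + \<psi> b n (\<psi> a m v) = (if a = b \<and> m + n = 0 then v else 0)"
    and psi_adjoint: "m \<in> half_integers \<Longrightarrow> cinner (\<psi> a m u) v = cinner u (\<psi> a (- m) v)"
    and psi_irreducible: "acts_irreducibly {\<psi> a m | a m. m \<in> half_integers}"
    and psi_vac: "m \<in> half_integers \<Longrightarrow> m > 0 \<Longrightarrow> \<psi> a m vac = 0"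
    and vac_unit: "cinner vac vac = 1"

section \<open>Fields, locality and products\<close>

text \<open>\<^term>\<open>A n\<close> is the coefficient of \<open>z\<^bsup>-n-1\<^esup>\<close> of the field.\<close>

type_synonym 'h fld = "int \<Rightarrow> 'h \<Rightarrow> 'h"

definition is_field :: "'h::complex_prehilbert fld \<Rightarrow> bool"
  where "is_field A \<longleftrightarrow> (\<forall>n. clinear (A n))"

definition id_field :: "'h::complex_prehilbert fld"
  where "id_field n v = (if n = -1 then v else 0)"

definition field_deriv :: "'h::complex_prehilbert fld \<Rightarrow> 'h fld"
  where "field_deriv A n v = (- of_int n) *\<^sub>C A (n - 1) v"

definition field_times_z :: "'h::complex_prehilbert fld \<Rightarrow> 'h fld"
  where "field_times_z A n v = A (n + 1) v"

definition field_commutator :: "('h::complex_prehilbert \<Rightarrow> 'h) \<Rightarrow> 'h fld \<Rightarrow> 'h fld"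
  where "field_commutator T A n v = T (A n v) - A n (T v)"

definition parity_sign :: "bit \<Rightarrow> complex"
  where "parity_sign \<epsilon> = (if \<epsilon> = 0 then 1 else -1)"

text \<open>
  The function \<open>p\<close> is the finitely supported coefficient family of a Laurent polynomial in two
  variables. The series of matrix coefficients is summed unconditionally over all pairs of modes.
\<close>

definition laurent_fraction :: "nat \<Rightarrow> (int \<times> int \<Rightarrow> complex) \<Rightarrow> complex \<Rightarrow> complex \<Rightarrow> complex"
  where "laurent_fraction N p z w =
    (\<Sum>(i, j)\<in>{k. p k \<noteq> 0}. p (i, j) * z powi i * w powi j) / (z - w) ^ N"

definition local_fields :: "bit \<Rightarrow> 'h::complex_prehilbert fld \<Rightarrow> 'h fld \<Rightarrow> bool"
  where "local_fields \<epsilon> A B \<longleftrightarrow> (\<exists>N::nat. \<forall>c d. \<exists>p. finite {k. p k \<noteq> 0} \<and>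
    (\<forall>z w. 0 < norm w \<and> norm w < norm z \<longrightarrow>
      ((\<lambda>(m, n). cinner (A m (B n c)) d * z powi (- m - 1) * w powi (- n - 1))
        has_sum laurent_fraction N p z w) UNIV) \<and>
    (\<forall>z w. 0 < norm z \<and> norm z < norm w \<longrightarrow>
      ((\<lambda>(m, n). parity_sign \<epsilon> *
          (cinner (B n (A m c)) d * z powi (- m - 1) * w powi (- n - 1)))
        has_sum laurent_fraction N p z w) UNIV))"

text \<open>
  The sum for negative \<open>n\<close> is over the natural numbers \<open>p\<close> with nonzero summand; on vectors
  annihilated by all sufficiently high modes of both fields only finitely many such \<open>p\<close> exist.
\<close>

definition field_prod ::
    "bit \<Rightarrow> int \<Rightarrow> 'h::complex_prehilbert fld \<Rightarrow> 'h fld \<Rightarrow> 'h fld"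
  where "field_prod \<epsilon> n A B m v =
    (if n \<ge> 0 then
       (\<Sum>p=0..nat n. ((-1) ^ p * of_nat (nat n choose p)) *\<^sub>C
         (A (n - int p) (B (m + int p) v)
          - parity_sign \<epsilon> *\<^sub>C B (m + int p) (A (n - int p) v)))
     else
       Sum_any (\<lambda>p::nat. of_nat (nat (int p - n - 1) choose p) *\<^sub>C
         (A (n - int p) (B (m + int p) v)
          - (parity_sign \<epsilon> * (-1) powi n) *\<^sub>C B (m + n - int p) (A (int p) v))))"

text \<open>
  The sign entering a product is the product of the parities of the factors, so the
  parity of every generated field is recorded along with it.
\<close>

inductive generated :: "('h::complex_prehilbert fld \<times> bit) set \<Rightarrow> 'h fld \<Rightarrow> bit \<Rightarrow> bool"
  for G where
    gen_id: "generated G id_field 0"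
  | gen_base: "(A, \<epsilon>) \<in> G \<Longrightarrow> generated G A \<epsilon>"
  | gen_prod: "generated G A \<epsilon>1 \<Longrightarrow> generated G B \<epsilon>2 \<Longrightarrow>
      generated G (field_prod (\<epsilon>1 * \<epsilon>2) n A B) (\<epsilon>1 + \<epsilon>2)"
  | gen_deriv: "generated G A \<epsilon> \<Longrightarrow> generated G (field_deriv A) \<epsilon>"

definition generated_part :: "('h::complex_prehilbert fld \<times> bit) set \<Rightarrow> bit \<Rightarrow> 'h fld set"
  where "generated_part G \<epsilon> = cspan {A. generated G A \<epsilon>}"

definition generated_fields :: "('h::complex_prehilbert fld \<times> bit) set \<Rightarrow> 'h fld set"
  where "generated_fields G = cspan {A. \<exists>\<epsilon>. generated G A \<epsilon>}"

text \<open>The value of \<open>A(z)\<Omega>\<close> at \<open>z = 0\<close>, for fields with \<open>A(n)\<Omega> = 0\<close> for all \<open>n \<ge> 0\<close>.\<close>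

definition creation :: "'h::complex_prehilbert \<Rightarrow> 'h fld \<Rightarrow> 'h"
  where "creation \<Omega> A = A (-1) \<Omega>"

section \<open>Vertex operator superalgebras\<close>

definition virasoro_mode :: "('h::complex_prehilbert \<Rightarrow> 'h fld) \<Rightarrow> 'h \<Rightarrow> int \<Rightarrow> 'h \<Rightarrow> 'h"
  where "virasoro_mode V \<omega> n = V \<omega> (n + 1)"

definition central_charge :: "'h::complex_prehilbert \<Rightarrow> complex"
  where "central_charge \<omega> = 2 * cinner \<omega> \<omega>"

definition energy_space :: "('h::complex_prehilbert \<Rightarrow> 'h fld) \<Rightarrow> 'h \<Rightarrow> real \<Rightarrow> 'h set"
  where "energy_space V \<omega> r = {v. virasoro_mode V \<omega> 0 v = complex_of_real r *\<^sub>C v}"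

definition half_naturals :: "real set"
  where "half_naturals = {real k / 2 | k :: nat. True}"

definition shifted_naturals :: "bit \<Rightarrow> real set"
  where "shifted_naturals \<epsilon> = {real k + (if \<epsilon> = 0 then 0 else 1/2) | k :: nat. True}"

locale vertex_operator_superalgebra =
  fixes Hp :: "bit \<Rightarrow> 'h::complex_prehilbert set"
    and V :: "'h \<Rightarrow> 'h fld"
    and \<Omega> \<omega> :: 'h
  assumes superspace:
      "csubspace (Hp \<epsilon>)" "Hp 0 \<inter> Hp 1 = {0}" "{u + v | u v. u \<in> Hp 0 \<and> v \<in> Hp 1} = UNIV"
    and V_linear: "clinear V"
    and V_field: "is_field (V a)"
    and vacuum: "n \<ge> 0 \<Longrightarrow> V a n \<Omega> = 0" "creation \<Omega> (V a) = a" "V \<Omega> = id_field"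
    and irreducible: "acts_irreducibly {V a n | a n. True}"
    and locality:
      "A \<in> V ` Hp \<epsilon>1 \<Longrightarrow> B \<in> V ` Hp \<epsilon>2 \<Longrightarrow> local_fields (\<epsilon>1 * \<epsilon>2) A B"
    and closed_prod:
      "A \<in> V ` Hp \<epsilon>1 \<Longrightarrow> B \<in> V ` Hp \<epsilon>2 \<Longrightarrow>
        field_prod (\<epsilon>1 * \<epsilon>2) n A B \<in> V ` Hp (\<epsilon>1 + \<epsilon>2)"
    and virasoro_vacuum:
      "virasoro_mode V \<omega> 0 \<Omega> = 0" "virasoro_mode V \<omega> (-1) \<Omega> = 0"
      "\<omega> = virasoro_mode V \<omega> (-2) \<Omega>"
    and virasoro:
      "virasoro_mode V \<omega> m (virasoro_mode V \<omega> n v) - virasoro_mode V \<omega> n (virasoro_mode V \<omega> m v) =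
        of_int (m - n) *\<^sub>C virasoro_mode V \<omega> (m + n) v
        + (if m + n = 0 then central_charge \<omega> / 12 * of_int (m * (m^2 - 1)) else 0) *\<^sub>C v"
    and energy_span: "cspan (\<Union>r\<in>half_naturals. energy_space V \<omega> r) = UNIV"
    and energy_finite:
      "r \<in> half_naturals \<Longrightarrow> \<exists>F. finite F \<and> energy_space V \<omega> r \<subseteq> cspan F"
    and energy_orthogonal:
      "r \<in> half_naturals \<Longrightarrow> s \<in> half_naturals \<Longrightarrow> r \<noteq> s \<Longrightarrow>
        u \<in> energy_space V \<omega> r \<Longrightarrow> v \<in> energy_space V \<omega> s \<Longrightarrow> cinner u v = 0"
    and energy_parity: "Hp \<epsilon> = cspan (\<Union>r\<in>shifted_naturals \<epsilon>. energy_space V \<omega> r)"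
    and vacuum_energy: "\<Omega> \<in> energy_space V \<omega> 0"
    and virasoro_energy: "\<omega> \<in> energy_space V \<omega> 2"
    and energy_commutator:
      "r \<in> half_naturals \<Longrightarrow> a \<in> energy_space V \<omega> r \<Longrightarrow>
        field_commutator (virasoro_mode V \<omega> 0) (V a) =
          field_times_z (field_deriv (V a)) + complex_of_real r *\<^sub>C V a"
    and translation:
      "field_commutator (virasoro_mode V \<omega> (-1)) (V a) = field_deriv (V a)"
      "field_deriv (V a) = V (virasoro_mode V \<omega> (-1) a)"
      "field_deriv (V a) \<in> range V"

section \<open>The fields on the tensor product\<close>

definition boson_field ::
    "('v::complex_prehilbert \<Rightarrow> 'f::complex_prehilbert \<Rightarrow> 'h::complex_prehilbert)
      \<Rightarrow> ('i \<Rightarrow> int \<Rightarrow> 'v \<Rightarrow> 'v) \<Rightarrow> 'i \<Rightarrow> 'h fld"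
  where "boson_field tens X a n = tensor_op tens (X a n) id"

definition fermion_op ::
    "('v::complex_prehilbert \<Rightarrow> 'f::complex_prehilbert \<Rightarrow> 'h::complex_prehilbert)
      \<Rightarrow> ('i \<Rightarrow> rat \<Rightarrow> 'f \<Rightarrow> 'f) \<Rightarrow> 'i \<Rightarrow> rat \<Rightarrow> 'h \<Rightarrow> 'h"
  where "fermion_op tens \<psi> a m = tensor_op tens id (\<psi> a m)"

definition fermion_field ::
    "('v::complex_prehilbert \<Rightarrow> 'f::complex_prehilbert \<Rightarrow> 'h::complex_prehilbert)
      \<Rightarrow> ('i \<Rightarrow> rat \<Rightarrow> 'f \<Rightarrow> 'f) \<Rightarrow> 'i \<Rightarrow> 'h fld"
  where "fermion_field tens \<psi> a n = fermion_op tens \<psi> a (of_int n + 1/2)"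

definition fermion_current ::
    "('i::finite \<Rightarrow> 'i \<Rightarrow> 'i \<Rightarrow> real) \<Rightarrow> ('i \<Rightarrow> 'h::complex_prehilbert fld) \<Rightarrow> 'i \<Rightarrow> 'h fld"
  where "fermion_current \<Gamma> \<Psi> c =
    (- \<i> / 2) *\<^sub>C (\<Sum>a\<in>UNIV. \<Sum>b\<in>UNIV.
      complex_of_real (\<Gamma> a b c) *\<^sub>C field_prod 1 (-1) (\<Psi> a) (\<Psi> b))"

end

theory Submission
  imports Defs
begin

text \<open>
  The commutation relations of the currents and the anticommutation relations of the fermions make
  these fields mutually local, so by Dong's lemma every field they generate is local with the correct
  sign. Reconstruction then turns the span of the generated fields into a vertex operator superalgebra
  as soon as a generated field \<open>T\<close> provides translations and a grading. The field \<open>T\<close> is the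
  Sugawara field; its commutators with the generators come from the Casimir identity
  \<open>\<Sum>\<^sub>a\<^sub>c \<Gamma>\<^sub>a\<^sub>c\<^sup>b \<Gamma>\<^sub>a\<^sub>c\<^sup>d = 2 g \<delta>\<^sub>b\<^sub>d\<close>, which is derived from the
  action of the Casimir element on the highest root space of the adjoint representation. Since
  \<open>[L\<^sub>m, L\<^sub>n] - (m - n) L\<^sub>m\<^sub>+\<^sub>n\<close> commutes with all generators, it is a scalar by uniqueness
  of the vacuum and irreducibility, and its value on the vacuum gives the central charge.
\<close>

text \<open>Locality through rational correlation functions behaves badly under products. It is
  replaced by the algebraic condition that a power of z - w kills the supercommutator, which on
  modes is an iterated finite difference. Convergence enters only when the correlation functions are
  recovered: there energy conservation makes the killed series Laurent polynomials. Three obstacles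
  shape the rest. The invariant form is an abstract one, so the root theory is redone from
  nondegeneracy and the finiteness of the root set. The sign in a product depends on parities, so
  locality and uniqueness are proved for fields of one parity, and even and odd states are separated
  by orthogonality. The commutator of the Sugawara field with a current mode is computed by hand
  only for nonnegative modes, where the sums telescope; locality carries it to the others. The
  tensor product is known only through its inner product, so operators on it are built from their
  adjoints.\<close>

lemma clinear_iff:
  "clinear f \<longleftrightarrow> (\<forall>x y. f (x + y) = f x + f y) \<and> (\<forall>c x. f (c *\<^sub>C x) = c *\<^sub>C f x)"
  unfolding Vector_Spaces.linear_iff
  by (auto intro: complex_vector.vector_space_axioms)

lemma clinearI:
  assumes "\<And>x y. f (x + y) = f x + f y" "\<And>c x. f (c *\<^sub>C x) = c *\<^sub>C f x"
  shows "clinear f"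
  using assms by (simp add: clinear_iff)

lemma
  assumes "clinear f"
  shows clinear_add: "f (x + y) = f x + f y"
    and clinear_scale: "f (c *\<^sub>C x) = c *\<^sub>C f x"
    and clinear_zero: "f 0 = 0"
    and clinear_neg: "f (- x) = - f x"
    and clinear_diff: "f (x - y) = f x - f y"
    and clinear_sum: "f (sum h A) = (\<Sum>a\<in>A. f (h a))"
proof -
  interpret Vector_Spaces.linear cscale cscale f by fact
  show "f (x + y) = f x + f y" "f (c *\<^sub>C x) = c *\<^sub>C f x" "f 0 = 0" "f (- x) = - f x"
    "f (x - y) = f x - f y" "f (sum h A) = (\<Sum>a\<in>A. f (h a))"
    by (simp_all add: add scale neg diff sum)
qed

lemmas clinear_simps = clinear_add clinear_scale clinear_zero clinear_neg clinear_diff clinear_sum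

lemma cspan_UNIV_induct:
  assumes "cspan S = UNIV" "\<And>x. x \<in> S \<Longrightarrow> P x" "csubspace {x. P x}"
  shows "P x"
  using complex_vector.span_induct[of x S P] assms by auto

lemma cspan_induct:
  assumes "x \<in> cspan S" "\<And>x. x \<in> S \<Longrightarrow> P x" "csubspace {x. P x}"
  shows "P x"
  using complex_vector.span_induct[of x S P] assms by auto

lemma csubspace_Collect:
  assumes "P 0" "\<And>x y. P x \<Longrightarrow> P y \<Longrightarrow> P (x + y)" "\<And>c x. P x \<Longrightarrow> P (c *\<^sub>C x)"
  shows "csubspace {x. P x}"
  using assms by (auto intro!: complex_vector.subspaceI)

lemmas cscale_simps = cscale_add_right cscale_add_left cscale_cscale cscale_one
  complex_vector.scale_right_diff_distrib complex_vector.scale_left_diff_distrib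

section \<open>Weight decomposition and the Casimir eigenvalue\<close>

text \<open>Applying T minus one eigenvalue \<nu> to the sum removes that component and multiplies
  every other one by the nonzero factor \<mu> - \<nu>, so induction on the number of components
  applies. Indexing f by its eigenvalue builds in distinctness.\<close>

lemma eigenvectors_in_invariant_subspace:
  assumes T: "clinear T" and W: "csubspace W" "\<And>w. w \<in> W \<Longrightarrow> T w \<in> W"
    and "finite M" "\<And>\<mu>. T (f \<mu>) = \<mu> *\<^sub>C f \<mu>" "(\<Sum>\<mu>\<in>M. f \<mu>) \<in> W"
  shows "\<forall>\<mu>\<in>M. f \<mu> \<in> W"
  using assms(4-6)
proof (induction M arbitrary: f rule: finite_induct)
  case (insert \<nu> M)
  let ?s = "\<Sum>\<mu>\<in>insert \<nu> M. f \<mu>"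
  have "T ?s - \<nu> *\<^sub>C ?s = (\<Sum>\<mu>\<in>insert \<nu> M. (\<mu> - \<nu>) *\<^sub>C f \<mu>)"
    by (simp add: clinear_sum[OF T] complex_vector.scale_sum_right sum_subtractf insert.prems(1)
        complex_vector.scale_left_diff_distrib del: sum.insert)
  also have "\<dots> = (\<Sum>\<mu>\<in>M. (\<mu> - \<nu>) *\<^sub>C f \<mu>)"
    using insert.hyps by simp
  finally have "(\<Sum>\<mu>\<in>M. (\<mu> - \<nu>) *\<^sub>C f \<mu>) = T ?s - \<nu> *\<^sub>C ?s" ..
  then have "(\<Sum>\<mu>\<in>M. (\<mu> - \<nu>) *\<^sub>C f \<mu>) \<in> W"
    by (simp only:) (intro complex_vector.subspace_diff complex_vector.subspace_scale W insert.prems(2))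
  then have *: "\<forall>\<mu>\<in>M. (\<mu> - \<nu>) *\<^sub>C f \<mu> \<in> W"
    by (intro insert.IH) (simp_all add: clinear_scale[OF T] insert.prems(1) cscale_cscale mult.commute)
  have M: "f \<mu> \<in> W" if "\<mu> \<in> M" for \<mu>
  proof -
    have "f \<mu> = (1 / (\<mu> - \<nu>)) *\<^sub>C ((\<mu> - \<nu>) *\<^sub>C f \<mu>)"
      using that insert.hyps by (auto simp: cscale_cscale cscale_one)
    then show ?thesis
      using * that W complex_vector.subspace_scale by metis
  qed
  have "f \<nu> = ?s - (\<Sum>\<mu>\<in>M. f \<mu>)"
    using insert.hyps by simp
  also have "\<dots> \<in> W"
    using M W(1) insert.prems(2) by (metis complex_vector.subspace_diff complex_vector.subspace_sum)
  finally show ?case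
    using M by auto
qed simp

text \<open>Eigenvectors with the same eigenvalue are merged: the family is indexed by the
  eigenvalue, in the form that the preceding lemma asks for.\<close>

lemma eigenvector_decomposition:
  assumes T: "clinear T" and y: "y \<in> cspan {y. \<exists>c. T y = c *\<^sub>C y}"
  obtains M f where "finite M" "\<And>\<mu>. T (f \<mu>) = \<mu> *\<^sub>C f \<mu>" "y = (\<Sum>\<mu>\<in>M. f \<mu>)"
proof -
  have "\<exists>f. finite {\<mu>. f \<mu> \<noteq> 0} \<and> (\<forall>\<mu>. T (f \<mu>) = \<mu> *\<^sub>C f \<mu>) \<and> y = Sum_any f"
  proof (rule cspan_induct[OF y], goal_cases)
    case (1 y)
    then obtain c where c: "T y = c *\<^sub>C y" by auto
    have "finite {\<mu>. (if \<mu> = c then y else 0) \<noteq> 0}"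
      by (rule finite_subset[of _ "{c}"]) auto
    then show ?case
      using c by (intro exI[of _ "\<lambda>\<mu>. if \<mu> = c then y else 0"]) (auto simp: clinear_zero[OF T])
  next
    case 2
    show ?case
    proof (rule csubspace_Collect, goal_cases)
      case 1
      show ?case by (rule exI[of _ "\<lambda>_. 0"]) (simp add: clinear_zero[OF T])
    next
      case (2 y z)
      then obtain f h where
        f: "finite {\<mu>. f \<mu> \<noteq> 0}" "\<forall>\<mu>. T (f \<mu>) = \<mu> *\<^sub>C f \<mu>" "y = Sum_any f" and
        h: "finite {\<mu>. h \<mu> \<noteq> 0}" "\<forall>\<mu>. T (h \<mu>) = \<mu> *\<^sub>C h \<mu>" "z = Sum_any h"
        by blast
      have "finite {\<mu>. f \<mu> + h \<mu> \<noteq> 0}"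
        by (rule finite_subset[OF _ finite_UnI[OF f(1) h(1)]]) auto
      then show ?case
        using f h by (intro exI[of _ "\<lambda>\<mu>. f \<mu> + h \<mu>"])
          (auto simp: clinear_add[OF T] cscale_simps Sum_any.distrib)
    next
      case (3 c y)
      then obtain f where
        f: "finite {\<mu>. f \<mu> \<noteq> 0}" "\<forall>\<mu>. T (f \<mu>) = \<mu> *\<^sub>C f \<mu>" "y = Sum_any f"
        by blast
      have fin: "finite {\<mu>. c *\<^sub>C f \<mu> \<noteq> 0}"
        by (rule finite_subset[OF _ f(1)]) auto
      have "c *\<^sub>C y = Sum_any (\<lambda>\<mu>. c *\<^sub>C f \<mu>)"
        unfolding f(3) Sum_any.expand_set[of f] complex_vector.scale_sum_right
        by (subst Sum_any.expand_superset[OF f(1)]) auto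
      then show ?case
        using f fin by (intro exI[of _ "\<lambda>\<mu>. c *\<^sub>C f \<mu>"])
          (auto simp: clinear_scale[OF T] cscale_cscale mult.commute)
    qed
  qed
  then obtain f where "finite {\<mu>. f \<mu> \<noteq> 0}" "\<forall>\<mu>. T (f \<mu>) = \<mu> *\<^sub>C f \<mu>" "y = Sum_any f"
    by blast
  then show ?thesis
    using that[of "{\<mu>. f \<mu> \<noteq> 0}" f] by (auto simp: Sum_any.expand_set)
qed

text \<open>Finite dimension enters only through a finite spanning set R: a maximal independent part
  of S lies in its span, so it is finite.\<close>

lemma finite_spanning_subset:
  fixes S R :: "'a::complex_vector set"
  assumes "finite R" "W \<subseteq> cspan R" "W \<subseteq> cspan S" "S \<subseteq> W"
  obtains Y where "finite Y" "Y \<subseteq> S" "W \<subseteq> cspan Y"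
proof -
  obtain Y where Y: "Y \<subseteq> S" "\<not> complex_vector.dependent Y" "S \<subseteq> cspan Y"
    using complex_vector.maximal_independent_subset[of S] by blast
  have "finite Y"
    using complex_vector.independent_span_bound[OF assms(1) Y(2)] Y(1) assms by auto
  moreover have "W \<subseteq> cspan Y"
    using assms(3) Y(3) complex_vector.span_minimal[OF Y(3)] by auto
  ultimately show ?thesis using that Y by blast
qed

locale cartan_decomposition = simple_lie_algebra br
  for br :: "'g::complex_vector \<Rightarrow> 'g \<Rightarrow> 'g" +
  fixes \<kappa> :: "'g \<Rightarrow> 'g \<Rightarrow> complex" and \<hh> :: "'g set" and x :: "'i::finite \<Rightarrow> 'g"
  assumes form: "invariant_form br \<kappa>"
    and cartan: "cartan_subalgebra br \<hh>"
    and orthonormal: "\<kappa> (x a) (x b) = (if a = b then 1 else 0)"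
    and spanning: "cspan (range x) = UNIV"
begin

lemmas br_l = clinear_simps[OF br_linear_left]
lemmas br_r = clinear_simps[OF br_linear_right]

lemma br_anti: "br y z = - br z y"
proof -
  have "br (y + z) (y + z) = br y z + br z y"
    by (simp add: br_l br_r br_self[of y] br_self[of z])
  then have "br y z + br z y = 0"
    by (simp only: br_self)
  then show ?thesis
    by (simp only: eq_neg_iff_add_eq_0)
qed

lemma br_jacobi: "br y (br z w) = br (br y z) w + br z (br y w)"
proof -
  have "br y (br z w) + br z (br w y) + br w (br y z) = 0" by (rule jacobi)
  moreover have "br z (br w y) = - br z (br y w)"
    by (subst br_anti[of w y]) (simp add: br_r)
  moreover have "br w (br y z) = - br (br y z) w"
    by (rule br_anti)
  ultimately show ?thesis by (simp add: algebra_simps)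
qed

lemma \<kappa>_commute: "\<kappa> y z = \<kappa> z y"
  using form unfolding invariant_form_def by blast

lemma \<kappa>_linear: "Vector_Spaces.linear cscale (*) (\<lambda>y. \<kappa> y z)"
  using form unfolding invariant_form_def by blast

lemma \<kappa>_add_left: "\<kappa> (y + z) w = \<kappa> y w + \<kappa> z w"
  and \<kappa>_scale_left: "\<kappa> (c *\<^sub>C y) w = c * \<kappa> y w"
  using \<kappa>_linear[of w] by (auto simp: Vector_Spaces.linear_iff)

lemma \<kappa>_add_right: "\<kappa> w (y + z) = \<kappa> w y + \<kappa> w z"
  and \<kappa>_scale_right: "\<kappa> w (c *\<^sub>C y) = c * \<kappa> w y"
  by (simp_all add: \<kappa>_commute[of w] \<kappa>_add_left \<kappa>_scale_left)

lemma \<kappa>_zero [simp]: "\<kappa> 0 y = 0" "\<kappa> y 0 = 0"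
  using \<kappa>_scale_left[of 0 0 y] by (simp_all add: \<kappa>_commute[of y])

lemma \<kappa>_minus [simp]: "\<kappa> (- z) y = - \<kappa> z y" "\<kappa> y (- z) = - \<kappa> y z"
  using \<kappa>_scale_left[of "-1" z y]
  by (simp_all add: cscale_one \<kappa>_commute[of y])

lemma \<kappa>_diff: "\<kappa> (y - z) w = \<kappa> y w - \<kappa> z w" "\<kappa> w (y - z) = \<kappa> w y - \<kappa> w z"
  using \<kappa>_add_left[of y "- z" w] \<kappa>_add_right[of w y "- z"] by simp_all

lemma \<kappa>_sum: "\<kappa> (sum f A) w = (\<Sum>a\<in>A. \<kappa> (f a) w)" "\<kappa> w (sum f A) = (\<Sum>a\<in>A. \<kappa> w (f a))"
  by (induction A rule: infinite_finite_induct; simp add: \<kappa>_add_left \<kappa>_add_right)+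

lemmas \<kappa>_simps = \<kappa>_add_left \<kappa>_add_right \<kappa>_scale_left \<kappa>_scale_right \<kappa>_diff \<kappa>_sum

lemma \<kappa>_invariant: "\<kappa> (br y z) w = \<kappa> y (br z w)"
  using form unfolding invariant_form_def by blast

lemma \<kappa>_skew: "\<kappa> (br y z) w = - \<kappa> z (br y w)"
  by (subst br_anti) (simp add: \<kappa>_invariant)

lemma \<kappa>_nondegenerate: "(\<And>z. \<kappa> y z = 0) \<Longrightarrow> y = 0"
  using form unfolding invariant_form_def by blast

lemma \<kappa>_nondegenerate_span:
  assumes "cspan S = UNIV" "\<And>z. z \<in> S \<Longrightarrow> \<kappa> y z = 0"
  shows "y = 0"
proof (rule \<kappa>_nondegenerate)
  fix z
  show "\<kappa> y z = 0"
    by (rule cspan_UNIV_induct[where x = z, OF assms]) (auto intro!: csubspace_Collect simp: \<kappa>_simps)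
qed

lemma \<hh>_subspace: "csubspace \<hh>"
  and \<hh>_abelian: "u \<in> \<hh> \<Longrightarrow> v \<in> \<hh> \<Longrightarrow> br u v = 0"
  and \<hh>_self_centralizing: "(\<And>u. u \<in> \<hh> \<Longrightarrow> br u y = 0) \<Longrightarrow> y \<in> \<hh>"
  and \<hh>_diagonalizable: "u \<in> \<hh> \<Longrightarrow> cspan {y. \<exists>c. br u y = c *\<^sub>C y} = UNIV"
  using cartan unfolding cartan_subalgebra_def by blast+

section \<open>Simultaneous diagonalisation of the Cartan subalgebra\<close>

definition joint_eigenvectors :: "'g set \<Rightarrow> 'g set"
  where "joint_eigenvectors F = {y. \<forall>u\<in>F. \<exists>c. br u y = c *\<^sub>C y}"

lemma joint_eigenvaluesE:
  assumes "y \<in> joint_eigenvectors F"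
  obtains m where "\<And>u. u \<in> F \<Longrightarrow> br u y = m u *\<^sub>C y"
proof -
  have "\<exists>m. \<forall>u\<in>F. br u y = m u *\<^sub>C y"
    by (rule bchoice) (use assms in \<open>simp add: joint_eigenvectors_def\<close>)
  then show ?thesis using that by blast
qed

text \<open>Induction on F. The joint eigenspace of a joint eigenvector y of F is stable under
  bracketing with u, because u commutes with F. Hence the components of y along the eigenspaces of u
  stay in it and are joint eigenvectors for u as well.\<close>

lemma joint_eigenvectors_span:
  assumes "finite F" "F \<subseteq> \<hh>"
  shows "cspan (joint_eigenvectors F) = UNIV"
  using assms
proof (induction F rule: finite_induct)
  case empty
  then show ?case by (simp add: joint_eigenvectors_def)
next
  case (insert u F)
  have "joint_eigenvectors F \<subseteq> cspan (joint_eigenvectors (insert u F))"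
  proof
    fix y assume "y \<in> joint_eigenvectors F"
    then obtain c where c: "\<And>v. v \<in> F \<Longrightarrow> br v y = c v *\<^sub>C y"
      by (rule joint_eigenvaluesE) blast
    define W where "W = {y. \<forall>v\<in>F. br v y = c v *\<^sub>C y}"
    have W: "csubspace W"
      unfolding W_def by (rule csubspace_Collect) (auto simp: br_r cscale_simps mult.commute)
    have inv: "br u w \<in> W" if "w \<in> W" for w
    proof -
      have "br v (br u w) = c v *\<^sub>C br u w" if v: "v \<in> F" for v
      proof -
        have "br v u = 0" using insert.prems v \<hh>_abelian by auto
        then show ?thesis
          using \<open>w \<in> W\<close> v by (simp add: br_jacobi[of v u w] br_l br_r W_def)
      qed
      then show ?thesis by (simp add: W_def)
    qed
    have "y \<in> cspan {y. \<exists>c. br u y = c *\<^sub>C y}"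
      using insert.prems \<hh>_diagonalizable by auto
    then obtain M f where f: "finite M" "\<And>\<mu>. br u (f \<mu>) = \<mu> *\<^sub>C f \<mu>" "y = (\<Sum>\<mu>\<in>M. f \<mu>)"
      by (rule eigenvector_decomposition[OF br_linear_right]) blast
    have "(\<Sum>\<mu>\<in>M. f \<mu>) \<in> W"
      using c f(3) by (simp add: W_def)
    then have "\<forall>\<mu>\<in>M. f \<mu> \<in> W"
      by (intro eigenvectors_in_invariant_subspace[OF br_linear_right W inv f(1,2)])
    then have "f \<mu> \<in> joint_eigenvectors (insert u F)" if "\<mu> \<in> M" for \<mu>
      using that f(2) by (auto simp: joint_eigenvectors_def W_def)
    then show "y \<in> cspan (joint_eigenvectors (insert u F))"
      unfolding f(3) by (intro complex_vector.span_sum complex_vector.span_base)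
  qed
  then have "cspan (joint_eigenvectors F) \<subseteq> cspan (joint_eigenvectors (insert u F))"
    by (intro complex_vector.span_minimal) auto
  then show ?case using insert by auto
qed

text \<open>A common eigenvector of several operators is an eigenvector of their linear
  combinations, so diagonalising a finite spanning set of \<open>\<hh>\<close> diagonalises all of
  it.\<close>

lemma finite_weight_basis:
  obtains Y where "finite Y" "cspan Y = UNIV" "Y \<subseteq> joint_eigenvectors \<hh>"
proof -
  have fin: "finite (range x)" by simp
  obtain F where F: "finite F" "F \<subseteq> \<hh>" "\<hh> \<subseteq> cspan F"
    by (rule finite_spanning_subset[OF fin, of \<hh> \<hh>])
      (use spanning complex_vector.span_superset in auto)
  have "joint_eigenvectors F \<subseteq> joint_eigenvectors \<hh>"
  proof
    fix y assume y: "y \<in> joint_eigenvectors F"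
    have "\<exists>c. br u y = c *\<^sub>C y" if "u \<in> \<hh>" for u
    proof -
      have "u \<in> cspan F" using that F by auto
      then show ?thesis
      proof (rule cspan_induct)
        show "\<And>v. v \<in> F \<Longrightarrow> \<exists>c. br v y = c *\<^sub>C y"
          using y by (auto simp: joint_eigenvectors_def)
        show "csubspace {v. \<exists>c. br v y = c *\<^sub>C y}"
        proof (rule csubspace_Collect, goal_cases)
          case 1
          show ?case by (rule exI[of _ 0]) (simp add: br_l)
        next
          case (2 v w)
          then obtain c d where "br v y = c *\<^sub>C y" "br w y = d *\<^sub>C y" by blast
          then show ?case by (intro exI[of _ "c + d"]) (simp add: br_l cscale_simps)
        next
          case (3 c v)
          then obtain d where "br v y = d *\<^sub>C y" by blast
          then show ?case by (intro exI[of _ "c * d"]) (simp add: br_l cscale_simps)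
        qed
      qed
    qed
    then show "y \<in> joint_eigenvectors \<hh>" by (simp add: joint_eigenvectors_def)
  qed
  moreover have "cspan (joint_eigenvectors F) = UNIV"
    using joint_eigenvectors_span F by auto
  ultimately have "cspan (joint_eigenvectors \<hh>) = UNIV"
    using complex_vector.span_mono by blast
  then obtain Y where "finite Y" "Y \<subseteq> joint_eigenvectors \<hh>" "UNIV \<subseteq> cspan Y"
    using finite_spanning_subset[OF fin, of UNIV "joint_eigenvectors \<hh>"] spanning by auto
  then show ?thesis using that by auto
qed

text \<open>Test against a weight vector z. If some u in \<open>\<hh>\<close> has a nonzero
  eigenvalue on z, invariance and [u, h] = 0 force \<open>\<kappa> h z = 0\<close>; otherwise z
  centralises \<open>\<hh>\<close>, hence lies in it, and the hypothesis applies.\<close>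

lemma \<hh>_nondegenerate:
  assumes h: "h \<in> \<hh>" and "\<And>u. u \<in> \<hh> \<Longrightarrow> \<kappa> h u = 0"
  shows "h = 0"
proof -
  obtain Y where "finite Y" and Y: "cspan Y = UNIV" "Y \<subseteq> joint_eigenvectors \<hh>"
    by (rule finite_weight_basis)
  show ?thesis
  proof (rule \<kappa>_nondegenerate_span[OF Y(1)])
    fix z assume "z \<in> Y"
    then have "z \<in> joint_eigenvectors \<hh>" using Y by blast
    then obtain \<mu> where \<mu>: "\<And>u. u \<in> \<hh> \<Longrightarrow> br u z = \<mu> u *\<^sub>C z"
      by (rule joint_eigenvaluesE) blast
    show "\<kappa> h z = 0"
    proof (cases "\<exists>u\<in>\<hh>. \<mu> u \<noteq> 0")
      case True
      then obtain u where u: "u \<in> \<hh>" "\<mu> u \<noteq> 0" by blast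
      have "\<kappa> (br u h) z = - \<kappa> h (br u z)" by (rule \<kappa>_skew)
      then have "\<mu> u * \<kappa> h z = 0"
        using u h by (simp add: \<hh>_abelian \<mu> \<kappa>_simps)
      then show ?thesis using u by simp
    next
      case False
      then have "z \<in> \<hh>"
        by (intro \<hh>_self_centralizing) (simp add: \<mu>)
      then show ?thesis using assms by blast
    qed
  qed
qed

section \<open>Root spaces and the invariant form\<close>

definition weight_space :: "'g \<Rightarrow> 'g set"
  where "weight_space \<alpha> = {y. \<forall>u\<in>\<hh>. br u y = \<kappa> \<alpha> u *\<^sub>C y}"

abbreviation \<Phi> :: "'g set" where "\<Phi> \<equiv> roots br \<kappa> \<hh>"

lemma weight_spaceD: "y \<in> weight_space \<alpha> \<Longrightarrow> u \<in> \<hh> \<Longrightarrow> br u y = \<kappa> \<alpha> u *\<^sub>C y"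
  by (simp add: weight_space_def)

lemma weight_space_subspace: "csubspace (weight_space \<alpha>)"
  unfolding weight_space_def
  by (rule csubspace_Collect) (auto simp: br_r cscale_simps mult.commute)

lemma weight_space_zero: "weight_space 0 = \<hh>"
  using \<hh>_self_centralizing \<hh>_abelian by (auto simp: weight_space_def)

lemma roots_iff: "\<alpha> \<in> \<Phi> \<longleftrightarrow> \<alpha> \<in> \<hh> \<and> \<alpha> \<noteq> 0 \<and> (\<exists>y\<in>weight_space \<alpha>. y \<noteq> 0)"
  by (auto simp: roots_def weight_space_def)

text \<open>Invariance under every u in \<open>\<hh>\<close> gives \<open>(\<kappa> \<alpha> u +
  \<kappa> \<beta> u) * \<kappa> y z = 0\<close>, and nondegeneracy on \<open>\<hh>\<close> turns
  the vanishing of the first factor into \<alpha> + \<beta> = 0.\<close>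

lemma weight_space_orthogonal:
  assumes "y \<in> weight_space \<alpha>" "z \<in> weight_space \<beta>" "\<alpha> \<in> \<hh>" "\<beta> \<in> \<hh>" "\<kappa> y z \<noteq> 0"
  shows "\<beta> = - \<alpha>"
proof -
  have "\<alpha> + \<beta> = 0"
  proof (rule \<hh>_nondegenerate)
    show "\<alpha> + \<beta> \<in> \<hh>" using assms \<hh>_subspace complex_vector.subspace_add by blast
    fix u assume "u \<in> \<hh>"
    then have "\<kappa> \<alpha> u * \<kappa> y z = - (\<kappa> \<beta> u * \<kappa> y z)"
      using \<kappa>_skew[of u y z] assms by (simp add: weight_spaceD \<kappa>_simps)
    then have "(\<kappa> \<alpha> u + \<kappa> \<beta> u) * \<kappa> y z = 0" by (simp add: algebra_simps)
    then show "\<kappa> (\<alpha> + \<beta>) u = 0" using assms(5) by (simp add: \<kappa>_simps)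
  qed
  then show ?thesis by (simp add: eq_neg_iff_add_eq_0 add.commute)
qed

lemma weight_space_bracket:
  assumes "y \<in> weight_space \<alpha>" "z \<in> weight_space \<beta>"
  shows "br y z \<in> weight_space (\<alpha> + \<beta>)"
  unfolding weight_space_def
  using assms by (auto simp: br_jacobi[of _ y z] weight_spaceD br_l br_r \<kappa>_simps cscale_simps)

text \<open>The eigenvalue functional has to be realised by an element of \<open>\<hh>\<close>. A
  weight vector z that pairs nontrivially with y has the opposite eigenvalues, so [y, z] centralises
  \<open>\<hh>\<close> and lies in it; divided by \<open>\<kappa> y z\<close> it represents the
  functional.\<close>

lemma joint_eigenvector_weight:
  assumes "y \<in> joint_eigenvectors \<hh>"
  shows "\<exists>\<alpha>\<in>\<hh>. y \<in> weight_space \<alpha>"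
proof (cases "y = 0")
  case True
  then show ?thesis
    using \<hh>_subspace complex_vector.subspace_0 weight_space_subspace by blast
next
  case False
  obtain Y where "finite Y" and Y: "cspan Y = UNIV" "Y \<subseteq> joint_eigenvectors \<hh>"
    by (rule finite_weight_basis)
  obtain lm where lm: "\<And>u. u \<in> \<hh> \<Longrightarrow> br u y = lm u *\<^sub>C y"
    by (rule joint_eigenvaluesE[OF assms]) blast
  obtain z where z: "z \<in> Y" "\<kappa> y z \<noteq> 0"
    using \<kappa>_nondegenerate_span[OF Y(1), of y] False by blast
  then have "z \<in> joint_eigenvectors \<hh>" using Y by blast
  then obtain \<mu> where \<mu>: "\<And>u. u \<in> \<hh> \<Longrightarrow> br u z = \<mu> u *\<^sub>C z"
    by (rule joint_eigenvaluesE) blast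
  have opp: "\<mu> u = - lm u" if "u \<in> \<hh>" for u
  proof -
    have "lm u * \<kappa> y z = - (\<mu> u * \<kappa> y z)"
      using \<kappa>_skew[of u y z] that by (simp add: lm \<mu> \<kappa>_simps)
    then have "(lm u + \<mu> u) * \<kappa> y z = 0" by (simp add: algebra_simps)
    then show ?thesis using z(2) by (simp add: add_eq_0_iff)
  qed
  have yz: "br y z \<in> \<hh>"
    by (rule \<hh>_self_centralizing)
      (simp add: br_jacobi[of _ y z] lm \<mu> opp br_l br_r)
  define \<alpha> where "\<alpha> = (1 / \<kappa> y z) *\<^sub>C br y z"
  have "\<alpha> \<in> \<hh>" unfolding \<alpha>_def using yz \<hh>_subspace complex_vector.subspace_scale by blast
  moreover have "\<kappa> \<alpha> u = lm u" if "u \<in> \<hh>" for u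
  proof -
    have "br z u = lm u *\<^sub>C z"
      using \<mu>[OF that] opp[OF that] br_anti[of z u] by simp
    then have "\<kappa> (br y z) u = lm u * \<kappa> y z"
      by (simp add: \<kappa>_invariant \<kappa>_simps)
    then show ?thesis using z(2) by (simp add: \<alpha>_def \<kappa>_simps)
  qed
  ultimately show ?thesis
    using lm by (intro bexI[of _ \<alpha>]) (auto simp: weight_space_def)
qed

lemma weight_vectors_span: "cspan (\<hh> \<union> (\<Union>\<alpha>\<in>\<Phi>. weight_space \<alpha>)) = UNIV"
proof -
  obtain Y where "finite Y" and Y: "cspan Y = UNIV" "Y \<subseteq> joint_eigenvectors \<hh>"
    by (rule finite_weight_basis)
  have "Y \<subseteq> \<hh> \<union> (\<Union>\<alpha>\<in>\<Phi>. weight_space \<alpha>)"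
  proof
    fix y assume "y \<in> Y"
    then obtain \<alpha> where \<alpha>: "\<alpha> \<in> \<hh>" "y \<in> weight_space \<alpha>"
      using joint_eigenvector_weight Y by blast
    show "y \<in> \<hh> \<union> (\<Union>\<alpha>\<in>\<Phi>. weight_space \<alpha>)"
    proof (cases "y = 0 \<or> \<alpha> = 0")
      case True
      then show ?thesis
        using \<alpha> weight_space_zero \<hh>_subspace complex_vector.subspace_0 by auto
    next
      case False
      then show ?thesis using \<alpha> roots_iff by blast
    qed
  qed
  then show ?thesis using Y(1) complex_vector.span_mono by blast
qed

lemma weight_space_pairing:
  assumes "y \<in> weight_space \<alpha>" "\<alpha> \<in> \<hh>" "y \<noteq> 0"
  obtains z where "z \<in> weight_space (- \<alpha>)" "\<kappa> y z = 1"
proof -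
  obtain z where z: "z \<in> \<hh> \<union> (\<Union>\<alpha>\<in>\<Phi>. weight_space \<alpha>)" "\<kappa> y z \<noteq> 0"
    using \<kappa>_nondegenerate_span[OF weight_vectors_span, of y] assms(3) by blast
  then obtain \<beta> where "\<beta> \<in> \<hh>" "z \<in> weight_space \<beta>"
    using weight_space_zero \<hh>_subspace complex_vector.subspace_0 by (auto simp: roots_iff)
  then have "z \<in> weight_space (- \<alpha>)"
    using weight_space_orthogonal z(2) assms by blast
  then have "(1 / \<kappa> y z) *\<^sub>C z \<in> weight_space (- \<alpha>)"
    using weight_space_subspace complex_vector.subspace_scale by blast
  moreover have "\<kappa> y ((1 / \<kappa> y z) *\<^sub>C z) = 1"
    using z(2) by (simp add: \<kappa>_simps)
  ultimately show ?thesis using that by blast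
qed

lemma weight_unique:
  assumes "y \<in> weight_space \<alpha>" "y \<in> weight_space \<beta>" "\<alpha> \<in> \<hh>" "\<beta> \<in> \<hh>" "y \<noteq> 0"
  shows "\<alpha> = \<beta>"
proof -
  obtain z where "z \<in> weight_space (- \<alpha>)" "\<kappa> y z = 1"
    using weight_space_pairing assms by blast
  then have "- \<alpha> = - \<beta>"
    using weight_space_orthogonal[of y \<beta> z "- \<alpha>"] assms \<hh>_subspace complex_vector.subspace_neg
    by auto
  then show ?thesis by simp
qed

text \<open>Every root \<alpha> is sent to a member of a finite spanning set of weight vectors that
  has weight -\<alpha>; uniqueness of weights makes this injective.\<close>

lemma finite_roots: "finite \<Phi>"
proof -
  obtain Y where Y: "finite Y" "cspan Y = UNIV" "Y \<subseteq> joint_eigenvectors \<hh>"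
    by (rule finite_weight_basis)
  have "\<exists>z\<in>Y. z \<noteq> 0 \<and> z \<in> weight_space (- \<alpha>)" if "\<alpha> \<in> \<Phi>" for \<alpha>
  proof -
    obtain y where y: "y \<in> weight_space \<alpha>" "y \<noteq> 0" "\<alpha> \<in> \<hh>"
      using \<open>\<alpha> \<in> \<Phi>\<close> by (auto simp: roots_iff)
    then obtain z where z: "z \<in> Y" "\<kappa> y z \<noteq> 0"
      using \<kappa>_nondegenerate_span[OF Y(2), of y] by blast
    then obtain \<beta> where "\<beta> \<in> \<hh>" "z \<in> weight_space \<beta>"
      using joint_eigenvector_weight Y by blast
    then show ?thesis
      using z y weight_space_orthogonal[of y \<alpha> z \<beta>] by (intro bexI[of _ z]) auto
  qed
  then obtain \<zeta> where \<zeta>: "\<And>\<alpha>. \<alpha> \<in> \<Phi> \<Longrightarrow> \<zeta> \<alpha> \<in> Y \<and> \<zeta> \<alpha> \<noteq> 0 \<and> \<zeta> \<alpha> \<in> weight_space (- \<alpha>)"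
    by metis
  have "inj_on \<zeta> \<Phi>"
  proof (rule inj_onI)
    fix \<alpha> \<beta> assume ab: "\<alpha> \<in> \<Phi>" "\<beta> \<in> \<Phi>" "\<zeta> \<alpha> = \<zeta> \<beta>"
    then have "- \<alpha> \<in> \<hh>" "- \<beta> \<in> \<hh>"
      using \<hh>_subspace complex_vector.subspace_neg by (auto simp: roots_iff)
    then have "- \<alpha> = - \<beta>"
      using weight_unique[of "\<zeta> \<alpha>" "- \<alpha>" "- \<beta>"] \<zeta>[OF ab(1)] \<zeta>[OF ab(2)] ab(3) by auto
    then show "\<alpha> = \<beta>" by simp
  qed
  then show ?thesis
    using \<zeta> Y(1) finite_imageD finite_subset by (metis image_subsetI)
qed

lemma root_uminus: "\<alpha> \<in> \<Phi> \<Longrightarrow> - \<alpha> \<in> \<Phi>"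
proof -
  assume a: "\<alpha> \<in> \<Phi>"
  then obtain y where y: "y \<in> weight_space \<alpha>" "y \<noteq> 0" "\<alpha> \<in> \<hh>"
    by (auto simp: roots_iff)
  then obtain z where z: "z \<in> weight_space (- \<alpha>)" "\<kappa> y z = 1"
    using weight_space_pairing by blast
  then have "z \<noteq> 0" by auto
  then show ?thesis
    using a z y \<hh>_subspace complex_vector.subspace_neg by (auto simp: roots_iff)
qed

text \<open>Both sides lie in \<open>\<hh>\<close> and, by invariance, pair equally with all of
  \<open>\<hh>\<close>.\<close>

lemma root_bracket:
  assumes "y \<in> weight_space \<alpha>" "z \<in> weight_space (- \<alpha>)" "\<alpha> \<in> \<hh>"
  shows "br y z = \<kappa> y z *\<^sub>C \<alpha>"
proof -
  have "br y z - \<kappa> y z *\<^sub>C \<alpha> = 0"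
  proof (rule \<hh>_nondegenerate)
    have "br y z \<in> \<hh>"
      using weight_space_bracket[OF assms(1,2)] by (simp add: weight_space_zero)
    then show "br y z - \<kappa> y z *\<^sub>C \<alpha> \<in> \<hh>"
      using assms \<hh>_subspace complex_vector.subspace_diff complex_vector.subspace_scale by blast
    fix u assume u: "u \<in> \<hh>"
    have "br z u = \<kappa> \<alpha> u *\<^sub>C z"
      using weight_spaceD[OF assms(2) u] by (subst br_anti) simp
    then show "\<kappa> (br y z - \<kappa> y z *\<^sub>C \<alpha>) u = 0"
      by (simp add: \<kappa>_simps \<kappa>_invariant)
  qed
  then show ?thesis by simp
qed

section \<open>Root strings, norms of roots and dimensions of root spaces\<close>

lemma finite_root_string:
  assumes "\<alpha> \<in> \<Phi>" "\<beta> \<in> \<hh>"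
  shows "\<exists>k::nat. \<forall>v\<in>weight_space (\<beta> + of_nat k *\<^sub>C \<alpha>). v = 0"
proof (rule ccontr)
  assume neg: "\<not> ?thesis"
  have "\<beta> + of_nat k *\<^sub>C \<alpha> \<in> insert 0 \<Phi>" for k :: nat
  proof -
    have "\<beta> + of_nat k *\<^sub>C \<alpha> \<in> \<hh>"
      using assms by (intro complex_vector.subspace_add complex_vector.subspace_scale \<hh>_subspace)
        (auto simp: roots_iff)
    moreover have "\<exists>y\<in>weight_space (\<beta> + of_nat k *\<^sub>C \<alpha>). y \<noteq> 0"
      using neg by blast
    ultimately show ?thesis by (auto simp: roots_iff)
  qed
  then have "finite (range (\<lambda>k::nat. \<beta> + of_nat k *\<^sub>C \<alpha>))"
    using finite_roots by (meson finite.insertI finite_subset image_subsetI)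
  moreover have "inj (\<lambda>k::nat. \<beta> + of_nat k *\<^sub>C \<alpha>)"
    using assms by (auto intro!: injI simp: roots_iff)
  ultimately show False
    using finite_imageD by fastforce
qed

text \<open>An \<open>\<ss>\<ll>\<^sub>2\<close>-type string argument that needs no traces: \<open>f\<close> sends the \<open>k\<close>-th vector of the string
  to a multiple of the previous one, and this multiple has to vanish somewhere.\<close>

lemma root_string_coefficient:
  assumes \<alpha>: "\<alpha> \<in> \<Phi>" and e: "e \<in> weight_space \<alpha>" and f: "f \<in> weight_space (- \<alpha>)" and ef: "\<kappa> e f = 1"
    and v: "v \<in> weight_space \<beta>" "\<beta> \<in> \<hh>" "v \<noteq> 0" and fv: "br f v = 0"
  shows "\<exists>k::nat. k \<ge> 1 \<and> of_nat k * \<kappa> \<alpha> \<beta> + \<kappa> \<alpha> \<alpha> * of_nat (k * (k - 1) div 2) = 0"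
proof (rule ccontr)
  assume neg: "\<not> ?thesis"
  \<comment> \<open>This is the sum over j < k of the values \<kappa>(\<alpha>, \<beta> + j
    \<alpha>): each commutation of f past e contributes the pairing of \<alpha> with the current
    weight.\<close>
  define c where "c k = of_nat k * \<kappa> \<alpha> \<beta> + \<kappa> \<alpha> \<alpha> * of_nat (k * (k - 1) div 2)" for k :: nat
  define w where "w k = (br e ^^ k) v" for k
  have \<alpha>h: "\<alpha> \<in> \<hh>" using \<alpha> by (simp add: roots_iff)
  have w: "w k \<in> weight_space (\<beta> + of_nat k *\<^sub>C \<alpha>)" for k
  proof (induction k)
    case (Suc k)
    have "br e (w k) \<in> weight_space (\<alpha> + (\<beta> + of_nat k *\<^sub>C \<alpha>))"
      by (rule weight_space_bracket[OF e Suc])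
    then show ?case by (simp add: w_def cscale_simps algebra_simps)
  qed (use v in \<open>simp add: w_def\<close>)
  have fe: "br f (br e y) = br e (br f y) - br \<alpha> y" for y
  proof -
    have "br f e = - \<alpha>"
      using root_bracket[OF e f \<alpha>h] ef br_anti[of f e] by (simp add: cscale_one)
    then show ?thesis by (simp add: br_jacobi[of f e y] br_l)
  qed
  have c_Suc: "c (Suc k) = c k + \<kappa> \<alpha> \<beta> + of_nat k * \<kappa> \<alpha> \<alpha>" for k
  proof -
    have "Suc k * (Suc k - 1) div 2 = k * (k - 1) div 2 + k"
      by (cases k) (auto simp: algebra_simps)
    then have "of_nat (Suc k * (Suc k - 1) div 2) = (of_nat (k * (k - 1) div 2) + of_nat k :: complex)"
      by (metis of_nat_add)
    then show ?thesis unfolding c_def by (simp add: algebra_simps)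
  qed
  have step: "br f (w (Suc k)) = - (c (Suc k) *\<^sub>C w k)" for k
  proof (induction k)
    case 0
    then show ?case
      using v weight_spaceD[OF v(1) \<alpha>h] fv
      by (simp add: w_def fe br_r c_def \<kappa>_commute)
  next
    case (Suc k)
    have "br f (w (Suc (Suc k))) = br e (br f (w (Suc k))) - br \<alpha> (w (Suc k))"
      by (simp add: w_def fe)
    also have "br e (br f (w (Suc k))) = - (c (Suc k) *\<^sub>C w (Suc k))"
      unfolding Suc by (simp add: br_r w_def)
    also have "br \<alpha> (w (Suc k)) = (\<kappa> \<alpha> \<beta> + of_nat (Suc k) * \<kappa> \<alpha> \<alpha>) *\<^sub>C w (Suc k)"
      using weight_spaceD[OF w \<alpha>h, of "Suc k"] by (simp add: \<kappa>_simps \<kappa>_commute)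
    also have "- (c (Suc k) *\<^sub>C w (Suc k)) - (\<kappa> \<alpha> \<beta> + of_nat (Suc k) * \<kappa> \<alpha> \<alpha>) *\<^sub>C w (Suc k)
        = - (c (Suc (Suc k)) *\<^sub>C w (Suc k))"
      by (simp add: c_Suc[of "Suc k"] cscale_simps algebra_simps)
    finally show ?case .
  qed
  have "w k \<noteq> 0" for k
  proof (induction k)
    case (Suc k)
    have "c (Suc k) \<noteq> 0" using neg unfolding c_def by (metis One_nat_def Suc_leI zero_less_Suc)
    then show ?case using step[of k] Suc by (auto simp: br_r)
  qed (use v in \<open>simp add: w_def\<close>)
  then show False
    using finite_root_string[OF \<alpha> v(2)] w by metis
qed

lemma center_trivial:
  assumes "\<And>z. br y z = 0"
  shows "y = 0"
proof -
  define Z where "Z = {y. \<forall>z. br y z = 0}"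
  have "lie_ideal br Z"
    unfolding lie_ideal_def
  proof (intro conjI allI ballI)
    show "csubspace Z" unfolding Z_def by (rule csubspace_Collect) (auto simp: br_l)
    fix z y assume "y \<in> Z"
    then have "br z y = 0" by (subst br_anti) (simp add: Z_def)
    then show "br z y \<in> Z" by (simp add: Z_def br_l)
  qed
  moreover have "Z \<noteq> UNIV" using nonabelian by (auto simp: Z_def)
  ultimately have "Z = {0}" using no_proper_ideal by blast
  then show ?thesis using assms by (auto simp: Z_def)
qed

text \<open>An isotropic root would reduce the string relation to
  \<open>k * \<kappa> \<alpha> \<beta> = 0\<close>, hence be orthogonal to all roots; its bracket
  with every weight vector then vanishes and it is central, against simplicity.\<close>

lemma root_norm_nonzero:
  assumes \<alpha>: "\<alpha> \<in> \<Phi>"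
  shows "\<kappa> \<alpha> \<alpha> \<noteq> 0"
proof
  assume 0: "\<kappa> \<alpha> \<alpha> = 0"
  have \<alpha>h: "\<alpha> \<in> \<hh>" using \<alpha> by (simp add: roots_iff)
  have orth: "\<kappa> \<alpha> \<beta> = 0" if \<beta>: "\<beta> \<in> \<Phi>" for \<beta>
  proof (rule ccontr)
    assume t: "\<kappa> \<alpha> \<beta> \<noteq> 0"
    have \<beta>h: "\<beta> \<in> \<hh>" using \<beta> by (simp add: roots_iff)
    obtain v where v: "v \<in> weight_space \<beta>" "v \<noteq> 0" using \<beta> by (auto simp: roots_iff)
    obtain e where e: "e \<in> weight_space \<alpha>" "e \<noteq> 0" using \<alpha> by (auto simp: roots_iff)
    then obtain f where f: "f \<in> weight_space (- \<alpha>)" "\<kappa> e f = 1"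
      using weight_space_pairing \<alpha>h by blast
    define w where "w k = (br f ^^ k) v" for k
    have w: "w k \<in> weight_space (\<beta> + of_nat k *\<^sub>C (- \<alpha>))" for k
    proof (induction k)
      case (Suc k)
      have "br f (w k) \<in> weight_space (- \<alpha> + (\<beta> + of_nat k *\<^sub>C (- \<alpha>)))"
        by (rule weight_space_bracket[OF f(1) Suc])
      then show ?case by (simp add: w_def cscale_simps algebra_simps)
    qed (use v in \<open>simp add: w_def\<close>)
    \<comment> \<open>The descending string stops, and its last nonzero vector is killed by f, as
      the string lemma requires. Moving down by j \<alpha> does not change the pairing with
      \<alpha>, which is isotropic here.\<close>
    obtain k where "w k = 0"
      using finite_root_string[OF root_uminus[OF \<alpha>] \<beta>h] w by blast
    moreover have "w 0 \<noteq> 0" using v by (simp add: w_def)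
    ultimately obtain j where j: "w j \<noteq> 0" "w (Suc j) = 0"
      by (induction k) auto
    have "\<beta> + of_nat j *\<^sub>C (- \<alpha>) \<in> \<hh>"
      using \<alpha>h \<beta>h \<hh>_subspace complex_vector.subspace_neg complex_vector.subspace_add
        complex_vector.subspace_scale by metis
    moreover have "br f (w j) = 0" using j by (simp add: w_def)
    ultimately obtain i :: nat where i: "i \<ge> 1"
      "of_nat i * \<kappa> \<alpha> (\<beta> + of_nat j *\<^sub>C (- \<alpha>)) + \<kappa> \<alpha> \<alpha> * of_nat (i * (i - 1) div 2) = 0"
      using root_string_coefficient[OF \<alpha> e(1) f w _ j(1)] by blast
    then show False using t 0 by (simp add: \<kappa>_simps)
  qed
  have "\<alpha> = 0"
  proof (rule center_trivial)
    fix z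
    show "br \<alpha> z = 0"
    proof (rule cspan_UNIV_induct[where x = z, OF weight_vectors_span])
      fix z assume "z \<in> \<hh> \<union> (\<Union>\<alpha>\<in>\<Phi>. weight_space \<alpha>)"
      then show "br \<alpha> z = 0"
        using \<alpha>h orth \<hh>_abelian weight_spaceD \<kappa>_commute by fastforce
    qed (auto intro!: csubspace_Collect simp: br_r)
  qed
  then show False using \<alpha> by (simp add: roots_iff)
qed

text \<open>Subtracting from y its component along e leaves a vector y' of the same weight with
  [f, y'] = 0. If y' were nonzero, the string lemma for \<beta> = \<alpha> would give (k + k(k-1)/2)
  \<kappa>(\<alpha>, \<alpha>) = 0 with k >= 1.\<close>

lemma root_space_one_dimensional:
  assumes \<alpha>: "\<alpha> \<in> \<Phi>" and e: "e \<in> weight_space \<alpha>" and f: "f \<in> weight_space (- \<alpha>)" and ef: "\<kappa> e f = 1"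
    and y: "y \<in> weight_space \<alpha>"
  shows "y = \<kappa> y f *\<^sub>C e"
proof (rule ccontr)
  assume neg: "y \<noteq> \<kappa> y f *\<^sub>C e"
  have \<alpha>h: "\<alpha> \<in> \<hh>" using \<alpha> by (simp add: roots_iff)
  define y' where "y' = y - \<kappa> y f *\<^sub>C e"
  have y': "y' \<in> weight_space \<alpha>" "y' \<noteq> 0" "\<kappa> y' f = 0"
    using neg e y ef weight_space_subspace
    by (auto simp: y'_def \<kappa>_simps complex_vector.subspace_diff complex_vector.subspace_scale)
  have "br f y' = 0"
    using root_bracket[OF y'(1) f \<alpha>h] y'(3) br_anti[of f y'] by simp
  then obtain k :: nat where k: "k \<ge> 1"
    "of_nat k * \<kappa> \<alpha> \<alpha> + \<kappa> \<alpha> \<alpha> * of_nat (k * (k - 1) div 2) = 0"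
    using root_string_coefficient[OF \<alpha> e f ef y'(1) \<alpha>h y'(2)] by blast
  have "\<kappa> \<alpha> \<alpha> * of_nat (k + k * (k - 1) div 2) = 0"
    using k(2) by (simp only: of_nat_add distrib_left) (simp add: mult.commute)
  then have "of_nat (k + k * (k - 1) div 2) = (0::complex)"
    using root_norm_nonzero[OF \<alpha>] by simp
  then show False
    using k(1) by (simp only: of_nat_eq_0_iff)
qed

section \<open>The Casimir operator of the adjoint representation\<close>

lemma expansion: "(\<Sum>a\<in>UNIV. \<kappa> z (x a) *\<^sub>C x a) = z"
proof (rule cspan_UNIV_induct[where x = z, OF spanning])
  show "\<And>z. z \<in> range x \<Longrightarrow> (\<Sum>a\<in>UNIV. \<kappa> z (x a) *\<^sub>C x a) = z"
    by (auto simp: orthonormal if_distrib[of "\<lambda>c. c *\<^sub>C _"] cscale_one cong: if_cong)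
  show "csubspace {z. (\<Sum>a\<in>UNIV. \<kappa> z (x a) *\<^sub>C x a) = z}"
  proof (rule csubspace_Collect)
    fix c z assume "(\<Sum>a\<in>UNIV. \<kappa> z (x a) *\<^sub>C x a) = z"
    moreover have "(\<Sum>a\<in>UNIV. \<kappa> (c *\<^sub>C z) (x a) *\<^sub>C x a) = c *\<^sub>C (\<Sum>a\<in>UNIV. \<kappa> z (x a) *\<^sub>C x a)"
      by (simp add: \<kappa>_simps complex_vector.scale_sum_right)
    ultimately show "(\<Sum>a\<in>UNIV. \<kappa> (c *\<^sub>C z) (x a) *\<^sub>C x a) = c *\<^sub>C z" by simp
  qed (simp_all add: \<kappa>_simps cscale_add_left sum.distrib)
qed

definition casimir :: "'g \<Rightarrow> 'g"
  where "casimir y = (\<Sum>a\<in>UNIV. br (x a) (br (x a) y))"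

lemma casimir_linear: "clinear casimir"
  by (rule clinearI) (simp_all add: casimir_def br_r sum.distrib complex_vector.scale_sum_right)

text \<open>In an orthonormal basis, bracketing with w has a skew matrix M; the two terms of the
  commutator with the sum of squares cancel after an exchange of the indices.\<close>

lemma casimir_commute: "casimir (br w z) = br w (casimir z)"
proof -
  define M where "M a b = \<kappa> (br w (x a)) (x b)" for a b
  define R where "R a b = br (x b) (br (x a) z)" for a b
  have skew: "M a b = - M b a" for a b
    unfolding M_def by (subst \<kappa>_skew) (simp add: \<kappa>_commute)
  have ex: "br w (x a) = (\<Sum>b\<in>UNIV. M a b *\<^sub>C x b)" for a
    unfolding M_def by (rule expansion[symmetric])
  have "br w (casimir z) - casimir (br w z) =
      (\<Sum>a\<in>UNIV. br (br w (x a)) (br (x a) z) + br (x a) (br (br w (x a)) z))"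
    by (simp add: casimir_def br_r br_jacobi[of w] sum_subtractf sum.distrib)
  also have "\<dots> = (\<Sum>a\<in>UNIV. \<Sum>b\<in>UNIV. M a b *\<^sub>C R a b) + (\<Sum>a\<in>UNIV. \<Sum>b\<in>UNIV. M a b *\<^sub>C R b a)"
    by (simp add: ex br_l br_r R_def sum.distrib)
  also have "(\<Sum>a\<in>UNIV. \<Sum>b\<in>UNIV. M a b *\<^sub>C R a b) = (\<Sum>a\<in>UNIV. \<Sum>b\<in>UNIV. M b a *\<^sub>C R b a)"
    by (rule sum.swap)
  also have "\<dots> = - (\<Sum>a\<in>UNIV. \<Sum>b\<in>UNIV. M a b *\<^sub>C R b a)"
    unfolding sum_negf[symmetric] by (intro sum.cong refl) (subst skew, simp)
  finally show ?thesis by simp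
qed

text \<open>The orthonormal basis is traded for a Cartan part and dual pairs E \<alpha>, F \<alpha>.
  The Cartan part contributes \<kappa>(\<theta>, \<theta>). A positive root contributes
  [E \<alpha>, F \<alpha>] = \<alpha>, since E \<alpha> kills the highest root vector; a negative
  root contributes nothing, because its F raises the weight.\<close>

lemma casimir_root_vector:
  assumes P: "positive_system \<Phi> P" and \<theta>: "highest_root \<Phi> P \<theta>" and y: "y \<in> weight_space \<theta>"
  shows "casimir y = (\<kappa> \<theta> \<theta> + (\<Sum>\<alpha>\<in>P. \<kappa> \<alpha> \<theta>)) *\<^sub>C y"
proof -
  have P': "P \<subseteq> \<Phi>" "\<And>\<alpha>. \<alpha> \<in> \<Phi> \<Longrightarrow> (\<alpha> \<in> P) \<noteq> (- \<alpha> \<in> P)"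
    using P unfolding positive_system_def by blast+
  have \<theta>': "\<theta> \<in> P" "\<And>\<alpha>. \<alpha> \<in> P \<Longrightarrow> \<theta> + \<alpha> \<notin> \<Phi>"
    using \<theta> unfolding highest_root_def by blast+
  have \<theta>h: "\<theta> \<in> \<hh>" using \<theta>'(1) P'(1) by (auto simp: roots_iff)
  have "\<exists>e f. e \<in> weight_space \<alpha> \<and> f \<in> weight_space (- \<alpha>) \<and> \<kappa> e f = 1" if "\<alpha> \<in> \<Phi>" for \<alpha>
    using that weight_space_pairing by (metis roots_iff)
  then obtain E F where EF: "\<And>\<alpha>. \<alpha> \<in> \<Phi> \<Longrightarrow>
      E \<alpha> \<in> weight_space \<alpha> \<and> F \<alpha> \<in> weight_space (- \<alpha>) \<and> \<kappa> (E \<alpha>) (F \<alpha>) = 1"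
    by metis
  \<comment> \<open>The projection to \<open>\<hh>\<close> along the root spaces; with it the Cartan
    part is handled without an orthonormal basis of \<open>\<hh>\<close>.\<close>
  define H where "H u = u - (\<Sum>\<alpha>\<in>\<Phi>. \<kappa> u (F \<alpha>) *\<^sub>C E \<alpha>)" for u
  have H_linear: "clinear H"
    by (rule clinearI) (simp_all add: H_def \<kappa>_simps cscale_simps sum.distrib
        complex_vector.scale_sum_right)
  have orth: "\<kappa> h w = 0" if "h \<in> \<hh>" "\<alpha> \<in> \<Phi>" "w \<in> weight_space \<alpha>" for h w \<alpha>
  proof (rule ccontr)
    assume "\<kappa> h w \<noteq> 0"
    moreover have "h \<in> weight_space 0" "0 \<in> \<hh>"
      using that weight_space_zero \<hh>_subspace complex_vector.subspace_0 by auto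
    ultimately have "\<alpha> = - 0"
      using that by (intro weight_space_orthogonal[of h 0 w \<alpha>]) (auto simp: roots_iff)
    then show False using that by (simp add: roots_iff)
  qed
  have \<Phi>h: "\<alpha> \<in> \<hh>" if "\<alpha> \<in> \<Phi>" for \<alpha> using that by (simp add: roots_iff)
  have H_in: "H u \<in> \<hh>" for u
  proof (rule cspan_UNIV_induct[where x = u, OF weight_vectors_span])
    show "csubspace {u. H u \<in> \<hh>}"
      using \<hh>_subspace
      by (intro csubspace_Collect) (auto simp: clinear_simps[OF H_linear] complex_vector.subspace_0
          complex_vector.subspace_add complex_vector.subspace_scale)
    fix u assume "u \<in> \<hh> \<union> (\<Union>\<alpha>\<in>\<Phi>. weight_space \<alpha>)"
    then show "H u \<in> \<hh>"
    proof
      assume u: "u \<in> \<hh>"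
      have "\<kappa> u (F \<alpha>) = 0" if "\<alpha> \<in> \<Phi>" for \<alpha>
        using orth[OF u root_uminus[OF that]] EF[OF that] by blast
      then show ?thesis using u by (simp add: H_def)
    next
      assume "u \<in> (\<Union>\<alpha>\<in>\<Phi>. weight_space \<alpha>)"
      then obtain \<beta> where \<beta>: "\<beta> \<in> \<Phi>" "u \<in> weight_space \<beta>" by blast
      have "\<kappa> u (F \<alpha>) *\<^sub>C E \<alpha> = (if \<alpha> = \<beta> then u else 0)" if \<alpha>: "\<alpha> \<in> \<Phi>" for \<alpha>
      proof (cases "\<alpha> = \<beta>")
        case True
        then show ?thesis
          using root_space_one_dimensional[OF \<beta>(1) _ _ _ \<beta>(2)] EF[OF \<beta>(1)] by auto
      next
        case False
        have "\<kappa> u (F \<alpha>) = 0"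
        proof (rule ccontr)
          assume "\<kappa> u (F \<alpha>) \<noteq> 0"
          then have "- \<alpha> = - \<beta>"
            using \<beta> \<alpha> EF[OF \<alpha>] \<Phi>h root_uminus by (intro weight_space_orthogonal) auto
          then show False using False by simp
        qed
        then show ?thesis using False by simp
      qed
      then have "(\<Sum>\<alpha>\<in>\<Phi>. \<kappa> u (F \<alpha>) *\<^sub>C E \<alpha>) = (\<Sum>\<alpha>\<in>\<Phi>. if \<alpha> = \<beta> then u else 0)"
        by (intro sum.cong) auto
      then have "H u = 0" using \<beta>(1) finite_roots by (simp add: H_def)
      then show ?thesis using \<hh>_subspace complex_vector.subspace_0 by auto
    qed
  qed
  have HF: "H (F \<alpha>) = 0" if \<alpha>: "\<alpha> \<in> \<Phi>" for \<alpha>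
  proof (rule \<hh>_nondegenerate[OF H_in])
    fix u assume u: "u \<in> \<hh>"
    have "\<kappa> (F \<alpha>) u = 0" "\<And>\<beta>. \<beta> \<in> \<Phi> \<Longrightarrow> \<kappa> (E \<beta>) u = 0"
      using orth[OF u] EF root_uminus[OF \<alpha>] \<alpha> by (metis \<kappa>_commute)+
    then show "\<kappa> (H (F \<alpha>)) u = 0"
      by (simp add: H_def \<kappa>_simps)
  qed
  have split: "x a = H (x a) + (\<Sum>\<alpha>\<in>\<Phi>. \<kappa> (x a) (F \<alpha>) *\<^sub>C E \<alpha>)" for a
    by (simp add: H_def)
  have "casimir y = (\<Sum>a\<in>UNIV. br (H (x a)) (br (x a) y))
      + (\<Sum>a\<in>UNIV. \<Sum>\<alpha>\<in>\<Phi>. \<kappa> (x a) (F \<alpha>) *\<^sub>C br (E \<alpha>) (br (x a) y))"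
    unfolding casimir_def
    by (subst (1) split) (simp add: br_l sum.distrib)
  \<comment> \<open>Summing over a first reassembles F \<alpha> from its coordinates; this is the
    change to dual bases.\<close>
  also have "(\<Sum>a\<in>UNIV. \<Sum>\<alpha>\<in>\<Phi>. \<kappa> (x a) (F \<alpha>) *\<^sub>C br (E \<alpha>) (br (x a) y))
      = (\<Sum>\<alpha>\<in>\<Phi>. br (E \<alpha>) (br (\<Sum>a\<in>UNIV. \<kappa> (F \<alpha>) (x a) *\<^sub>C x a) y))"
    by (subst sum.swap) (simp add: br_l br_r \<kappa>_commute)
  also have "\<dots> = (\<Sum>\<alpha>\<in>\<Phi>. br (E \<alpha>) (br (F \<alpha>) y))"
    by (simp add: expansion)
  also have "(\<Sum>a\<in>UNIV. br (H (x a)) (br (x a) y))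
      = (\<Sum>a\<in>UNIV. br (H (x a)) (br (H (x a)) y))
      + (\<Sum>a\<in>UNIV. \<Sum>\<alpha>\<in>\<Phi>. \<kappa> (x a) (F \<alpha>) *\<^sub>C br (H (x a)) (br (E \<alpha>) y))"
    by (subst (2) split) (simp add: br_l br_r sum.distrib)
  also have "(\<Sum>a\<in>UNIV. \<Sum>\<alpha>\<in>\<Phi>. \<kappa> (x a) (F \<alpha>) *\<^sub>C br (H (x a)) (br (E \<alpha>) y))
      = (\<Sum>\<alpha>\<in>\<Phi>. br (H (\<Sum>a\<in>UNIV. \<kappa> (F \<alpha>) (x a) *\<^sub>C x a)) (br (E \<alpha>) y))"
    by (subst sum.swap) (simp add: br_l clinear_simps[OF H_linear] \<kappa>_commute)
  \<comment> \<open>The mixed terms between the Cartan part and the root vectors vanish, since the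
    projection kills F \<alpha>.\<close>
  also have "\<dots> = 0"
    by (simp add: expansion HF br_l)
  also have "(\<Sum>a\<in>UNIV. br (H (x a)) (br (H (x a)) y)) = \<kappa> \<theta> \<theta> *\<^sub>C y"
  proof -
    have \<theta>H: "\<kappa> \<theta> (H u) = \<kappa> \<theta> u" for u
      using orth[OF \<theta>h] EF by (simp add: H_def \<kappa>_simps)
    have "br (H (x a)) (br (H (x a)) y) = (\<kappa> \<theta> (x a) * \<kappa> \<theta> (x a)) *\<^sub>C y" for a
      by (simp add: weight_spaceD[OF y H_in] br_r cscale_simps \<theta>H)
    then have "(\<Sum>a\<in>UNIV. br (H (x a)) (br (H (x a)) y))
        = \<kappa> \<theta> (\<Sum>a\<in>UNIV. \<kappa> \<theta> (x a) *\<^sub>C x a) *\<^sub>C y"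
      by (simp add: \<kappa>_simps complex_vector.scale_sum_left)
    then show ?thesis by (simp only: expansion)
  qed
  also have "(\<Sum>\<alpha>\<in>\<Phi>. br (E \<alpha>) (br (F \<alpha>) y)) = (\<Sum>\<alpha>\<in>P. \<kappa> \<alpha> \<theta>) *\<^sub>C y"
  proof -
    have vanish: "w = 0" if w: "w \<in> weight_space (\<alpha> + \<theta>)" and \<alpha>: "\<alpha> \<in> P" for w \<alpha>
    proof (rule ccontr)
      assume "w \<noteq> 0"
      have "\<alpha> + \<theta> \<in> \<hh>"
        using \<alpha> P'(1) \<Phi>h \<theta>h \<hh>_subspace complex_vector.subspace_add by blast
      moreover have "\<alpha> + \<theta> \<noteq> 0"
      proof
        assume "\<alpha> + \<theta> = 0"
        then have "\<alpha> = - \<theta>" by (simp add: eq_neg_iff_add_eq_0)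
        then show False using P' \<theta>'(1) \<alpha> by blast
      qed
      ultimately have "\<alpha> + \<theta> \<in> \<Phi>" using w \<open>w \<noteq> 0\<close> by (auto simp: roots_iff)
      then show False using \<theta>'(2)[OF \<alpha>] by (simp add: add.commute)
    qed
    have "br (E \<alpha>) (br (F \<alpha>) y) = (if \<alpha> \<in> P then \<kappa> \<alpha> \<theta> *\<^sub>C y else 0)" if \<alpha>: "\<alpha> \<in> \<Phi>" for \<alpha>
    proof (cases "\<alpha> \<in> P")
      case True
      have "br (E \<alpha>) y = 0"
        using vanish[OF weight_space_bracket True] EF[OF \<alpha>] y by blast
      moreover have "br (E \<alpha>) (F \<alpha>) = \<alpha>"
        using root_bracket[of "E \<alpha>" \<alpha> "F \<alpha>"] EF[OF \<alpha>] \<Phi>h[OF \<alpha>] by (simp add: cscale_one)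
      ultimately show ?thesis
        using True weight_spaceD[OF y \<Phi>h[OF \<alpha>]]
        by (simp add: br_jacobi[of "E \<alpha>"] br_r \<kappa>_commute)
    next
      case False
      then have "- \<alpha> \<in> P" using P'(2)[OF \<alpha>] by blast
      then have "br (F \<alpha>) y = 0"
        using vanish[OF weight_space_bracket, of "F \<alpha>" "- \<alpha>" y] EF[OF \<alpha>] y by blast
      then show ?thesis using False by (simp add: br_r)
    qed
    then have "(\<Sum>\<alpha>\<in>\<Phi>. br (E \<alpha>) (br (F \<alpha>) y)) = (\<Sum>\<alpha>\<in>\<Phi>. if \<alpha> \<in> P then \<kappa> \<alpha> \<theta> *\<^sub>C y else 0)"
      by (intro sum.cong) auto
    also have "\<dots> = (\<Sum>\<alpha>\<in>\<Phi> \<inter> P. \<kappa> \<alpha> \<theta> *\<^sub>C y)"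
      using finite_roots by (simp add: sum.inter_restrict)
    also have "\<Phi> \<inter> P = P" using P'(1) by blast
    finally show ?thesis by (simp add: complex_vector.scale_sum_left)
  qed
  finally show ?thesis by (simp add: cscale_simps)
qed

text \<open>The set where the Casimir acts by a given scalar is an ideal, since the Casimir commutes
  with brackets; it contains a highest root vector, so it is everything. With \<kappa>(\<theta>,
  \<theta>) = 2 the scalar 2 + \<Sum> \<kappa>(\<alpha>, \<theta>) over the positive roots is twice
  1 + \<kappa>(\<rho>, \<theta>), that is 2g.\<close>

lemma casimir_scalar:
  assumes P: "positive_system \<Phi> P" and \<theta>: "highest_root \<Phi> P \<theta>" and n: "\<kappa> \<theta> \<theta> = 2"
  shows "casimir z = (2 * dual_coxeter_number \<kappa> P \<theta>) *\<^sub>C z"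
proof -
  let ?c = "\<kappa> \<theta> \<theta> + (\<Sum>\<alpha>\<in>P. \<kappa> \<alpha> \<theta>)"
  have c: "2 * dual_coxeter_number \<kappa> P \<theta> = ?c"
    by (simp add: dual_coxeter_number_def n \<kappa>_simps)
  have "\<theta> \<in> \<Phi>"
    using P \<theta> unfolding positive_system_def highest_root_def by blast
  then obtain y where y: "y \<in> weight_space \<theta>" "y \<noteq> 0"
    by (auto simp: roots_iff)
  define I where "I = {z. casimir z = ?c *\<^sub>C z}"
  have "lie_ideal br I"
    unfolding lie_ideal_def
  proof (intro conjI allI ballI)
    show "csubspace I" unfolding I_def
      by (rule csubspace_Collect)
        (auto simp: clinear_simps[OF casimir_linear] cscale_add_right cscale_cscale mult.commute)
    show "\<And>w z. z \<in> I \<Longrightarrow> br w z \<in> I"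
      by (simp add: I_def casimir_commute br_r)
  qed
  moreover have "y \<in> I" using casimir_root_vector[OF P \<theta> y(1)] by (simp add: I_def)
  ultimately have "I = UNIV" using no_proper_ideal y(2) by blast
  then show ?thesis unfolding c by (auto simp: I_def)
qed

end

text \<open>The first identity is a matrix entry of the scalar Casimir in the orthonormal basis. The
  second keeps the level plus g away from 0: since the algebra is not abelian some structure
  constant is nonzero, and the first identity for its middle index writes 2g as a nonzero sum of
  squares.\<close>

proposition structure_constants_casimir:
  fixes br :: "'g::complex_vector \<Rightarrow> 'g \<Rightarrow> 'g" and x :: "'i::finite \<Rightarrow> 'g"
  assumes "simple_lie_algebra br" "invariant_form br \<kappa>" "cartan_subalgebra br \<hh>"
    "positive_system (roots br \<kappa> \<hh>) P" "highest_root (roots br \<kappa> \<hh>) P \<theta>"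
    and nb: "normalized_basis br \<kappa> \<theta> x \<Gamma>"
  shows "complex_of_real (\<Sum>a\<in>UNIV. \<Sum>c\<in>UNIV. \<Gamma> a b c * \<Gamma> a d c)
      = (if b = d then 2 * dual_coxeter_number \<kappa> P \<theta> else 0)"
    and "Re (dual_coxeter_number \<kappa> P \<theta>) > 0"
proof -
  have nb': "cspan (range x) = UNIV"
    "\<And>a b. br (x a) (x b) = \<i> *\<^sub>C (\<Sum>c\<in>UNIV. complex_of_real (\<Gamma> a b c) *\<^sub>C x c)"
    "\<kappa> \<theta> \<theta> = 2" "\<And>a b. \<kappa> (x a) (x b) = (if a = b then 1 else 0)"
    using nb unfolding normalized_basis_def by blast+
  interpret cartan_decomposition br \<kappa> \<hh> x
    using assms(1-3) nb' by (simp add: cartan_decomposition_def cartan_decomposition_axioms_def)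
  have comp: "\<kappa> (br (x a) (x b)) (x c) = \<i> * complex_of_real (\<Gamma> a b c)" for a b c
    by (simp add: nb' \<kappa>_simps if_distrib[of "\<lambda>c. _ * c"] cong: if_cong)
  show main: "complex_of_real (\<Sum>a\<in>UNIV. \<Sum>c\<in>UNIV. \<Gamma> a b c * \<Gamma> a d c)
      = (if b = d then 2 * dual_coxeter_number \<kappa> P \<theta> else 0)" for b d
  proof -
    have "(if b = d then 2 * dual_coxeter_number \<kappa> P \<theta> else 0) = \<kappa> (casimir (x b)) (x d)"
      by (simp add: casimir_scalar[OF assms(4,5) nb'(3)] \<kappa>_simps nb'(4))
    also have "\<dots> = (\<Sum>a\<in>UNIV. - \<kappa> (br (x a) (x b)) (br (x a) (x d)))"
      by (simp add: casimir_def \<kappa>_simps \<kappa>_skew[of _ "br _ _"])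
    \<comment> \<open>The minus sign from invariance is absorbed by the product of the two factors
      \<i> in the brackets.\<close>
    also have "\<dots> = (\<Sum>a\<in>UNIV. \<Sum>c\<in>UNIV. complex_of_real (\<Gamma> a b c * \<Gamma> a d c))"
      unfolding nb'(2)[of _ d] \<kappa>_sum \<kappa>_scale_right comp sum_distrib_left sum_negf[symmetric]
      by (intro sum.cong refl) (simp add: algebra_simps)
    finally show ?thesis by simp
  qed
  obtain a b c where nz: "\<Gamma> a b c \<noteq> 0"
  proof (rule ccontr)
    assume "\<not> thesis"
    then have "\<And>a b c. \<Gamma> a b c = 0" using that by blast
    then have xx: "br (x a) (x b) = 0" for a b by (simp add: nb'(2))
    have x0: "br (x a) z = 0" for a z
      by (rule cspan_UNIV_induct[where x = z, OF nb'(1)]) (auto intro!: csubspace_Collect simp: br_r xx)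
    have "br y z = 0" for y z
      by (rule cspan_UNIV_induct[where x = y, OF nb'(1)]) (auto intro!: csubspace_Collect simp: br_l x0)
    then show False using nonabelian by blast
  qed
  have "0 < \<Gamma> a b c * \<Gamma> a b c"
    using nz by (metis not_real_square_gt_zero)
  also have "\<dots> \<le> (\<Sum>c\<in>UNIV. \<Gamma> a b c * \<Gamma> a b c)"
    by (rule member_le_sum) auto
  also have "\<dots> \<le> (\<Sum>a\<in>UNIV. \<Sum>c\<in>UNIV. \<Gamma> a b c * \<Gamma> a b c)"
    by (rule member_le_sum[of a UNIV "\<lambda>a. \<Sum>c\<in>UNIV. \<Gamma> a b c * \<Gamma> a b c"]) (auto intro: sum_nonneg)
  also have "\<dots> = Re (2 * dual_coxeter_number \<kappa> P \<theta>)"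
    unfolding main[of b b, simplified, symmetric] by simp
  finally show "Re (dual_coxeter_number \<kappa> P \<theta>) > 0" by simp
qed

section \<open>Locality of fields in terms of modes\<close>

abbreviation eventually_zero :: "(nat \<Rightarrow> 'a::zero) \<Rightarrow> bool"
  where "eventually_zero f \<equiv> (\<forall>\<^sub>F j in sequentially. f j = 0)"

lemma eventually_zero_finite: "eventually_zero f \<Longrightarrow> finite {j. f j \<noteq> 0}"
proof -
  assume "eventually_zero f"
  then obtain N where "\<forall>j\<ge>N. f j = 0" by (auto simp: eventually_sequentially)
  then have "{j. f j \<noteq> 0} \<subseteq> {..<N}" by (auto simp: not_le[symmetric])
  then show ?thesis using finite_subset by blast
qed

lemma eventually_zero_Suc: "eventually_zero f \<Longrightarrow> eventually_zero (\<lambda>j. f (Suc j))"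
  using eventually_sequentially_Suc[of "\<lambda>j. f j = 0"] by simp

lemma Sum_any_add:
  fixes f g :: "nat \<Rightarrow> 'a::comm_monoid_add"
  assumes "eventually_zero f" "eventually_zero g"
  shows "Sum_any (\<lambda>j. f j + g j) = Sum_any f + Sum_any g"
  by (intro Sum_any.distrib eventually_zero_finite assms)

lemma Sum_any_additive:
  fixes f :: "nat \<Rightarrow> 'a::comm_monoid_add" and h :: "'a \<Rightarrow> 'b::comm_monoid_add"
  assumes f: "eventually_zero f" and h: "h 0 = 0" "\<And>x y. h (x + y) = h x + h y"
  shows "h (Sum_any f) = Sum_any (\<lambda>j. h (f j))"
proof -
  have sum: "h (sum f A) = (\<Sum>j\<in>A. h (f j))" for A
    by (induction A rule: infinite_finite_induct) (simp_all add: h)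
  show ?thesis
    unfolding Sum_any.expand_set[of f] sum
    by (rule Sum_any.expand_superset[symmetric]) (auto simp: h eventually_zero_finite[OF f])
qed

lemma Sum_any_diff:
  fixes f g :: "nat \<Rightarrow> 'a::ab_group_add"
  assumes "eventually_zero f" "eventually_zero g"
  shows "Sum_any (\<lambda>j. f j - g j) = Sum_any f - Sum_any g"
proof -
  have "Sum_any (\<lambda>j. - g j) = - Sum_any g"
    by (rule Sum_any_additive[symmetric]) (use assms in auto)
  then show ?thesis
    using Sum_any_add[of f "\<lambda>j. - g j"] assms by simp
qed

lemma Sum_any_clinear:
  assumes "eventually_zero f" "clinear h"
  shows "h (Sum_any f) = Sum_any (\<lambda>j. h (f j))"
  using assms by (intro Sum_any_additive) (auto simp: clinear_simps)

lemma Sum_any_cscale: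
  fixes f :: "nat \<Rightarrow> 'a::complex_vector"
  shows "eventually_zero f \<Longrightarrow> c *\<^sub>C Sum_any f = Sum_any (\<lambda>j. c *\<^sub>C f j)"
  by (rule Sum_any_additive) (auto simp: cscale_add_right)

lemma Sum_any_shift:
  fixes f :: "nat \<Rightarrow> 'a::comm_monoid_add"
  assumes "eventually_zero f"
  shows "Sum_any f = f 0 + Sum_any (\<lambda>j. f (Suc j))"
proof -
  obtain N where N: "\<forall>j\<ge>N. f j = 0" using assms by (auto simp: eventually_sequentially)
  have "Sum_any f = sum f {..<Suc N}"
    by (rule Sum_any.expand_superset) (use N in \<open>auto simp: not_le[symmetric]\<close>)
  moreover have "Sum_any (\<lambda>j. f (Suc j)) = (\<Sum>j<N. f (Suc j))"
    by (rule Sum_any.expand_superset) (use N in \<open>auto simp: not_le[symmetric]\<close>)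
  ultimately show ?thesis by (simp only: sum.lessThan_Suc_shift)
qed

lemma Sum_any_single:
  fixes f :: "nat \<Rightarrow> 'a::comm_monoid_add"
  assumes "\<And>j. j \<noteq> k \<Longrightarrow> f j = 0"
  shows "Sum_any f = f k"
proof -
  have "Sum_any f = sum f {k}"
    by (rule Sum_any.expand_superset) (use assms in auto)
  then show ?thesis by simp
qed

text \<open>The coefficients of (z - w)^n expanded for |w| < |z|. For n >= 0 and for n < 0 they are
  the two kinds of coefficients in \<open>field_prod\<close>, so both cases can be treated
  uniformly.\<close>

definition binom_coeff :: "int \<Rightarrow> nat \<Rightarrow> complex"
  where "binom_coeff n p = (-1) ^ p * (of_int n gchoose p)"

lemma binom_coeff_0_right [simp]: "binom_coeff n 0 = 1"
  by (simp add: binom_coeff_def)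

lemma binom_coeff_0_left: "binom_coeff 0 p = (if p = 0 then 1 else 0)"
  by (cases p) (simp_all add: binom_coeff_def)

lemma binom_coeff_Suc: "binom_coeff (n + 1) (Suc p) = binom_coeff n (Suc p) - binom_coeff n p"
  using gbinomial_Suc_Suc[of "of_int n :: complex" p]
  by (simp add: binom_coeff_def algebra_simps)

lemma binom_coeff_absorb: "of_nat (Suc p) * binom_coeff n (Suc p) = - ((of_int n - of_nat p) * binom_coeff n p)"
proof -
  have "of_nat (Suc p) * (of_int n gchoose Suc p) = (of_int n - of_nat p) * (of_int n gchoose p :: complex)"
    using gbinomial_absorb_comp[of "of_int n :: complex" p] gbinomial_absorption[of p "of_int n :: complex"]
    by simp
  then show ?thesis
    unfolding binom_coeff_def mult.left_commute[of _ "(- 1) ^ _"] by simp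
qed

lemma binom_coeff_nonneg: "n \<ge> 0 \<Longrightarrow> binom_coeff n p = (-1) ^ p * of_nat (nat n choose p)"
  using binomial_gbinomial[of "nat n" p, where 'a = complex]
  by (simp add: binom_coeff_def)

lemma binom_coeff_neg: "n < 0 \<Longrightarrow> binom_coeff n p = of_nat (nat (int p - n - 1) choose p)"
proof -
  assume n: "n < 0"
  have "(of_int n :: complex) = - (of_int (- n))" by simp
  then have "(of_int n gchoose p :: complex) = (-1) ^ p * (of_int (- n) + of_nat p - 1 gchoose p)"
    using gbinomial_minus[of "of_int (- n) :: complex" p] by simp
  moreover have "of_int (- n) + of_nat p - 1 = (of_nat (nat (int p - n - 1)) :: complex)"
    using n by simp
  ultimately show ?thesis
    by (simp add: binom_coeff_def binomial_gbinomial mult.assoc[symmetric] power_mult_distrib[symmetric])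
qed

text \<open>If F holds the coefficients of z^(-p-1) w^(-m-1), this is multiplication by (z - w)^n
  expanded for |w| < |z|.\<close>

definition mode_conv :: "int \<Rightarrow> (int \<Rightarrow> int \<Rightarrow> 'a::complex_vector) \<Rightarrow> int \<Rightarrow> int \<Rightarrow> 'a"
  where "mode_conv n F p m = Sum_any (\<lambda>j. binom_coeff n j *\<^sub>C F (p + n - int j) (m + int j))"

text \<open>Makes every sum in \<open>mode_conv\<close> finite. Products of truncated fields have it
  because the right factor acts first.\<close>

definition right_truncated :: "(int \<Rightarrow> int \<Rightarrow> 'a::zero) \<Rightarrow> bool"
  where "right_truncated F \<longleftrightarrow> (\<forall>p m. eventually_zero (\<lambda>j. F (p - int j) (m + int j)))"

text \<open>In terms of generating series, multiplication by \<open>z - w\<close>.\<close>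

definition shift_diff :: "(int \<Rightarrow> int \<Rightarrow> 'a::ab_group_add) \<Rightarrow> int \<Rightarrow> int \<Rightarrow> 'a"
  where "shift_diff F = (\<lambda>m n. F (m + 1) n - F m (n + 1))"

lemma right_truncated_mode_conv:
  "right_truncated F \<Longrightarrow> eventually_zero (\<lambda>j. binom_coeff n j *\<^sub>C F (p + n - int j) (m + int j))"
  unfolding right_truncated_def by (elim allE[of _ "p + n"] allE[of _ m] eventually_mono) simp

lemma mode_conv_0: "mode_conv 0 F = F"
  unfolding mode_conv_def fun_eq_iff
  by (subst Sum_any_single[of 0]) (simp_all add: binom_coeff_0_left cscale_one)

text \<open>Pascal's rule for the coefficients, in the guise of (z - w)^(n+1) = (z - w) (z -
  w)^n.\<close>

lemma mode_conv_Suc: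
  assumes "right_truncated F"
  shows "mode_conv (n + 1) F = shift_diff (mode_conv n F)"
proof (intro ext)
  fix p m
  note ez = right_truncated_mode_conv[OF assms]
  have ez1: "eventually_zero (\<lambda>j. binom_coeff n (Suc j) *\<^sub>C F (p + n - int j) (m + 1 + int j))"
    using eventually_zero_Suc[OF ez[of n "p + 1" m]] by (simp add: algebra_simps)
  have "mode_conv (n + 1) F p m = F (p + n + 1) m
      + Sum_any (\<lambda>j. binom_coeff (n + 1) (Suc j) *\<^sub>C F (p + n - int j) (m + 1 + int j))"
    unfolding mode_conv_def
    by (subst Sum_any_shift[OF ez]) (simp add: cscale_one algebra_simps)
  also have "Sum_any (\<lambda>j. binom_coeff (n + 1) (Suc j) *\<^sub>C F (p + n - int j) (m + 1 + int j))
      = Sum_any (\<lambda>j. binom_coeff n (Suc j) *\<^sub>C F (p + n - int j) (m + 1 + int j))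
      - mode_conv n F p (m + 1)"
    unfolding mode_conv_def
    by (subst Sum_any_diff[OF ez1 ez, symmetric])
      (simp add: binom_coeff_Suc complex_vector.scale_left_diff_distrib)
  also have "F (p + n + 1) m + (Sum_any (\<lambda>j. binom_coeff n (Suc j) *\<^sub>C F (p + n - int j) (m + 1 + int j))
      - mode_conv n F p (m + 1)) = mode_conv n F (p + 1) m - mode_conv n F p (m + 1)"
    unfolding mode_conv_def[of n F "p + 1" m]
    by (subst Sum_any_shift[OF ez]) (simp add: cscale_one algebra_simps)
  finally show "mode_conv (n + 1) F p m = shift_diff (mode_conv n F) p m"
    by (simp add: shift_diff_def)
qed

section \<open>Truncated fields and their products\<close>

definition truncated_field :: "'h::complex_prehilbert fld \<Rightarrow> bool"
  where "truncated_field A \<longleftrightarrow> is_field A \<and> (\<forall>v. \<exists>N. \<forall>n\<ge>N. A n v = 0)"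

lemma truncated_field_linear: "truncated_field A \<Longrightarrow> clinear (A n)"
  by (simp add: truncated_field_def is_field_def)

lemma truncated_fieldD: "truncated_field A \<Longrightarrow> \<exists>N. \<forall>n\<ge>N. A n v = 0"
  by (simp add: truncated_field_def)

lemma truncated_field_eventually:
  assumes "truncated_field A"
  shows "eventually_zero (\<lambda>j. A (m + int j) v)"
proof -
  obtain N where "\<forall>n\<ge>N. A n v = 0" using truncated_fieldD[OF assms] by blast
  then show ?thesis
    unfolding eventually_sequentially by (intro exI[of _ "nat (N - m)"]) auto
qed

lemma right_truncated_modes:
  assumes "truncated_field B" "\<And>p. f p 0 = 0"
  shows "right_truncated (\<lambda>p m. f p (B m v))"
  unfolding right_truncated_def
proof (intro allI)
  fix p m
  from truncated_field_eventually[OF assms(1), of m v]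
  show "eventually_zero (\<lambda>j. f (p - int j) (B (m + int j) v))"
    by eventually_elim (simp add: assms)
qed

lemma right_truncated_product:
  "truncated_field A \<Longrightarrow> truncated_field B \<Longrightarrow> right_truncated (\<lambda>p m. A p (B m v))"
  by (rule right_truncated_modes) (simp_all add: clinear_zero[OF truncated_field_linear])

text \<open>Both orders of the product multiplied by (z - w)^n, each expanded in its own domain. The
  residue in z, which is the slice p = 0, is the product A_nB, and for n = 0 the whole series is the
  supercommutator; multiplication by z - w thus links the products for different n.\<close>

definition product_modes :: "complex \<Rightarrow> int \<Rightarrow> 'h::complex_prehilbert fld \<Rightarrow> 'h fld \<Rightarrow> 'h \<Rightarrow> int \<Rightarrow> int \<Rightarrow> 'h"
  where "product_modes s n A B v = (\<lambda>p m. mode_conv n (\<lambda>p m. A p (B m v)) p m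
    - (s * (-1) powi n) *\<^sub>C mode_conv n (\<lambda>m p. B m (A p v)) m p)"

lemma product_modes_Suc:
  assumes "truncated_field A" "truncated_field B"
  shows "product_modes s (n + 1) A B v = shift_diff (product_modes s n A B v)"
proof -
  have "(- 1 :: complex) powi (n + 1) = - ((- 1) powi n)"
    by (simp add: power_int_add)
  then show ?thesis
    unfolding product_modes_def
    by (simp add: mode_conv_Suc right_truncated_product assms fun_eq_iff shift_diff_def
        complex_vector.scale_right_diff_distrib)
qed

lemma product_modes_add_nat:
  assumes "truncated_field A" "truncated_field B"
  shows "product_modes s (n + int k) A B v = (shift_diff ^^ k) (product_modes s n A B v)"
proof (induction k)
  case (Suc k)
  have "product_modes s (n + int (Suc k)) A B v = product_modes s ((n + int k) + 1) A B v"
    by (simp add: algebra_simps)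
  then show ?case using Suc by (simp add: product_modes_Suc assms)
qed simp

definition supercommutator :: "complex \<Rightarrow> 'h::complex_prehilbert fld \<Rightarrow> 'h fld \<Rightarrow> 'h \<Rightarrow> int \<Rightarrow> int \<Rightarrow> 'h"
  where "supercommutator s A B v = (\<lambda>m n. A m (B n v) - s *\<^sub>C B n (A m v))"

lemma product_modes_0: "product_modes s 0 A B v = supercommutator s A B v"
  by (simp add: product_modes_def supercommutator_def mode_conv_0)

text \<open>For n >= 0 the definition runs both orders over the same modes, for n < 0 over reflected
  ones. Reflecting p to n - p in the second half, at the price of the sign (-1)^n, brings both cases
  into one form.\<close>

lemma field_prod_Sum_any:
  assumes A: "truncated_field A" and B: "truncated_field B"
  shows "field_prod \<epsilon> n A B m v = Sum_any (\<lambda>p. binom_coeff n p *\<^sub>C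
    (A (n - int p) (B (m + int p) v) - (parity_sign \<epsilon> * (-1) powi n) *\<^sub>C B (m + n - int p) (A (int p) v)))"
    (is "_ = Sum_any (\<lambda>p. _ *\<^sub>C (?f p - ?s *\<^sub>C ?g p))")
proof (cases "n \<ge> 0")
  case False
  then show ?thesis by (simp add: field_prod_def binom_coeff_neg)
next
  case True
  have c0: "p \<le> nat n" if "binom_coeff n p \<noteq> 0" for p
    using True that by (auto simp: binom_coeff_nonneg not_less[symmetric] binomial_eq_0)
  have "Sum_any (\<lambda>p. binom_coeff n p *\<^sub>C (?f p - ?s *\<^sub>C ?g p))
      = (\<Sum>p=0..nat n. binom_coeff n p *\<^sub>C (?f p - ?s *\<^sub>C ?g p))"
    by (rule Sum_any.expand_superset) (use c0 in auto)
  also have "\<dots> = (\<Sum>p=0..nat n. binom_coeff n p *\<^sub>C ?f p) - (\<Sum>p=0..nat n. (binom_coeff n p * ?s) *\<^sub>C ?g p)"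
    by (simp add: complex_vector.scale_right_diff_distrib cscale_cscale sum_subtractf)
  also have "(\<Sum>p=0..nat n. (binom_coeff n p * ?s) *\<^sub>C ?g p)
      = (\<Sum>p=0..nat n. (binom_coeff n (nat n - p) * ?s) *\<^sub>C ?g (nat n - p))"
    by (rule sum.reindex_bij_witness[of _ "\<lambda>p. nat n - p" "\<lambda>p. nat n - p"]) auto
  also have "\<dots> = (\<Sum>p=0..nat n. (binom_coeff n p * parity_sign \<epsilon>) *\<^sub>C B (m + int p) (A (n - int p) v))"
  proof (rule sum.cong)
    fix p assume p: "p \<in> {0..nat n}"
    have "(- 1 :: complex) ^ (nat n - p) * (- 1) powi n = (- 1) ^ p"
    proof -
      have "(- 1 :: complex) powi n = (- 1) ^ nat n"
        using True by (simp add: power_int_def)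
      also have "\<dots> = (- 1) ^ (nat n - p) * (- 1) ^ p"
        using p by (simp flip: power_add)
      finally show ?thesis
        by (simp add: mult.assoc[symmetric] power_mult_distrib[symmetric])
    qed
    moreover have "nat n choose (nat n - p) = nat n choose p"
      using p by (simp add: binomial_symmetric[symmetric])
    ultimately have "binom_coeff n (nat n - p) * ?s = binom_coeff n p * parity_sign \<epsilon>"
      using True by (simp add: binom_coeff_nonneg)
    moreover have "m + n - int (nat n - p) = m + int p" "int (nat n - p) = n - int p"
      using p True by auto
    ultimately show "(binom_coeff n (nat n - p) * ?s) *\<^sub>C ?g (nat n - p)
        = (binom_coeff n p * parity_sign \<epsilon>) *\<^sub>C B (m + int p) (A (n - int p) v)"
      by simp
  qed simp
  finally show ?thesis
    using True by (simp add: field_prod_def binom_coeff_nonneg complex_vector.scale_right_diff_distrib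
        cscale_cscale sum_subtractf)
qed

lemma field_prod_split:
  assumes A: "truncated_field A" and B: "truncated_field B"
  shows "field_prod \<epsilon> n A B m v = Sum_any (\<lambda>p. binom_coeff n p *\<^sub>C A (n - int p) (B (m + int p) v))
    - (parity_sign \<epsilon> * (-1) powi n) *\<^sub>C Sum_any (\<lambda>p. binom_coeff n p *\<^sub>C B (m + n - int p) (A (int p) v))"
proof -
  have 1: "eventually_zero (\<lambda>p. binom_coeff n p *\<^sub>C A (n - int p) (B (m + int p) v))"
    using right_truncated_mode_conv[OF right_truncated_product[OF A B], of n 0 m v] by simp
  have 2: "eventually_zero (\<lambda>p. binom_coeff n p *\<^sub>C B (m + n - int p) (A (int p) v))"
    using right_truncated_mode_conv[OF right_truncated_product[OF B A], of n m 0 v] by simp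
  from 2 have 3: "eventually_zero (\<lambda>p. (parity_sign \<epsilon> * (-1) powi n) *\<^sub>C (binom_coeff n p *\<^sub>C B (m + n - int p) (A (int p) v)))"
    by eventually_elim simp
  show ?thesis
    unfolding field_prod_Sum_any[OF A B] Sum_any_cscale[OF 2] Sum_any_diff[OF 1 3, symmetric]
    by (simp add: complex_vector.scale_right_diff_distrib cscale_cscale mult.commute)
qed

lemma field_prod_product_modes:
  assumes "truncated_field A" "truncated_field B"
  shows "field_prod \<epsilon> n A B m v = product_modes (parity_sign \<epsilon>) n A B v 0 m"
  by (simp add: field_prod_split[OF assms] product_modes_def mode_conv_def)

lemma truncated_field_prod:
  assumes A: "truncated_field A" and B: "truncated_field B"
  shows "truncated_field (field_prod \<epsilon> n A B)"
  unfolding truncated_field_def is_field_def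
proof (intro conjI allI)
  note A' = clinear_simps[OF truncated_field_linear[OF A]]
  note B' = clinear_simps[OF truncated_field_linear[OF B]]
  fix m
  have ez: "eventually_zero (\<lambda>p. binom_coeff n p *\<^sub>C A (n - int p) (B (m + int p) v))"
    "eventually_zero (\<lambda>p. binom_coeff n p *\<^sub>C B (m + n - int p) (A (int p) v))" for v
    using right_truncated_mode_conv[OF right_truncated_product[OF A B], of n 0 m v]
      right_truncated_mode_conv[OF right_truncated_product[OF B A], of n m 0 v] by simp_all
  show "clinear (field_prod \<epsilon> n A B m)"
  proof (rule clinearI)
    show "field_prod \<epsilon> n A B m (x + y) = field_prod \<epsilon> n A B m x + field_prod \<epsilon> n A B m y" for x y
      by (simp add: field_prod_split[OF A B] A' B' cscale_add_right Sum_any_add[OF ez(1) ez(1)]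
          Sum_any_add[OF ez(2) ez(2)] complex_vector.scale_right_diff_distrib)
    show "field_prod \<epsilon> n A B m (c *\<^sub>C x) = c *\<^sub>C field_prod \<epsilon> n A B m x" for c x
    proof -
      have "Sum_any (\<lambda>p. binom_coeff n p *\<^sub>C A (n - int p) (B (m + int p) (c *\<^sub>C x)))
          = c *\<^sub>C Sum_any (\<lambda>p. binom_coeff n p *\<^sub>C A (n - int p) (B (m + int p) x))"
        by (simp add: Sum_any_cscale[OF ez(1)] A' B' mult.commute)
      moreover have "Sum_any (\<lambda>p. binom_coeff n p *\<^sub>C B (m + n - int p) (A (int p) (c *\<^sub>C x)))
          = c *\<^sub>C Sum_any (\<lambda>p. binom_coeff n p *\<^sub>C B (m + n - int p) (A (int p) x))"
        by (simp add: Sum_any_cscale[OF ez(2)] A' B' mult.commute)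
      ultimately show ?thesis
        by (simp add: field_prod_split[OF A B] complex_vector.scale_right_diff_distrib mult.commute)
    qed
  qed
next
  fix v
  note A0 = clinear_zero[OF truncated_field_linear[OF A]]
  note B0 = clinear_zero[OF truncated_field_linear[OF B]]
  obtain NA where NA: "\<forall>k\<ge>NA. A k v = 0" using truncated_fieldD[OF A] by blast
  obtain NB where NB: "\<forall>k\<ge>NB. B k v = 0" using truncated_fieldD[OF B] by blast
  have "\<exists>N. \<forall>k\<ge>N. B k (A (int p) v) = 0" for p
    using truncated_fieldD[OF B] by blast
  then obtain M where M: "\<And>p k. k \<ge> M p \<Longrightarrow> B k (A (int p) v) = 0" by metis
  \<comment> \<open>In the second half only the finitely many vectors A(p) v with p below NA can be
    nonzero; N exceeds their bounds M p even after the shift of the mode by n - p.\<close>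
  define N where "N = max NB (Max (insert 0 (M ` {..nat NA})) + int (nat NA) - n)"
  have "field_prod \<epsilon> n A B m v = 0" if m: "m \<ge> N" for m
  proof -
    have "A (n - int p) (B (m + int p) v) = 0" for p
      using NB m A0 by (simp add: N_def)
    moreover have "B (m + n - int p) (A (int p) v) = 0" for p
    proof (cases "p \<le> nat NA")
      case True
      then have "M p \<le> Max (insert 0 (M ` {..nat NA}))" by (intro Max_ge) auto
      moreover have "Max (insert 0 (M ` {..nat NA})) + int (nat NA) - n \<le> m"
        using m unfolding N_def by (simp only: max.bounded_iff)
      moreover have "int p \<le> int (nat NA)" using True by (simp only: of_nat_le_iff)
      ultimately show ?thesis by (intro M) linarith
    next
      case False
      then show ?thesis using NA B0 by simp
    qed
    ultimately show ?thesis by (simp add: field_prod_Sum_any[OF A B])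
  qed
  then show "\<exists>N. \<forall>k\<ge>N. field_prod \<epsilon> n A B k v = 0" by blast
qed

text \<open>A power of z - w kills the supercommutator as a formal series, with an exponent
  independent of the vector. This stands in for the rational-function condition until correlation
  functions are recovered.\<close>

definition mode_local :: "complex \<Rightarrow> 'h::complex_prehilbert fld \<Rightarrow> 'h fld \<Rightarrow> bool"
  where "mode_local s A B \<longleftrightarrow> (\<exists>N. \<forall>v. (shift_diff ^^ N) (supercommutator s A B v) = (\<lambda>m n. 0))"

lemma funpow_shift_diff_zero: "(shift_diff ^^ N) (\<lambda>m n. 0) = (\<lambda>m n. 0)"
  by (induction N) (simp_all add: shift_diff_def)

lemma funpow_shift_diff_add:
  "(shift_diff ^^ N) (\<lambda>m n. F m n + G m n) = (\<lambda>m n. (shift_diff ^^ N) F m n + (shift_diff ^^ N) G m n)"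
  by (induction N) (simp_all add: shift_diff_def algebra_simps)

lemma funpow_shift_diff_additive:
  assumes "\<And>x y. h (x - y) = h x - (h y :: 'b::ab_group_add)"
  shows "(shift_diff ^^ N) (\<lambda>m n. h (F m n)) = (\<lambda>m n. h ((shift_diff ^^ N) F m n))"
  by (induction N) (simp_all add: shift_diff_def assms)

lemma funpow_shift_diff_le:
  assumes "(shift_diff ^^ N) F = (\<lambda>m n. 0)" "N \<le> M"
  shows "(shift_diff ^^ M) F = (\<lambda>m n. 0)"
proof -
  obtain k where "M = k + N" using assms(2) by (metis le_add_diff_inverse2)
  then show ?thesis by (simp add: funpow_add assms(1) funpow_shift_diff_zero)
qed

lemma funpow_shift_diff_swap:
  "(shift_diff ^^ N) (\<lambda>m n. F n m) = (\<lambda>m n. (if even N then 1 else -1) *\<^sub>C (shift_diff ^^ N) F n m)"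
  by (induction N) (auto simp: shift_diff_def cscale_one)

text \<open>Exchanging the fields multiplies the supercommutator by -s because s squares to 1, and
  exchanging the variables changes z - w only by a sign.\<close>

lemma mode_local_sym:
  assumes s: "s * s = 1" and l: "mode_local s A B"
  shows "mode_local s B A"
proof -
  obtain N where N: "\<And>v. (shift_diff ^^ N) (supercommutator s A B v) = (\<lambda>m n. 0)"
    using l by (auto simp: mode_local_def)
  have eq: "supercommutator s B A v = (\<lambda>m n. (- s) *\<^sub>C supercommutator s A B v n m)" for v
    by (simp add: supercommutator_def fun_eq_iff complex_vector.scale_right_diff_distrib cscale_cscale s cscale_one)
  have "(shift_diff ^^ N) (supercommutator s B A v) = (\<lambda>m n. 0)" for v
  proof -
    have scale: "(shift_diff ^^ N) (\<lambda>m n. (- s) *\<^sub>C F m n) = (\<lambda>m n. (- s) *\<^sub>C (shift_diff ^^ N) F m n)"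
      for F :: "int \<Rightarrow> int \<Rightarrow> 'a"
      by (rule funpow_shift_diff_additive) (rule complex_vector.scale_right_diff_distrib)
    have "(shift_diff ^^ N) (supercommutator s B A v)
        = (\<lambda>m n. (- s) *\<^sub>C (shift_diff ^^ N) (\<lambda>m n. supercommutator s A B v n m) m n)"
      by (subst eq) (rule scale)
    also have "(shift_diff ^^ N) (\<lambda>m n. supercommutator s A B v n m) = (\<lambda>m n. 0)"
      by (subst funpow_shift_diff_swap) (simp add: N)
    finally show ?thesis by simp
  qed
  then show ?thesis by (auto simp: mode_local_def)
qed

lemma mode_local_add_left:
  assumes A: "mode_local s A C" "mode_local s B C" and C: "truncated_field C"
  shows "mode_local s (A + B) C"
proof -
  obtain N where N: "\<And>v. (shift_diff ^^ N) (supercommutator s A C v) = (\<lambda>m n. 0)"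
    using A(1) by (auto simp: mode_local_def)
  obtain M where M: "\<And>v. (shift_diff ^^ M) (supercommutator s B C v) = (\<lambda>m n. 0)"
    using A(2) by (auto simp: mode_local_def)
  have "supercommutator s (A + B) C v = (\<lambda>m n. supercommutator s A C v m n + supercommutator s B C v m n)" for v
    by (simp add: supercommutator_def fun_eq_iff clinear_add[OF truncated_field_linear[OF C]] cscale_add_right)
  moreover have "(shift_diff ^^ max N M) (supercommutator s A C v) = (\<lambda>m n. 0)"
    "(shift_diff ^^ max N M) (supercommutator s B C v) = (\<lambda>m n. 0)" for v
    by (rule funpow_shift_diff_le[OF N] funpow_shift_diff_le[OF M]; simp)+
  ultimately have "(shift_diff ^^ max N M) (supercommutator s (A + B) C v) = (\<lambda>m n. 0)" for v
    by (simp add: funpow_shift_diff_add)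
  then show ?thesis by (auto simp: mode_local_def)
qed

lemma mode_local_scale_left:
  assumes A: "mode_local s A C" and C: "truncated_field C"
  shows "mode_local s (c *\<^sub>C A) C"
proof -
  obtain N where N: "\<And>v. (shift_diff ^^ N) (supercommutator s A C v) = (\<lambda>m n. 0)"
    using A by (auto simp: mode_local_def)
  have "supercommutator s (c *\<^sub>C A) C v = (\<lambda>m n. c *\<^sub>C supercommutator s A C v m n)" for v
    by (simp add: supercommutator_def fun_eq_iff cscale_fun_def clinear_scale[OF truncated_field_linear[OF C]]
        complex_vector.scale_right_diff_distrib cscale_cscale mult.commute)
  then have "(shift_diff ^^ N) (supercommutator s (c *\<^sub>C A) C v) = (\<lambda>m n. 0)" for v
    by (simp add: funpow_shift_diff_additive[of "\<lambda>x. c *\<^sub>C x"] complex_vector.scale_right_diff_distrib N)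
  then show ?thesis by (auto simp: mode_local_def)
qed

lemma mode_local_zero: "truncated_field C \<Longrightarrow> mode_local s 0 C"
  unfolding mode_local_def
  by (intro exI[of _ 0]) (simp add: supercommutator_def fun_eq_iff clinear_zero[OF truncated_field_linear])

section \<open>Dong's lemma\<close>

lemma funpow_commute_op:
  assumes "\<And>F. S (T F) = T (S F)"
  shows "(S ^^ a) ((T ^^ b) F) = (T ^^ b) ((S ^^ a) F)"
proof -
  have "S ((T ^^ b) F) = (T ^^ b) (S F)" for F
    by (induction b) (simp_all add: assms)
  then show ?thesis by (induction a arbitrary: F) simp_all
qed

text \<open>Every monomial in the expansion of (T - S)^(a+b) contains the a-th power of S or the
  b-th power of T. Splitting off one factor and passing to T G and S G lowers a + b, which replaces
  the binomial expansion by an induction.\<close>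

lemma funpow_diff_eq_0:
  fixes S T :: "'a::ab_group_add \<Rightarrow> 'a"
  assumes S: "\<And>F G. S (F - G) = S F - S G" and T: "\<And>F G. T (F - G) = T F - T G"
    and comm: "\<And>F. S (T F) = T (S F)"
    and "(S ^^ a) G = 0" "(T ^^ b) G = 0"
  shows "((\<lambda>F. T F - S F) ^^ (a + b)) G = 0"
  using assms(4,5)
proof (induction "a + b" arbitrary: a b G)
  case 0
  then show ?case by simp
next
  case (Suc n)
  let ?U = "\<lambda>F. T F - S F"
  have U_diff: "(?U ^^ k) (F - G) = (?U ^^ k) F - (?U ^^ k) G" for k F G
  proof (induction k)
    case (Suc k)
    then show ?case by (simp only: funpow.simps comp_def S T) (simp add: algebra_simps)
  qed simp
  have S0: "S 0 = 0" using S[of 0 0] by simp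
  have T0: "T 0 = 0" using T[of 0 0] by simp
  have U0: "(?U ^^ k) 0 = 0" for k by (induction k) (simp_all add: S0 T0)
  have Sa: "(S ^^ k) 0 = 0" for k by (induction k) (simp_all add: S0)
  have Tb: "(T ^^ k) 0 = 0" for k by (induction k) (simp_all add: T0)
  show ?case
  proof (cases "a = 0 \<or> b = 0")
    case True
    then have "G = 0" using Suc.prems by auto
    then show ?thesis by (simp add: U0)
  next
    case False
    then obtain a' b' where ab: "a = Suc a'" "b = Suc b'" by (meson not0_implies_Suc)
    have 1: "(?U ^^ (a + b')) (T G) = 0"
    proof (rule Suc.hyps(1))
      show "n = a + b'" using Suc.hyps(2) ab by simp
      have "(S ^^ a) (T G) = T ((S ^^ a) G)"
        using funpow_commute_op[of S T a 1 G] comm by simp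
      then show "(S ^^ a) (T G) = 0" by (simp only: Suc.prems(1) T0)
      show "(T ^^ b') (T G) = 0" using Suc.prems(2) ab by (simp add: funpow_swap1)
    qed
    have 2: "(?U ^^ (a' + b)) (S G) = 0"
    proof (rule Suc.hyps(1))
      show "n = a' + b" using Suc.hyps(2) ab by simp
      show "(S ^^ a') (S G) = 0" using Suc.prems(1) ab by (simp add: funpow_swap1)
      have "(T ^^ b) (S G) = S ((T ^^ b) G)"
        using funpow_commute_op[of T S b 1 G] comm by simp
      then show "(T ^^ b) (S G) = 0" by (simp only: Suc.prems(2) S0)
    qed
    have "a + b = Suc (a + b')" "a' + b = a + b'" using ab by auto
    then have "(?U ^^ (a + b)) G = (?U ^^ (a + b')) (T G - S G)"
      by (simp only: funpow_Suc_right comp_def)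
    also have "\<dots> = 0" using 1 2 \<open>a' + b = a + b'\<close> by (simp add: U_diff)
    finally show ?thesis .
  qed
qed

section \<open>Series in three variables z, w, u\<close>

type_synonym 'a modes3 = "int \<Rightarrow> int \<Rightarrow> int \<Rightarrow> 'a"

text \<open>With a third variable u for the field C, the three operators multiply by z - w, z - u
  and w - u. Dong's argument rests on w - u = (z - u) - (z - w).\<close>

definition diff_zw :: "'a::ab_group_add modes3 \<Rightarrow> 'a modes3"
  where "diff_zw F = (\<lambda>p m k. F (p + 1) m k - F p (m + 1) k)"

definition diff_zu :: "'a::ab_group_add modes3 \<Rightarrow> 'a modes3"
  where "diff_zu F = (\<lambda>p m k. F (p + 1) m k - F p m (k + 1))"

definition diff_wu :: "'a::ab_group_add modes3 \<Rightarrow> 'a modes3"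
  where "diff_wu F = (\<lambda>p m k. F p (m + 1) k - F p m (k + 1))"

lemma diff_wu_eq: "diff_wu = (\<lambda>F. diff_zu F - diff_zw F)"
  by (simp add: diff_wu_def diff_zu_def diff_zw_def fun_eq_iff)

lemma diff3_diff:
  "diff_zw (F - G) = diff_zw F - diff_zw G" "diff_zu (F - G) = diff_zu F - diff_zu G"
  "diff_wu (F - G) = diff_wu F - diff_wu G"
  by (simp_all add: diff_wu_def diff_zu_def diff_zw_def fun_eq_iff)

lemma diff3_commute:
  "diff_zw (diff_zu F) = diff_zu (diff_zw F)" "diff_zw (diff_wu F) = diff_wu (diff_zw F)"
  "diff_zu (diff_wu F) = diff_wu (diff_zu F)"
  by (simp_all add: diff_wu_def diff_zu_def diff_zw_def fun_eq_iff algebra_simps)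

lemma diff3_funpow_commute:
  "(diff_zw ^^ a) ((diff_wu ^^ b) F) = (diff_wu ^^ b) ((diff_zw ^^ a) F)"
  "(diff_zu ^^ a) ((diff_wu ^^ b) F) = (diff_wu ^^ b) ((diff_zu ^^ a) F)"
  using funpow_commute_op[of diff_zw diff_wu a b F] funpow_commute_op[of diff_zu diff_wu a b F]
  by (simp_all add: diff3_commute)

lemma diff3_funpow_diff:
  "(diff_zw ^^ N) (F - G) = (diff_zw ^^ N) F - (diff_zw ^^ N) G"
  "(diff_zu ^^ N) (F - G) = (diff_zu ^^ N) F - (diff_zu ^^ N) G"
  "(diff_wu ^^ N) (F - G) = (diff_wu ^^ N) F - (diff_wu ^^ N) G"
  by (induction N) (simp_all add: diff3_diff)

lemma diff3_funpow_0: "(diff_zw ^^ N) 0 = 0" "(diff_zu ^^ N) 0 = 0" "(diff_wu ^^ N) 0 = 0"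
  by (induction N) (simp_all add: diff_wu_def diff_zu_def diff_zw_def fun_eq_iff)

lemma diff3_funpow_scale:
  "(diff_zw ^^ N) (c *\<^sub>C F) = c *\<^sub>C (diff_zw ^^ N) F"
  "(diff_zu ^^ N) (c *\<^sub>C F) = c *\<^sub>C (diff_zu ^^ N) F"
  "(diff_wu ^^ N) (c *\<^sub>C F) = c *\<^sub>C (diff_wu ^^ N) F"
  by (induction N) (simp_all add: diff_wu_def diff_zu_def diff_zw_def fun_eq_iff cscale_fun_def
      complex_vector.scale_right_diff_distrib)

lemma diff3_funpow_linear:
  "(diff_zu ^^ a) ((diff_wu ^^ b) (F - c *\<^sub>C G)) = (diff_zu ^^ a) ((diff_wu ^^ b) F) - c *\<^sub>C (diff_zu ^^ a) ((diff_wu ^^ b) G)"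
  by (simp only: diff3_funpow_diff diff3_funpow_scale)

lemma diff3_funpow_zero: "(diff_zw ^^ a) F = 0 \<Longrightarrow> (diff_zw ^^ a) ((diff_wu ^^ b) F) = 0"
  by (simp only: diff3_funpow_commute(1) diff3_funpow_0)

lemma diff_wu_nilpotent:
  assumes "(diff_zw ^^ a) G = 0" "(diff_zu ^^ b) G = 0"
  shows "(diff_wu ^^ (a + b)) G = 0"
  unfolding diff_wu_eq by (rule funpow_diff_eq_0) (use assms in \<open>simp_all add: diff3_diff diff3_commute\<close>)

lemma funpow_diff_zw_slice: "(diff_zw ^^ N) F = (\<lambda>p m k. (shift_diff ^^ N) (\<lambda>p m. F p m k) p m)"
  by (induction N) (simp_all add: diff_zw_def shift_diff_def)

lemma funpow_diff_zu_slice: "(diff_zu ^^ N) F = (\<lambda>p m k. (shift_diff ^^ N) (\<lambda>p k. F p m k) p k)"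
  by (induction N) (simp_all add: diff_zu_def shift_diff_def)

lemma funpow_diff_wu_slice: "(diff_wu ^^ N) F = (\<lambda>p m k. (shift_diff ^^ N) (\<lambda>m k. F p m k) m k)"
  by (induction N) (simp_all add: diff_wu_def shift_diff_def)

definition conv3 :: "int \<Rightarrow> 'a::complex_vector modes3 \<Rightarrow> 'a modes3"
  where "conv3 n F = (\<lambda>p m k. mode_conv n (\<lambda>p m. F p m k) p m)"

definition right_truncated3 :: "'a::zero modes3 \<Rightarrow> bool"
  where "right_truncated3 F \<longleftrightarrow> (\<forall>k. right_truncated (\<lambda>p m. F p m k))"

lemma right_truncated3_closed:
  assumes "right_truncated3 (F :: 'a::ab_group_add modes3)"
  shows "right_truncated3 (diff_zu F)" "right_truncated3 (diff_wu F)"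
proof -
  have ez: "eventually_zero (\<lambda>j. F (p - int j) (m + int j) k)" for p m k
    using assms by (auto simp: right_truncated3_def right_truncated_def)
  show "right_truncated3 (diff_zu F)"
    unfolding right_truncated3_def right_truncated_def
  proof (intro allI)
    fix k p m
    from ez[of "p + 1" m k] ez[of p m "k + 1"]
    show "eventually_zero (\<lambda>j. diff_zu F (p - int j) (m + int j) k)"
      by eventually_elim (simp add: diff_zu_def algebra_simps)
  qed
  show "right_truncated3 (diff_wu F)"
    unfolding right_truncated3_def right_truncated_def
  proof (intro allI)
    fix k p m
    from ez[of p "m + 1" k] ez[of p m "k + 1"]
    show "eventually_zero (\<lambda>j. diff_wu F (p - int j) (m + int j) k)"
      by eventually_elim (simp add: diff_wu_def algebra_simps)
  qed
qed

lemma right_truncated3_funpow: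
  assumes "right_truncated3 (F :: 'a::ab_group_add modes3)"
  shows "right_truncated3 ((diff_zu ^^ N) F)" "right_truncated3 ((diff_wu ^^ N) F)"
  by (induction N) (use assms right_truncated3_closed in auto)

lemma right_truncated3_conv:
  "right_truncated3 F \<Longrightarrow> eventually_zero (\<lambda>j. binom_coeff n j *\<^sub>C F (p + n - int j) (m + int j) k)"
  unfolding right_truncated3_def by (rule right_truncated_mode_conv[of "\<lambda>p m. F p m k"]) simp

lemma conv3_diff:
  assumes "right_truncated3 F" "right_truncated3 G"
  shows "conv3 n (F - G) = conv3 n F - conv3 n G"
proof (intro ext)
  fix p m k
  have ez: "eventually_zero (\<lambda>j. binom_coeff n j *\<^sub>C F (p + n - int j) (m + int j) k)"
    "eventually_zero (\<lambda>j. binom_coeff n j *\<^sub>C G (p + n - int j) (m + int j) k)"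
    by (rule right_truncated3_conv; fact)+
  show "conv3 n (F - G) p m k = (conv3 n F - conv3 n G) p m k"
    by (simp add: conv3_def mode_conv_def complex_vector.scale_right_diff_distrib Sum_any_diff[OF ez, symmetric])
qed

lemma conv3_scale:
  assumes "right_truncated3 F"
  shows "conv3 n (c *\<^sub>C F) = c *\<^sub>C conv3 n F"
proof (intro ext)
  fix p m k
  have ez: "eventually_zero (\<lambda>j. binom_coeff n j *\<^sub>C F (p + n - int j) (m + int j) k)"
    by (rule right_truncated3_conv; fact)
  show "conv3 n (c *\<^sub>C F) p m k = (c *\<^sub>C conv3 n F) p m k"
    by (simp add: conv3_def mode_conv_def cscale_fun_def Sum_any_cscale[OF ez] cscale_cscale mult.commute)
qed

lemma conv3_commute:
  assumes "right_truncated3 F"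
  shows "conv3 n (diff_zu F) = diff_zu (conv3 n F)" "conv3 n (diff_wu F) = diff_wu (conv3 n F)"
proof -
  have ez: "eventually_zero (\<lambda>j. binom_coeff n j *\<^sub>C F (p + n - int j) (m + int j) k)" for p m k
    by (rule right_truncated3_conv; fact)
  show "conv3 n (diff_zu F) = diff_zu (conv3 n F)"
  proof (intro ext)
    fix p m k
    have "diff_zu (conv3 n F) p m k = Sum_any (\<lambda>j. binom_coeff n j *\<^sub>C F (p + 1 + n - int j) (m + int j) k
        - binom_coeff n j *\<^sub>C F (p + n - int j) (m + int j) (k + 1))"
      unfolding diff_zu_def conv3_def mode_conv_def by (rule Sum_any_diff[OF ez ez, symmetric])
    also have "\<dots> = conv3 n (diff_zu F) p m k"
      by (simp add: diff_zu_def conv3_def mode_conv_def complex_vector.scale_right_diff_distrib algebra_simps)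
    finally show "conv3 n (diff_zu F) p m k = diff_zu (conv3 n F) p m k" by simp
  qed
  show "conv3 n (diff_wu F) = diff_wu (conv3 n F)"
  proof (intro ext)
    fix p m k
    have "diff_wu (conv3 n F) p m k = Sum_any (\<lambda>j. binom_coeff n j *\<^sub>C F (p + n - int j) (m + 1 + int j) k
        - binom_coeff n j *\<^sub>C F (p + n - int j) (m + int j) (k + 1))"
      unfolding diff_wu_def conv3_def mode_conv_def by (rule Sum_any_diff[OF ez ez, symmetric])
    also have "\<dots> = conv3 n (diff_wu F) p m k"
      by (simp add: diff_wu_def conv3_def mode_conv_def complex_vector.scale_right_diff_distrib algebra_simps)
    finally show "conv3 n (diff_wu F) p m k = diff_wu (conv3 n F) p m k" by simp
  qed
qed

lemma conv3_funpow:
  assumes "right_truncated3 F"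
  shows "conv3 n ((diff_zu ^^ N) F) = (diff_zu ^^ N) (conv3 n F)"
    and "conv3 n ((diff_wu ^^ N) F) = (diff_wu ^^ N) (conv3 n F)"
  by (induction N) (simp_all add: conv3_commute right_truncated3_funpow assms)

lemma conv3_zero: "conv3 n 0 = 0"
  by (simp add: conv3_def mode_conv_def fun_eq_iff)

text \<open>Moving C to the left past B costs (w - u)^N2, and past A it costs (z - u)^N1.
  Multiplication by these polynomials commutes with the expansion of (z - w)^n.\<close>

lemma dong_half:
  assumes A: "truncated_field A" and B: "truncated_field B" and C: "truncated_field C"
    and AC: "\<And>v. (shift_diff ^^ N1) (supercommutator sac A C v) = (\<lambda>m n. 0)"
    and BC: "\<And>v. (shift_diff ^^ N2) (supercommutator sbc B C v) = (\<lambda>m n. 0)"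
  shows "(diff_zu ^^ N1) ((diff_wu ^^ N2) (conv3 n (\<lambda>p m k. A p (B m (C k v)))
    - (sac * sbc) *\<^sub>C conv3 n (\<lambda>p m k. C k (A p (B m v))))) = 0"
proof -
  note A' = clinear_simps[OF truncated_field_linear[OF A]]
  note B' = clinear_simps[OF truncated_field_linear[OF B]]
  note C' = clinear_simps[OF truncated_field_linear[OF C]]
  let ?ABC = "\<lambda>p m k. A p (B m (C k v))"
  let ?ACB = "\<lambda>p m k. A p (C k (B m v))"
  let ?CAB = "\<lambda>p m k. C k (A p (B m v))"
  have tr: "right_truncated3 ?ABC" "right_truncated3 ?CAB"
    unfolding right_truncated3_def
    using right_truncated_product[OF A B] right_truncated_modes[OF B, of "\<lambda>p u. C _ (A p u)"]
    by (simp_all add: A' C')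
  have tr_scale: "right_truncated3 (c *\<^sub>C F)" if "right_truncated3 F" for c and F :: "'a modes3"
    using that unfolding right_truncated3_def right_truncated_def cscale_fun_def
    by (auto elim!: allE eventually_mono)
  have tr_diff: "right_truncated3 (F - G)" if F: "right_truncated3 F" and G: "right_truncated3 G" for F G :: "'a modes3"
    unfolding right_truncated3_def right_truncated_def
  proof (intro allI)
    fix k p m
    have "eventually_zero (\<lambda>j. F (p - int j) (m + int j) k)" "eventually_zero (\<lambda>j. G (p - int j) (m + int j) k)"
      using F G by (auto simp: right_truncated3_def right_truncated_def)
    then show "eventually_zero (\<lambda>j. (F - G) (p - int j) (m + int j) k)"
      by eventually_elim simp
  qed
  define P where "P = ?ABC - sbc *\<^sub>C ?ACB"
  define Q where "Q = ?ACB - sac *\<^sub>C ?CAB"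
  have P: "(diff_wu ^^ N2) P = 0"
  proof -
    have "P = (\<lambda>p m k. A p (supercommutator sbc B C v m k))"
      by (simp add: P_def fun_eq_iff supercommutator_def A' cscale_fun_def)
    then show ?thesis
      by (simp add: funpow_diff_wu_slice funpow_shift_diff_additive[of "A _"] A' BC fun_eq_iff)
  qed
  have Q: "(diff_zu ^^ N1) Q = 0"
  proof -
    have "Q = (\<lambda>p m k. supercommutator sac A C (B m v) p k)"
      by (simp add: Q_def fun_eq_iff supercommutator_def A' cscale_fun_def)
    then show ?thesis
      by (simp add: funpow_diff_zu_slice AC fun_eq_iff)
  qed
  define R where "R = ?ABC - (sac * sbc) *\<^sub>C ?CAB"
  have R: "R = P - (- sbc) *\<^sub>C Q"
    by (simp add: R_def P_def Q_def fun_eq_iff cscale_fun_def complex_vector.scale_right_diff_distrib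
        cscale_cscale mult.commute)
  have trR: "right_truncated3 R"
    unfolding R_def by (intro tr_diff tr_scale tr)
  have "conv3 n ?ABC - (sac * sbc) *\<^sub>C conv3 n ?CAB = conv3 n R"
    unfolding R_def by (simp only: conv3_diff[OF tr(1) tr_scale[OF tr(2)]] conv3_scale[OF tr(2)])
  then have conv: "(diff_zu ^^ N1) ((diff_wu ^^ N2) (conv3 n ?ABC - (sac * sbc) *\<^sub>C conv3 n ?CAB))
      = conv3 n ((diff_zu ^^ N1) ((diff_wu ^^ N2) R))"
    by (simp only: conv3_funpow(1)[OF right_truncated3_funpow(2)[OF trR]] conv3_funpow(2)[OF trR])
  have "(diff_zu ^^ N1) ((diff_wu ^^ N2) R) = 0"
    unfolding R diff3_funpow_linear diff3_funpow_commute(2)[of N1 N2 Q] P Q diff3_funpow_0 by simp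
  with conv show ?thesis by (simp only: conv3_zero)
qed

text \<open>The three-variable supercommutator of the product with C is killed by a power of z - w,
  because A and B are local, and by (z - u)^N1 (w - u)^N2. As w - u is the difference of z - u and z
  - w, a power of w - u alone kills it, and this survives taking the residue in z, which is
  A_nB.\<close>

theorem dong:
  assumes A: "truncated_field A" and B: "truncated_field B" and C: "truncated_field C"
    and AB: "mode_local (parity_sign \<epsilon>) A B" and AC: "mode_local sac A C" and BC: "mode_local sbc B C"
  shows "mode_local (sac * sbc) (field_prod \<epsilon> n A B) C"
proof -
  note A' = clinear_simps[OF truncated_field_linear[OF A]]
  note B' = clinear_simps[OF truncated_field_linear[OF B]]
  note C' = clinear_simps[OF truncated_field_linear[OF C]]
  let ?sab = "parity_sign \<epsilon>"
  obtain N where N: "\<And>v. (shift_diff ^^ N) (supercommutator ?sab A B v) = (\<lambda>m n. 0)"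
    using AB by (auto simp: mode_local_def)
  obtain N1 where N1: "\<And>v. (shift_diff ^^ N1) (supercommutator sac A C v) = (\<lambda>m n. 0)"
    using AC by (auto simp: mode_local_def)
  obtain N2 where N2: "\<And>v. (shift_diff ^^ N2) (supercommutator sbc B C v) = (\<lambda>m n. 0)"
    using BC by (auto simp: mode_local_def)
  \<comment> \<open>Multiplying by (z - w)^M raises n to the maximum of n and N, where the series is
    a multiple of the supercommutator that already vanishes.\<close>
  define M where "M = nat (int N - n)"
  have M: "(shift_diff ^^ M) (product_modes ?sab n A B v) = (\<lambda>m n. 0)" for v
  proof -
    have "n + int M = 0 + int (nat (n + int M))" by (simp add: M_def)
    then have "product_modes ?sab (n + int M) A B v = (shift_diff ^^ nat (n + int M)) (supercommutator ?sab A B v)"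
      using product_modes_add_nat[OF A B, of ?sab 0 "nat (n + int M)" v] by (simp only: product_modes_0)
    moreover have "(shift_diff ^^ nat (n + int M)) (supercommutator ?sab A B v) = (\<lambda>m n. 0)"
      by (rule funpow_shift_diff_le[OF N]) (auto simp: M_def le_nat_iff)
    ultimately show ?thesis
      by (simp only: product_modes_add_nat[OF A B])
  qed
  have "(shift_diff ^^ (M + N1 + N2)) (supercommutator (sac * sbc) (field_prod \<epsilon> n A B) C v) = (\<lambda>m n. 0)" for v
  proof -
    define G where "G = (\<lambda>p m k. product_modes ?sab n A B (C k v) p m
      - (sac * sbc) *\<^sub>C C k (product_modes ?sab n A B v p m))"
    define F1 where "F1 = conv3 n (\<lambda>p m k. A p (B m (C k v)))"
    define F3 where "F3 = conv3 n (\<lambda>p m k. C k (A p (B m v)))"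
    define F2 where "F2 = conv3 n (\<lambda>m p k. B m (A p (C k v)))"
    define F4 where "F4 = conv3 n (\<lambda>m p k. C k (B m (A p v)))"
    \<comment> \<open>Exchanging z and w makes the half with B to the left of A an instance of the
      same lemma with A and B interchanged.\<close>
    define swp where "swp F = (\<lambda>p m k. F m p k)" for F :: "'a modes3"
    have C_conv: "C k (mode_conv n F p m) = mode_conv n (\<lambda>p m. C k (F p m)) p m"
      if "right_truncated F" for F p m k
      unfolding mode_conv_def
      by (subst Sum_any_clinear[OF right_truncated_mode_conv[OF that] truncated_field_linear[OF C]])
        (simp add: C')
    let ?t = "?sab * (-1) powi n"
    have G_eq: "G = (F1 - (sac * sbc) *\<^sub>C F3) - ?t *\<^sub>C (swp F2 - (sac * sbc) *\<^sub>C swp F4)"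
      by (simp add: G_def F1_def F2_def F3_def F4_def swp_def fun_eq_iff cscale_fun_def product_modes_def
          conv3_def C' C_conv right_truncated_product A B complex_vector.scale_right_diff_distrib
          cscale_cscale algebra_simps)
    have half1: "(diff_zu ^^ N1) ((diff_wu ^^ N2) (F1 - (sac * sbc) *\<^sub>C F3)) = 0"
      unfolding F1_def F3_def by (rule dong_half[OF A B C N1 N2])
    have half2: "(diff_zu ^^ N2) ((diff_wu ^^ N1) (F2 - (sbc * sac) *\<^sub>C F4)) = 0"
      unfolding F2_def F4_def by (rule dong_half[OF B A C N2 N1])
    have swp_diff: "swp (diff_zu F) = diff_wu (swp F)" "swp (diff_wu F) = diff_zu (swp F)" for F
      by (simp_all add: swp_def diff_zu_def diff_wu_def)
    have swp_zu: "swp ((diff_zu ^^ a) F) = (diff_wu ^^ a) (swp F)"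
      and swp_wu: "swp ((diff_wu ^^ a) F) = (diff_zu ^^ a) (swp F)" for a F
      by (induction a) (simp_all add: swp_diff)
    have "swp F2 - (sac * sbc) *\<^sub>C swp F4 = swp (F2 - (sbc * sac) *\<^sub>C F4)"
      by (simp add: swp_def fun_eq_iff cscale_fun_def mult.commute)
    then have half2': "(diff_zu ^^ N1) ((diff_wu ^^ N2) (swp F2 - (sac * sbc) *\<^sub>C swp F4)) = 0"
      using half2 by (simp only: swp_zu[symmetric] swp_wu[symmetric] diff3_funpow_commute(2)[symmetric])
        (simp add: swp_def fun_eq_iff)
    have zu: "(diff_zu ^^ N1) ((diff_wu ^^ N2) G) = 0"
      by (simp only: G_eq diff3_funpow_linear[of N1 N2 "F1 - (sac * sbc) *\<^sub>C F3" ?t] half1 half2') simp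
    have zw: "(diff_zw ^^ M) ((diff_wu ^^ N2) G) = 0"
    proof -
      have "(diff_zw ^^ M) G = 0"
        unfolding funpow_diff_zw_slice
      proof (intro ext)
        fix p m k
        have 1: "(\<lambda>p m. G p m k) = (\<lambda>p m. product_modes ?sab n A B (C k v) p m
            + (- (sac * sbc)) *\<^sub>C C k (product_modes ?sab n A B v p m))"
          by (simp add: G_def)
        have 2: "(shift_diff ^^ M) (\<lambda>p m. (- (sac * sbc)) *\<^sub>C C k (product_modes ?sab n A B v p m))
            = (\<lambda>p m. (- (sac * sbc)) *\<^sub>C C k ((shift_diff ^^ M) (product_modes ?sab n A B v) p m))"
          by (rule funpow_shift_diff_additive) (simp only: C' complex_vector.scale_right_diff_distrib)
        show "(shift_diff ^^ M) (\<lambda>p m. G p m k) p m = 0 p m k"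
          by (subst 1, subst funpow_shift_diff_add, subst 2) (simp add: M C')
      qed
      then show ?thesis by (rule diff3_funpow_zero)
    qed
    have "(diff_wu ^^ (M + N1)) ((diff_wu ^^ N2) G) = 0"
      by (rule diff_wu_nilpotent[OF zw zu])
    then have "(diff_wu ^^ (M + N1 + N2)) G = 0"
      by (simp only: funpow_add comp_def)
    then have "(shift_diff ^^ (M + N1 + N2)) (G 0) = (\<lambda>m n. 0)"
      using funpow_diff_wu_slice[of "M + N1 + N2" G] by (simp add: fun_eq_iff)
    moreover have "G 0 = supercommutator (sac * sbc) (field_prod \<epsilon> n A B) C v"
      by (simp add: G_def supercommutator_def field_prod_product_modes A B)
    ultimately show ?thesis by simp
  qed
  then show ?thesis by (auto simp: mode_local_def)
qed

section \<open>Generated fields\<close>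

lemma bit_cases: "(b::bit) = 0 \<or> b = 1"
  by (cases b) auto

declare add_bit_eq_xor [simp del] mult_bit_eq_and [simp del]

lemma parity_sign_square: "parity_sign \<epsilon> * parity_sign \<epsilon> = 1"
  by (simp add: parity_sign_def)

lemma parity_sign_distrib: "parity_sign ((a + b) * c) = parity_sign (a * c) * parity_sign (b * c)"
  using bit_cases[of a] bit_cases[of b] bit_cases[of c] by (auto simp: parity_sign_def)

lemma truncated_field_subspace: "csubspace {A :: 'h::complex_prehilbert fld. truncated_field A}"
proof (rule csubspace_Collect)
  show "truncated_field 0"
    by (auto simp: truncated_field_def is_field_def clinear_iff)
next
  fix A B :: "'h fld"
  assume A: "truncated_field A" and B: "truncated_field B"
  show "truncated_field (A + B)"
    unfolding truncated_field_def is_field_def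
  proof (intro conjI allI)
    show "clinear ((A + B) n)" for n
      by (rule clinearI) (simp_all add: clinear_simps[OF truncated_field_linear[OF A]]
          clinear_simps[OF truncated_field_linear[OF B]] cscale_add_right)
    fix v
    obtain N M where "\<forall>n\<ge>N. A n v = 0" "\<forall>n\<ge>M. B n v = 0"
      using truncated_fieldD[OF A] truncated_fieldD[OF B] by blast
    then show "\<exists>N. \<forall>n\<ge>N. (A + B) n v = 0"
      by (intro exI[of _ "max N M"]) simp
  qed
next
  fix c and A :: "'h fld"
  assume A: "truncated_field A"
  show "truncated_field (c *\<^sub>C A)"
    unfolding truncated_field_def is_field_def
  proof (intro conjI allI)
    show "clinear ((c *\<^sub>C A) n)" for n
      by (rule clinearI) (simp_all add: cscale_fun_def clinear_simps[OF truncated_field_linear[OF A]]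
          cscale_add_right cscale_cscale mult.commute)
    fix v
    obtain N where "\<forall>n\<ge>N. A n v = 0" using truncated_fieldD[OF A] by blast
    then show "\<exists>N. \<forall>n\<ge>N. (c *\<^sub>C A) n v = 0"
      by (intro exI[of _ N]) (simp add: cscale_fun_def)
  qed
qed

lemma truncated_field_id: "truncated_field id_field"
  unfolding truncated_field_def is_field_def
proof (intro conjI allI)
  show "clinear (id_field n)" for n
    by (rule clinearI) (simp_all add: id_field_def)
  show "\<exists>N. \<forall>n\<ge>N. id_field n v = 0" for v
    by (rule exI[of _ 0]) (simp add: id_field_def)
qed

text \<open>As Id has the single mode -1, at most one term survives in each half of the product with
  index -2: in the first half for m <= -1, in the second for m >= 1. Closure under derivatives
  thereby becomes a case of closure under products.\<close>

lemma field_deriv_eq_prod: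
  assumes A: "truncated_field A"
  shows "field_deriv A = field_prod 0 (-2) A id_field"
proof (intro ext)
  fix m v
  note A0 = clinear_zero[OF truncated_field_linear[OF A]]
  have c: "binom_coeff (- 2) p = of_nat (Suc p)" for p
  proof -
    have "nat (int p - (- 2) - 1) = Suc p" by simp
    then show ?thesis by (simp only: binom_coeff_neg) simp
  qed
  have s: "parity_sign 0 * (- 1) powi (- 2) = 1"
    by (simp add: parity_sign_def power_int_def)
  have "Sum_any (\<lambda>p. binom_coeff (- 2) p *\<^sub>C A (- 2 - int p) (id_field (m + int p) v))
      = (if m \<le> - 1 then (- of_int m) *\<^sub>C A (m - 1) v else 0)"
  proof (cases "m \<le> - 1")
    case True
    then have eq: "int p = - 1 - m \<longleftrightarrow> p = nat (- 1 - m)" for p by auto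
    have "Sum_any (\<lambda>p. binom_coeff (- 2) p *\<^sub>C A (- 2 - int p) (id_field (m + int p) v))
      = binom_coeff (- 2) (nat (- 1 - m)) *\<^sub>C A (- 2 - int (nat (- 1 - m))) (id_field (m + int (nat (- 1 - m))) v)"
      by (rule Sum_any_single) (use True in \<open>auto simp: id_field_def A0\<close>)
    moreover have "- 2 - int (nat (- 1 - m)) = m - 1" "m + int (nat (- 1 - m)) = - 1"
      using True by auto
    ultimately show ?thesis using True by (simp add: id_field_def c)
  next
    case False
    then show ?thesis by (simp add: id_field_def A0)
  qed
  moreover have "Sum_any (\<lambda>p. binom_coeff (- 2) p *\<^sub>C id_field (m + (- 2) - int p) (A (int p) v))
      = (if m \<ge> 1 then of_int m *\<^sub>C A (m - 1) v else 0)"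
  proof (cases "m \<ge> 1")
    case True
    have "Sum_any (\<lambda>p. binom_coeff (- 2) p *\<^sub>C id_field (m + (- 2) - int p) (A (int p) v))
      = binom_coeff (- 2) (nat (m - 1)) *\<^sub>C id_field (m + (- 2) - int (nat (m - 1))) (A (int (nat (m - 1))) v)"
      by (rule Sum_any_single) (use True in \<open>auto simp: id_field_def\<close>)
    then show ?thesis using True by (simp add: id_field_def c)
  next
    case False
    then show ?thesis by (simp add: id_field_def)
  qed
  moreover have "field_deriv A m v = 0" if "m = 0"
    using that by (simp add: field_deriv_def)
  ultimately show "field_deriv A m v = field_prod 0 (- 2) A id_field m v"
    unfolding field_prod_split[OF A truncated_field_id] s
    by (auto simp: field_deriv_def cscale_one)
qed

lemma mode_local_id:
  assumes "truncated_field A"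
  shows "mode_local 1 A id_field"
  unfolding mode_local_def
  by (rule exI[of _ 0])
    (simp add: supercommutator_def id_field_def fun_eq_iff cscale_one clinear_zero[OF truncated_field_linear[OF assms]])

lemma mode_local_id': "truncated_field A \<Longrightarrow> mode_local 1 id_field A"
  by (rule mode_local_sym) (simp_all add: mode_local_id)

section \<open>Locality of all generated fields\<close>

definition truncated_generators :: "('h::complex_prehilbert fld \<times> bit) set \<Rightarrow> bool"
  where "truncated_generators G \<longleftrightarrow> (\<forall>(A, \<epsilon>)\<in>G. truncated_field A)"

text \<open>Since derivatives are products with Id, an induction over generated fields needs only
  the product case, and there both factors may be taken truncated.\<close>

lemma generated_truncated_induct [consumes 2, case_names id base prod]:
  assumes "generated G A \<epsilon>" and G: "truncated_generators G"
    and id: "P id_field 0" and base: "\<And>A \<epsilon>. (A, \<epsilon>) \<in> G \<Longrightarrow> P A \<epsilon>"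
    and prod: "\<And>A \<epsilon>1 B \<epsilon>2 n. truncated_field A \<Longrightarrow> truncated_field B \<Longrightarrow>
      generated G A \<epsilon>1 \<Longrightarrow> generated G B \<epsilon>2 \<Longrightarrow> P A \<epsilon>1 \<Longrightarrow> P B \<epsilon>2 \<Longrightarrow>
      P (field_prod (\<epsilon>1 * \<epsilon>2) n A B) (\<epsilon>1 + \<epsilon>2)"
  shows "P A \<epsilon>"
proof -
  from assms(1) have "truncated_field A \<and> P A \<epsilon>"
  proof (induction rule: generated.induct)
    case gen_id
    then show ?case using id truncated_field_id by blast
  next
    case (gen_base A \<epsilon>)
    then show ?case using base G by (auto simp: truncated_generators_def)
  next
    case (gen_prod A \<epsilon>1 B \<epsilon>2 n)
    then show ?case using prod truncated_field_prod by blast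
  next
    case (gen_deriv A \<epsilon>)
    have "P (field_prod (\<epsilon> * 0) (- 2) A id_field) (\<epsilon> + 0)"
      using gen_deriv generated.gen_id by (intro prod) (auto simp: truncated_field_id id)
    then show ?case
      using gen_deriv truncated_field_prod[OF _ truncated_field_id, of A 0 "- 2"]
      by (simp add: field_deriv_eq_prod)
  qed
  then show ?thesis by blast
qed

lemma generated_truncated:
  assumes "generated G A \<epsilon>" "truncated_generators G"
  shows "truncated_field A"
  using assms
  by (induction rule: generated_truncated_induct)
    (use assms(2) in \<open>auto simp: truncated_field_id truncated_field_prod truncated_generators_def\<close>)

definition pairwise_local :: "('h::complex_prehilbert fld \<times> bit) set \<Rightarrow> bool"
  where "pairwise_local G \<longleftrightarrow> (\<forall>(A, \<epsilon>1)\<in>G. \<forall>(B, \<epsilon>2)\<in>G. mode_local (parity_sign (\<epsilon>1 * \<epsilon>2)) A B)"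

text \<open>One round of products. Dong's lemma asks for all three pairs of fields to be local, so
  locality is carried as a property of whole stages rather than of single fields.\<close>

definition adjoin_products :: "('h::complex_prehilbert fld \<times> bit) set \<Rightarrow> ('h fld \<times> bit) set"
  where "adjoin_products M = M \<union> {(field_prod (\<epsilon>1 * \<epsilon>2) n A B, \<epsilon>1 + \<epsilon>2) | A \<epsilon>1 B \<epsilon>2 n. (A, \<epsilon>1) \<in> M \<and> (B, \<epsilon>2) \<in> M}"

text \<open>Dong's lemma is used twice: with a new product on the left and an old field on the right
  and then, after symmetry, with any field of the enlarged stage on the right.\<close>

lemma adjoin_products_local:
  assumes t: "truncated_generators M" and l: "pairwise_local M"
  shows "truncated_generators (adjoin_products M)" "pairwise_local (adjoin_products M)"
proof -
  have tr: "truncated_field A" if "(A, \<epsilon>) \<in> M" for A \<epsilon>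
    using t that by (auto simp: truncated_generators_def)
  have loc: "mode_local (parity_sign (\<epsilon>1 * \<epsilon>2)) A B" if "(A, \<epsilon>1) \<in> M" "(B, \<epsilon>2) \<in> M" for A \<epsilon>1 B \<epsilon>2
    using l that by (auto simp: pairwise_local_def)
  show t': "truncated_generators (adjoin_products M)"
    unfolding truncated_generators_def adjoin_products_def using tr by (auto intro!: truncated_field_prod)
  have tr': "truncated_field A" if "(A, \<epsilon>) \<in> adjoin_products M" for A \<epsilon>
    using t' that by (auto simp: truncated_generators_def)
  have sym: "mode_local (parity_sign (\<epsilon>1 * \<epsilon>2)) A B" if "mode_local (parity_sign (\<epsilon>2 * \<epsilon>1)) B A" for A B :: "'a fld" and \<epsilon>1 \<epsilon>2
    using mode_local_sym[OF parity_sign_square that] by (simp add: mult.commute)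
  have half: "mode_local (parity_sign (\<epsilon>1 * \<epsilon>2)) A B"
    if A: "(A, \<epsilon>1) \<in> adjoin_products M" and B: "truncated_field B"
      and AB: "\<And>A' \<epsilon>. (A', \<epsilon>) \<in> M \<Longrightarrow> mode_local (parity_sign (\<epsilon> * \<epsilon>2)) A' B" for A \<epsilon>1 B \<epsilon>2
  proof (cases "(A, \<epsilon>1) \<in> M")
    case True
    then show ?thesis by (rule AB)
  next
    case False
    then obtain C \<epsilon>3 D \<epsilon>4 n where CD: "A = field_prod (\<epsilon>3 * \<epsilon>4) n C D" "\<epsilon>1 = \<epsilon>3 + \<epsilon>4"
      "(C, \<epsilon>3) \<in> M" "(D, \<epsilon>4) \<in> M"
      using A by (auto simp: adjoin_products_def)
    show ?thesis
      unfolding CD(1,2) parity_sign_distrib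
      using CD(3,4) by (intro dong tr[of C] tr[of D] B loc AB)
  qed
  have M_left: "mode_local (parity_sign (\<epsilon>1 * \<epsilon>2)) A B" if "(A, \<epsilon>1) \<in> adjoin_products M" "(B, \<epsilon>2) \<in> M" for A \<epsilon>1 B \<epsilon>2
    by (rule half[OF that(1) tr[OF that(2)]]) (rule loc[OF _ that(2)])
  show "pairwise_local (adjoin_products M)"
    unfolding pairwise_local_def
  proof (intro ballI, clarify)
    fix A \<epsilon>1 B \<epsilon>2 assume A: "(A, \<epsilon>1) \<in> adjoin_products M" and B: "(B, \<epsilon>2) \<in> adjoin_products M"
    show "mode_local (parity_sign (\<epsilon>1 * \<epsilon>2)) A B"
      using A tr'[OF B] by (rule half) (rule sym, rule M_left[OF B])
  qed
qed

text \<open>The stages increase, so any two generated fields occur together in one of them.\<close>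

theorem generated_local:
  assumes t: "truncated_generators G" and l: "pairwise_local G"
    and A: "generated G A \<epsilon>1" and B: "generated G B \<epsilon>2"
  shows "mode_local (parity_sign (\<epsilon>1 * \<epsilon>2)) A B"
proof -
  define M where "M k = (adjoin_products ^^ k) (insert (id_field, 0) G)" for k
  have "truncated_generators (insert (id_field, 0) G)"
    using t by (auto simp: truncated_generators_def truncated_field_id)
  moreover have "pairwise_local (insert (id_field, 0) G)"
    unfolding pairwise_local_def
  proof (intro ballI, clarify)
    fix A \<epsilon>1 B \<epsilon>2
    assume A: "(A, \<epsilon>1) \<in> insert (id_field, 0) G" and B: "(B, \<epsilon>2) \<in> insert (id_field, 0) G"
    have tr: "truncated_field A" "truncated_field B"
      using A B t by (auto simp: truncated_generators_def truncated_field_id)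
    have sign: "parity_sign (0 * b) = 1" "parity_sign (b * 0) = 1" for b
      by (simp_all add: parity_sign_def)
    show "mode_local (parity_sign (\<epsilon>1 * \<epsilon>2)) A B"
    proof (cases "(A, \<epsilon>1) \<in> G \<and> (B, \<epsilon>2) \<in> G")
      case True
      then show ?thesis using l by (auto simp: pairwise_local_def)
    next
      case False
      then show ?thesis
        using A B tr sign mode_local_id[of A] mode_local_id'[of B] by auto
    qed
  qed
  ultimately have M: "truncated_generators (M k) \<and> pairwise_local (M k)" for k
    unfolding M_def by (induction k) (auto intro: adjoin_products_local)
  have mono: "M k \<subseteq> M (k + j)" for k j
    by (induction j) (auto simp: M_def adjoin_products_def)
  have "\<exists>k. (A, \<epsilon>) \<in> M k" if "generated G A \<epsilon>" for A \<epsilon>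
    using that t
  proof (induction rule: generated_truncated_induct)
    case id
    show ?case by (rule exI[of _ 0]) (simp add: M_def)
  next
    case (base A \<epsilon>)
    then show ?case by (intro exI[of _ 0]) (simp add: M_def)
  next
    case (prod A \<epsilon>1 B \<epsilon>2 n)
    then obtain k j where "(A, \<epsilon>1) \<in> M k" "(B, \<epsilon>2) \<in> M j" by blast
    then have "(A, \<epsilon>1) \<in> M (k + j)" "(B, \<epsilon>2) \<in> M (k + j)"
      using mono[of k j] mono[of j k] by (auto simp: add.commute)
    then have "(field_prod (\<epsilon>1 * \<epsilon>2) n A B, \<epsilon>1 + \<epsilon>2) \<in> adjoin_products (M (k + j))"
      unfolding adjoin_products_def by blast
    then show ?case by (intro exI[of _ "Suc (k + j)"]) (simp add: M_def)
  qed
  then obtain k j where "(A, \<epsilon>1) \<in> M k" "(B, \<epsilon>2) \<in> M j" using A B by meson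
  then have "(A, \<epsilon>1) \<in> M (k + j)" "(B, \<epsilon>2) \<in> M (k + j)"
    using mono[of k j] mono[of j k] by (auto simp: add.commute)
  then show ?thesis using M[of "k + j"] by (auto simp: pairwise_local_def)
qed

section \<open>The spans of even and of odd generated fields\<close>

lemma generated_part_truncated:
  assumes t: "truncated_generators G" and A: "A \<in> generated_part G \<epsilon>"
  shows "truncated_field A"
  using A unfolding generated_part_def
  by (rule cspan_induct) (use t generated_truncated in \<open>auto intro: truncated_field_subspace\<close>)

lemma generated_fields_truncated:
  assumes t: "truncated_generators G" and A: "A \<in> generated_fields G"
  shows "truncated_field A"
  using A unfolding generated_fields_def
  by (rule cspan_induct) (use t generated_truncated in \<open>auto intro: truncated_field_subspace\<close>)

lemma mode_local_span_left:
  assumes C: "truncated_field C" and S: "\<And>A. A \<in> S \<Longrightarrow> mode_local s A C" and A: "A \<in> cspan S"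
  shows "mode_local s A C"
  using A by (rule cspan_induct)
    (use S C in \<open>auto intro!: csubspace_Collect mode_local_zero mode_local_add_left mode_local_scale_left\<close>)

lemma generated_part_local:
  assumes t: "truncated_generators G" and l: "pairwise_local G"
    and A: "A \<in> generated_part G \<epsilon>1" and B: "B \<in> generated_part G \<epsilon>2"
  shows "mode_local (parity_sign (\<epsilon>1 * \<epsilon>2)) A B"
proof -
  have 1: "mode_local (parity_sign (\<epsilon>1 * \<epsilon>2)) A' B" if "generated G A' \<epsilon>1" for A'
  proof (rule mode_local_sym[OF parity_sign_square])
    show "mode_local (parity_sign (\<epsilon>1 * \<epsilon>2)) B A'"
      using generated_truncated[OF that t] _ B[unfolded generated_part_def]
    proof (rule mode_local_span_left)
      fix B' assume "B' \<in> {B. generated G B \<epsilon>2}"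
      then show "mode_local (parity_sign (\<epsilon>1 * \<epsilon>2)) B' A'"
        using generated_local[OF t l _ that, of B' \<epsilon>2] by (simp add: mult.commute)
    qed
  qed
  show ?thesis
    using generated_part_truncated[OF t B] _ A[unfolded generated_part_def]
    by (rule mode_local_span_left) (use 1 in auto)
qed

lemma generated_part_subset: "generated_part G \<epsilon> \<subseteq> generated_fields G"
  unfolding generated_part_def generated_fields_def by (rule complex_vector.span_mono) auto

lemma generated_fields_split:
  assumes "A \<in> generated_fields G"
  obtains A0 A1 where "A0 \<in> generated_part G 0" "A1 \<in> generated_part G 1" "A = A0 + A1"
proof -
  have "{A. \<exists>\<epsilon>. generated G A \<epsilon>} = {A. generated G A 0} \<union> {A. generated G A 1}"
    using bit_cases by (auto, metis)
  then show ?thesis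
    using assms that complex_vector.span_Un[of "{A. generated G A 0}" "{A. generated G A 1}"]
    unfolding generated_fields_def generated_part_def by auto
qed

lemma generated_part_subspace: "csubspace (generated_part G \<epsilon>)"
  and generated_fields_subspace: "csubspace (generated_fields G)"
  unfolding generated_part_def generated_fields_def by simp_all

lemma field_prod_add_left:
  assumes "truncated_field A" "truncated_field A'" "truncated_field B"
  shows "field_prod \<epsilon> n (A + A') B = field_prod \<epsilon> n A B + field_prod \<epsilon> n A' B"
proof (intro ext)
  fix m v
  have AA: "truncated_field (A + A')"
    using complex_vector.subspace_add[OF truncated_field_subspace, of A A'] assms by simp
  have 1: "eventually_zero (\<lambda>p. binom_coeff n p *\<^sub>C A (n - int p) (B (m + int p) v))"
    if "truncated_field A" for A
    using right_truncated_mode_conv[OF right_truncated_product[OF that assms(3)], of n 0 m v] by simp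
  have 2: "eventually_zero (\<lambda>p. binom_coeff n p *\<^sub>C B (m + n - int p) (A (int p) v))"
    if "truncated_field A" for A
    using right_truncated_mode_conv[OF right_truncated_product[OF assms(3) that], of n m 0 v] by simp
  show "field_prod \<epsilon> n (A + A') B m v = (field_prod \<epsilon> n A B + field_prod \<epsilon> n A' B) m v"
    by (simp add: field_prod_split assms AA cscale_add_right clinear_simps[OF truncated_field_linear[OF assms(3)]]
        Sum_any_add[OF 1[OF assms(1)] 1[OF assms(2)]] Sum_any_add[OF 2[OF assms(1)] 2[OF assms(2)]])
qed

lemma field_prod_add_right:
  assumes "truncated_field A" "truncated_field B" "truncated_field B'"
  shows "field_prod \<epsilon> n A (B + B') = field_prod \<epsilon> n A B + field_prod \<epsilon> n A B'"
proof (intro ext)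
  fix m v
  have BB: "truncated_field (B + B')"
    using complex_vector.subspace_add[OF truncated_field_subspace, of B B'] assms by simp
  have 1: "eventually_zero (\<lambda>p. binom_coeff n p *\<^sub>C A (n - int p) (B (m + int p) v))"
    if "truncated_field B" for B
    using right_truncated_mode_conv[OF right_truncated_product[OF assms(1) that], of n 0 m v] by simp
  have 2: "eventually_zero (\<lambda>p. binom_coeff n p *\<^sub>C B (m + n - int p) (A (int p) v))"
    if "truncated_field B" for B
    using right_truncated_mode_conv[OF right_truncated_product[OF that assms(1)], of n m 0 v] by simp
  show "field_prod \<epsilon> n A (B + B') m v = (field_prod \<epsilon> n A B + field_prod \<epsilon> n A B') m v"
    by (simp add: field_prod_split assms BB cscale_add_right clinear_simps[OF truncated_field_linear[OF assms(1)]]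
        Sum_any_add[OF 1[OF assms(2)] 1[OF assms(3)]] Sum_any_add[OF 2[OF assms(2)] 2[OF assms(3)]])
qed

lemma truncated_field_scale: "truncated_field A \<Longrightarrow> truncated_field (c *\<^sub>C A)"
  using complex_vector.subspace_scale[OF truncated_field_subspace, of A] by simp

lemma field_prod_scale:
  assumes A: "truncated_field A" and B: "truncated_field B"
  shows "field_prod \<epsilon> n (c *\<^sub>C A) B = c *\<^sub>C field_prod \<epsilon> n A B"
    and "field_prod \<epsilon> n A (c *\<^sub>C B) = c *\<^sub>C field_prod \<epsilon> n A B"
proof -
  have ez: "eventually_zero (\<lambda>p. binom_coeff n p *\<^sub>C A (n - int p) (B (m + int p) v))"
    "eventually_zero (\<lambda>p. binom_coeff n p *\<^sub>C B (m + n - int p) (A (int p) v))" for m v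
    using right_truncated_mode_conv[OF right_truncated_product[OF A B], of n 0 m v]
      right_truncated_mode_conv[OF right_truncated_product[OF B A], of n m 0 v] by simp_all
  have 1: "Sum_any (\<lambda>p. (binom_coeff n p * c) *\<^sub>C A (n - int p) (B (m + int p) v))
      = c *\<^sub>C Sum_any (\<lambda>p. binom_coeff n p *\<^sub>C A (n - int p) (B (m + int p) v))" for m v
    by (simp add: Sum_any_cscale[OF ez(1)] mult.commute)
  have 2: "Sum_any (\<lambda>p. (binom_coeff n p * c) *\<^sub>C B (m + n - int p) (A (int p) v))
      = c *\<^sub>C Sum_any (\<lambda>p. binom_coeff n p *\<^sub>C B (m + n - int p) (A (int p) v))" for m v
    by (simp add: Sum_any_cscale[OF ez(2)] mult.commute)
  have scale_apply: "(c *\<^sub>C F) k v = c *\<^sub>C F k v" for F :: "'a fld" and k v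
    by (simp add: cscale_fun_def)
  show "field_prod \<epsilon> n (c *\<^sub>C A) B = c *\<^sub>C field_prod \<epsilon> n A B"
    by (intro ext) (simp add: field_prod_split[OF truncated_field_scale[OF A] B] field_prod_split[OF A B] scale_apply
        1 2 clinear_simps[OF truncated_field_linear[OF B]] complex_vector.scale_right_diff_distrib mult.commute[of c "parity_sign \<epsilon> * (-1) powi n"])
  show "field_prod \<epsilon> n A (c *\<^sub>C B) = c *\<^sub>C field_prod \<epsilon> n A B"
    by (intro ext) (simp add: field_prod_split[OF A truncated_field_scale[OF B]] field_prod_split[OF A B] scale_apply
        1 2 clinear_simps[OF truncated_field_linear[OF A]] complex_vector.scale_right_diff_distrib mult.commute[of c "parity_sign \<epsilon> * (-1) powi n"])
qed

lemma field_prod_zero: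
  "truncated_field A \<Longrightarrow> field_prod \<epsilon> n A 0 = 0" "truncated_field A \<Longrightarrow> field_prod \<epsilon> n 0 A = 0"
  using field_prod_scale[of A A \<epsilon> n 0] by simp_all

text \<open>Bilinearity of the product holds for truncated factors, which is why truncation is
  carried along in both inductions over spans.\<close>

lemma generated_part_prod:
  assumes t: "truncated_generators G" and A: "A \<in> generated_part G \<epsilon>1" and B: "B \<in> generated_part G \<epsilon>2"
  shows "field_prod (\<epsilon>1 * \<epsilon>2) n A B \<in> generated_part G (\<epsilon>1 + \<epsilon>2)"
proof -
  have 1: "field_prod (\<epsilon>1 * \<epsilon>2) n A' B \<in> generated_part G (\<epsilon>1 + \<epsilon>2)" if A': "generated G A' \<epsilon>1" for A'
  proof -
    have tA: "truncated_field A'" by (rule generated_truncated[OF A' t])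
    have "truncated_field B \<and> field_prod (\<epsilon>1 * \<epsilon>2) n A' B \<in> generated_part G (\<epsilon>1 + \<epsilon>2)"
      using B[unfolded generated_part_def]
    proof (rule cspan_induct)
      fix B' assume "B' \<in> {B. generated G B \<epsilon>2}"
      then have B': "generated G B' \<epsilon>2" by simp
      have "generated G (field_prod (\<epsilon>1 * \<epsilon>2) n A' B') (\<epsilon>1 + \<epsilon>2)"
        by (rule generated.gen_prod[OF A' B'])
      then show "truncated_field B' \<and> field_prod (\<epsilon>1 * \<epsilon>2) n A' B' \<in> generated_part G (\<epsilon>1 + \<epsilon>2)"
        unfolding generated_part_def
        by (intro conjI complex_vector.span_base CollectI generated_truncated[OF B' t])
    next
      show "csubspace {B. truncated_field B \<and> field_prod (\<epsilon>1 * \<epsilon>2) n A' B \<in> generated_part G (\<epsilon>1 + \<epsilon>2)}"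
        using generated_part_subspace[of G "\<epsilon>1 + \<epsilon>2"] complex_vector.subspace_0[OF truncated_field_subspace]
          complex_vector.subspace_add[OF truncated_field_subspace]
        by (intro csubspace_Collect)
          (auto simp: field_prod_zero field_prod_add_right field_prod_scale tA truncated_field_scale
            complex_vector.subspace_0 complex_vector.subspace_add complex_vector.subspace_scale)
    qed
    then show ?thesis by blast
  qed
  have tB: "truncated_field B" by (rule generated_part_truncated[OF t B])
  have "truncated_field A \<and> field_prod (\<epsilon>1 * \<epsilon>2) n A B \<in> generated_part G (\<epsilon>1 + \<epsilon>2)"
    using A[unfolded generated_part_def]
  proof (rule cspan_induct)
    fix A' assume "A' \<in> {A. generated G A \<epsilon>1}"
    then show "truncated_field A' \<and> field_prod (\<epsilon>1 * \<epsilon>2) n A' B \<in> generated_part G (\<epsilon>1 + \<epsilon>2)"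
      using 1 generated_truncated[OF _ t] by blast
  next
    show "csubspace {A. truncated_field A \<and> field_prod (\<epsilon>1 * \<epsilon>2) n A B \<in> generated_part G (\<epsilon>1 + \<epsilon>2)}"
      using generated_part_subspace[of G "\<epsilon>1 + \<epsilon>2"] complex_vector.subspace_0[OF truncated_field_subspace]
          complex_vector.subspace_add[OF truncated_field_subspace]
      by (intro csubspace_Collect)
        (auto simp: field_prod_zero field_prod_add_left field_prod_scale tB truncated_field_scale
          complex_vector.subspace_0 complex_vector.subspace_add complex_vector.subspace_scale)
  qed
  then show ?thesis by blast
qed

section \<open>Creation property, translation covariance and conformal weights\<close>

definition vacuum_field :: "'h::complex_prehilbert \<Rightarrow> 'h fld \<Rightarrow> bool"
  where "vacuum_field \<Omega> A \<longleftrightarrow> (\<forall>n\<ge>0. A n \<Omega> = 0)"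

lemma vacuum_field_subspace: "csubspace {A. vacuum_field \<Omega> A}"
  by (rule csubspace_Collect) (auto simp: vacuum_field_def cscale_fun_def)

lemma vacuum_field_id: "vacuum_field \<Omega> id_field"
  by (simp add: vacuum_field_def id_field_def)

text \<open>On the vacuum only the term p = 0 of the first half survives. The second identity ties
  fields to states: a mode applied to a created state gives the state of a product field.\<close>

lemma field_prod_vacuum:
  assumes A: "truncated_field A" and B: "truncated_field B"
    and vA: "vacuum_field \<Omega> A" and vB: "vacuum_field \<Omega> B"
  shows "vacuum_field \<Omega> (field_prod \<epsilon> n A B)"
    and "creation \<Omega> (field_prod \<epsilon> n A B) = A n (creation \<Omega> B)"
proof -
  note A0 = clinear_zero[OF truncated_field_linear[OF A]]
  note B0 = clinear_zero[OF truncated_field_linear[OF B]]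
  show "vacuum_field \<Omega> (field_prod \<epsilon> n A B)"
    using vA vB by (auto simp: vacuum_field_def field_prod_Sum_any[OF A B] A0 B0)
  have "Sum_any (\<lambda>p. binom_coeff n p *\<^sub>C A (n - int p) (B (- 1 + int p) \<Omega>)) = A n (B (- 1) \<Omega>)"
    using vB by (subst Sum_any_single[of 0]) (auto simp: vacuum_field_def A0 cscale_one)
  then show "creation \<Omega> (field_prod \<epsilon> n A B) = A n (creation \<Omega> B)"
    using vA by (simp add: creation_def field_prod_split[OF A B] vacuum_field_def B0)
qed

definition translation_covariant :: "('h::complex_prehilbert \<Rightarrow> 'h) \<Rightarrow> 'h fld \<Rightarrow> bool"
  where "translation_covariant D A \<longleftrightarrow> field_commutator D A = field_deriv A"

lemma translation_covariant_iff:
  "translation_covariant D A \<longleftrightarrow> (\<forall>n v. D (A n v) = A n (D v) - of_int n *\<^sub>C A (n - 1) v)"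
  by (simp add: translation_covariant_def field_commutator_def field_deriv_def fun_eq_iff algebra_simps)

lemma translation_covariant_subspace:
  assumes D: "clinear D"
  shows "csubspace {A. translation_covariant D A}"
  by (rule csubspace_Collect)
    (auto simp: translation_covariant_iff clinear_simps[OF D] cscale_fun_def cscale_add_right cscale_cscale
      complex_vector.scale_right_diff_distrib mult.commute)

lemma translation_covariant_id: "clinear D \<Longrightarrow> translation_covariant D id_field"
  by (auto simp: translation_covariant_iff id_field_def clinear_simps)

text \<open>Commuting D with a mode lowers the index of that mode, so D of a product differs from
  the expected formula by terms that telescope in p.\<close>

lemma translation_covariant_prod:
  assumes D: "clinear D" and A: "truncated_field A" and B: "truncated_field B"
    and tA: "translation_covariant D A" and tB: "translation_covariant D B"
  shows "translation_covariant D (field_prod \<epsilon> n A B)"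
  unfolding translation_covariant_iff
proof (intro allI)
  fix m v
  note D' = clinear_simps[OF D]
  note A' = clinear_simps[OF truncated_field_linear[OF A]]
  note B' = clinear_simps[OF truncated_field_linear[OF B]]
  have DA: "D (A k u) = A k (D u) - of_int k *\<^sub>C A (k - 1) u"
    and DB: "D (B k u) = B k (D u) - of_int k *\<^sub>C B (k - 1) u" for k u
    using tA tB by (auto simp: translation_covariant_iff)
  have ez1: "eventually_zero (\<lambda>p. binom_coeff n p *\<^sub>C A (n - int p) (B (m + int p) v))"
    and ez2: "eventually_zero (\<lambda>p. binom_coeff n p *\<^sub>C B (m + n - int p) (A (int p) v))" for m v
    using right_truncated_mode_conv[OF right_truncated_product[OF A B], of n 0 m v]
      right_truncated_mode_conv[OF right_truncated_product[OF B A], of n m 0 v] by simp_all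
  have absorb: "(of_int n - of_nat p) * binom_coeff n p = - (of_nat (Suc p) * binom_coeff n (Suc p))" for p
    using binom_coeff_absorb[of p n] by simp
  have tele: "Sum_any (\<lambda>p. g p - g (Suc p)) = 0" if "eventually_zero g" "g 0 = 0" for g :: "nat \<Rightarrow> 'a"
  proof -
    have "Sum_any (\<lambda>p. g p - g (Suc p)) = Sum_any g - Sum_any (\<lambda>p. g (Suc p))"
      by (rule Sum_any_diff[OF that(1) eventually_zero_Suc[OF that(1)]])
    then show ?thesis using Sum_any_shift[OF that(1)] that(2) by simp
  qed
  have 1: "D (Sum_any (\<lambda>p. binom_coeff n p *\<^sub>C A (n - int p) (B (m + int p) v)))
      = Sum_any (\<lambda>p. binom_coeff n p *\<^sub>C A (n - int p) (B (m + int p) (D v)))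
      - of_int m *\<^sub>C Sum_any (\<lambda>p. binom_coeff n p *\<^sub>C A (n - int p) (B (m - 1 + int p) v))"
  proof -
    define Y where "Y p = A (n - int p) (B (m - 1 + int p) v)" for p
    \<comment> \<open>The excess of the factor m + p over m. By the absorption identity, n - p times
      the coefficient at p is -(p + 1) times the coefficient at p + 1, so the term from the mode of
      A is \<open>g (Suc p)\<close> and the two telescope.\<close>
    define g where "g p = (of_nat p * binom_coeff n p) *\<^sub>C Y p" for p
    have Y: "eventually_zero (\<lambda>p. binom_coeff n p *\<^sub>C Y p)"
      unfolding Y_def by (rule ez1)
    then have g: "eventually_zero g"
      unfolding g_def by eventually_elim auto
    have "binom_coeff n p *\<^sub>C D (A (n - int p) (B (m + int p) v))
      = (binom_coeff n p *\<^sub>C A (n - int p) (B (m + int p) (D v)) - of_int m *\<^sub>C (binom_coeff n p *\<^sub>C Y p)) - (g p - g (Suc p))" for p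
    proof -
      have "binom_coeff n p *\<^sub>C D (A (n - int p) (B (m + int p) v))
        = binom_coeff n p *\<^sub>C A (n - int p) (B (m + int p) (D v)) - (binom_coeff n p * of_int (m + int p)) *\<^sub>C Y p
          - (binom_coeff n p * of_int (n - int p)) *\<^sub>C Y (Suc p)"
        by (simp add: DA DB A' Y_def complex_vector.scale_right_diff_distrib cscale_cscale algebra_simps)
      also have "binom_coeff n p * of_int (n - int p) = - (of_nat (Suc p) * binom_coeff n (Suc p))"
        using absorb[of p] by (simp add: mult.commute)
      also have "(binom_coeff n p * of_int (m + int p)) *\<^sub>C Y p = of_int m *\<^sub>C (binom_coeff n p *\<^sub>C Y p) + g p"
        by (simp add: g_def cscale_cscale cscale_add_left[symmetric] distrib_left mult.commute)
      finally show ?thesis by (simp add: g_def)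
    qed
    then have "D (Sum_any (\<lambda>p. binom_coeff n p *\<^sub>C A (n - int p) (B (m + int p) v)))
      = Sum_any (\<lambda>p. (binom_coeff n p *\<^sub>C A (n - int p) (B (m + int p) (D v)) - of_int m *\<^sub>C (binom_coeff n p *\<^sub>C Y p)) - (g p - g (Suc p)))"
      by (subst Sum_any_clinear[OF ez1 D]) (simp add: D')
    also have "\<dots> = Sum_any (\<lambda>p. binom_coeff n p *\<^sub>C A (n - int p) (B (m + int p) (D v)))
        - Sum_any (\<lambda>p. of_int m *\<^sub>C (binom_coeff n p *\<^sub>C Y p)) - Sum_any (\<lambda>p. g p - g (Suc p))"
    proof -
      have mY: "eventually_zero (\<lambda>p. of_int m *\<^sub>C (binom_coeff n p *\<^sub>C Y p))"
        using Y by eventually_elim auto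
      have gg: "eventually_zero (\<lambda>p. g p - g (Suc p))"
        using g eventually_zero_Suc[OF g] by eventually_elim simp
      have "eventually_zero (\<lambda>p. binom_coeff n p *\<^sub>C A (n - int p) (B (m + int p) (D v)) - of_int m *\<^sub>C (binom_coeff n p *\<^sub>C Y p))"
        using ez1[of m "D v"] mY by eventually_elim (simp only: diff_self)
      from Sum_any_diff[OF this gg] Sum_any_diff[OF ez1[of m "D v"] mY] show ?thesis by simp
    qed
    also have "Sum_any (\<lambda>p. g p - g (Suc p)) = 0"
      by (rule tele[OF g]) (simp add: g_def)
    finally show ?thesis
      by (simp only: Sum_any_cscale[OF Y, symmetric] diff_zero) (simp only: Y_def)
  qed
  have 2: "D (Sum_any (\<lambda>p. binom_coeff n p *\<^sub>C B (m + n - int p) (A (int p) v)))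
      = Sum_any (\<lambda>p. binom_coeff n p *\<^sub>C B (m + n - int p) (A (int p) (D v)))
      - of_int m *\<^sub>C Sum_any (\<lambda>p. binom_coeff n p *\<^sub>C B (m - 1 + n - int p) (A (int p) v))"
  proof -
    define Z where "Z p = B (m - 1 + n - int p) (A (int p) v)" for p
    \<comment> \<open>In this order \<open>g p\<close> comes from lowering the mode of A, and
      \<open>g (Suc p)\<close> from the dependence on p of the mode of B.\<close>
    define g where "g p = (of_nat p * binom_coeff n p) *\<^sub>C B (m + n - int p) (A (int p - 1) v)" for p
    have Z: "eventually_zero (\<lambda>p. binom_coeff n p *\<^sub>C Z p)"
      unfolding Z_def by (rule ez2)
    have "eventually_zero (\<lambda>p. A (- 1 + int p) v)"
      by (rule truncated_field_eventually[OF A])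
    then have g: "eventually_zero g"
      unfolding g_def by eventually_elim (simp add: B')
    have "binom_coeff n p *\<^sub>C D (B (m + n - int p) (A (int p) v))
      = (binom_coeff n p *\<^sub>C B (m + n - int p) (A (int p) (D v)) - of_int m *\<^sub>C (binom_coeff n p *\<^sub>C Z p)) - (g p - g (Suc p))" for p
    proof -
      have "binom_coeff n p *\<^sub>C D (B (m + n - int p) (A (int p) v))
        = binom_coeff n p *\<^sub>C B (m + n - int p) (A (int p) (D v)) - g p
          - (of_int m * binom_coeff n p + of_int (n - int p) * binom_coeff n p) *\<^sub>C Z p"
        by (simp add: DA DB B' Z_def g_def complex_vector.scale_right_diff_distrib cscale_cscale algebra_simps)
      also have "of_int (n - int p) * binom_coeff n p = - (of_nat (Suc p) * binom_coeff n (Suc p))"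
        using absorb[of p] by simp
      also have "(of_int m * binom_coeff n p + - (of_nat (Suc p) * binom_coeff n (Suc p))) *\<^sub>C Z p
          = of_int m *\<^sub>C (binom_coeff n p *\<^sub>C Z p) - g (Suc p)"
        by (simp add: g_def Z_def cscale_cscale cscale_add_left algebra_simps)
      finally show ?thesis by simp
    qed
    then have "D (Sum_any (\<lambda>p. binom_coeff n p *\<^sub>C B (m + n - int p) (A (int p) v)))
      = Sum_any (\<lambda>p. (binom_coeff n p *\<^sub>C B (m + n - int p) (A (int p) (D v)) - of_int m *\<^sub>C (binom_coeff n p *\<^sub>C Z p)) - (g p - g (Suc p)))"
      by (subst Sum_any_clinear[OF ez2 D]) (simp add: D')
    also have "\<dots> = Sum_any (\<lambda>p. binom_coeff n p *\<^sub>C B (m + n - int p) (A (int p) (D v)))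
        - Sum_any (\<lambda>p. of_int m *\<^sub>C (binom_coeff n p *\<^sub>C Z p)) - Sum_any (\<lambda>p. g p - g (Suc p))"
    proof -
      have mZ: "eventually_zero (\<lambda>p. of_int m *\<^sub>C (binom_coeff n p *\<^sub>C Z p))"
        using Z by eventually_elim auto
      have gg: "eventually_zero (\<lambda>p. g p - g (Suc p))"
        using g eventually_zero_Suc[OF g] by eventually_elim simp
      have "eventually_zero (\<lambda>p. binom_coeff n p *\<^sub>C B (m + n - int p) (A (int p) (D v)) - of_int m *\<^sub>C (binom_coeff n p *\<^sub>C Z p))"
        using ez2[of m "D v"] mZ by eventually_elim (simp only: diff_self)
      from Sum_any_diff[OF this gg] Sum_any_diff[OF ez2[of m "D v"] mZ] show ?thesis by simp
    qed
    also have "Sum_any (\<lambda>p. g p - g (Suc p)) = 0"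
      by (rule tele[OF g]) (simp add: g_def)
    finally show ?thesis
      by (simp only: Sum_any_cscale[OF Z, symmetric] diff_zero) (simp only: Z_def)
  qed
  show "D (field_prod \<epsilon> n A B m v) = field_prod \<epsilon> n A B m (D v) - of_int m *\<^sub>C field_prod \<epsilon> n A B (m - 1) v"
    by (simp add: field_prod_split[OF A B] D' 1 2 complex_vector.scale_right_diff_distrib cscale_cscale mult.commute)
qed

section \<open>Conformal weights\<close>

definition has_weight :: "('h::complex_prehilbert \<Rightarrow> 'h) \<Rightarrow> complex \<Rightarrow> 'h fld \<Rightarrow> bool"
  where "has_weight H \<Delta> A \<longleftrightarrow> (\<forall>n v. H (A n v) = A n (H v) + (\<Delta> - 1 - of_int n) *\<^sub>C A n v)"

lemma has_weight_subspace:
  assumes "clinear H"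
  shows "csubspace {A. has_weight H \<Delta> A}"
  by (rule csubspace_Collect)
    (auto simp: has_weight_def clinear_simps[OF assms] cscale_fun_def cscale_add_right complex_vector.scale_left_commute)

lemma has_weight_id: "clinear H \<Longrightarrow> has_weight H 0 id_field"
  by (auto simp: has_weight_def id_field_def clinear_simps)

lemma has_weight_prod:
  assumes H: "clinear H" and A: "truncated_field A" and B: "truncated_field B"
    and wA: "has_weight H \<Delta>1 A" and wB: "has_weight H \<Delta>2 B"
  shows "has_weight H (\<Delta>1 + \<Delta>2 - 1 - of_int n) (field_prod \<epsilon> n A B)"
  unfolding has_weight_def
proof (intro allI)
  fix m v
  note H' = clinear_simps[OF H]
  note A' = clinear_simps[OF truncated_field_linear[OF A]]
  note B' = clinear_simps[OF truncated_field_linear[OF B]]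
  let ?d = "\<Delta>1 + \<Delta>2 - 1 - of_int n - 1 - of_int m"
  have HA: "H (A k u) = A k (H u) + (\<Delta>1 - 1 - of_int k) *\<^sub>C A k u"
    and HB: "H (B k u) = B k (H u) + (\<Delta>2 - 1 - of_int k) *\<^sub>C B k u" for k u
    using wA wB by (auto simp: has_weight_def)
  have ez1: "eventually_zero (\<lambda>p. binom_coeff n p *\<^sub>C A (n - int p) (B (m + int p) v))"
    and ez2: "eventually_zero (\<lambda>p. binom_coeff n p *\<^sub>C B (m + n - int p) (A (int p) v))" for v
    using right_truncated_mode_conv[OF right_truncated_product[OF A B], of n 0 m v]
      right_truncated_mode_conv[OF right_truncated_product[OF B A], of n m 0 v] by simp_all
  have AB: "H (A (n - int p) (B (m + int p) v)) = A (n - int p) (B (m + int p) (H v)) + ?d *\<^sub>C A (n - int p) (B (m + int p) v)" for p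
    by (simp add: HA HB A' cscale_add_left[symmetric] add.assoc)
  have BA: "H (B (m + n - int p) (A (int p) v)) = B (m + n - int p) (A (int p) (H v)) + ?d *\<^sub>C B (m + n - int p) (A (int p) v)" for p
    by (simp add: HA HB B' cscale_add_left[symmetric] add.assoc)
  have s1: "eventually_zero (\<lambda>p. ?d *\<^sub>C (binom_coeff n p *\<^sub>C A (n - int p) (B (m + int p) v)))"
    using ez1[of v] by eventually_elim auto
  have s2: "eventually_zero (\<lambda>p. ?d *\<^sub>C (binom_coeff n p *\<^sub>C B (m + n - int p) (A (int p) v)))"
    using ez2[of v] by eventually_elim auto
  have 1: "H (Sum_any (\<lambda>p. binom_coeff n p *\<^sub>C A (n - int p) (B (m + int p) v)))
      = Sum_any (\<lambda>p. binom_coeff n p *\<^sub>C A (n - int p) (B (m + int p) (H v)))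
        + ?d *\<^sub>C Sum_any (\<lambda>p. binom_coeff n p *\<^sub>C A (n - int p) (B (m + int p) v))"
    unfolding Sum_any_clinear[OF ez1 H] Sum_any_cscale[OF ez1] Sum_any_add[OF ez1 s1, symmetric]
    by (simp only: H' AB cscale_add_right complex_vector.scale_left_commute)
  have 2: "H (Sum_any (\<lambda>p. binom_coeff n p *\<^sub>C B (m + n - int p) (A (int p) v)))
      = Sum_any (\<lambda>p. binom_coeff n p *\<^sub>C B (m + n - int p) (A (int p) (H v)))
        + ?d *\<^sub>C Sum_any (\<lambda>p. binom_coeff n p *\<^sub>C B (m + n - int p) (A (int p) v))"
    unfolding Sum_any_clinear[OF ez2 H] Sum_any_cscale[OF ez2] Sum_any_add[OF ez2 s2, symmetric]
    by (simp only: H' BA cscale_add_right complex_vector.scale_left_commute)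
  show "H (field_prod \<epsilon> n A B m v) = field_prod \<epsilon> n A B m (H v) + ?d *\<^sub>C field_prod \<epsilon> n A B m v"
    unfolding field_prod_split[OF A B] H' 1 2 cscale_add_right complex_vector.scale_right_diff_distrib
    by (simp only: complex_vector.scale_left_commute[of ?d]) (simp only: algebra_simps)
qed

section \<open>Uniqueness of fields\<close>

text \<open>A series killed by z - w is constant along antidiagonals, and sliding along one of them
  reaches the region where F vanishes; induction removes one factor z - w at a time.\<close>

lemma shift_diff_funpow_vanish:
  fixes F :: "int \<Rightarrow> int \<Rightarrow> 'a::ab_group_add"
  assumes "(shift_diff ^^ N) F = (\<lambda>m n. 0)" "\<And>n m. n \<ge> K \<Longrightarrow> F m n = 0"
  shows "F m n = 0"
  using assms
proof (induction N arbitrary: F m n)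
  case (Suc N)
  have "shift_diff F m n = 0" for m n
  proof (rule Suc.IH)
    show "(shift_diff ^^ N) (shift_diff F) = (\<lambda>m n. 0)"
      using Suc.prems(1) by (simp only: funpow_Suc_right comp_def)
    show "shift_diff F m n = 0" if "n \<ge> K" for m n
      using Suc.prems(2) that by (simp add: shift_diff_def)
  qed
  then have step: "F m n = F (m - 1) (n + 1)" for m n
    by (simp add: shift_diff_def) (metis diff_add_cancel)
  have "F m n = F (m - int k) (n + int k)" for k
  proof (induction k)
    case (Suc k)
    then show ?case using step[of "m - int k" "n + int k"] by (simp add: algebra_simps)
  qed simp
  from this[of "nat (K - n)"] show ?case using Suc.prems(2) by simp
qed simp

text \<open>When all modes of A kill v, the supercommutator on v is just A(m) B(n) v. It vanishes
  for large n and is killed by a power of z - w, so it is zero. In this way annihilation propagates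
  from v to the vectors B(n) v.\<close>

lemma mode_local_annihilator:
  assumes "mode_local s A B" "truncated_field B" and A: "truncated_field A" and v: "\<And>m. A m v = 0"
  shows "A m (B n v) = 0"
proof -
  obtain N where N: "\<And>v. (shift_diff ^^ N) (supercommutator s A B v) = (\<lambda>m n. 0)"
    using assms(1) by (auto simp: mode_local_def)
  obtain K where K: "\<forall>n\<ge>K. B n v = 0" using truncated_fieldD[OF assms(2)] by blast
  have eq: "supercommutator s A B v m n = A m (B n v)" for m n
    by (simp add: supercommutator_def v clinear_zero[OF truncated_field_linear[OF assms(2)]])
  have "supercommutator s A B v m n = 0"
  proof (rule shift_diff_funpow_vanish[OF N])
    show "supercommutator s A B v m n = 0" if "n \<ge> K" for m n
      using K that by (simp add: eq clinear_zero[OF truncated_field_linear[OF A]])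
  qed
  then show ?thesis by (simp add: eq)
qed

section \<open>From mode locality to rational correlation functions\<close>

text \<open>Nonzero coefficients lie on finitely many antidiagonals m + n = k. For matrix
  coefficients of fields of definite weight this is conservation of energy.\<close>

definition bounded_band :: "(int \<Rightarrow> int \<Rightarrow> complex) \<Rightarrow> bool"
  where "bounded_band f \<longleftrightarrow> finite {k. \<exists>m. f m (k - m) \<noteq> 0}"

lemma bounded_band_zero: "bounded_band (\<lambda>m n. 0)"
  by (simp add: bounded_band_def)

lemma bounded_band_add:
  assumes "bounded_band f" "bounded_band g"
  shows "bounded_band (\<lambda>m n. f m n + g m n)"
  unfolding bounded_band_def
  by (rule finite_subset[OF _ finite_UnI[OF assms[unfolded bounded_band_def]]]) auto

lemma bounded_band_scale:
  assumes "bounded_band f"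
  shows "bounded_band (\<lambda>m n. c * f m n)"
  unfolding bounded_band_def
  by (rule finite_subset[OF _ assms[unfolded bounded_band_def]]) auto

lemma bounded_band_shift_diff:
  assumes "bounded_band f"
  shows "bounded_band (shift_diff f)"
proof -
  have "{k. \<exists>m. shift_diff f m (k - m) \<noteq> 0} \<subseteq> (\<lambda>k. k - 1) ` {k. \<exists>m. f m (k - m) \<noteq> 0}"
  proof
    fix k assume "k \<in> {k. \<exists>m. shift_diff f m (k - m) \<noteq> 0}"
    then obtain m where "shift_diff f m (k - m) \<noteq> 0" by blast
    then have "f (m + 1) (k - m) \<noteq> 0 \<or> f m (k - m + 1) \<noteq> 0"
      by (auto simp: shift_diff_def)
    then have "f (m + 1) (k + 1 - (m + 1)) \<noteq> 0 \<or> f m (k + 1 - m) \<noteq> 0"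
      by (simp add: algebra_simps)
    then have "k + 1 \<in> {k. \<exists>m. f m (k - m) \<noteq> 0}" by blast
    then show "k \<in> (\<lambda>k. k - 1) ` {k. \<exists>m. f m (k - m) \<noteq> 0}"
      by (intro image_eqI[of _ _ "k + 1"]) auto
  qed
  then show ?thesis
    using assms finite_surj unfolding bounded_band_def by blast
qed

lemma bounded_band_funpow: "bounded_band f \<Longrightarrow> bounded_band ((shift_diff ^^ N) f)"
  by (induction N) (simp_all add: bounded_band_shift_diff)

lemma funpow_shift_diff_vanish_right:
  fixes f :: "int \<Rightarrow> int \<Rightarrow> 'a::ab_group_add"
  assumes "\<And>m n. n \<ge> K \<Longrightarrow> f m n = 0"
  shows "n \<ge> K \<Longrightarrow> (shift_diff ^^ N) f m n = 0"
  by (induction N arbitrary: m n) (simp_all add: assms shift_diff_def)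

abbreviation laurent_term :: "(int \<Rightarrow> int \<Rightarrow> complex) \<Rightarrow> complex \<Rightarrow> complex \<Rightarrow> int \<Rightarrow> int \<Rightarrow> complex"
  where "laurent_term f z w m n \<equiv> f m n * z powi (- m - 1) * w powi (- n - 1)"

text \<open>Undoing one factor \<open>z - w\<close> amounts to multiplying an absolutely convergent series by the
  geometric series of \<open>1 / (z - w)\<close>.\<close>

lemma laurent_term_has_sum_step:
  assumes zw: "0 < norm w" "norm w < norm z"
    and van: "\<And>m n. n \<ge> K \<Longrightarrow> f m n = 0"
    and S: "((\<lambda>(m, n). laurent_term (shift_diff f) z w m n) has_sum S) UNIV"
  shows "((\<lambda>(m, n). laurent_term f z w m n) has_sum (S / (z - w))) UNIV"
proof -
  have nz: "z \<noteq> 0" "w \<noteq> 0" using zw by auto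
  define t where "t = (\<lambda>(m, n). laurent_term (shift_diff f) z w m n)"
  define g where "g j = w ^ j / z ^ Suc j" for j :: nat
  have q: "norm (w / z) < 1" using zw nz by (simp add: norm_divide)
  have g_eq: "g = (\<lambda>j. (1 / z) * (w / z) ^ j)"
    by (simp add: g_def fun_eq_iff power_divide)
  have "(\<lambda>j. (1 / z) * (w / z) ^ j) sums ((1 / z) * (1 / (1 - w / z)))"
    by (intro sums_mult geometric_sums q)
  moreover have "(1 / z) * (1 / (1 - w / z)) = 1 / (z - w)"
    using nz zw by (simp add: field_simps)
  ultimately have g_sums: "g sums (1 / (z - w))" by (simp only: g_eq)
  have "summable (\<lambda>j. norm (g j))"
    unfolding g_eq norm_mult norm_power by (intro summable_mult summable_geometric) (use q in simp)
  then have g_has: "(g has_sum (1 / (z - w))) UNIV" and g_abs: "(\<lambda>j. norm (g j)) summable_on UNIV"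
    using g_sums norm_summable_imp_summable_on[of "\<lambda>j. norm (g j)"]
    by (simp_all add: norm_summable_imp_has_sum norm_summable_imp_summable_on)
  have t_abs: "(\<lambda>x. norm (t x)) summable_on UNIV"
    using S unfolding t_def by (intro summable_on_iff_abs_summable_on_complex[THEN iffD1]) (rule has_sum_imp_summable)
  have "(\<lambda>y. norm ((\<lambda>(x, j). t x * g j) y)) summable_on (UNIV \<times> UNIV)"
    unfolding Infinite_Sum.abs_summable_on_Sigma_iff
  proof (intro conjI ballI)
    show "(\<lambda>j. norm (case (x, j) of (x, j) \<Rightarrow> t x * g j)) summable_on UNIV" for x
      using summable_on_cmult_right[OF g_abs, of "norm (t x)"] by (simp add: norm_mult)
    have "(\<lambda>x. norm (t x) * infsum (\<lambda>j. norm (g j)) UNIV) summable_on UNIV"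
      by (rule summable_on_cmult_left[OF t_abs])
    then have "(\<lambda>x. norm (norm (t x) * infsum (\<lambda>j. norm (g j)) UNIV)) summable_on UNIV"
      by (simp only: norm_mult real_norm_def abs_mult abs_norm_cancel
          abs_of_nonneg[OF infsum_nonneg[OF norm_ge_zero]])
    then show "(\<lambda>x. norm (infsum (\<lambda>j. norm (case (x, j) of (x, j) \<Rightarrow> t x * g j)) UNIV)) summable_on UNIV"
      by (simp add: norm_mult infsum_cmult_right')
  qed
  then have "(\<lambda>(x, j). t x * g j) summable_on (UNIV \<times> UNIV)"
    by (rule abs_summable_summable)
  then obtain R where R: "((\<lambda>(x, j). t x * g j) has_sum R) (UNIV \<times> UNIV)"
    by (auto simp: summable_on_def)
  have "((\<lambda>x. t x * (1 / (z - w))) has_sum R) UNIV"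
    by (rule has_sum_SigmaD[OF R]) (use has_sum_cmult_right[OF g_has] in simp)
  moreover have "((\<lambda>x. t x * (1 / (z - w))) has_sum (S * (1 / (z - w)))) UNIV"
    using S unfolding t_def by (rule has_sum_cmult_left)
  ultimately have RS: "R = S / (z - w)"
    using has_sum_unique by fastforce
  \<comment> \<open>Reindexed so that, for fixed (m, n), the sum over j collects all contributions
    to z^(-m-1) w^(-n-1); that inner sum telescopes.\<close>
  have "((\<lambda>(x, j). case x of (m, n) \<Rightarrow> t (m - 1 - int j, n + int j) * g j) has_sum R) (UNIV \<times> UNIV)"
    using R
    by (subst has_sum_reindex_bij_witness[where i = "\<lambda>(x, j). case x of (m, n) \<Rightarrow> ((m + 1 + int j, n - int j), j)"
          and j = "\<lambda>(x, j). case x of (m, n) \<Rightarrow> ((m - 1 - int j, n + int j), j)" and T = "UNIV \<times> UNIV"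
          and h = "\<lambda>(x, j). t x * g j" and s' = R]) auto
  then show ?thesis
    unfolding RS
  proof (rule has_sum_SigmaD)
    fix x :: "int \<times> int"
    obtain m n where x: "x = (m, n)" by fastforce
    define u where "u = z powi (- m - 1) * w powi (- n - 1)"
    have shifted: "t (m - 1 - int j, n + int j) * g j = (f (m - int j) (n + int j) - f (m - int (Suc j)) (n + int (Suc j))) * u" for j
    proof -
      have "z powi (- (m - 1 - int j) - 1) = z powi (- m - 1) * z ^ Suc j"
        using nz by (simp add: power_int_add[symmetric] flip: power_int_of_nat)
      moreover have "w powi (- n - 1) = w powi (- (n + int j) - 1) * w ^ j"
        using nz by (simp add: power_int_add[symmetric] flip: power_int_of_nat)
      ultimately have "z powi (- (m - 1 - int j) - 1) * w powi (- (n + int j) - 1) * g j = u"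
        using nz by (simp add: g_def u_def)
      then show ?thesis
        by (simp add: t_def shift_diff_def mult.assoc) (simp add: algebra_simps)
    qed
    have tele: "(\<Sum>j<J. f (m - int j) (n + int j) - f (m - int (Suc j)) (n + int (Suc j))) = f m n - f (m - int J) (n + int J)" for J
      by (induction J) simp_all
    \<comment> \<open>From j = J on the second index is at least K, so the telescoped remainder
      vanishes.\<close>
    define J where "J = nat (K - n)"
    have "((\<lambda>j. (f (m - int j) (n + int j) - f (m - int (Suc j)) (n + int (Suc j))) * u) has_sum (f m n * u)) UNIV"
    proof (rule has_sum_finite_neutralI[of "{..<J}"])
      show "(f (m - int j) (n + int j) - f (m - int (Suc j)) (n + int (Suc j))) * u = 0" if "j \<in> UNIV - {..<J}" for j
        using that by (simp add: van J_def)
      show "f m n * u = (\<Sum>j<J. (f (m - int j) (n + int j) - f (m - int (Suc j)) (n + int (Suc j))) * u)"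
        unfolding sum_distrib_right[symmetric] tele by (simp add: van J_def)
    qed auto
    then show "((\<lambda>j. case (x, j) of (x, j) \<Rightarrow> case x of (m, n) \<Rightarrow> t (m - 1 - int j, n + int j) * g j) has_sum
        (case x of (m, n) \<Rightarrow> laurent_term f z w m n)) UNIV"
      by (simp add: x shifted u_def mult.assoc)
  qed
qed

lemma laurent_term_has_sum:
  assumes zw: "0 < norm w" "norm w < norm z"
    and van: "\<And>m n. n \<ge> K \<Longrightarrow> f m n = 0"
    and fin: "finite {(m, n). (shift_diff ^^ N) f m n \<noteq> 0}"
  shows "((\<lambda>(m, n). laurent_term f z w m n) has_sum
    ((\<Sum>(m, n)\<in>{(m, n). (shift_diff ^^ N) f m n \<noteq> 0}. laurent_term ((shift_diff ^^ N) f) z w m n) / (z - w) ^ N)) UNIV"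
  using van fin
proof (induction N arbitrary: f)
  case 0
  then show ?case
    by (intro has_sum_finite_neutralI[of "{(m, n). f m n \<noteq> 0}"]) auto
next
  case (Suc N)
  have eq: "(shift_diff ^^ Suc N) f = (shift_diff ^^ N) (shift_diff f)"
    by (simp only: funpow_Suc_right comp_def)
  have "((\<lambda>(m, n). laurent_term (shift_diff f) z w m n) has_sum
    ((\<Sum>(m, n)\<in>{(m, n). (shift_diff ^^ N) (shift_diff f) m n \<noteq> 0}. laurent_term ((shift_diff ^^ N) (shift_diff f)) z w m n) / (z - w) ^ N)) UNIV"
  proof (rule Suc.IH)
    show "shift_diff f m n = 0" if "n \<ge> K" for m n
      using that by (simp add: shift_diff_def Suc.prems(1))
    show "finite {(m, n). (shift_diff ^^ N) (shift_diff f) m n \<noteq> 0}"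
      using Suc.prems(2) unfolding eq .
  qed
  from laurent_term_has_sum_step[OF zw Suc.prems(1) this] show ?case
    unfolding eq by (simp add: mult.commute)
qed

lemma funpow_shift_diff_swap_complex:
  fixes F :: "int \<Rightarrow> int \<Rightarrow> complex"
  shows "(shift_diff ^^ N) (\<lambda>m n. F n m) m n = (- 1) ^ N * (shift_diff ^^ N) F n m"
  by (induction N arbitrary: m n) (simp_all add: shift_diff_def algebra_simps)

section \<open>Sesquilinearity of the inner product\<close>

lemma
  shows cinner_zero_left: "cinner 0 (y::'a::complex_prehilbert) = 0"
    and cinner_minus_left: "cinner (- x) (y::'a) = - cinner x y"
    and cinner_diff_left: "cinner (x - x') (y::'a) = cinner x y - cinner x' y"
    and cinner_sum_left: "cinner (sum f A) (y::'a) = (\<Sum>a\<in>A. cinner (f a) y)"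
    and cinner_add_right: "cinner (y::'a) (x + x') = cinner y x + cinner y x'"
    and cinner_cscale_right: "cinner (y::'a) (c *\<^sub>C x) = cnj c * cinner y x"
    and cinner_zero_right: "cinner (y::'a) 0 = 0"
    and cinner_minus_right: "cinner (y::'a) (- x) = - cinner y x"
    and cinner_diff_right: "cinner (y::'a) (x - x') = cinner y x - cinner y x'"
    and cinner_sum_right: "cinner (y::'a) (sum f A) = (\<Sum>a\<in>A. cinner y (f a))"
proof -
  show z: "cinner 0 (y::'a) = 0" for y
    using cinner_cscale_left[of 0 "0::'a" y] by simp
  show m: "cinner (- x) (y::'a) = - cinner x y" for x y
    using cinner_cscale_left[of "-1" x y] by (simp add: cscale_one)
  show d: "cinner (x - x') (y::'a) = cinner x y - cinner x' y" for x x' y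
    using cinner_add_left[of x "- x'" y] m by simp
  show s: "cinner (sum f A) (y::'a) = (\<Sum>a\<in>A. cinner (f a) y)" for f :: "'b \<Rightarrow> 'a" and A y
    by (induction A rule: infinite_finite_induct) (simp_all add: z cinner_add_left)
  show "cinner (y::'a) (x + x') = cinner y x + cinner y x'"
    "cinner (y::'a) (c *\<^sub>C x) = cnj c * cinner y x" "cinner (y::'a) 0 = 0"
    "cinner (y::'a) (- x) = - cinner y x" "cinner (y::'a) (x - x') = cinner y x - cinner y x'"
    by (simp_all only: cinner_commute[where y = y] cinner_add_left cinner_cscale_left z m d
        complex_cnj_add complex_cnj_mult complex_cnj_zero complex_cnj_minus complex_cnj_diff)
  show "cinner (y::'a) (sum f A) = (\<Sum>a\<in>A. cinner y (f a))"
    by (subst cinner_commute, subst s) (simp add: cinner_commute[symmetric])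
qed

lemmas cinner_simps = cinner_add_left cinner_cscale_left cinner_zero_left cinner_minus_left cinner_diff_left
  cinner_sum_left cinner_add_right cinner_cscale_right cinner_zero_right cinner_minus_right cinner_diff_right
  cinner_sum_right

lemma cinner_left_eq_0:
  assumes "cspan S = UNIV" "\<And>v. v \<in> S \<Longrightarrow> cinner u v = 0"
  shows "u = (0::'a::complex_prehilbert)"
proof -
  have "cinner u u = 0"
    by (rule cspan_UNIV_induct[where x = u and P = "\<lambda>v. cinner u v = 0", OF assms(1)])
      (auto intro!: csubspace_Collect simp: assms(2) cinner_simps)
  then show ?thesis by (simp add: cinner_eq_zero_iff)
qed

text \<open>Let Q be (z - w)^N times the correlator in the order A B. By locality the other order
  gives the same up to sign, so truncation of B bounds the second index of Q and truncation of A the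
  first, while the band condition leaves finitely many values of m + n. Hence Q has finite support
  and is the common Laurent polynomial.\<close>

lemma local_fieldsI:
  assumes A: "truncated_field A" and B: "truncated_field B"
    and loc: "mode_local (parity_sign \<epsilon>) A B"
    and band: "\<And>c d. bounded_band (\<lambda>m n. cinner (A m (B n c)) d)"
    and band': "\<And>c d. bounded_band (\<lambda>n m. cinner (B n (A m c)) d)"
  shows "local_fields \<epsilon> A B"
proof -
  obtain N where N: "\<And>v. (shift_diff ^^ N) (supercommutator (parity_sign \<epsilon>) A B v) = (\<lambda>m n. 0)"
    using loc by (auto simp: mode_local_def)
  have "\<exists>p. finite {k. p k \<noteq> 0} \<and>
    (\<forall>z w. 0 < norm w \<and> norm w < norm z \<longrightarrow>
      ((\<lambda>(m, n). cinner (A m (B n c)) d * z powi (- m - 1) * w powi (- n - 1))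
        has_sum laurent_fraction N p z w) UNIV) \<and>
    (\<forall>z w. 0 < norm z \<and> norm z < norm w \<longrightarrow>
      ((\<lambda>(m, n). parity_sign \<epsilon> * (cinner (B n (A m c)) d * z powi (- m - 1) * w powi (- n - 1)))
        has_sum laurent_fraction N p z w) UNIV)" for c d
  proof -
    define f where "f m n = cinner (A m (B n c)) d" for m n
    define h where "h n m = parity_sign \<epsilon> * cinner (B n (A m c)) d" for n m
    define Q where "Q = (shift_diff ^^ N) f"
    have Q_h: "(shift_diff ^^ N) h n m = (- 1) ^ N * Q m n" for m n
    proof -
      have "f = (\<lambda>m n. cinner (supercommutator (parity_sign \<epsilon>) A B c m n) d + h n m)"
        by (simp add: f_def h_def supercommutator_def cinner_simps fun_eq_iff)
      then have "Q = (shift_diff ^^ N) (\<lambda>m n. cinner (supercommutator (parity_sign \<epsilon>) A B c m n) d + h n m)"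
        by (simp only: Q_def)
      then have "Q m n = (shift_diff ^^ N) (\<lambda>m n. h n m) m n" for m n
        using funpow_shift_diff_add[of N "\<lambda>m n. cinner (supercommutator (parity_sign \<epsilon>) A B c m n) d" "\<lambda>m n. h n m"]
          funpow_shift_diff_additive[of "\<lambda>x. cinner x d" N "supercommutator (parity_sign \<epsilon>) A B c"]
        by (simp add: N cinner_simps)
      from this funpow_shift_diff_swap_complex[of N h m n] have "Q m n = (- 1) ^ N * (shift_diff ^^ N) h n m"
        by (rule trans)
      then show ?thesis by (simp add: mult.assoc[symmetric] power_mult_distrib[symmetric])
    qed
    obtain KB where KB: "\<forall>n\<ge>KB. B n c = 0" using truncated_fieldD[OF B] by blast
    obtain KA where KA: "\<forall>n\<ge>KA. A n c = 0" using truncated_fieldD[OF A] by blast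
    have f_van: "f m n = 0" if "n \<ge> KB" for m n
      using KB that by (simp add: f_def clinear_zero[OF truncated_field_linear[OF A]] cinner_simps)
    have h_van: "h n m = 0" if "m \<ge> KA" for m n
      using KA that by (simp add: h_def clinear_zero[OF truncated_field_linear[OF B]] cinner_simps)
    have Q_van: "n < KB \<and> m < KA" if "Q m n \<noteq> 0" for m n
    proof -
      have "n < KB"
        using funpow_shift_diff_vanish_right[of KB f n N m] f_van that unfolding Q_def by force
      moreover have "m < KA"
        using funpow_shift_diff_vanish_right[of KA h m N n] h_van that Q_h[of n m] by force
      ultimately show ?thesis ..
    qed
    have bQ: "bounded_band Q"
      unfolding Q_def by (rule bounded_band_funpow) (simp add: f_def[abs_def] band)
    define I where "I = {k. \<exists>m. Q m (k - m) \<noteq> 0}"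
    have "finite I" using bQ by (simp add: I_def bounded_band_def)
    have "{(m, n). Q m n \<noteq> 0} \<subseteq> (\<lambda>(k, m). (m, k - m)) ` (SIGMA k:I. {k - KB..KA})"
    proof clarify
      fix m n assume q: "Q m n \<noteq> 0"
      then have "m + n \<in> I" unfolding I_def by (auto intro!: exI[of _ m])
      moreover have "m \<in> {m + n - KB..KA}" using Q_van[OF q] by auto
      ultimately show "(m, n) \<in> (\<lambda>(k, m). (m, k - m)) ` (SIGMA k:I. {k - KB..KA})"
        by (intro image_eqI[of _ _ "(m + n, m)"]) auto
    qed
    moreover have "finite (SIGMA k:I. {k - KB..KA})" using \<open>finite I\<close> by auto
    ultimately have Q_fin: "finite {(m, n). Q m n \<noteq> 0}"
      using finite_surj by blast
    \<comment> \<open>A mode m stands for the exponent -m-1.\<close>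
    define p where "p = (\<lambda>(i, j). Q (- i - 1) (- j - 1))"
    have supp: "{k. p k \<noteq> 0} = (\<lambda>(m, n). (- m - 1, - n - 1)) ` {(m, n). Q m n \<noteq> 0}"
    proof (intro set_eqI iffI)
      fix k assume "k \<in> {k. p k \<noteq> 0}"
      then show "k \<in> (\<lambda>(m, n). (- m - 1, - n - 1)) ` {(m, n). Q m n \<noteq> 0}"
        by (intro image_eqI[of _ _ "(- fst k - 1, - snd k - 1)"]) (auto simp: p_def split: prod.splits)
    qed (auto simp: p_def)
    have frac: "laurent_fraction N p z w = (\<Sum>(m, n)\<in>{(m, n). Q m n \<noteq> 0}. laurent_term Q z w m n) / (z - w) ^ N" for z w
    proof -
      have "inj_on (\<lambda>(m, n). (- m - 1, - n - 1)) {(m, n). Q m n \<noteq> 0}"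
        by (auto simp: inj_on_def)
      then show ?thesis
        unfolding laurent_fraction_def supp
        by (subst sum.reindex) (auto simp: p_def case_prod_unfold)
    qed
    show ?thesis
    proof (intro exI[of _ p] conjI allI impI)
      show "finite {k. p k \<noteq> 0}" unfolding supp using Q_fin by simp
      fix z w :: complex
      assume "0 < norm w \<and> norm w < norm z"
      then show "((\<lambda>(m, n). cinner (A m (B n c)) d * z powi (- m - 1) * w powi (- n - 1))
          has_sum laurent_fraction N p z w) UNIV"
        using laurent_term_has_sum[of w z KB f N] f_van Q_fin
        unfolding frac by (simp add: Q_def[symmetric] f_def[symmetric])
    next
      fix z w :: complex
      assume zw: "0 < norm z \<and> norm z < norm w"
      define Qh where "Qh = (shift_diff ^^ N) h"
      have Qh: "Qh n m = (- 1) ^ N * Q m n" for m n using Q_h by (simp add: Qh_def)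
      have suppQh: "{(n, m). Qh n m \<noteq> 0} = prod.swap ` {(m, n). Q m n \<noteq> 0}"
        by (auto simp: Qh image_iff)
      have "finite {(n, m). Qh n m \<noteq> 0}" unfolding suppQh using Q_fin by simp
      then have "((\<lambda>(n, m). laurent_term h w z n m) has_sum
          ((\<Sum>(n, m)\<in>{(n, m). Qh n m \<noteq> 0}. laurent_term Qh w z n m) / (w - z) ^ N)) UNIV"
        using laurent_term_has_sum[of z w KA h N] zw h_van unfolding Qh_def by blast
      moreover have "(\<Sum>(n, m)\<in>{(n, m). Qh n m \<noteq> 0}. laurent_term Qh w z n m) / (w - z) ^ N = laurent_fraction N p z w"
      proof -
        have "(\<Sum>(n, m)\<in>{(n, m). Qh n m \<noteq> 0}. laurent_term Qh w z n m)
            = (\<Sum>(m, n)\<in>{(m, n). Q m n \<noteq> 0}. (- 1) ^ N * laurent_term Q z w m n)"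
          unfolding suppQh by (subst sum.reindex) (auto simp: Qh case_prod_unfold mult_ac)
        also have "\<dots> = (- 1) ^ N * (\<Sum>(m, n)\<in>{(m, n). Q m n \<noteq> 0}. laurent_term Q z w m n)"
          by (simp add: sum_distrib_left case_prod_unfold)
        finally have sum_eq: "(\<Sum>(n, m)\<in>{(n, m). Qh n m \<noteq> 0}. laurent_term Qh w z n m) = \<dots>" .
        have "(w - z) ^ N = (- 1) ^ N * (z - w) ^ N"
          by (simp add: power_mult_distrib[symmetric])
        then show ?thesis unfolding frac sum_eq by simp
      qed
      ultimately have "((\<lambda>(n, m). laurent_term h w z n m) has_sum laurent_fraction N p z w) (UNIV \<times> UNIV)"
        by simp
      then have "((\<lambda>(m, n). laurent_term h w z n m) has_sum laurent_fraction N p z w) (UNIV \<times> UNIV)"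
        by (subst has_sum_swap) (simp add: case_prod_unfold)
      then show "((\<lambda>(m, n). parity_sign \<epsilon> * (cinner (B n (A m c)) d * z powi (- m - 1) * w powi (- n - 1)))
          has_sum laurent_fraction N p z w) UNIV"
        by (simp add: h_def mult_ac)
    qed
  qed
  then show ?thesis unfolding local_fields_def by blast
qed

section \<open>The vertex operator superalgebra of a generating family\<close>

lemma field_times_z_deriv_iff:
  "field_commutator H A = field_times_z (field_deriv A) + r *\<^sub>C A \<longleftrightarrow> has_weight H r A"
proof -
  have "field_times_z (field_deriv A) n v + (r *\<^sub>C A) n v = (r - 1 - of_int n) *\<^sub>C A n v" for n v
    by (simp add: field_times_z_def field_deriv_def cscale_fun_def cscale_add_left[symmetric] algebra_simps)
  then show ?thesis
    by (simp add: has_weight_def field_commutator_def fun_eq_iff diff_eq_eq add.commute[of "A _ (H _)"])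
qed

text \<open>The input for reconstruction; T 0 and T 1 play the roles of L_(-1) and L_0. Weights of
  generators are assumed integral or half-integral according to parity; that energies are
  nonnegative comes from the spectrum of T 1.\<close>

locale vertex_generators =
  fixes G :: "('h::complex_prehilbert fld \<times> bit) set" and \<Omega> :: 'h and T :: "'h fld"
  assumes gen_truncated: "truncated_generators G"
    and gen_local: "pairwise_local G"
    and gen_vacuum: "(A, \<epsilon>) \<in> G \<Longrightarrow> vacuum_field \<Omega> A"
    and irreducible: "acts_irreducibly {A n | A n. A \<in> generated_fields G}"
    and vacuum_nonzero: "\<Omega> \<noteq> 0"
    and T_generated: "T \<in> generated_part G 0"
    and gen_translation: "(A, \<epsilon>) \<in> G \<Longrightarrow> translation_covariant (T 0) A"
    and gen_weight: "(A, \<epsilon>) \<in> G \<Longrightarrow> \<exists>k::int. has_weight (T 1) (of_int k + (if \<epsilon> = 0 then 0 else 1/2)) A"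
    and energy_symmetric: "cinner (T 1 u) v = cinner u (T 1 v)"
    and energy_spanning: "cspan (\<Union>r\<in>half_naturals. {v. T 1 v = complex_of_real r *\<^sub>C v}) = UNIV"
    and energy_finite: "r \<in> half_naturals \<Longrightarrow> \<exists>F. finite F \<and> {v. T 1 v = complex_of_real r *\<^sub>C v} \<subseteq> cspan F"
    and virasoro_relation: "T (m + 1) (T (n + 1) v) - T (n + 1) (T (m + 1) v) =
        of_int (m - n) *\<^sub>C T (m + n + 1) v
        + (if m + n = 0 then central_charge (creation \<Omega> T) / 12 * of_int (m * (m^2 - 1)) else 0) *\<^sub>C v"
begin

abbreviation E :: "complex \<Rightarrow> 'h set" where "E r \<equiv> {v. T 1 v = r *\<^sub>C v}"
abbreviation Hp :: "bit \<Rightarrow> 'h set" where "Hp \<epsilon> \<equiv> creation \<Omega> ` generated_part G \<epsilon>"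

lemma T_fields: "T \<in> generated_fields G"
  using T_generated generated_part_subset by blast

lemmas part_truncated = generated_part_truncated[OF gen_truncated]
lemmas fields_truncated = generated_fields_truncated[OF gen_truncated]

lemma T_linear: "clinear (T n)"
  by (rule truncated_field_linear[OF fields_truncated[OF T_fields]])

lemmas T_simps = clinear_simps[OF T_linear]

lemma fields_linear: "A \<in> generated_fields G \<Longrightarrow> clinear (A n)"
  by (rule truncated_field_linear[OF fields_truncated])

lemma generated_vacuum: "generated G A \<epsilon> \<Longrightarrow> vacuum_field \<Omega> A"
  by (erule generated_truncated_induct[OF _ gen_truncated])
    (auto intro: vacuum_field_id field_prod_vacuum gen_vacuum)

lemma fields_vacuum:
  assumes "A \<in> generated_fields G"
  shows "vacuum_field \<Omega> A"
  using assms unfolding generated_fields_def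
  by (rule cspan_induct) (auto intro: generated_vacuum vacuum_field_subspace)

lemma generated_translation: "generated G A \<epsilon> \<Longrightarrow> translation_covariant (T 0) A"
  by (erule generated_truncated_induct[OF _ gen_truncated])
    (auto intro: translation_covariant_id translation_covariant_prod T_linear gen_translation)

lemma fields_translation:
  assumes "A \<in> generated_fields G"
  shows "translation_covariant (T 0) A"
  using assms unfolding generated_fields_def
  by (rule cspan_induct) (auto intro: generated_translation translation_covariant_subspace T_linear)

lemma generated_weight:
  "generated G A \<epsilon> \<Longrightarrow> \<exists>k::int. has_weight (T 1) (of_int k + (if \<epsilon> = 0 then 0 else 1/2)) A"
proof (erule generated_truncated_induct[OF _ gen_truncated])
  show "\<exists>k::int. has_weight (T 1) (of_int k + (if 0 = (0::bit) then 0 else 1/2)) id_field"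
    by (rule exI[of _ 0]) (simp add: has_weight_id T_linear)
next
  fix A B and \<epsilon>1 \<epsilon>2 :: bit and n :: int
  assume tr: "truncated_field A" "truncated_field B"
    and "\<exists>k::int. has_weight (T 1) (of_int k + (if \<epsilon>1 = 0 then 0 else 1/2)) A"
      "\<exists>k::int. has_weight (T 1) (of_int k + (if \<epsilon>2 = 0 then 0 else 1/2)) B"
  then obtain k l :: int where k: "has_weight (T 1) (of_int k + (if \<epsilon>1 = 0 then 0 else 1/2)) A"
    and l: "has_weight (T 1) (of_int l + (if \<epsilon>2 = 0 then 0 else 1/2)) B" by blast
  \<comment> \<open>Two odd factors contribute 1/2 + 1/2, which is carried over to the integer
    part.\<close>
  define j where "j = k + l - 1 - n + (if \<epsilon>1 = 1 \<and> \<epsilon>2 = 1 then 1 else 0)"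
  have "(of_int k + (if \<epsilon>1 = 0 then 0 else 1/2)) + (of_int l + (if \<epsilon>2 = 0 then 0 else 1/2)) - 1 - of_int n
      = (of_int j + (if \<epsilon>1 + \<epsilon>2 = 0 then 0 else 1/2) :: complex)"
    using bit_cases[of \<epsilon>1] bit_cases[of \<epsilon>2] by (auto simp: j_def)
  then show "\<exists>j::int. has_weight (T 1) (of_int j + (if \<epsilon>1 + \<epsilon>2 = 0 then 0 else 1/2)) (field_prod (\<epsilon>1 * \<epsilon>2) n A B)"
    using has_weight_prod[OF T_linear tr k l, of n "\<epsilon>1 * \<epsilon>2"] by metis
qed (rule gen_weight)

lemma L0_vacuum: "T 1 \<Omega> = 0" and translation_vacuum: "T 0 \<Omega> = 0"
  using fields_vacuum[OF T_fields] by (auto simp: vacuum_field_def)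

lemma creation_add: "creation \<Omega> (A + B) = creation \<Omega> A + creation \<Omega> B"
  and creation_scale: "creation \<Omega> (c *\<^sub>C A) = c *\<^sub>C creation \<Omega> A"
  by (simp_all add: creation_def cscale_fun_def)

lemma creation_linear: "clinear (creation \<Omega>)"
  by (rule clinearI) (simp_all add: creation_add creation_scale)

lemma creation_weight: "has_weight (T 1) \<Delta> A \<Longrightarrow> clinear (A (- 1)) \<Longrightarrow> creation \<Omega> A \<in> E \<Delta>"
  by (simp add: has_weight_def creation_def L0_vacuum clinear_zero)

lemma creation_prod:
  assumes "A \<in> generated_fields G" "B \<in> generated_fields G"
  shows "creation \<Omega> (field_prod \<epsilon> n A B) = A n (creation \<Omega> B)"
  using assms by (intro field_prod_vacuum(2)) (auto intro: fields_truncated fields_vacuum)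

text \<open>The created states form a subspace containing \<Omega>, and it is invariant because a
  mode applied to a created state is created by a product field. The splitting by parity is there
  because the sign in a product depends on it.\<close>

lemma creation_surj: "creation \<Omega> ` generated_fields G = UNIV"
proof -
  let ?W = "creation \<Omega> ` generated_fields G"
  have W: "csubspace ?W"
  proof (rule complex_vector.subspaceI)
    show "0 \<in> ?W"
      using complex_vector.subspace_0[OF generated_fields_subspace] clinear_zero[OF creation_linear] by force
    show "x + y \<in> ?W" if "x \<in> ?W" "y \<in> ?W" for x y
      using that by (auto simp flip: creation_add intro!: imageI complex_vector.subspace_add[OF generated_fields_subspace])
    show "c *\<^sub>C x \<in> ?W" if "x \<in> ?W" for c x
      using that by (auto simp flip: creation_scale intro!: imageI complex_vector.subspace_scale[OF generated_fields_subspace])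
  qed
  have part: "A n (creation \<Omega> B) \<in> ?W" if "A \<in> generated_part G \<epsilon>1" "B \<in> generated_part G \<epsilon>2" for A B \<epsilon>1 \<epsilon>2 n
    using generated_part_prod[OF gen_truncated that, of n] that generated_part_subset
    by (metis creation_prod image_eqI subsetD)
  have inv: "A n ` ?W \<subseteq> ?W" if A: "A \<in> generated_fields G" for A n
  proof clarify
    fix B assume B: "B \<in> generated_fields G"
    obtain A0 A1 where A01: "A0 \<in> generated_part G 0" "A1 \<in> generated_part G 1" "A = A0 + A1"
      using generated_fields_split[OF A] by blast
    obtain B0 B1 where B01: "B0 \<in> generated_part G 0" "B1 \<in> generated_part G 1" "B = B0 + B1"
      using generated_fields_split[OF B] by blast
    have "A n (creation \<Omega> B) = (A0 n (creation \<Omega> B0) + A0 n (creation \<Omega> B1)) + (A1 n (creation \<Omega> B0) + A1 n (creation \<Omega> B1))"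
      using A01 B01 by (simp add: creation_add clinear_add[OF truncated_field_linear[OF part_truncated]])
    then show "A n (creation \<Omega> B) \<in> ?W"
      using part A01 B01 complex_vector.subspace_add[OF W] by (metis (no_types, lifting))
  qed
  have "\<Omega> = creation \<Omega> id_field" by (simp add: creation_def id_field_def)
  moreover have "id_field \<in> generated_fields G"
    unfolding generated_fields_def by (intro complex_vector.span_base) (auto intro: generated.gen_id)
  ultimately have "\<Omega> \<in> ?W" by blast
  then have "?W \<noteq> {0}" using vacuum_nonzero by blast
  then show ?thesis
    using irreducible W inv unfolding acts_irreducibly_def by blast
qed

section \<open>Energy eigenspaces and the grading by parity\<close>

lemma eigenvectors_orthogonal:
  assumes "u \<in> E a" "v \<in> E (complex_of_real r)" "a \<noteq> complex_of_real r"
  shows "cinner u v = 0"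
proof -
  have "a * cinner u v = complex_of_real r * cinner u v"
    using energy_symmetric[of u v] assms(1,2) by (simp add: cinner_simps)
  then show ?thesis using assms(3) by simp
qed

lemma orthogonal_spans:
  assumes "u \<in> cspan S" "v \<in> cspan S'" "\<And>u v. u \<in> S \<Longrightarrow> v \<in> S' \<Longrightarrow> cinner u v = 0"
  shows "cinner u v = 0"
  using assms(1)
proof (rule cspan_induct)
  fix u assume u: "u \<in> S"
  show "cinner u v = 0"
    using assms(2) by (rule cspan_induct) (auto intro!: csubspace_Collect simp: cinner_simps assms(3)[OF u])
qed (auto intro!: csubspace_Collect simp: cinner_simps)

text \<open>An eigenvector with any other eigenvalue would be orthogonal to the listed eigenspaces,
  which span.\<close>

lemma eigenvalue_half_natural:
  assumes "v \<in> E a" "v \<noteq> 0"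
  shows "\<exists>r\<in>half_naturals. a = complex_of_real r"
proof (rule ccontr)
  assume neg: "\<not> ?thesis"
  have "v = 0"
    by (rule cinner_left_eq_0[OF energy_spanning]) (use neg eigenvectors_orthogonal[OF assms(1)] in blast)
  then show False using assms(2) by blast
qed

lemma Hp_span: "Hp \<epsilon> = cspan (creation \<Omega> ` {A. generated G A \<epsilon>})"
proof -
  interpret Vector_Spaces.linear cscale cscale "creation \<Omega>" by (rule creation_linear)
  show ?thesis unfolding generated_part_def by (rule span_image[symmetric])
qed

text \<open>The weight of the field is the energy of its state, at first an arbitrary integer
  shifted according to parity; a nonzero state makes it an eigenvalue, hence nonnegative.\<close>

lemma generated_creation_energy:
  assumes "generated G A \<epsilon>"
  shows "\<exists>r\<in>shifted_naturals \<epsilon>. creation \<Omega> A \<in> E (complex_of_real r)"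
proof -
  obtain k :: int where k: "has_weight (T 1) (of_int k + (if \<epsilon> = 0 then 0 else 1/2)) A"
    using generated_weight[OF assms] by blast
  have "clinear (A (- 1))"
    by (rule truncated_field_linear[OF generated_truncated[OF assms gen_truncated]])
  then have e: "creation \<Omega> A \<in> E (of_int k + (if \<epsilon> = 0 then 0 else 1/2))"
    by (rule creation_weight[OF k])
  show ?thesis
  proof (cases "creation \<Omega> A = 0")
    case True
    \<comment> \<open>The zero state has every energy; the lowest admissible one is taken.\<close>
    have "real 0 + (if \<epsilon> = 0 then 0 else 1/2) \<in> shifted_naturals \<epsilon>" unfolding shifted_naturals_def by blast
    then show ?thesis using True T_simps(3) by auto
  next
    case False
    then obtain r where r: "r \<in> half_naturals" "of_int k + (if \<epsilon> = 0 then 0 else 1/2) = complex_of_real r"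
      using eigenvalue_half_natural[OF e] by blast
    then have "complex_of_real r = complex_of_real (of_int k + (if \<epsilon> = 0 then 0 else 1/2))" by auto
    then have rk: "r = of_int k + (if \<epsilon> = 0 then 0 else 1/2)" using of_real_eq_iff by blast
    moreover have "r \<ge> 0" using r(1) by (auto simp: half_naturals_def)
    ultimately have "k \<ge> 0" by (cases "\<epsilon> = 0") auto
    then have "r = real (nat k) + (if \<epsilon> = 0 then 0 else 1/2)" using rk by simp
    then have "r \<in> shifted_naturals \<epsilon>" unfolding shifted_naturals_def by blast
    then show ?thesis using e r(2) by auto
  qed
qed

lemma Hp_subset: "Hp \<epsilon> \<subseteq> cspan (\<Union>r\<in>shifted_naturals \<epsilon>. E (complex_of_real r))"
  unfolding Hp_span using generated_creation_energy
  by (intro complex_vector.span_minimal) (auto intro!: complex_vector.span_base)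

lemma shifted_naturals_disjoint: "r \<in> shifted_naturals 0 \<Longrightarrow> s \<in> shifted_naturals 1 \<Longrightarrow> r \<noteq> s"
proof
  assume "r \<in> shifted_naturals 0" "s \<in> shifted_naturals 1" "r = s"
  then obtain k l :: nat where "real k = real l + 1/2" by (auto simp: shifted_naturals_def)
  then have "real (2 * k) = real (2 * l + 1)" by simp
  then have "2 * k = 2 * l + 1" by (simp only: of_nat_eq_iff)
  then show False by presburger
qed

lemma parity_orthogonal:
  assumes "u \<in> cspan (\<Union>r\<in>shifted_naturals 0. E (complex_of_real r))"
    and "v \<in> cspan (\<Union>r\<in>shifted_naturals 1. E (complex_of_real r))"
  shows "cinner u v = 0"
  using assms
proof (rule orthogonal_spans)
  fix u v assume "u \<in> (\<Union>r\<in>shifted_naturals 0. E (complex_of_real r))" "v \<in> (\<Union>r\<in>shifted_naturals 1. E (complex_of_real r))"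
  then obtain r s where rs: "r \<in> shifted_naturals 0" "s \<in> shifted_naturals 1" "u \<in> E (complex_of_real r)" "v \<in> E (complex_of_real s)"
    by blast
  then show "cinner u v = 0"
    using eigenvectors_orthogonal[OF rs(3,4)] shifted_naturals_disjoint[OF rs(1,2)] by simp
qed

lemma Hp_sum: "\<exists>u0\<in>Hp 0. \<exists>u1\<in>Hp 1. v = u0 + u1"
proof -
  obtain A where A: "A \<in> generated_fields G" "v = creation \<Omega> A" using creation_surj by blast
  obtain A0 A1 where A01: "A0 \<in> generated_part G 0" "A1 \<in> generated_part G 1" "A = A0 + A1"
    using generated_fields_split[OF A(1)] by blast
  then have "v = creation \<Omega> A0 + creation \<Omega> A1" using A(2) by (simp add: creation_add)
  then show ?thesis using A01 by blast
qed

lemma Hp_subspace: "csubspace (Hp \<epsilon>)"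
  unfolding Hp_span by simp

text \<open>For the reverse inclusion split v by parity: the component of the wrong parity lies in
  the energy spans of both parities, which are orthogonal, so it is zero.\<close>

lemma Hp_eq: "Hp \<epsilon> = cspan (\<Union>r\<in>shifted_naturals \<epsilon>. E (complex_of_real r))"
proof (rule antisym[OF Hp_subset])
  let ?U = "\<lambda>\<epsilon>. cspan (\<Union>r\<in>shifted_naturals \<epsilon>. E (complex_of_real r))"
  show "?U \<epsilon> \<subseteq> Hp \<epsilon>"
  proof
    fix v assume v: "v \<in> ?U \<epsilon>"
    obtain u0 u1 where u: "u0 \<in> Hp 0" "u1 \<in> Hp 1" "v = u0 + u1" using Hp_sum by blast
    have U: "u0 \<in> ?U 0" "u1 \<in> ?U 1" using u Hp_subset by blast+
    show "v \<in> Hp \<epsilon>"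
    proof (cases "\<epsilon> = 0")
      case True
      then have "u1 \<in> ?U 0"
        using v U u(3) complex_vector.span_diff[of v _ u0] by simp
      then have "cinner u1 u1 = 0" using U by (intro parity_orthogonal)
      then show ?thesis using u True by (simp add: cinner_eq_zero_iff)
    next
      case False
      then have e1: "\<epsilon> = 1" using bit_cases by blast
      then have "u0 \<in> ?U 1"
        using v U u(3) complex_vector.span_diff[of v _ u1] by simp
      then have "cinner u0 u0 = 0" using U by (intro parity_orthogonal)
      then show ?thesis using u e1 by (simp add: cinner_eq_zero_iff)
    qed
  qed
qed

text \<open>As T 0 kills \<Omega>, translation covariance carries A(-1) \<Omega> = 0 to all lower
  modes, so every mode of A kills \<Omega>. The vectors killed by all modes of A form an invariant
  subspace by locality, and irreducibility makes it everything.\<close>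

lemma part_eq_0:
  assumes A: "A \<in> generated_part G \<epsilon>" and 0: "creation \<Omega> A = 0"
  shows "A = 0"
proof -
  have A': "A \<in> generated_fields G" using A generated_part_subset by blast
  have "A (- 1 - int k) \<Omega> = 0" for k
  proof (induction k)
    case 0
    then show ?case using \<open>creation \<Omega> A = 0\<close> by (simp add: creation_def)
  next
    case (Suc k)
    have "T 0 (A (- 1 - int k) \<Omega>) = A (- 1 - int k) (T 0 \<Omega>) - of_int (- 1 - int k) *\<^sub>C A (- 1 - int k - 1) \<Omega>"
      using fields_translation[OF A'] unfolding translation_covariant_iff by blast
    then have "of_int (- 1 - int k) *\<^sub>C A (- 1 - int k - 1) \<Omega> = 0"
      using Suc by (simp add: translation_vacuum clinear_zero[OF fields_linear[OF A']] T_simps)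
    moreover have "of_int (- 1 - int k) \<noteq> (0::complex)" by (simp only: of_int_eq_0_iff)
    ultimately have "A (- 1 - int k - 1) \<Omega> = 0" by simp
    then show ?case by (simp add: algebra_simps)
  qed
  note neg = this
  have A\<Omega>: "A m \<Omega> = 0" for m
  proof (cases "m \<ge> 0")
    case True
    then show ?thesis using fields_vacuum[OF A'] by (simp add: vacuum_field_def)
  next
    case False
    then show ?thesis using neg[of "nat (- 1 - m)"] by simp
  qed
  define W where "W = {v. \<forall>m. A m v = 0}"
  have "csubspace W"
    unfolding W_def by (rule csubspace_Collect) (simp_all add: clinear_simps[OF fields_linear[OF A']])
  moreover have "B n ` W \<subseteq> W" if B: "B \<in> generated_fields G" for B n
  proof clarify
    fix v assume v: "v \<in> W"
    obtain B0 B1 where B01: "B0 \<in> generated_part G 0" "B1 \<in> generated_part G 1" "B = B0 + B1"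
      using generated_fields_split[OF B] by blast
    have "A m (B' n v) = 0" if "B' \<in> generated_part G \<epsilon>'" for B' \<epsilon>' m
      using mode_local_annihilator[OF generated_part_local[OF gen_truncated gen_local A that] part_truncated[OF that]
          part_truncated[OF A]] v by (simp add: W_def)
    then show "B n v \<in> W"
      using B01 by (simp add: W_def clinear_simps[OF fields_linear[OF A']])
  qed
  moreover have "\<Omega> \<in> W" using A\<Omega> by (simp add: W_def)
  ultimately have "W = UNIV"
    using irreducible vacuum_nonzero unfolding acts_irreducibly_def by blast
  then show ?thesis by (auto simp: W_def fun_eq_iff)
qed

text \<open>If the states of the even and odd components of a field cancel, they are opposite and
  orthogonal, so both vanish, and the two components vanish separately.\<close>

lemma creation_bij: "bij_betw (creation \<Omega>) (generated_fields G) UNIV"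
proof (rule bij_betw_imageI[OF _ creation_surj])
  have "A = 0" if A: "A \<in> generated_fields G" "creation \<Omega> A = 0" for A
  proof -
    obtain A0 A1 where A01: "A0 \<in> generated_part G 0" "A1 \<in> generated_part G 1" "A = A0 + A1"
      using generated_fields_split[OF A(1)] by blast
    have U: "creation \<Omega> A0 \<in> Hp 0" "creation \<Omega> A1 \<in> Hp 1" using A01 by blast+
    have neg: "creation \<Omega> A0 = - creation \<Omega> A1"
      using A(2) A01(3) by (simp add: creation_add eq_neg_iff_add_eq_0)
    have "cinner (creation \<Omega> A0) (creation \<Omega> A1) = 0"
      using U Hp_eq parity_orthogonal by blast
    then have "creation \<Omega> A1 = 0" by (simp add: neg cinner_simps cinner_eq_zero_iff)
    then have "A0 = 0" "A1 = 0" using part_eq_0[OF A01(1)] part_eq_0[OF A01(2)] neg by simp_all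
    then show ?thesis using A01(3) by simp
  qed
  note kernel = this
  have "A - B = 0" if "A \<in> generated_fields G" "B \<in> generated_fields G" "creation \<Omega> A = creation \<Omega> B" for A B
    by (rule kernel[OF complex_vector.subspace_diff[OF generated_fields_subspace that(1,2)]])
      (simp only: clinear_diff[OF creation_linear] that(3) diff_self)
  then show "inj_on (creation \<Omega>) (generated_fields G)"
    by (meson inj_onI eq_iff_diff_eq_0)
qed

section \<open>The state-field correspondence\<close>

definition V :: "'h \<Rightarrow> 'h fld" where "V = inv_into (generated_fields G) (creation \<Omega>)"

lemma V_fields: "V a \<in> generated_fields G"
  and creation_V: "creation \<Omega> (V a) = a"
  and V_creation: "A \<in> generated_fields G \<Longrightarrow> V (creation \<Omega> A) = A"
  using creation_bij unfolding V_def bij_betw_def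
  by (auto simp: inv_into_into f_inv_into_f inv_into_f_f)

lemma V_Hp: "V ` Hp \<epsilon> = generated_part G \<epsilon>"
proof -
  have "V (creation \<Omega> A) = A" if "A \<in> generated_part G \<epsilon>" for A
    using that V_creation generated_part_subset by blast
  then show ?thesis
    unfolding image_image using image_cong[of "generated_part G \<epsilon>" "generated_part G \<epsilon>" "\<lambda>A. V (creation \<Omega> A)" "\<lambda>A. A"]
    by simp
qed

text \<open>Write the field as a part of weight r plus a combination of fields of other weights. The
  state of the latter has energy r and is orthogonal to all states of energy r, so it is zero, and
  injectivity removes the field itself.\<close>

lemma V_weight:
  assumes a: "a \<in> E (complex_of_real r)"
  shows "has_weight (T 1) (complex_of_real r) (V a)"
proof -
  let ?r = "complex_of_real r"
  define S1 where "S1 = {A \<in> generated_fields G. has_weight (T 1) ?r A}"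
  define S2 where "S2 = {A \<in> generated_fields G. \<exists>s. s \<noteq> ?r \<and> has_weight (T 1) s A}"
  have S1: "csubspace S1"
    using has_weight_subspace[OF T_linear, of 1 ?r] generated_fields_subspace
    unfolding S1_def complex_vector.subspace_def by auto
  have "generated_fields G \<subseteq> cspan (S1 \<union> S2)"
    unfolding generated_fields_def
  proof (rule complex_vector.span_minimal)
    show "{A. \<exists>\<epsilon>. generated G A \<epsilon>} \<subseteq> cspan (S1 \<union> S2)"
    proof clarify
      fix A \<epsilon> assume A: "generated G A \<epsilon>"
      then have "A \<in> generated_fields G"
        unfolding generated_fields_def by (intro complex_vector.span_base) auto
      moreover obtain s where "has_weight (T 1) s A" using generated_weight[OF A] by blast
      ultimately have "A \<in> S1 \<union> S2" unfolding S1_def S2_def by (cases "s = ?r") auto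
      then show "A \<in> cspan (S1 \<union> S2)" by (rule complex_vector.span_base)
    qed
  qed simp
  then obtain A1 A2 where A12: "A1 \<in> cspan S1" "A2 \<in> cspan S2" "V a = A1 + A2"
    using V_fields[of a] unfolding complex_vector.span_Un by blast
  have A1: "A1 \<in> S1" using A12(1) S1 by (metis complex_vector.span_eq_iff)
  have S2': "S2 \<subseteq> generated_fields G" by (auto simp: S2_def)
  have A2: "A2 \<in> generated_fields G"
    using A12(2) complex_vector.span_minimal[OF S2' generated_fields_subspace] by blast
  have "creation \<Omega> A1 \<in> E ?r"
    using A1 by (intro creation_weight) (auto simp: S1_def fields_linear)
  then have "creation \<Omega> A2 \<in> E ?r"
    using a creation_V[of a] A12(3) by (simp add: creation_add cscale_add_right T_simps) (metis add_left_cancel creation_add T_simps(1) cscale_add_right)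
  moreover have "cinner (creation \<Omega> A2) v = 0" if v: "v \<in> E ?r" for v
    using A12(2)
  proof (rule cspan_induct)
    fix A assume "A \<in> S2"
    then obtain s where "s \<noteq> ?r" "has_weight (T 1) s A" "A \<in> generated_fields G" by (auto simp: S2_def)
    then show "cinner (creation \<Omega> A) v = 0"
      using eigenvectors_orthogonal[OF creation_weight v] fields_linear by blast
  next
    show "csubspace {A. cinner (creation \<Omega> A) v = 0}"
      by (rule csubspace_Collect)
        (simp_all only: clinear_zero[OF creation_linear] creation_add creation_scale cinner_simps mult_zero_right add_0_left)
  qed
  ultimately have "creation \<Omega> A2 = 0" using cinner_eq_zero_iff by blast
  moreover have "creation \<Omega> 0 = (0::'h)" by (rule clinear_zero[OF creation_linear])
  ultimately have "A2 = 0"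
    using V_creation[OF A2] V_creation[OF complex_vector.subspace_0[OF generated_fields_subspace]] by simp
  then show ?thesis using A1 A12(3) by (simp add: S1_def)
qed

text \<open>For fields of definite weight and energy eigenvectors c, d a nonzero coefficient
  determines m + n. Linearity extends this in turn to d, c, B and A.\<close>

lemma fields_bounded_band:
  assumes A: "A \<in> generated_fields G" and B: "B \<in> generated_fields G"
  shows "bounded_band (\<lambda>m n. cinner (A m (B n c)) d)"
proof -
  have 1: "bounded_band (\<lambda>m n. cinner (A m (B n c)) d)"
    if wA: "has_weight (T 1) a A" and wB: "has_weight (T 1) b B" and c: "c \<in> E (complex_of_real r)"
      and d: "d \<in> E (complex_of_real s)" and lA: "\<And>m. clinear (A m)" and lB: "\<And>m. clinear (B m)"
    for A B a b c d r s
  proof -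
    have "of_int k = complex_of_real r + a + b - 2 - complex_of_real s" if "cinner (A m (B (k - m) c)) d \<noteq> 0" for m k
    proof -
      have "A m (B (k - m) c) \<in> E (complex_of_real r + (b - 1 - of_int (k - m)) + (a - 1 - of_int m))"
        using wA wB c by (simp add: has_weight_def clinear_simps[OF lA] clinear_simps[OF lB] cscale_add_left[symmetric])
      then have "complex_of_real r + (b - 1 - of_int (k - m)) + (a - 1 - of_int m) = complex_of_real s"
        using eigenvectors_orthogonal[OF _ d] that by blast
      then show ?thesis by (simp add: algebra_simps)
    qed
    then have "{k. \<exists>m. cinner (A m (B (k - m) c)) d \<noteq> 0} \<subseteq> {k. of_int k = complex_of_real r + a + b - 2 - complex_of_real s}"
      by blast
    moreover have "finite {k. of_int k = (z::complex)}" for z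
      by (rule finite_subset[of _ "{THE k. of_int k = z}"]) auto
    ultimately show ?thesis unfolding bounded_band_def using finite_subset by blast
  qed
  have 2: "bounded_band (\<lambda>m n. cinner (A m (B n c)) d)"
    if "has_weight (T 1) a A" "has_weight (T 1) b B" "c \<in> E (complex_of_real r)"
      and lA: "\<And>m. clinear (A m)" and lB: "\<And>m. clinear (B m)" for A B a b c d r
  proof (rule cspan_UNIV_induct[where x = d, OF energy_spanning])
    show "bounded_band (\<lambda>m n. cinner (A m (B n c)) d)" if "d \<in> (\<Union>r\<in>half_naturals. E (complex_of_real r))" for d
      using that 1[OF \<open>has_weight (T 1) a A\<close> \<open>has_weight (T 1) b B\<close> \<open>c \<in> E (complex_of_real r)\<close> _ lA lB] by blast
  qed (auto intro!: csubspace_Collect simp: cinner_simps bounded_band_add bounded_band_scale bounded_band_zero)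
  have 3: "bounded_band (\<lambda>m n. cinner (A m (B n c)) d)"
    if "has_weight (T 1) a A" "has_weight (T 1) b B"
      and lA: "\<And>m. clinear (A m)" and lB: "\<And>m. clinear (B m)" for A B a b c d
  proof (rule cspan_UNIV_induct[where x = c, OF energy_spanning])
    show "bounded_band (\<lambda>m n. cinner (A m (B n c)) d)" if "c \<in> (\<Union>r\<in>half_naturals. E (complex_of_real r))" for c
      using that 2[OF \<open>has_weight (T 1) a A\<close> \<open>has_weight (T 1) b B\<close> _ lA lB] by blast
  qed (auto intro!: csubspace_Collect simp: cinner_simps bounded_band_add bounded_band_scale bounded_band_zero
        clinear_simps[OF lA] clinear_simps[OF lB])
  have 4: "bounded_band (\<lambda>m n. cinner (A m (B n c)) d)" if gA: "generated G A \<epsilon>" for A \<epsilon>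
  proof -
    have lA: "clinear (A m)" for m by (rule truncated_field_linear[OF generated_truncated[OF gA gen_truncated]])
    show ?thesis
      using B unfolding generated_fields_def
    proof (rule cspan_induct)
      fix B assume "B \<in> {A. \<exists>\<epsilon>. generated G A \<epsilon>}"
      then obtain \<epsilon>' where gB: "generated G B \<epsilon>'" by blast
      then show "bounded_band (\<lambda>m n. cinner (A m (B n c)) d)"
        using 3 generated_weight[OF gA] generated_weight[OF gB] lA
          truncated_field_linear[OF generated_truncated[OF gB gen_truncated]] by blast
    qed (auto intro!: csubspace_Collect simp: cinner_simps bounded_band_add bounded_band_scale bounded_band_zero
        clinear_simps[OF lA] cscale_fun_def)
  qed
  show ?thesis
    using A unfolding generated_fields_def
    by (rule cspan_induct)
      (use 4 in \<open>auto intro!: csubspace_Collect simp: cinner_simps bounded_band_add bounded_band_scale bounded_band_zero cscale_fun_def\<close>)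
qed

theorem vertex_operator_superalgebra: "vertex_operator_superalgebra Hp V \<Omega> (creation \<Omega> T)"
proof -
  have vir: "virasoro_mode V (creation \<Omega> T) n = T (n + 1)" for n
    by (simp add: virasoro_mode_def V_creation[OF T_fields])
  have es: "energy_space V (creation \<Omega> T) r = E (complex_of_real r)" for r
    by (simp add: energy_space_def vir)
  have sub: "csubspace (generated_fields G)" by (rule generated_fields_subspace)
  show ?thesis
  proof (rule vertex_operator_superalgebra.intro)
    show "csubspace (Hp \<epsilon>)" for \<epsilon> by (rule Hp_subspace)
    show "Hp 0 \<inter> Hp 1 = {0}"
    proof
      show "Hp 0 \<inter> Hp 1 \<subseteq> {0}"
        using Hp_eq parity_orthogonal cinner_eq_zero_iff by blast
      show "{0} \<subseteq> Hp 0 \<inter> Hp 1" using complex_vector.subspace_0[OF Hp_subspace] by blast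
    qed
    show "{u + v | u v. u \<in> Hp 0 \<and> v \<in> Hp 1} = UNIV" using Hp_sum by blast
    show "clinear V"
    proof (rule clinearI)
      show "V (x + y) = V x + V y" for x y
        using V_creation[OF complex_vector.subspace_add[OF sub V_fields[of x] V_fields[of y]]]
        by (simp add: creation_add creation_V)
      show "V (c *\<^sub>C x) = c *\<^sub>C V x" for c x
        using V_creation[OF complex_vector.subspace_scale[OF sub V_fields[of x], of c]]
        by (simp add: creation_scale creation_V)
    qed
    show "is_field (V a)" for a
      using fields_truncated[OF V_fields] by (simp add: truncated_field_def)
    show "V a n \<Omega> = 0" if "n \<ge> 0" for a n
      using fields_vacuum[OF V_fields] that by (simp add: vacuum_field_def)
    show "creation \<Omega> (V a) = a" for a by (rule creation_V)
    have id: "id_field \<in> generated_fields G"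
      unfolding generated_fields_def by (intro complex_vector.span_base) (auto intro: generated.gen_id)
    show "V \<Omega> = id_field"
      using V_creation[OF id] by (simp add: creation_def id_field_def)
    have "{V a n | a n. True} = {A n | A n. A \<in> generated_fields G}"
      using V_fields V_creation by (auto, metis)
    then show "acts_irreducibly {V a n | a n. True}"
      using irreducible by simp
    show "local_fields (\<epsilon>1 * \<epsilon>2) A B" if "A \<in> V ` Hp \<epsilon>1" "B \<in> V ` Hp \<epsilon>2" for A B \<epsilon>1 \<epsilon>2
    proof -
      have A: "A \<in> generated_part G \<epsilon>1" and B: "B \<in> generated_part G \<epsilon>2" using that by (simp_all add: V_Hp)
      then have "A \<in> generated_fields G" "B \<in> generated_fields G" using generated_part_subset by blast+
      then show ?thesis
        by (intro local_fieldsI part_truncated[OF A] part_truncated[OF B] generated_part_local[OF gen_truncated gen_local A B]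
            fields_bounded_band)
    qed
    show "field_prod (\<epsilon>1 * \<epsilon>2) n A B \<in> V ` Hp (\<epsilon>1 + \<epsilon>2)" if "A \<in> V ` Hp \<epsilon>1" "B \<in> V ` Hp \<epsilon>2" for A B \<epsilon>1 \<epsilon>2 n
      using that unfolding V_Hp by (rule generated_part_prod[OF gen_truncated])
    show "virasoro_mode V (creation \<Omega> T) 0 \<Omega> = 0" "virasoro_mode V (creation \<Omega> T) (- 1) \<Omega> = 0"
      by (simp_all add: vir L0_vacuum translation_vacuum)
    show "creation \<Omega> T = virasoro_mode V (creation \<Omega> T) (- 2) \<Omega>"
      unfolding vir by (simp add: creation_def)
    show "virasoro_mode V (creation \<Omega> T) m (virasoro_mode V (creation \<Omega> T) n v) -
        virasoro_mode V (creation \<Omega> T) n (virasoro_mode V (creation \<Omega> T) m v) =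
        of_int (m - n) *\<^sub>C virasoro_mode V (creation \<Omega> T) (m + n) v
        + (if m + n = 0 then central_charge (creation \<Omega> T) / 12 * of_int (m * (m^2 - 1)) else 0) *\<^sub>C v" for m n v
      unfolding vir by (rule virasoro_relation)
    show "cspan (\<Union>r\<in>half_naturals. energy_space V (creation \<Omega> T) r) = UNIV"
      unfolding es by (rule energy_spanning)
    show "\<exists>F. finite F \<and> energy_space V (creation \<Omega> T) r \<subseteq> cspan F" if "r \<in> half_naturals" for r
      unfolding es by (rule energy_finite[OF that])
    show "cinner u v = 0" if "r \<in> half_naturals" "s \<in> half_naturals" "r \<noteq> s"
      "u \<in> energy_space V (creation \<Omega> T) r" "v \<in> energy_space V (creation \<Omega> T) s" for r s u v
      using that unfolding es by (intro eigenvectors_orthogonal[of u "complex_of_real r" v s]) auto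
    show "Hp \<epsilon> = cspan (\<Union>r\<in>shifted_naturals \<epsilon>. energy_space V (creation \<Omega> T) r)" for \<epsilon>
      unfolding es by (rule Hp_eq)
    show "\<Omega> \<in> energy_space V (creation \<Omega> T) 0"
      by (simp add: es L0_vacuum)
    show "creation \<Omega> T \<in> energy_space V (creation \<Omega> T) 2"
    proof -
      have "T 1 (T (- 1) \<Omega>) - T (- 1) (T 1 \<Omega>) = of_int 2 *\<^sub>C T (- 1) \<Omega>"
        using virasoro_relation[of 0 "- 2" \<Omega>] by simp
      then have "T 1 (creation \<Omega> T) = 2 *\<^sub>C creation \<Omega> T"
        by (simp add: creation_def L0_vacuum T_simps)
      then show ?thesis by (simp add: es)
    qed
    show "field_commutator (virasoro_mode V (creation \<Omega> T) 0) (V a) =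
        field_times_z (field_deriv (V a)) + complex_of_real r *\<^sub>C V a"
      if "r \<in> half_naturals" "a \<in> energy_space V (creation \<Omega> T) r" for r a
      using that V_weight[of a r] unfolding vir es field_times_z_deriv_iff by simp
    show tr: "field_commutator (virasoro_mode V (creation \<Omega> T) (- 1)) (V a) = field_deriv (V a)" for a
      using fields_translation[OF V_fields] by (simp add: vir translation_covariant_def)
    have deriv: "field_deriv (V a) \<in> generated_fields G" for a
    proof -
      obtain A0 A1 where A: "A0 \<in> generated_part G 0" "A1 \<in> generated_part G 1" "V a = A0 + A1"
        using generated_fields_split[OF V_fields] by blast
      have id': "id_field \<in> generated_part G 0"
        unfolding generated_part_def by (intro complex_vector.span_base) (auto intro: generated.gen_id)
      have "field_deriv B \<in> generated_fields G" if "B \<in> generated_part G \<epsilon>" for B \<epsilon>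
        using generated_part_prod[OF gen_truncated that id', of "- 2"] generated_part_subset
          field_deriv_eq_prod[OF part_truncated[OF that]] by auto
      moreover have "field_deriv (V a) = field_deriv A0 + field_deriv A1"
        by (simp add: A(3) field_deriv_def fun_eq_iff cscale_add_right)
      ultimately show ?thesis using A complex_vector.subspace_add[OF sub] by metis
    qed
    show "field_deriv (V a) = V (virasoro_mode V (creation \<Omega> T) (- 1) a)" for a
    proof -
      have "creation \<Omega> (field_deriv (V a)) = T 0 a"
      proof -
        have "T 0 (V a (- 1) \<Omega>) = V a (- 1) (T 0 \<Omega>) - of_int (- 1) *\<^sub>C V a (- 1 - 1) \<Omega>"
          using fields_translation[OF V_fields, of a] unfolding translation_covariant_iff by blast
        moreover have "V a (- 1) \<Omega> = a" using creation_V[of a] by (simp add: creation_def)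
        ultimately show ?thesis
          by (simp add: creation_def field_deriv_def translation_vacuum cscale_one clinear_zero[OF fields_linear[OF V_fields]])
      qed
      then show ?thesis using V_creation[OF deriv, of a] by (simp add: vir)
    qed
    show "field_deriv (V a) \<in> range V" for a
      using V_creation[OF deriv] by (metis rangeI)
  qed
qed

end

section \<open>Currents and fermions\<close>

lemma mode_local_symmetric_funpow_vanish:
  fixes F :: "int \<Rightarrow> int \<Rightarrow> 'a::complex_vector"
  assumes "(shift_diff ^^ N) F = (\<lambda>m n. 0)" "\<And>m n. m \<ge> K \<Longrightarrow> F m n = 0"
  shows "F m n = 0"
proof -
  have "(shift_diff ^^ N) (\<lambda>n m. F m n) = (\<lambda>m n. 0)"
    using funpow_shift_diff_swap[of N F] assms(1) by simp
  then show ?thesis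
    by (rule shift_diff_funpow_vanish[where F = "\<lambda>n m. F m n"]) (rule assms(2))
qed

lemma sum_shift_telescope:
  fixes f :: "nat \<Rightarrow> 'a::ab_group_add"
  assumes "\<And>p. p \<ge> N \<Longrightarrow> f p = 0"
  shows "(\<Sum>p<N. f p - f (p + k)) = (\<Sum>p<k. f p)"
proof -
  have "(\<Sum>p<N + k. f p) = (\<Sum>p<k. f p) + (\<Sum>p<N. f (p + k))"
    by (induction N) (simp_all add: algebra_simps)
  moreover have "(\<Sum>p<N + k. f p) = (\<Sum>p<N. f p)"
    by (rule sum.mono_neutral_right) (use assms in \<open>auto simp: not_less\<close>)
  ultimately show ?thesis by (simp add: sum_subtractf)
qed

lemma sum_delta_int:
  fixes f :: "nat \<Rightarrow> 'a::comm_monoid_add"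
  assumes "t < int N"
  shows "(\<Sum>p<N. if int p = t then f p else 0) = (if t \<ge> 0 then f (nat t) else 0)"
proof (cases "t \<ge> 0")
  case True
  have "(\<Sum>p<N. if int p = t then f p else 0) = (\<Sum>p<N. if p = nat t then f p else 0)"
    using True by (intro sum.cong) auto
  then show ?thesis using assms True by (simp add: nat_less_iff)
qed (auto intro!: sum.neutral)

text \<open>A product written as an ordinary sum up to any large N can be compared with others under
  one common bound.\<close>

lemma field_prod_eventually_sum:
  assumes A: "truncated_field A" and B: "truncated_field B"
  shows "\<exists>N0. \<forall>N\<ge>N0. field_prod \<epsilon> n A B m v = (\<Sum>p<N. binom_coeff n p *\<^sub>C
    (A (n - int p) (B (m + int p) v) - (parity_sign \<epsilon> * (-1) powi n) *\<^sub>C B (m + n - int p) (A (int p) v)))"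
proof -
  define f where "f p = binom_coeff n p *\<^sub>C
    (A (n - int p) (B (m + int p) v) - (parity_sign \<epsilon> * (-1) powi n) *\<^sub>C B (m + n - int p) (A (int p) v))" for p
  have "eventually_zero (\<lambda>p. A (0 + int p) v)" "eventually_zero (\<lambda>p. B (m + int p) v)"
    using truncated_field_eventually A B by blast+
  then have "eventually_zero f"
    by eventually_elim (simp add: f_def clinear_zero[OF truncated_field_linear[OF A]]
        clinear_zero[OF truncated_field_linear[OF B]])
  then obtain N0 where N0: "\<forall>p\<ge>N0. f p = 0" by (auto simp: eventually_sequentially)
  have "field_prod \<epsilon> n A B m v = (\<Sum>p<N. f p)" if "N \<ge> N0" for N
    unfolding field_prod_Sum_any[OF A B] f_def[symmetric]
    by (rule Sum_any.expand_superset) (use N0 that in \<open>auto simp: not_le[symmetric] intro: ccontr\<close>)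
  then show ?thesis unfolding f_def by blast
qed

text \<open>Isolates what the construction takes from the tensor product: relations, adjoints, the
  vacuum and irreducibility. Mode n of \<open>PSI\<close> is the fermion with index n + 1/2, whence
  the shifts m + n + 1 and -n - 1.\<close>

locale current_fermion_space =
  fixes \<Gamma> :: "'i::finite \<Rightarrow> 'i \<Rightarrow> 'i \<Rightarrow> real" and level :: nat and g :: complex
    and XX PSI :: "'i \<Rightarrow> 'h::complex_prehilbert fld" and \<Omega> :: 'h
  assumes XX_linear: "clinear (XX a n)" and PSI_linear: "clinear (PSI a n)"
    and XX_commutator: "XX a m (XX b n v) = XX b n (XX a m v) +
        \<i> *\<^sub>C (\<Sum>c\<in>UNIV. complex_of_real (\<Gamma> a b c) *\<^sub>C XX c (m + n) v)
        + (if a = b \<and> m + n = 0 then of_int m * of_nat level else 0) *\<^sub>C v"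
    and PSI_anticommutator: "PSI a m (PSI b n v) + PSI b n (PSI a m v) = (if a = b \<and> m + n + 1 = 0 then v else 0)"
    and XX_PSI: "XX a m (PSI b n v) = PSI b n (XX a m v)"
    and XX_adjoint: "cinner (XX a n u) v = cinner u (XX a (- n) v)"
    and PSI_adjoint: "cinner (PSI a n u) v = cinner u (PSI a (- n - 1) v)"
    and XX_vacuum: "n \<ge> 0 \<Longrightarrow> XX a n \<Omega> = 0" and PSI_vacuum: "n \<ge> 0 \<Longrightarrow> PSI a n \<Omega> = 0"
    and vacuum_unit: "cinner \<Omega> \<Omega> = 1"
    and modes_irreducible: "acts_irreducibly ({XX a n | a n. True} \<union> {PSI a n | a n. True})"
    and vacuum_unique: "(\<And>a n. n \<ge> 0 \<Longrightarrow> XX a n v = 0) \<Longrightarrow> (\<And>a n. n \<ge> 0 \<Longrightarrow> PSI a n v = 0) \<Longrightarrow> v \<in> cspan {\<Omega>}"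
    and \<Gamma>_skew: "\<Gamma> a b c = - \<Gamma> b a c" "\<Gamma> a b c = - \<Gamma> a c b"
    and \<Gamma>_casimir: "complex_of_real (\<Sum>a\<in>UNIV. \<Sum>c\<in>UNIV. \<Gamma> a b c * \<Gamma> a d c) = (if b = d then 2 * g else 0)"
    and level_shift: "of_nat level + g \<noteq> 0"
begin

lemmas XX_simps = clinear_simps[OF XX_linear]
lemmas PSI_simps = clinear_simps[OF PSI_linear]

lemma invariant_subspace_UNIV:
  assumes "csubspace W" "\<Omega> \<in> W"
    and "\<And>a n w. w \<in> W \<Longrightarrow> XX a n w \<in> W" "\<And>a n w. w \<in> W \<Longrightarrow> PSI a n w \<in> W"
  shows "W = UNIV"
proof -
  have "\<Omega> \<noteq> 0" using vacuum_unit by (auto simp: cinner_simps)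
  then have "W \<noteq> {0}" using assms(2) by blast
  moreover have "\<forall>S\<in>{XX a n | a n. True} \<union> {PSI a n | a n. True}. S ` W \<subseteq> W"
    using assms(3,4) by auto
  ultimately show ?thesis
    using modes_irreducible assms(1) unfolding acts_irreducibly_def by blast
qed

text \<open>The vectors killed by all large modes form a subspace that contains \<Omega> and is
  stable under every mode, since a commutator only shifts indices; irreducibility makes it
  everything.\<close>

lemma truncated: "\<exists>N. \<forall>n\<ge>N. \<forall>a. XX a n v = 0 \<and> PSI a n v = 0"
proof -
  define W where "W = {v. \<exists>N. \<forall>n\<ge>N. \<forall>a. XX a n v = 0 \<and> PSI a n v = 0}"
  have "W = UNIV"
  proof (rule invariant_subspace_UNIV)
    show "csubspace W" unfolding W_def
    proof (rule csubspace_Collect)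
      fix x y assume "\<exists>N. \<forall>n\<ge>N. \<forall>a. XX a n x = 0 \<and> PSI a n x = 0" "\<exists>N. \<forall>n\<ge>N. \<forall>a. XX a n y = 0 \<and> PSI a n y = 0"
      then obtain N M where "\<forall>n\<ge>N. \<forall>a. XX a n x = 0 \<and> PSI a n x = 0" "\<forall>n\<ge>M. \<forall>a. XX a n y = 0 \<and> PSI a n y = 0"
        by blast
      then show "\<exists>N. \<forall>n\<ge>N. \<forall>a. XX a n (x + y) = 0 \<and> PSI a n (x + y) = 0"
        by (intro exI[of _ "max N M"]) (simp add: XX_simps PSI_simps)
    qed (auto simp: XX_simps PSI_simps)
    show "\<Omega> \<in> W" unfolding W_def using XX_vacuum PSI_vacuum by blast
    fix b k w assume "w \<in> W"
    then obtain N where N: "\<And>n a. n \<ge> N \<Longrightarrow> XX a n w = 0" "\<And>n a. n \<ge> N \<Longrightarrow> PSI a n w = 0"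
      unfolding W_def by blast
    \<comment> \<open>The bound keeps n and n + k beyond N, and n + k away from 0, so neither the
      bracket nor the central term contributes.\<close>
    have "XX a n (XX b k w) = 0 \<and> PSI a n (XX b k w) = 0" if "n \<ge> max N (max (N - k) (1 - k))" for a n
    proof
      have "n \<ge> N" "n + k \<ge> N" "n + k \<noteq> 0" using that by auto
      then show "XX a n (XX b k w) = 0"
        by (simp add: XX_commutator[of a n b k] N XX_simps)
      show "PSI a n (XX b k w) = 0"
        using \<open>n \<ge> N\<close> by (simp add: XX_PSI[symmetric] N XX_simps)
    qed
    then show "XX b k w \<in> W" unfolding W_def by blast
    have "XX a n (PSI b k w) = 0 \<and> PSI a n (PSI b k w) = 0" if "n \<ge> max N (- k)" for a n
    proof
      have n: "n \<ge> N" "n + k + 1 \<noteq> 0" using that by auto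
      then show "XX a n (PSI b k w) = 0" by (simp add: XX_PSI N PSI_simps)
      show "PSI a n (PSI b k w) = 0"
        using PSI_anticommutator[of a n b k w] n by (simp add: N PSI_simps)
    qed
    then show "PSI b k w \<in> W" unfolding W_def by blast
  qed
  then show ?thesis by (auto simp: W_def)
qed

lemma XX_truncated: "truncated_field (XX a)" and PSI_truncated: "truncated_field (PSI a)"
  unfolding truncated_field_def is_field_def using truncated XX_linear PSI_linear by meson+

text \<open>The elementary generators. The fields \<open>B a\<close> are composite, so their
  truncation and locality are read off from membership in what \<open>G1\<close> generates.\<close>

definition G1 :: "('h fld \<times> bit) set" where "G1 = {(PSI a, 1) | a. True} \<union> {(XX a, 0) | a. True}"

lemma G1_truncated: "truncated_generators G1"
  by (auto simp: truncated_generators_def G1_def XX_truncated PSI_truncated)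

lemma XX_local: "mode_local 1 (XX a) (XX b)"
proof -
  have "shift_diff (shift_diff (supercommutator 1 (XX a) (XX b) v)) = (\<lambda>m n. 0)" for v
  proof (intro ext)
    fix m n
    define F where "F k = \<i> *\<^sub>C (\<Sum>c\<in>UNIV. complex_of_real (\<Gamma> a b c) *\<^sub>C XX c k v)" for k
    have sc: "supercommutator 1 (XX a) (XX b) v m n = F (m + n) + (if a = b \<and> m + n = 0 then of_int m * of_nat level else 0) *\<^sub>C v" for m n
      by (simp add: supercommutator_def XX_commutator[of a m b n] F_def cscale_one)
    have "shift_diff (supercommutator 1 (XX a) (XX b) v) m n = (if a = b \<and> m + n + 1 = 0 then of_nat level else 0) *\<^sub>C v" for m n
    proof -
      have F: "F (m + 1 + n) = F (m + (n + 1))" by (simp add: algebra_simps)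
      have "(x + y *\<^sub>C v) - (x + z *\<^sub>C v) = (y - z) *\<^sub>C v" for x y z
        by (simp add: complex_vector.scale_left_diff_distrib)
      then show ?thesis
        unfolding shift_diff_def sc F by (simp only:) (auto simp: algebra_simps)
    qed
    then show "shift_diff (shift_diff (supercommutator 1 (XX a) (XX b) v)) m n = 0"
      by (simp add: shift_diff_def[of "shift_diff _"] algebra_simps)
  qed
  then show ?thesis
    unfolding mode_local_def by (intro exI[of _ 2]) (simp add: numeral_2_eq_2)
qed

lemma PSI_local: "mode_local (- 1) (PSI a) (PSI b)"
proof -
  have "supercommutator (- 1) (PSI a) (PSI b) v m n = (if a = b \<and> m + n + 1 = 0 then v else 0)" for v m n
    using PSI_anticommutator[of a m b n v] by (simp add: supercommutator_def cscale_one)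
  then have "shift_diff (supercommutator (- 1) (PSI a) (PSI b) v) = (\<lambda>m n. 0)" for v
    by (simp add: shift_diff_def fun_eq_iff algebra_simps)
  then show ?thesis
    unfolding mode_local_def by (intro exI[of _ 1]) simp
qed

lemma XX_PSI_local: "mode_local 1 (XX a) (PSI b)" and PSI_XX_local: "mode_local 1 (PSI a) (XX b)"
  unfolding mode_local_def
  by (intro exI[of _ 0]; simp add: supercommutator_def XX_PSI fun_eq_iff cscale_one)+

lemma G1_local: "pairwise_local G1"
  unfolding pairwise_local_def G1_def
  by (auto simp: parity_sign_def XX_local PSI_local XX_PSI_local PSI_XX_local)

definition S :: "'i \<Rightarrow> 'h fld" where "S = fermion_current \<Gamma> PSI"
definition B :: "'i \<Rightarrow> 'h fld" where "B a = XX a + S a"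
definition G :: "('h fld \<times> bit) set" where "G = {(PSI a, 1) | a. True} \<union> {(B a, 0) | a. True}"

definition T :: "'h fld"
  where "T = (1/2) *\<^sub>C (\<Sum>a\<in>UNIV. field_prod 1 (- 2) (PSI a) (PSI a))
    + (1 / (2 * (of_nat level + g))) *\<^sub>C (\<Sum>a\<in>UNIV. field_prod 0 (- 1) (XX a) (XX a))"

lemma bit_arith: "(1::bit) * 1 = 1" "(1::bit) + 1 = 0" "(0::bit) * 0 = 0" "(0::bit) + 0 = 0"
  by simp_all

lemma generated_part_base: "(A, \<epsilon>) \<in> G' \<Longrightarrow> A \<in> generated_part G' \<epsilon>"
  unfolding generated_part_def by (intro complex_vector.span_base) (simp add: generated.gen_base)

lemma S_subspace:
  assumes "csubspace W" "\<And>a b. field_prod 1 (- 1) (PSI a) (PSI b) \<in> W"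
  shows "S c \<in> W"
  unfolding S_def fermion_current_def
  by (intro complex_vector.subspace_scale complex_vector.subspace_sum assms)

lemma T_subspace:
  assumes "csubspace W" "\<And>a. field_prod 1 (- 2) (PSI a) (PSI a) \<in> W" "\<And>a. field_prod 0 (- 1) (XX a) (XX a) \<in> W"
  shows "T \<in> W"
  unfolding T_def
  by (intro complex_vector.subspace_add complex_vector.subspace_scale complex_vector.subspace_sum assms)

lemma PSI_products_generated:
  assumes "\<And>a. PSI a \<in> generated_part G' 1" "truncated_generators G'"
  shows "field_prod 1 n (PSI a) (PSI b) \<in> generated_part G' 0"
  using generated_part_prod[OF assms(2) assms(1) assms(1), of n a b] by (simp only: bit_arith)

lemma XX_products_generated:
  assumes "\<And>a. XX a \<in> generated_part G' 0" "truncated_generators G'"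
  shows "field_prod 0 n (XX a) (XX b) \<in> generated_part G' 0"
  using generated_part_prod[OF assms(2) assms(1) assms(1), of n a b] by (simp only: bit_arith)

lemma G1_generated: "PSI a \<in> generated_part G1 1" "XX a \<in> generated_part G1 0" "S a \<in> generated_part G1 0"
  "T \<in> generated_part G1 0"
proof -
  show P: "PSI a \<in> generated_part G1 1" for a by (rule generated_part_base) (auto simp: G1_def)
  show X: "XX a \<in> generated_part G1 0" for a by (rule generated_part_base) (auto simp: G1_def)
  show "S a \<in> generated_part G1 0"
    by (intro S_subspace generated_part_subspace PSI_products_generated P G1_truncated)
  show "T \<in> generated_part G1 0"
    by (intro T_subspace generated_part_subspace PSI_products_generated XX_products_generated P X G1_truncated)
qed

lemma G_in_G1: "(A, \<epsilon>) \<in> G \<Longrightarrow> A \<in> generated_part G1 \<epsilon>"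
  using G1_generated complex_vector.subspace_add[OF generated_part_subspace, of "XX _" G1 0 "S _"]
  by (auto simp: G_def B_def)

lemma G_truncated: "truncated_generators G"
  using G_in_G1 generated_part_truncated[OF G1_truncated] by (auto simp: truncated_generators_def)

lemma G_local: "pairwise_local G"
  using G_in_G1 generated_part_local[OF G1_truncated G1_local] by (auto simp: pairwise_local_def)

lemma G_generated: "PSI a \<in> generated_part G 1" "S a \<in> generated_part G 0" "XX a \<in> generated_part G 0"
  "T \<in> generated_part G 0"
proof -
  show P: "PSI a \<in> generated_part G 1" for a by (rule generated_part_base) (auto simp: G_def)
  show S: "S a \<in> generated_part G 0" for a
    by (intro S_subspace generated_part_subspace PSI_products_generated P G_truncated)
  have "B a \<in> generated_part G 0" for a by (rule generated_part_base) (auto simp: G_def)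
  moreover have "XX a = B a - S a" for a by (simp add: B_def)
  ultimately show X: "XX a \<in> generated_part G 0" for a
    using S complex_vector.subspace_diff[OF generated_part_subspace] by metis
  show "T \<in> generated_part G 0"
    by (intro T_subspace generated_part_subspace PSI_products_generated XX_products_generated P X G_truncated)
qed

lemma T_truncated: "truncated_field T"
  by (rule generated_part_truncated[OF G1_truncated G1_generated(4)])

lemma T_linear: "clinear (T n)"
  by (rule truncated_field_linear[OF T_truncated])

lemmas T_simps = clinear_simps[OF T_linear]

lemma fld_apply: "(A + A') n v = A n v + A' n v" "(c *\<^sub>C A) n v = c *\<^sub>C A n v" "(sum F I) n v = (\<Sum>i\<in>I. F i n v)"
  for A A' :: "'h fld" and F :: "'b \<Rightarrow> 'h fld"
proof -
  show "(A + A') n v = A n v + A' n v" "(c *\<^sub>C A) n v = c *\<^sub>C A n v"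
    by (simp_all add: cscale_fun_def)
  show "(sum F I) n v = (\<Sum>i\<in>I. F i n v)"
    by (induction I rule: infinite_finite_induct) simp_all
qed

subsection \<open>The Sugawara construction\<close>

lemma fermion_modes_sum:
  "\<exists>N0. \<forall>N\<ge>N0. field_prod 1 (- 2) (PSI a) (PSI a) m v = (\<Sum>p<N. of_nat (Suc p) *\<^sub>C
    (PSI a (- 2 - int p) (PSI a (m + int p) v) + PSI a (m - 2 - int p) (PSI a (int p) v)))"
proof -
  have c: "binom_coeff (- 2) p = of_nat (Suc p)" for p
  proof -
    have "nat (int p - (- 2) - 1) = Suc p" by simp
    then show ?thesis by (simp only: binom_coeff_neg) simp
  qed
  have s: "parity_sign 1 * (- 1) powi (- 2) = - 1"
    by (simp add: parity_sign_def power_int_def)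
  show ?thesis
    using field_prod_eventually_sum[OF PSI_truncated PSI_truncated, of 1 "- 2" a a m v]
    unfolding c s by (simp add: cscale_one)
qed

lemma boson_modes_sum:
  "\<exists>N0. \<forall>N\<ge>N0. field_prod 0 (- 1) (XX a) (XX a) m v = (\<Sum>p<N.
    XX a (- 1 - int p) (XX a (m + int p) v) + XX a (m - 1 - int p) (XX a (int p) v))"
proof -
  have c: "binom_coeff (- 1) p = 1" for p
  proof -
    have "nat (int p - (- 1) - 1) = p" by simp
    then show ?thesis by (simp only: binom_coeff_neg) simp
  qed
  have s: "parity_sign 0 * (- 1) powi (- 1) = - 1"
    by (simp add: parity_sign_def power_int_def)
  show ?thesis
    using field_prod_eventually_sum[OF XX_truncated XX_truncated, of 0 "- 1" a a m v]
    unfolding c s by (simp add: cscale_one)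
qed

lemma fermion_pair_commutator:
  "PSI a q (PSI a r (PSI b k v)) = PSI b k (PSI a q (PSI a r v))
    + (if a = b \<and> r + k + 1 = 0 then PSI a q v else 0) - (if a = b \<and> q + k + 1 = 0 then PSI a r v else 0)"
proof -
  have "PSI a r (PSI b k v) = (if a = b \<and> r + k + 1 = 0 then v else 0) - PSI b k (PSI a r v)"
    using PSI_anticommutator[of a r b k v] by (simp add: algebra_simps)
  moreover have "PSI a q (PSI b k (PSI a r v)) = (if a = b \<and> q + k + 1 = 0 then PSI a r v else 0) - PSI b k (PSI a q (PSI a r v))"
    using PSI_anticommutator[of a q b k "PSI a r v"] by (simp add: algebra_simps)
  ultimately show ?thesis by (simp add: PSI_simps)
qed

text \<open>Each delta selects at most one p. The four one-sided contributions combine in pairs to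
  the two-sided values -(m + k) and -k, which is why no case distinction is left in the
  result.\<close>

lemma fermion_delta_sum:
  assumes N: "\<bar>m\<bar> + \<bar>k\<bar> + 3 \<le> int N"
  shows "(\<Sum>p<N. of_nat (Suc p) *\<^sub>C ((if m + int p + k + 1 = 0 then w else 0) - (if - 2 - int p + k + 1 = 0 then w else 0)
        + ((if int p + k + 1 = 0 then w else 0) - (if m - 2 - int p + k + 1 = 0 then w else 0))))
    = - (of_int (m + 2 * k) *\<^sub>C (w :: 'a::complex_vector))"
proof -
  have e: "(\<Sum>p<N. if int p = t then of_nat (Suc p) else 0) = (if t \<ge> 0 then of_int (t + 1) else (0::complex))" if "t < int N" for t
    using sum_delta_int[OF that, of "\<lambda>p. of_nat (Suc p) :: complex"] by simp
  have conds: "m + int p + k + 1 = 0 \<longleftrightarrow> int p = - 1 - m - k" "- 2 - int p + k + 1 = 0 \<longleftrightarrow> int p = k - 1"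
    "int p + k + 1 = 0 \<longleftrightarrow> int p = - 1 - k" "m - 2 - int p + k + 1 = 0 \<longleftrightarrow> int p = m + k - 1" for p
    by linarith+
  have bounds: "- 1 - m - k < int N" "k - 1 < int N" "- 1 - k < int N" "m + k - 1 < int N"
    using N by linarith+
  have "of_nat (Suc p) *\<^sub>C ((if A then w else 0) - (if B then w else 0) + ((if C then w else 0) - (if D then w else 0)))
      = ((if A then of_nat (Suc p) else 0) - (if B then of_nat (Suc p) else 0) + ((if C then of_nat (Suc p) else 0) - (if D then of_nat (Suc p) else 0))) *\<^sub>C w"
    for p A B C D
    by (simp add: cscale_add_left complex_vector.scale_left_diff_distrib complex_vector.scale_right_diff_distrib cscale_add_right del: of_nat_Suc)
  then have "(\<Sum>p<N. of_nat (Suc p) *\<^sub>C ((if m + int p + k + 1 = 0 then w else 0) - (if - 2 - int p + k + 1 = 0 then w else 0)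
        + ((if int p + k + 1 = 0 then w else 0) - (if m - 2 - int p + k + 1 = 0 then w else 0))))
     = ((if - 1 - m - k \<ge> 0 then of_int (- 1 - m - k + 1) else 0) - (if k - 1 \<ge> 0 then of_int (k - 1 + 1) else 0)
        + ((if - 1 - k \<ge> 0 then of_int (- 1 - k + 1) else 0) - (if m + k - 1 \<ge> 0 then of_int (m + k - 1 + 1) else 0))) *\<^sub>C w"
    by (simp only: complex_vector.scale_sum_left[symmetric] conds sum.distrib sum_subtractf e bounds)
  moreover have "(if - 1 - m - k \<ge> 0 then of_int (- 1 - m - k + 1) else 0) - (if k - 1 \<ge> 0 then of_int (k - 1 + 1) else 0)
        + ((if - 1 - k \<ge> 0 then of_int (- 1 - k + 1) else 0) - (if m + k - 1 \<ge> 0 then of_int (m + k - 1 + 1) else 0)) = (- of_int (m + 2 * k) :: complex)"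
  proof -
    have "(if - 1 - m - k \<ge> 0 then - 1 - m - k + 1 else 0) - (if k - 1 \<ge> 0 then k - 1 + 1 else 0)
        + ((if - 1 - k \<ge> 0 then - 1 - k + 1 else 0) - (if m + k - 1 \<ge> 0 then m + k - 1 + 1 else 0)) = - (m + 2 * k)"
      by auto
    from arg_cong[OF this, of "of_int :: int \<Rightarrow> complex"] show ?thesis
      by (simp only: of_int_add of_int_diff of_int_minus if_distrib[of of_int] of_int_0 cong: if_cong)
  qed
  ultimately show ?thesis by (simp only: complex_vector.scale_minus_left)
qed

lemma fermion_square_PSI:
  "field_prod 1 (- 2) (PSI a) (PSI a) m (PSI b k v) = PSI b k (field_prod 1 (- 2) (PSI a) (PSI a) m v)
    - (if a = b then of_int (m + 2 * k) *\<^sub>C PSI b (m + k - 1) v else 0)"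
proof -
  obtain N1 where N1: "\<forall>N\<ge>N1. field_prod 1 (- 2) (PSI a) (PSI a) m (PSI b k v) = (\<Sum>p<N. of_nat (Suc p) *\<^sub>C
    (PSI a (- 2 - int p) (PSI a (m + int p) (PSI b k v)) + PSI a (m - 2 - int p) (PSI a (int p) (PSI b k v))))"
    using fermion_modes_sum by blast
  obtain N2 where N2: "\<forall>N\<ge>N2. field_prod 1 (- 2) (PSI a) (PSI a) m v = (\<Sum>p<N. of_nat (Suc p) *\<^sub>C
    (PSI a (- 2 - int p) (PSI a (m + int p) v) + PSI a (m - 2 - int p) (PSI a (int p) v)))"
    using fermion_modes_sum by blast
  define N where "N = max (max N1 N2) (nat (\<bar>m\<bar> + \<bar>k\<bar> + 3))"
  have N: "N \<ge> N1" "N \<ge> N2" "\<bar>m\<bar> + \<bar>k\<bar> + 3 \<le> int N" by (auto simp: N_def)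
  \<comment> \<open>On the support of each of the four deltas the remaining mode is m + k -
    1.\<close>
  define w where "w = PSI b (m + k - 1) v"
  have d: "(if a = b \<and> P then PSI a j v else 0) = (if a = b then (if P then w else 0) else 0)"
    if "P \<Longrightarrow> j = m + k - 1" for P j
    using that by (auto simp: w_def)
  have d1: "(if a = b \<and> m + int p + k + 1 = 0 then PSI a (- 2 - int p) v else 0) = (if a = b then (if m + int p + k + 1 = 0 then w else 0) else 0)"
    and d2: "(if a = b \<and> - 2 - int p + k + 1 = 0 then PSI a (m + int p) v else 0) = (if a = b then (if - 2 - int p + k + 1 = 0 then w else 0) else 0)"
    and d3: "(if a = b \<and> int p + k + 1 = 0 then PSI a (m - 2 - int p) v else 0) = (if a = b then (if int p + k + 1 = 0 then w else 0) else 0)"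
    and d4: "(if a = b \<and> m - 2 - int p + k + 1 = 0 then PSI a (int p) v else 0) = (if a = b then (if m - 2 - int p + k + 1 = 0 then w else 0) else 0)" for p
    by (rule d; linarith)+
  have diff: "field_prod 1 (- 2) (PSI a) (PSI a) m (PSI b k v) - PSI b k (field_prod 1 (- 2) (PSI a) (PSI a) m v)
    = (\<Sum>p<N. of_nat (Suc p) *\<^sub>C
        ((if a = b \<and> m + int p + k + 1 = 0 then PSI a (- 2 - int p) v else 0)
        - (if a = b \<and> - 2 - int p + k + 1 = 0 then PSI a (m + int p) v else 0)
        + ((if a = b \<and> int p + k + 1 = 0 then PSI a (m - 2 - int p) v else 0)
        - (if a = b \<and> m - 2 - int p + k + 1 = 0 then PSI a (int p) v else 0))))"
    unfolding N1[rule_format, OF N(1)] N2[rule_format, OF N(2)] PSI_simps(6) PSI_simps(2) sum_subtractf[symmetric]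
      complex_vector.scale_right_diff_distrib[symmetric] PSI_simps(1) fermion_pair_commutator
    by (intro sum.cong refl arg_cong[where f = "\<lambda>x. of_nat _ *\<^sub>C x"]) (simp only: algebra_simps)
  have "field_prod 1 (- 2) (PSI a) (PSI a) m (PSI b k v) - PSI b k (field_prod 1 (- 2) (PSI a) (PSI a) m v)
    = (if a = b then - (of_int (m + 2 * k) *\<^sub>C w) else 0)"
  proof (cases "a = b")
    case True
    then have ab: "(a = b) = True" by simp
    show ?thesis
      unfolding diff d1 d2 d3 d4 unfolding ab if_True by (rule fermion_delta_sum[OF N(3)])
  next
    case False
    show ?thesis
      unfolding diff d1 d2 d3 d4 using False by simp
  qed
  then show ?thesis by (simp add: w_def diff_eq_eq)
qed

lemma XX_fermion_square: "XX b k (field_prod 1 (- 2) (PSI a) (PSI a) m v) = field_prod 1 (- 2) (PSI a) (PSI a) m (XX b k v)"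
proof -
  obtain N1 where N1: "\<forall>N\<ge>N1. field_prod 1 (- 2) (PSI a) (PSI a) m (XX b k v) = (\<Sum>p<N. of_nat (Suc p) *\<^sub>C
    (PSI a (- 2 - int p) (PSI a (m + int p) (XX b k v)) + PSI a (m - 2 - int p) (PSI a (int p) (XX b k v))))"
    using fermion_modes_sum by blast
  obtain N2 where N2: "\<forall>N\<ge>N2. field_prod 1 (- 2) (PSI a) (PSI a) m v = (\<Sum>p<N. of_nat (Suc p) *\<^sub>C
    (PSI a (- 2 - int p) (PSI a (m + int p) v) + PSI a (m - 2 - int p) (PSI a (int p) v)))"
    using fermion_modes_sum by blast
  show ?thesis
    using N1[rule_format, of "max N1 N2"] N2[rule_format, of "max N1 N2"]
    by (simp add: XX_simps XX_PSI del: of_nat_Suc)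
qed

lemma boson_square_PSI: "field_prod 0 (- 1) (XX a) (XX a) m (PSI b k v) = PSI b k (field_prod 0 (- 1) (XX a) (XX a) m v)"
proof -
  obtain N1 where N1: "\<forall>N\<ge>N1. field_prod 0 (- 1) (XX a) (XX a) m (PSI b k v) = (\<Sum>p<N.
    XX a (- 1 - int p) (XX a (m + int p) (PSI b k v)) + XX a (m - 1 - int p) (XX a (int p) (PSI b k v)))"
    using boson_modes_sum by blast
  obtain N2 where N2: "\<forall>N\<ge>N2. field_prod 0 (- 1) (XX a) (XX a) m v = (\<Sum>p<N.
    XX a (- 1 - int p) (XX a (m + int p) v) + XX a (m - 1 - int p) (XX a (int p) v))"
    using boson_modes_sum by blast
  show ?thesis
    using N1[rule_format, of "max N1 N2"] N2[rule_format, of "max N1 N2"]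
    by (simp add: PSI_simps XX_PSI)
qed

lemma T_PSI: "T m (PSI b k v) = PSI b k (T m v) - (of_int m / 2 + of_int k) *\<^sub>C PSI b (m + k - 1) v"
proof -
  have "(1/2) *\<^sub>C (of_int (m + 2 * k) *\<^sub>C PSI b (m + k - 1) v) = (of_int m / 2 + of_int k) *\<^sub>C PSI b (m + k - 1) v"
    by (simp add: cscale_cscale add_divide_distrib)
  then show ?thesis
    by (simp add: T_def fld_apply fermion_square_PSI boson_square_PSI PSI_simps sum_subtractf
        complex_vector.scale_right_diff_distrib)
qed

text \<open>The contraction that remains when a bracket with X_b replaces one factor in the sum of
  the squares of the currents.\<close>

definition YY :: "'i \<Rightarrow> int \<Rightarrow> int \<Rightarrow> 'h \<Rightarrow> 'h"
  where "YY b q r v = (\<Sum>a\<in>UNIV. \<Sum>c\<in>UNIV. complex_of_real (\<Gamma> a b c) *\<^sub>C XX c q (XX a r v))"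

lemma \<Gamma>_reverse: "\<Gamma> c b a = - \<Gamma> a b c"
  using \<Gamma>_skew(1)[of c b a] \<Gamma>_skew(2)[of b c a] \<Gamma>_skew(1)[of b a c] by simp

lemma YY_swap: "(\<Sum>a\<in>UNIV. \<Sum>c\<in>UNIV. complex_of_real (\<Gamma> a b c) *\<^sub>C XX a q (XX c r v)) = - YY b q r v"
proof -
  have "(\<Sum>a\<in>UNIV. \<Sum>c\<in>UNIV. complex_of_real (\<Gamma> a b c) *\<^sub>C XX a q (XX c r v))
      = (\<Sum>a\<in>UNIV. \<Sum>c\<in>UNIV. complex_of_real (\<Gamma> c b a) *\<^sub>C XX c q (XX a r v))"
    by (rule sum.swap)
  then show ?thesis
    unfolding YY_def sum_negf[symmetric] by (simp only:) (intro sum.cong refl, subst \<Gamma>_reverse, simp)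
qed

text \<open>By skewness of \<Gamma> the second summand is minus the first with its factors reversed,
  so the sum is a commutator. Its central term drops out as \<open>\<Gamma> a b a = 0\<close>, and
  the contraction of the two structure constants is 2g.\<close>

lemma YY_symmetrize: "YY b q r v + YY b r q v = (\<i> * (2 * g)) *\<^sub>C XX b (q + r) v"
proof -
  have \<Gamma>0: "\<Gamma> a b a = 0" for a using \<Gamma>_reverse[of a b a] by simp
  have "YY b q r v + YY b r q v = YY b q r v - (\<Sum>a\<in>UNIV. \<Sum>c\<in>UNIV. complex_of_real (\<Gamma> a b c) *\<^sub>C XX a r (XX c q v))"
    by (simp add: YY_swap)
  also have "\<dots> = (\<Sum>a\<in>UNIV. \<Sum>c\<in>UNIV. complex_of_real (\<Gamma> a b c) *\<^sub>C (XX c q (XX a r v) - XX a r (XX c q v)))"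
    by (simp add: YY_def sum_subtractf complex_vector.scale_right_diff_distrib)
  also have "\<dots> = (\<Sum>a\<in>UNIV. \<Sum>c\<in>UNIV. complex_of_real (\<Gamma> a b c) *\<^sub>C
      (\<i> *\<^sub>C (\<Sum>d\<in>UNIV. complex_of_real (\<Gamma> c a d) *\<^sub>C XX d (q + r) v)))"
    by (intro sum.cong refl) (auto simp: XX_commutator[of _ q _ r] \<Gamma>0)
  also have "\<dots> = (\<Sum>a\<in>UNIV. \<Sum>c\<in>UNIV. \<Sum>d\<in>UNIV. (\<i> * complex_of_real (\<Gamma> a b c * \<Gamma> a d c)) *\<^sub>C XX d (q + r) v)"
  proof -
    have "\<Gamma> c a d = \<Gamma> a d c" for a c d using \<Gamma>_skew(1)[of c a d] \<Gamma>_skew(2)[of a c d] by simp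
    then show ?thesis
      by (simp add: complex_vector.scale_sum_right cscale_cscale mult.left_commute)
  qed
  also have "\<dots> = (\<Sum>d\<in>UNIV. (\<i> * complex_of_real (\<Sum>a\<in>UNIV. \<Sum>c\<in>UNIV. \<Gamma> a b c * \<Gamma> a d c)) *\<^sub>C XX d (q + r) v)"
  proof -
    have "(\<Sum>a\<in>UNIV. \<Sum>c\<in>UNIV. \<Sum>d\<in>UNIV. h a c d) = (\<Sum>d\<in>UNIV. \<Sum>a\<in>UNIV. \<Sum>c\<in>UNIV. h a c d)" for h :: "'i \<Rightarrow> 'i \<Rightarrow> 'i \<Rightarrow> 'h"
    proof -
      have "(\<Sum>c\<in>UNIV. \<Sum>d\<in>UNIV. h a c d) = (\<Sum>d\<in>UNIV. \<Sum>c\<in>UNIV. h a c d)" for a by (rule sum.swap)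
      then have "(\<Sum>a\<in>UNIV. \<Sum>c\<in>UNIV. \<Sum>d\<in>UNIV. h a c d) = (\<Sum>a\<in>UNIV. \<Sum>d\<in>UNIV. \<Sum>c\<in>UNIV. h a c d)" by simp
      also have "\<dots> = (\<Sum>d\<in>UNIV. \<Sum>a\<in>UNIV. \<Sum>c\<in>UNIV. h a c d)" by (rule sum.swap)
      finally show ?thesis .
    qed
    then show ?thesis
      by (simp add: complex_vector.scale_sum_left sum_distrib_left)
  qed
  also have "\<dots> = (\<i> * (2 * g)) *\<^sub>C XX b (q + r) v"
    unfolding \<Gamma>_casimir by (simp add: if_distrib[of "\<lambda>x. (\<i> * x) *\<^sub>C _"] cong: if_cong)
  finally show ?thesis .
qed

lemma boson_pair_commutator:
  "(\<Sum>a\<in>UNIV. XX a q (XX a r (XX b k v)) - XX b k (XX a q (XX a r v))) = \<i> *\<^sub>C (YY b (q + k) r v - YY b q (r + k) v)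
    + ((if r + k = 0 then of_int r * of_nat level else 0) *\<^sub>C XX b q v + (if q + k = 0 then of_int q * of_nat level else 0) *\<^sub>C XX b r v)"
proof -
  have "XX a q (XX a r (XX b k v)) - XX b k (XX a q (XX a r v))
     = \<i> *\<^sub>C (\<Sum>c\<in>UNIV. complex_of_real (\<Gamma> a b c) *\<^sub>C XX a q (XX c (r + k) v))
     + \<i> *\<^sub>C (\<Sum>c\<in>UNIV. complex_of_real (\<Gamma> a b c) *\<^sub>C XX c (q + k) (XX a r v))
     + ((if a = b then (if r + k = 0 then of_int r * of_nat level else 0) *\<^sub>C XX b q v else 0)
       + (if a = b then (if q + k = 0 then of_int q * of_nat level else 0) *\<^sub>C XX b r v else 0))" for a
    by (auto simp: XX_commutator[of a r b k] XX_simps XX_commutator[of a q b k] algebra_simps)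
  then show ?thesis
    by (simp add: sum.distrib complex_vector.scale_sum_right[symmetric] YY_swap)
      (simp add: YY_def complex_vector.scale_right_diff_distrib)
qed

text \<open>For k >= 0 the bracket terms have the form f p - f (p + k) and telescope to k terms from
  each of the two mode orderings; paired up they give 2 g k. The central terms add 2 k times the
  level, and the shifted level appears.\<close>

lemma boson_square_XX_nonneg:
  assumes k: "k \<ge> 0"
  shows "(\<Sum>a\<in>UNIV. field_prod 0 (- 1) (XX a) (XX a) m (XX b k v)) - XX b k (\<Sum>a\<in>UNIV. field_prod 0 (- 1) (XX a) (XX a) m v)
    = - ((2 * of_int k * (of_nat level + g)) *\<^sub>C XX b (m + k - 1) v)"
proof -
  define w where "w = XX b (m + k - 1) v"
  have "\<forall>a. \<exists>N0. \<forall>N\<ge>N0. field_prod 0 (- 1) (XX a) (XX a) m (XX b k v) = (\<Sum>p<N.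
    XX a (- 1 - int p) (XX a (m + int p) (XX b k v)) + XX a (m - 1 - int p) (XX a (int p) (XX b k v)))"
    using boson_modes_sum by blast
  from choice[OF this] obtain N1 where "\<forall>a. \<forall>N\<ge>N1 a. field_prod 0 (- 1) (XX a) (XX a) m (XX b k v) = (\<Sum>p<N.
    XX a (- 1 - int p) (XX a (m + int p) (XX b k v)) + XX a (m - 1 - int p) (XX a (int p) (XX b k v)))"
    by blast
  note N1 = this[rule_format]
  have "\<forall>a. \<exists>N0. \<forall>N\<ge>N0. field_prod 0 (- 1) (XX a) (XX a) m v = (\<Sum>p<N.
    XX a (- 1 - int p) (XX a (m + int p) v) + XX a (m - 1 - int p) (XX a (int p) v))"
    using boson_modes_sum by blast
  from choice[OF this] obtain N2 where "\<forall>a. \<forall>N\<ge>N2 a. field_prod 0 (- 1) (XX a) (XX a) m v = (\<Sum>p<N.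
    XX a (- 1 - int p) (XX a (m + int p) v) + XX a (m - 1 - int p) (XX a (int p) v))"
    by blast
  note N2 = this[rule_format]
  obtain K where K: "\<And>n a. n \<ge> K \<Longrightarrow> XX a n v = 0" using truncated by meson
  \<comment> \<open>Large enough for the expansions with all indices a, for the telescoped tails to
    vanish, and to reach every delta.\<close>
  define N where "N = Max (range N1) + Max (range N2) + nat (\<bar>K\<bar> + \<bar>m\<bar> + \<bar>k\<bar> + 3)"
  have "N1 a \<le> Max (range N1)" "N2 a \<le> Max (range N2)" for a by (auto intro: Max_ge)
  then have N: "N \<ge> N1 a" "N \<ge> N2 a" for a unfolding N_def by (meson le_add1 le_add2 le_trans trans_le_add1 add_leE)+
  have N': "\<bar>K\<bar> + \<bar>m\<bar> + \<bar>k\<bar> + 3 \<le> int N" by (simp add: N_def)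
  define C where "C q r = (\<Sum>a\<in>UNIV. XX a q (XX a r (XX b k v)) - XX b k (XX a q (XX a r v)))" for q r
  let ?lhs = "(\<Sum>a\<in>UNIV. field_prod 0 (- 1) (XX a) (XX a) m (XX b k v)) - XX b k (\<Sum>a\<in>UNIV. field_prod 0 (- 1) (XX a) (XX a) m v)"
  have "?lhs = (\<Sum>a\<in>UNIV. \<Sum>p<N. (XX a (- 1 - int p) (XX a (m + int p) (XX b k v)) - XX b k (XX a (- 1 - int p) (XX a (m + int p) v)))
      + (XX a (m - 1 - int p) (XX a (int p) (XX b k v)) - XX b k (XX a (m - 1 - int p) (XX a (int p) v))))"
    unfolding N1[OF N(1)] N2[OF N(2)] XX_simps(6) XX_simps(1) sum_subtractf[symmetric] add_diff_add ..
  moreover have "\<dots> = (\<Sum>p<N. \<Sum>a\<in>UNIV. (XX a (- 1 - int p) (XX a (m + int p) (XX b k v)) - XX b k (XX a (- 1 - int p) (XX a (m + int p) v)))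
      + (XX a (m - 1 - int p) (XX a (int p) (XX b k v)) - XX b k (XX a (m - 1 - int p) (XX a (int p) v))))"
    by (rule sum.swap)
  ultimately have lhs: "?lhs = (\<Sum>p<N. C (- 1 - int p) (m + int p) + C (m - 1 - int p) (int p))"
    unfolding C_def by (simp only: sum.distrib)
  define u where "u = (- of_int k * of_nat level) *\<^sub>C w"
  define f1 where "f1 p = YY b (k - 1 - int p) (m + int p) v" for p
  define f2 where "f2 p = YY b (m + k - 1 - int p) (int p) v" for p
  have C1: "C (- 1 - int p) (m + int p) = \<i> *\<^sub>C (f1 p - f1 (p + nat k))
       + ((if int p = - m - k then u else 0) + (if int p = k - 1 then u else 0))" for p
  proof -
    have e: "- 1 - int p + k = k - 1 - int p" "k - 1 - int (p + nat k) = - 1 - int p" "m + int (p + nat k) = m + int p + k"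
      using k by auto
    have 1: "(if m + int p + k = 0 then of_int (m + int p) * of_nat level else 0) *\<^sub>C XX b (- 1 - int p) v
        = (if int p = - m - k then u else 0)"
    proof (cases "int p = - m - k")
      case True
      then have "m + int p + k = 0" "m + int p = - k" "- 1 - int p = m + k - 1" by auto
      then show ?thesis using True by (simp only: w_def u_def if_True) simp
    qed auto
    have 2: "(if k - 1 - int p = 0 then of_int (- 1 - int p) * of_nat level else 0) *\<^sub>C XX b (m + int p) v
        = (if int p = k - 1 then u else 0)"
    proof (cases "int p = k - 1")
      case True
      then have "k - 1 - int p = 0" "- 1 - int p = - k" "m + int p = m + k - 1" by auto
      then show ?thesis using True by (simp only: w_def u_def if_True) simp
    qed auto
    show ?thesis
      unfolding C_def boson_pair_commutator f1_def e 1 2 ..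
  qed
  have C2: "C (m - 1 - int p) (int p) = \<i> *\<^sub>C (f2 p - f2 (p + nat k)) + (if int p = m + k - 1 then u else 0)" for p
  proof -
    have e: "m - 1 - int p + k = m + k - 1 - int p" "m + k - 1 - (int p + k) = m - 1 - int p" "int (p + nat k) = int p + k"
      using k by auto
    have 1: "(if int p + k = 0 then of_int (int p) * of_nat level else 0) *\<^sub>C XX b (m - 1 - int p) v = 0"
      using k by auto
    have 2: "(if m + k - 1 - int p = 0 then of_int (m - 1 - int p) * of_nat level else 0) *\<^sub>C XX b (int p) v
        = (if int p = m + k - 1 then u else 0)"
    proof (cases "int p = m + k - 1")
      case True
      then have "m + k - 1 - int p = 0" "m - 1 - int p = - k" by auto
      then show ?thesis using True by (simp only: w_def u_def if_True) simp
    qed auto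
    show ?thesis
      unfolding C_def boson_pair_commutator f2_def e 1 2 add_0 ..
  qed
  have "?lhs = \<i> *\<^sub>C ((\<Sum>p<N. f1 p - f1 (p + nat k)) + (\<Sum>p<N. f2 p - f2 (p + nat k)))
      + ((\<Sum>p<N. if int p = - m - k then u else 0) + (\<Sum>p<N. if int p = k - 1 then u else 0)
        + (\<Sum>p<N. if int p = m + k - 1 then u else 0))"
    unfolding lhs C1 C2 by (simp only: sum.distrib complex_vector.scale_sum_right cscale_add_right ac_simps)
  moreover have "(\<Sum>p<N. f1 p - f1 (p + nat k)) = (\<Sum>p<nat k. f1 p)"
    by (rule sum_shift_telescope) (use N' K in \<open>simp add: f1_def YY_def XX_simps\<close>)
  moreover have "(\<Sum>p<N. f2 p - f2 (p + nat k)) = (\<Sum>p<nat k. f2 p)"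
    by (rule sum_shift_telescope) (use N' K in \<open>simp add: f2_def YY_def XX_simps\<close>)
  moreover have "(\<Sum>p<nat k. f1 p) + (\<Sum>p<nat k. f2 p) = (of_int k * (\<i> * (2 * g))) *\<^sub>C w"
  proof -
    \<comment> \<open>Reversing the summation gives \<open>f1\<close> the two mode indices of
      \<open>f2\<close> in the opposite order, so that symmetrisation applies.\<close>
    have "(\<Sum>p<nat k. f1 p) = (\<Sum>p<nat k. YY b (int p) (m + k - 1 - int p) v)"
      unfolding f1_def
      by (rule sum.reindex_bij_witness[of _ "\<lambda>p. nat k - 1 - p" "\<lambda>p. nat k - 1 - p"]) (auto simp: of_nat_diff algebra_simps)
    then have "(\<Sum>p<nat k. f1 p) + (\<Sum>p<nat k. f2 p) = (\<Sum>p<nat k. (\<i> * (2 * g)) *\<^sub>C w)"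
      unfolding f2_def by (simp only: sum.distrib[symmetric] YY_symmetrize) (simp add: w_def algebra_simps)
    then show ?thesis
      using k by (simp add: complex_vector.sum_constant_scale cscale_cscale)
  qed
  moreover have "(\<Sum>p<N. if int p = - m - k then u else 0) + (\<Sum>p<N. if int p = k - 1 then u else 0)
        + (\<Sum>p<N. if int p = m + k - 1 then u else 0) = u + u"
  proof -
    have bounds: "- m - k < int N" "k - 1 < int N" "m + k - 1 < int N" using N' by linarith+
    \<comment> \<open>For k > 0 the middle condition holds and exactly one of the outer two, which
      are complementary; for k = 0 the vector u is zero.\<close>
    have "(if - m - k \<ge> 0 then u else 0) + (if k - 1 \<ge> 0 then u else 0) + (if m + k - 1 \<ge> 0 then u else 0) = u + u"
    proof (cases "k = 0")
      case True
      then show ?thesis by (simp add: u_def)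
    next
      case False
      then show ?thesis using k by (cases "m + k \<le> 0") auto
    qed
    then show ?thesis by (simp only: sum_delta_int[OF bounds(1)] sum_delta_int[OF bounds(2)] sum_delta_int[OF bounds(3)])
  qed
  ultimately have "?lhs = \<i> *\<^sub>C ((of_int k * (\<i> * (2 * g))) *\<^sub>C w) + (u + u)"
    by (simp only:)
  moreover have "\<i> *\<^sub>C ((of_int k * (\<i> * (2 * g))) *\<^sub>C w) + (u + u) = - ((2 * of_int k * (of_nat level + g)) *\<^sub>C w)"
  proof -
    have "\<i> * (of_int k * (\<i> * (2 * g))) + (- of_int k * of_nat level + - of_int k * of_nat level) = - (2 * of_int k * (of_nat level + g))"
      by (simp add: algebra_simps)
    then show ?thesis
      unfolding u_def cscale_cscale cscale_add_left[symmetric] by (simp only: complex_vector.scale_minus_left)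
  qed
  ultimately show ?thesis by (simp only: w_def)
qed

lemma T_XX_nonneg:
  assumes "k \<ge> 0"
  shows "T m (XX b k v) = XX b k (T m v) - of_int k *\<^sub>C XX b (m + k - 1) v"
proof -
  define c where "c = 1 / (2 * (of_nat level + g))"
  \<comment> \<open>The normalisation 1/(2(level + g)) is the one that makes the currents have
    weight 1.\<close>
  have cf: "c * (2 * of_int k * (of_nat level + g)) = of_int k"
  proof -
    have "1 / (2 * L) * L = 1 / 2" if "L \<noteq> 0" for L :: complex using that by simp
    then have "c * (of_nat level + g) = 1 / 2" unfolding c_def using level_shift by blast
    moreover have "c * (2 * of_int k * (of_nat level + g)) = (2 * of_int k) * (c * (of_nat level + g))"
      by (simp only: mult_ac)
    ultimately show ?thesis by (simp only:) simp
  qed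
  have "(\<Sum>a\<in>UNIV. field_prod 0 (- 1) (XX a) (XX a) m (XX b k v)) = XX b k (\<Sum>a\<in>UNIV. field_prod 0 (- 1) (XX a) (XX a) m v)
      - (2 * of_int k * (of_nat level + g)) *\<^sub>C XX b (m + k - 1) v"
    using boson_square_XX_nonneg[OF assms, of m b v] by (simp add: algebra_simps)
  moreover have "(\<Sum>a\<in>UNIV. field_prod 1 (- 2) (PSI a) (PSI a) m (XX b k v)) = XX b k (\<Sum>a\<in>UNIV. field_prod 1 (- 2) (PSI a) (PSI a) m v)"
    by (simp add: XX_simps XX_fermion_square)
  ultimately show ?thesis
    unfolding T_def fld_apply c_def[symmetric]
    by (simp only: XX_simps(1,2) complex_vector.scale_right_diff_distrib cscale_cscale cf) (simp add: algebra_simps)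
qed

text \<open>The difference between the commutator and its expected value is killed by a power of z -
  w and vanishes for k >= 0 by the direct computation, hence everywhere.\<close>

lemma T_XX: "T m (XX b k v) = XX b k (T m v) - of_int k *\<^sub>C XX b (m + k - 1) v"
proof -
  have "mode_local (parity_sign (0 * 0)) (XX b) T"
    by (rule generated_part_local[OF G1_truncated G1_local G1_generated(2,4)])
  then have "mode_local 1 (XX b) T" by (simp add: parity_sign_def)
  then obtain N where N: "\<And>v. (shift_diff ^^ N) (supercommutator 1 (XX b) T v) = (\<lambda>m n. 0)"
    by (auto simp: mode_local_def)
  \<comment> \<open>Minus the expected commutator. Two differences kill it, because along an
    antidiagonal it is linear in k.\<close>
  define h where "h k m = (- of_int k) *\<^sub>C XX b (m + k - 1) v" for k m
  have h1: "shift_diff h = (\<lambda>k m. - XX b (m + k) v)"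
    by (simp add: fun_eq_iff shift_diff_def h_def algebra_simps cscale_one)
  have "shift_diff (\<lambda>k m. - XX b (m + k) v) = (\<lambda>k m. 0)"
    by (simp add: fun_eq_iff shift_diff_def algebra_simps)
  then have "(shift_diff ^^ 2) h = (\<lambda>k m. 0)"
    by (simp only: numeral_2_eq_2 funpow.simps comp_def id_apply h1)
  then have h: "(shift_diff ^^ max N 2) h = (\<lambda>k m. 0)"
    by (rule funpow_shift_diff_le) simp
  define F where "F k m = supercommutator 1 (XX b) T v k m + h k m" for k m
  have "(shift_diff ^^ max N 2) (supercommutator 1 (XX b) T v) = (\<lambda>m n. 0)"
    by (rule funpow_shift_diff_le[OF N]) simp
  then have "(shift_diff ^^ max N 2) F = (\<lambda>k m. 0)"
    unfolding F_def[abs_def] funpow_shift_diff_add h by simp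
  then have "F k m = 0"
  proof (rule mode_local_symmetric_funpow_vanish)
    show "F k m = 0" if "k \<ge> 0" for k m
      using T_XX_nonneg[OF that, of m b v] by (simp add: F_def supercommutator_def h_def cscale_one)
  qed
  then show ?thesis by (simp add: F_def supercommutator_def h_def cscale_one algebra_simps)
qed

end

context current_fermion_space
begin

subsection \<open>Words in the creation modes\<close>

text \<open>A letter \<open>(b, a, n)\<close> stands for the mode \<open>-1-n\<close> of the current or of the fermion with index \<open>a\<close>.\<close>

definition letter_op :: "bool \<times> 'i \<times> nat \<Rightarrow> 'h \<Rightarrow> 'h"
  where "letter_op = (\<lambda>(b, a, n). if b then XX a (- 1 - int n) else PSI a (- 1 - int n))"

definition letter_energy :: "bool \<times> 'i \<times> nat \<Rightarrow> real"
  where "letter_energy = (\<lambda>(b, a, n). if b then real n + 1 else real n + 1/2)"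

definition word :: "(bool \<times> 'i \<times> nat) list \<Rightarrow> 'h"
  where "word ls = foldr letter_op ls \<Omega>"

definition word_energy :: "(bool \<times> 'i \<times> nat) list \<Rightarrow> real"
  where "word_energy ls = (\<Sum>l\<leftarrow>ls. letter_energy l)"

lemma word_simps: "word [] = \<Omega>" "word (l # ls) = letter_op l (word ls)"
  "word_energy [] = 0" "word_energy (l # ls) = letter_energy l + word_energy ls"
  by (simp_all add: word_def word_energy_def)

lemma letter_op_linear: "clinear (letter_op l)"
  by (cases l) (auto simp: letter_op_def XX_linear PSI_linear)

lemma span_words_closed:
  assumes f: "clinear f" and w: "\<And>ls. f (word ls) \<in> cspan (range word)" and v: "v \<in> cspan (range word)"
  shows "f v \<in> cspan (range word)"
  using v
proof (rule cspan_induct)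
  show "csubspace {v. f v \<in> cspan (range word)}"
    by (rule csubspace_Collect) (simp_all add: clinear_simps[OF f] complex_vector.span_zero
        complex_vector.span_add complex_vector.span_scale)
qed (use w in auto)

lemma letter_op_span:
  assumes "v \<in> cspan (range word)"
  shows "letter_op l v \<in> cspan (range word)"
proof (rule span_words_closed[OF letter_op_linear _ assms])
  fix ls
  have "letter_op l (word ls) = word (l # ls)" by (simp add: word_simps)
  then show "letter_op l (word ls) \<in> cspan (range word)"
    by (simp only:) (rule complex_vector.span_base, rule rangeI)
qed

lemma negative_modes_span:
  assumes "v \<in> cspan (range word)" "n < 0"
  shows "XX a n v \<in> cspan (range word)" "PSI a n v \<in> cspan (range word)"
proof -
  have n: "- 1 - int (nat (- 1 - n)) = n" using assms(2) by simp
  show "XX a n v \<in> cspan (range word)" "PSI a n v \<in> cspan (range word)"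
    using letter_op_span[OF assms(1), of "(True, a, nat (- 1 - n))"] letter_op_span[OF assms(1), of "(False, a, nat (- 1 - n))"]
    unfolding letter_op_def case_prod_conv n by simp_all
qed

text \<open>Moving a mode past the first letter gives that letter applied to a mode of the shorter
  word, plus modes or multiples of the shorter word. At the vacuum nonnegative modes vanish and
  negative ones are letters.\<close>

lemma modes_word_span: "XX a n (word ls) \<in> cspan (range word) \<and> PSI a n (word ls) \<in> cspan (range word)"
proof (induction ls arbitrary: a n)
  case Nil
  have "\<Omega> \<in> cspan (range word)"
    by (rule complex_vector.span_base) (metis rangeI word_simps(1))
  then show ?case
    using negative_modes_span[of \<Omega> n a] XX_vacuum[of n a] PSI_vacuum[of n a]
    by (cases "n < 0") (auto simp: word_simps complex_vector.span_zero)
next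
  case (Cons l ls)
  obtain b c k where l: "l = (b, c, k)" by (cases l)
  let ?w = "word ls"
  have w: "?w \<in> cspan (range word)" by (rule complex_vector.span_base) (rule rangeI)
  have Xw: "XX a n ?w \<in> cspan (range word)" and Pw: "PSI a n ?w \<in> cspan (range word)" for a n
    using Cons.IH by blast+
  have neg: "- 1 - int k < 0" by simp
  show ?case
  proof (cases b)
    case True
    then have wl: "word (l # ls) = XX c (- 1 - int k) ?w" by (simp add: word_simps l letter_op_def)
    have "XX a n (word (l # ls)) \<in> cspan (range word)"
      unfolding wl XX_commutator[of a n c]
      by (intro complex_vector.span_add complex_vector.span_scale complex_vector.span_sum negative_modes_span[OF _ neg] Xw w)
    moreover have "PSI a n (word (l # ls)) \<in> cspan (range word)"
      unfolding wl XX_PSI[symmetric] by (intro negative_modes_span[OF _ neg] Pw)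
    ultimately show ?thesis ..
  next
    case False
    then have wl: "word (l # ls) = PSI c (- 1 - int k) ?w" by (simp add: word_simps l letter_op_def)
    have "XX a n (word (l # ls)) \<in> cspan (range word)"
      unfolding wl XX_PSI by (intro negative_modes_span[OF _ neg] Xw)
    moreover have "PSI a n (PSI c (- 1 - int k) ?w) = (if a = c \<and> n + (- 1 - int k) + 1 = 0 then ?w else 0) - PSI c (- 1 - int k) (PSI a n ?w)"
      using PSI_anticommutator[of a n c "- 1 - int k" ?w] by (simp add: eq_diff_eq)
    then have "PSI a n (word (l # ls)) \<in> cspan (range word)"
      unfolding wl using w negative_modes_span(2)[OF Pw neg]
      by (simp only:) (rule complex_vector.span_diff, simp_all add: complex_vector.span_zero)
    ultimately show ?thesis by blast
  qed
qed

lemma words_span: "cspan (range word) = UNIV"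
proof (rule invariant_subspace_UNIV)
  show "\<Omega> \<in> cspan (range word)"
    by (rule complex_vector.span_base) (metis rangeI word_simps(1))
  show "XX a n w \<in> cspan (range word)" "PSI a n w \<in> cspan (range word)" if "w \<in> cspan (range word)" for a n w
    using that modes_word_span by (auto intro: span_words_closed[OF XX_linear] span_words_closed[OF PSI_linear])
qed simp

lemma vacuum_T: "n \<ge> 0 \<Longrightarrow> T n \<Omega> = 0"
proof -
  have vX: "vacuum_field \<Omega> (XX a)" and vP: "vacuum_field \<Omega> (PSI a)" for a
    by (simp_all add: vacuum_field_def XX_vacuum PSI_vacuum)
  have "vacuum_field \<Omega> T"
    using T_subspace[OF vacuum_field_subspace[of \<Omega>]]
      field_prod_vacuum(1)[OF XX_truncated XX_truncated vX vX] field_prod_vacuum(1)[OF PSI_truncated PSI_truncated vP vP]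
    by simp
  then show "n \<ge> 0 \<Longrightarrow> T n \<Omega> = 0" by (simp add: vacuum_field_def)
qed

lemma T1_XX: "T 1 (XX b k v) = XX b k (T 1 v) - of_int k *\<^sub>C XX b k v"
  by (simp add: T_XX)

lemma T1_PSI: "T 1 (PSI b k v) = PSI b k (T 1 v) - (1/2 + of_int k) *\<^sub>C PSI b k v"
  by (simp add: T_PSI)

lemma word_eigenvector: "T 1 (word ls) = complex_of_real (word_energy ls) *\<^sub>C word ls"
proof (induction ls)
  case Nil
  then show ?case by (simp add: word_simps vacuum_T)
next
  case (Cons l ls)
  obtain b a n where l: "l = (b, a, n)" by (cases l)
  show ?case
  proof (cases b)
    case True
    define k where "k = - 1 - int n"
    have e: "complex_of_real (letter_energy l) = - of_int k" using True by (simp add: l letter_energy_def k_def)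
    have "word (l # ls) = XX a k (word ls)" using True by (simp add: word_simps l letter_op_def k_def)
    then show ?thesis
      by (simp add: T1_XX Cons.IH XX_simps word_simps e complex_vector.scale_left_diff_distrib)
  next
    case False
    define k where "k = - 1 - int n"
    have e: "complex_of_real (letter_energy l) = - (1/2 + of_int k)" using False by (simp add: l letter_energy_def k_def field_simps)
    have "word (l # ls) = PSI a k (word ls)" using False by (simp add: word_simps l letter_op_def k_def)
    moreover have "complex_of_real (letter_energy l + word_energy ls) = complex_of_real (word_energy ls) - (1/2 + of_int k)"
      using e by simp
    ultimately show ?thesis
      by (simp only: T1_PSI Cons.IH PSI_simps word_simps(4) complex_vector.scale_left_diff_distrib)
  qed
qed

lemma word_energy_half_natural: "word_energy ls \<in> half_naturals"
proof -
  have "\<exists>k::nat. word_energy ls = real k / 2"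
  proof (induction ls)
    case Nil
    then show ?case by (intro exI[of _ 0]) (simp add: word_simps)
  next
    case (Cons l ls)
    then obtain k :: nat where "word_energy ls = real k / 2" by blast
    then show ?case
      by (cases l) (auto simp: word_simps letter_energy_def
          intro: exI[of _ "k + 2 * snd (snd l) + 2"] exI[of _ "k + 2 * snd (snd l) + 1"])
  qed
  then show ?thesis unfolding half_naturals_def by blast
qed

text \<open>Every letter has energy at least 1/2, which bounds the length of a word, and at least
  its number n, which bounds the alphabet.\<close>

lemma finite_words: "finite {ls. word_energy ls = r}"
proof -
  define A :: "(bool \<times> 'i \<times> nat) set" where "A = UNIV \<times> UNIV \<times> {..nat \<lceil>r\<rceil>}"
  have bound: "real (length ls) \<le> 2 * word_energy ls \<and> (\<forall>(b, a, n)\<in>set ls. real n \<le> word_energy ls)" for ls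
  proof (induction ls)
    case (Cons l ls)
    have nn: "word_energy ls \<ge> 0" using Cons by linarith
    have "letter_energy l \<ge> 1/2" "letter_energy l \<ge> real (snd (snd l))"
      by (cases l; simp add: letter_energy_def)+
    then show ?case using Cons nn by (fastforce simp: word_simps split: prod.splits)
  qed (simp add: word_simps)
  have "{ls. word_energy ls = r} \<subseteq> {ls. set ls \<subseteq> A \<and> length ls \<le> nat \<lceil>2 * r\<rceil>}"
  proof (rule subsetI)
    fix ls assume "ls \<in> {ls. word_energy ls = r}"
    then have "real (length ls) \<le> 2 * r" "\<forall>(b, a, n)\<in>set ls. real n \<le> r" using bound[of ls] by auto
    moreover have "n \<le> nat \<lceil>r\<rceil>" if "real n \<le> r" for n using that by linarith
    moreover have "length ls \<le> nat \<lceil>2 * r\<rceil>" using calculation(1) by linarith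
    ultimately show "ls \<in> {ls. set ls \<subseteq> A \<and> length ls \<le> nat \<lceil>2 * r\<rceil>}"
      by (fastforce simp: A_def)
  qed
  moreover have "finite A" by (simp add: A_def)
  ultimately show ?thesis
    using finite_lists_length_le finite_subset by blast
qed

text \<open>Symmetry is propagated from the vacuum: the vectors u for which it holds against all v
  are stable under the modes, by the commutators of T 1 with the generators and the adjoints of the
  generators.\<close>

lemma T1_symmetric: "cinner (T 1 u) v = cinner u (T 1 v)"
proof -
  define W where "W = {u. \<forall>v. cinner (T 1 u) v = cinner u (T 1 v)}"
  \<comment> \<open>The vacuum is orthogonal to every nonempty word, because the adjoint of the
    first letter is an annihilation mode.\<close>
  have vac: "cinner \<Omega> (T 1 v) = 0" for v
  proof (rule cspan_UNIV_induct[where x = v, OF words_span])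
    fix v assume "v \<in> range word"
    then obtain ls where v: "v = word ls" by blast
    show "cinner \<Omega> (T 1 v) = 0"
    proof (cases ls)
      case Nil
      then show ?thesis by (simp add: v word_simps vacuum_T cinner_simps)
    next
      case (Cons l ls')
      obtain b a n where l: "l = (b, a, n)" by (cases l)
      have "cinner \<Omega> (XX a (- 1 - int n) w) = 0" "cinner \<Omega> (PSI a (- 1 - int n) w) = 0" for w
        using XX_adjoint[of a "1 + int n" \<Omega> w] PSI_adjoint[of a "int n" \<Omega> w]
        by (simp_all add: XX_vacuum PSI_vacuum cinner_simps diff_diff_add add.commute[of _ 1] diff_conv_add_uminus[symmetric] minus_diff_commute)
      then have "cinner \<Omega> v = 0" by (auto simp: v Cons word_simps l letter_op_def)
      then show ?thesis by (simp add: v word_eigenvector cinner_simps)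
    qed
  qed (auto intro!: csubspace_Collect simp: T_simps cinner_simps)
  have "W = UNIV"
  proof (rule invariant_subspace_UNIV)
    show "csubspace W" unfolding W_def
      by (rule csubspace_Collect) (auto simp: T_simps cinner_simps)
    show "\<Omega> \<in> W" by (simp add: W_def vac vacuum_T cinner_simps)
    fix a k u assume u: "u \<in> W"
    have "cinner (T 1 (XX a k u)) v = cinner (XX a k u) (T 1 v)" for v
    proof -
      have "cinner (T 1 (XX a k u)) v = cinner u (T 1 (XX a (- k) v)) - of_int k * cinner u (XX a (- k) v)"
        using u by (simp add: T_XX cinner_simps XX_adjoint W_def)
      also have "\<dots> = cinner u (XX a (- k) (T 1 v))"
        by (simp add: T_XX cinner_simps)
      finally show ?thesis by (simp add: XX_adjoint)
    qed
    then show "XX a k u \<in> W" by (simp add: W_def)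
    have "cinner (T 1 (PSI a k u)) v = cinner (PSI a k u) (T 1 v)" for v
    proof -
      have "cinner (T 1 (PSI a k u)) v = cinner u (T 1 (PSI a (- k - 1) v)) - (1/2 + of_int k) * cinner u (PSI a (- k - 1) v)"
        using u by (simp add: T_PSI cinner_simps PSI_adjoint W_def)
      also have "\<dots> = cinner u (PSI a (- k - 1) (T 1 v))"
        by (simp add: T_PSI cinner_simps algebra_simps)
      finally show ?thesis by (simp add: PSI_adjoint)
    qed
    then show "PSI a k u \<in> W" by (simp add: W_def)
  qed
  then show ?thesis by (auto simp: W_def)
qed

text \<open>The part of v along words of other energies is again an eigenvector for r; being
  orthogonal to those words, it is orthogonal to itself.\<close>

lemma energy_space_words:
  "{v. T 1 v = complex_of_real r *\<^sub>C v} \<subseteq> cspan (word ` {ls. word_energy ls = r})"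
proof
  fix v assume "v \<in> {v. T 1 v = complex_of_real r *\<^sub>C v}"
  then have v: "T 1 v = complex_of_real r *\<^sub>C v" by simp
  let ?A = "word ` {ls. word_energy ls = r}" and ?B = "word ` {ls. word_energy ls \<noteq> r}"
  have "?A \<union> ?B = range word" by auto
  then have "v \<in> cspan (?A \<union> ?B)" using words_span by simp
  then obtain x y where xy: "x \<in> cspan ?A" "y \<in> cspan ?B" "v = x + y"
    unfolding complex_vector.span_Un by blast
  have "T 1 x = complex_of_real r *\<^sub>C x"
    using xy(1) by (rule cspan_induct)
      (auto intro!: csubspace_Collect simp: word_eigenvector T_simps cscale_simps mult.commute)
  then have y: "T 1 y = complex_of_real r *\<^sub>C y"
    using v xy(3) by (simp add: T_simps cscale_add_right)
  have "cinner u y = 0" if "u \<in> ?B" for u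
  proof -
    obtain s where s: "T 1 u = complex_of_real s *\<^sub>C u" "s \<noteq> r" using \<open>u \<in> ?B\<close> word_eigenvector by auto
    have "complex_of_real s * cinner u y = complex_of_real r * cinner u y"
      using T1_symmetric[of u y] s y by (simp add: cinner_simps)
    then show ?thesis using s(2) by simp
  qed
  then have "cinner y y = 0"
    by (intro cspan_induct[OF xy(2), where P = "\<lambda>u. cinner u y = 0"]) (auto intro!: csubspace_Collect simp: cinner_simps)
  then show "v \<in> cspan ?A" using xy by (simp add: cinner_eq_zero_iff)
qed

subsection \<open>The Virasoro relations\<close>

lemma vacuum_like_scalar:
  assumes K: "clinear K" and XK: "\<And>a n v. K (XX a n v) = XX a n (K v)" and PK: "\<And>a n v. K (PSI a n v) = PSI a n (K v)"
  obtains c where "\<And>v. K v = c *\<^sub>C v"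
proof -
  have "K \<Omega> \<in> cspan {\<Omega>}"
    by (rule vacuum_unique) (simp_all add: XK[symmetric] PK[symmetric] XX_vacuum PSI_vacuum clinear_zero[OF K])
  then obtain c where c: "K \<Omega> = c *\<^sub>C \<Omega>" by (auto simp: complex_vector.span_singleton)
  have "{v. K v = c *\<^sub>C v} = UNIV"
    by (rule invariant_subspace_UNIV)
      (auto intro!: csubspace_Collect simp: clinear_simps[OF K] c XK PK XX_simps PSI_simps cscale_simps mult.commute)
  then show ?thesis using that by blast
qed

lemma T_weight: "has_weight (T 1) 2 T"
proof -
  have wX: "has_weight (T 1) 1 (XX a)" and wP: "has_weight (T 1) (1/2) (PSI a)" for a
    by (simp_all add: has_weight_def T_XX T_PSI algebra_simps cscale_simps)
  have "has_weight (T 1) 2 (field_prod 1 (- 2) (PSI a) (PSI a))" "has_weight (T 1) 2 (field_prod 0 (- 1) (XX a) (XX a))" for a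
    using has_weight_prod[OF T_linear PSI_truncated PSI_truncated wP wP, where n = "- 2" and \<epsilon> = 1]
      has_weight_prod[OF T_linear XX_truncated XX_truncated wX wX, where n = "- 1" and \<epsilon> = 0] by simp_all
  then show ?thesis
    using T_subspace[OF has_weight_subspace[OF T_linear, of 1 2]] by simp
qed

section \<open>The Virasoro modes and their central term\<close>

definition L :: "int \<Rightarrow> 'h \<Rightarrow> 'h" where "L m = T (m + 1)"

lemma L_linear: "clinear (L m)"
  by (simp add: L_def T_linear)

lemmas L_simps = clinear_simps[OF L_linear]

lemma L_XX: "L m (XX b k v) = XX b k (L m v) - of_int k *\<^sub>C XX b (m + k) v"
  by (simp add: L_def T_XX algebra_simps)

lemma L_PSI: "L m (PSI b k v) = PSI b k (L m v) - ((of_int m + 1) / 2 + of_int k) *\<^sub>C PSI b (m + k) v"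
  by (simp add: L_def T_PSI algebra_simps)

lemma L_vacuum: "m \<ge> - 1 \<Longrightarrow> L m \<Omega> = 0"
  by (simp add: L_def vacuum_T)

lemma L0_L: "L 0 (L m v) = L m (L 0 v) - of_int m *\<^sub>C L m v"
  using T_weight[unfolded has_weight_def, rule_format, of "m + 1" v]
  by (simp add: L_def complex_vector.scale_left_diff_distrib)

definition virasoro_defect :: "int \<Rightarrow> int \<Rightarrow> 'h \<Rightarrow> 'h"
  where "virasoro_defect m n v = L m (L n v) - L n (L m v) - of_int (m - n) *\<^sub>C L (m + n) v"

text \<open>The cross terms of the two double commutators cancel whatever the field is; only the
  coefficients of the single remaining mode R have to match. This serves currents and fermions
  alike.\<close>

lemma defect_cancel:
  assumes "p - q + d * s = 0"
  shows "(A1 - x *\<^sub>C P - y *\<^sub>C Q + p *\<^sub>C R) - (A2 - y *\<^sub>C Q - x *\<^sub>C P + q *\<^sub>C R) - d *\<^sub>C (Z - s *\<^sub>C R)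
    = A1 - A2 - d *\<^sub>C (Z :: 'a::complex_vector)"
proof -
  have "p = q - d * s" using assms by (simp add: algebra_simps)
  then show ?thesis
    by (simp add: complex_vector.scale_left_diff_distrib complex_vector.scale_right_diff_distrib cscale_cscale)
qed

lemma virasoro_defect_scalar: "\<exists>c. \<forall>v. virasoro_defect m n v = c *\<^sub>C v"
proof -
  have "clinear (virasoro_defect m n)"
    by (rule clinearI) (simp_all add: virasoro_defect_def L_simps cscale_simps algebra_simps)
  moreover have "virasoro_defect m n (XX a k v) = XX a k (virasoro_defect m n v)" for a k v
  proof -
    have LL: "L m (L n (XX a k v)) = XX a k (L m (L n v)) - of_int k *\<^sub>C XX a (m + k) (L n v)
        - of_int k *\<^sub>C XX a (n + k) (L m v) + (of_int k * of_int (n + k)) *\<^sub>C XX a (m + n + k) v" for m n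
      by (simp add: L_XX L_simps complex_vector.scale_right_diff_distrib cscale_cscale add.assoc del: of_int_add)
    have swap: "n + m = m + n" by simp
    show ?thesis
      unfolding virasoro_defect_def LL[of m n] LL[of n m] L_XX[of "m + n"] XX_simps swap
      by (rule defect_cancel) (simp add: algebra_simps)
  qed
  moreover have "virasoro_defect m n (PSI a k v) = PSI a k (virasoro_defect m n v)" for a k v
  proof -
    define d where "d m k = (of_int m + 1) / 2 + (of_int k :: complex)" for m k :: int
    have L_PSI': "L m (PSI b k v) = PSI b k (L m v) - d m k *\<^sub>C PSI b (m + k) v" for m b k v
      unfolding d_def by (rule L_PSI)
    have LL: "L m (L n (PSI a k v)) = PSI a k (L m (L n v)) - d m k *\<^sub>C PSI a (m + k) (L n v)
        - d n k *\<^sub>C PSI a (n + k) (L m v) + (d n k * d m (n + k)) *\<^sub>C PSI a (m + n + k) v" for m n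
      by (simp add: L_PSI' L_simps complex_vector.scale_right_diff_distrib cscale_cscale add.assoc)
    have swap: "n + m = m + n" by simp
    have "d n k * d m (n + k) - d m k * d n (m + k) + of_int (m - n) * d (m + n) k = 0"
      by (simp add: d_def field_simps)
    then show ?thesis
      unfolding virasoro_defect_def LL[of m n] LL[of n m] L_PSI'[of "m + n"] PSI_simps swap
      by (rule defect_cancel)
  qed
  ultimately show ?thesis
    using vacuum_like_scalar by metis
qed

definition vc :: "int \<Rightarrow> int \<Rightarrow> complex"
  where "vc m n = (SOME c. \<forall>v. virasoro_defect m n v = c *\<^sub>C v)"

lemma vc: "virasoro_defect m n v = vc m n *\<^sub>C v"
  using someI_ex[OF virasoro_defect_scalar[of m n]] unfolding vc_def by blast

lemma vacuum_nonzero: "\<Omega> \<noteq> 0"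
  using vacuum_unit by (auto simp: cinner_simps)

lemma vc_eqI: "virasoro_defect m n \<Omega> = c *\<^sub>C \<Omega> \<Longrightarrow> vc m n = c"
  using vc[of m n \<Omega>] vacuum_nonzero by simp

lemma L_commutator: "L m (L n v) = L n (L m v) + of_int (m - n) *\<^sub>C L (m + n) v + vc m n *\<^sub>C v"
  using vc[of m n v] by (simp add: virasoro_defect_def algebra_simps)

text \<open>The defect applied to \<Omega> has energy -(m + n), while a multiple of \<Omega> has
  energy 0.\<close>

lemma vc_off_diagonal:
  assumes "m + n \<noteq> 0"
  shows "vc m n = 0"
proof -
  define e where "e = - (of_int (m + n) :: complex)"
  have one: "L 0 (L k \<Omega>) = - of_int k *\<^sub>C L k \<Omega>" for k
    by (simp add: L0_L[of k] L_vacuum L_simps)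
  have "L 0 (L m (L n \<Omega>)) = e *\<^sub>C L m (L n \<Omega>)" "L 0 (L n (L m \<Omega>)) = e *\<^sub>C L n (L m \<Omega>)"
    by (simp_all add: L0_L[of m] L0_L[of n] one L_simps e_def complex_vector.scale_left_diff_distrib)
  then have "L 0 (virasoro_defect m n \<Omega>) = e *\<^sub>C virasoro_defect m n \<Omega>"
    using one[of "m + n", folded e_def]
    by (simp add: virasoro_defect_def L_simps complex_vector.scale_right_diff_distrib cscale_cscale mult.commute)
  then have "(e * vc m n) *\<^sub>C \<Omega> = 0"
    by (simp add: vc L_simps L_vacuum cscale_cscale)
  moreover have "e \<noteq> 0" using assms unfolding e_def neg_equal_0_iff_equal of_int_eq_0_iff .
  ultimately show ?thesis using vacuum_nonzero by simp
qed

lemma vc_antisym: "vc m n = - vc n m"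
proof (rule vc_eqI)
  have "virasoro_defect m n \<Omega> = - virasoro_defect n m \<Omega>"
    by (simp add: virasoro_defect_def algebra_simps complex_vector.scale_left_diff_distrib)
  then show "virasoro_defect m n \<Omega> = (- vc n m) *\<^sub>C \<Omega>" by (simp add: vc)
qed

lemma vc_recursion: "(of_int m - 1) * vc (m + 1) (- m - 1) = (of_int m + 2) * vc m (- m)" if "m \<ge> 1"
proof -
  define k where "k = - m - 1"
  have e: "m + k = - 1" "1 + k = - m" "m + (1 + k) = 0" "k + 1 = - m" by (simp_all add: k_def)
  have v1: "vc 1 (- 1) = 0"
    by (rule vc_eqI) (simp add: virasoro_defect_def L_vacuum L_simps)
  text \<open>Evaluate \<open>L\<^sub>1 L\<^sub>m L\<^sub>-\<^sub>m\<^sub>-\<^sub>1\<close> on the vacuum in two ways.\<close>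
  have z: "vc m k = 0" "vc 1 m = 0" "vc 1 k = 0" using that by (simp_all add: vc_off_diagonal k_def)
  have Lk: "L m (L k \<Omega>) = 0"
    using L_commutator[of m k \<Omega>] that by (simp add: L_vacuum L_simps e z)
  have L1k: "L 1 (L k \<Omega>) = of_int (1 - k) *\<^sub>C L (- m) \<Omega>"
    using L_commutator[of 1 k \<Omega>] by (simp add: L_vacuum L_simps e z)
  have Lm: "L m (L (- m) \<Omega>) = vc m (- m) *\<^sub>C \<Omega>"
    using L_commutator[of m "- m" \<Omega>] that by (simp add: L_vacuum L_simps)
  have Lm1: "L (1 + m) (L k \<Omega>) = vc (1 + m) k *\<^sub>C \<Omega>"
    using L_commutator[of "1 + m" k \<Omega>] that by (simp add: L_vacuum L_simps k_def)
  have "L 1 (L m (L k \<Omega>)) = L m (L 1 (L k \<Omega>)) + of_int (1 - m) *\<^sub>C L (1 + m) (L k \<Omega>) + vc 1 m *\<^sub>C L k \<Omega>"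
    by (rule L_commutator)
  then have "(of_int (1 - k) * vc m (- m) + of_int (1 - m) * vc (1 + m) k) *\<^sub>C \<Omega> = 0"
    by (simp add: Lk L1k Lm Lm1 z L_simps cscale_cscale cscale_add_left del: of_int_diff)
  then have "of_int (1 - k) * vc m (- m) + of_int (1 - m) * vc (1 + m) k = 0"
    using vacuum_nonzero by simp
  moreover have "of_int (1 - k) = (of_int m + 2 :: complex)" "of_int (1 - m) = - (of_int m - 1 :: complex)" by (simp_all add: k_def)
  moreover have "vc (1 + m) k = vc (m + 1) (- m - 1)" by (simp add: k_def add.commute)
  ultimately have "(of_int m + 2) * vc m (- m) + - (of_int m - 1) * vc (m + 1) (- m - 1) = 0" by (simp only:)
  then show ?thesis by (simp only: mult_minus_left right_minus_eq diff_conv_add_uminus[symmetric])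
qed

text \<open>The factor m - 1 in the recursion vanishes at m = 1, so it starts at 2 and leaves
  \<open>vc 2 (- 2)\<close> as the only free constant; m(m^2 - 1) solves it and equals 6 at m =
  2.\<close>

lemma vc_nat: "vc (int n + 2) (- int n - 2) = vc 2 (- 2) / 6 * of_int ((int n + 2) * ((int n + 2)^2 - 1))"
proof (induction n)
  case (Suc n)
  have "(of_int (int n + 2) - 1) * vc (int n + 2 + 1) (- (int n + 2) - 1) = (of_int (int n + 2) + 2) * vc (int n + 2) (- (int n + 2))"
    by (rule vc_recursion) simp
  moreover have e: "int n + 2 + 1 = int (Suc n) + 2" "- (int n + 2) - 1 = - int (Suc n) - 2" "- (int n + 2) = - int n - 2" by simp_all
  ultimately have "(of_int (int n + 2) - 1) * vc (int (Suc n) + 2) (- int (Suc n) - 2)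
      = (of_int (int n + 2) + 2) * (vc 2 (- 2) / 6 * of_int ((int n + 2) * ((int n + 2)^2 - 1)))"
    unfolding e Suc by simp
  moreover define x where "x = (of_nat n :: complex)"
  moreover define C where "C = vc 2 (- 2) / 6"
  moreover have x: "of_int (int n + 2) - 1 = x + 1" "of_int (int n + 2) + 2 = x + 4"
    "of_int ((int n + 2) * ((int n + 2)^2 - 1)) = (x + 2) * ((x + 2)^2 - 1)"
    "of_int ((int (Suc n) + 2) * ((int (Suc n) + 2)^2 - 1)) = (x + 3) * ((x + 3)^2 - 1)"
    by (simp_all add: x_def add.commute)
  moreover have "(x + 4) * ((x + 2) * ((x + 2)^2 - 1)) = (x + 1) * ((x + 3) * ((x + 3)^2 - 1))"
    by (simp add: power2_eq_square algebra_simps)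
  ultimately have "(x + 1) * vc (int (Suc n) + 2) (- int (Suc n) - 2)
      = (x + 1) * (vc 2 (- 2) / 6 * of_int ((int (Suc n) + 2) * ((int (Suc n) + 2)^2 - 1)))"
    unfolding x C_def[symmetric] mult.left_commute[of _ C] by (simp only:)
  moreover have "x + 1 \<noteq> 0" unfolding x_def by (metis of_nat_Suc of_nat_eq_0_iff nat.distinct(2) add.commute)
  ultimately show ?case by simp
qed simp

lemma vc_diagonal: "vc m (- m) = vc 2 (- 2) / 6 * of_int (m * (m^2 - 1))"
proof -
  have nonneg: "vc m (- m) = vc 2 (- 2) / 6 * of_int (m * (m^2 - 1))" if "m \<ge> 0" for m
  proof -
    consider "m = 0" | "m = 1" | "m \<ge> 2" using \<open>m \<ge> 0\<close> by linarith
    then show ?thesis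
    proof cases
      case 1
      have "vc 0 0 = - vc 0 0" by (rule vc_antisym)
      then show ?thesis using 1 by simp
    next
      case 2
      have "vc 1 (- 1) = 0"
        by (rule vc_eqI) (simp add: virasoro_defect_def L_vacuum L_simps)
      then show ?thesis using 2 by simp
    next
      case 3
      then show ?thesis using vc_nat[of "nat (m - 2)"] by simp
    qed
  qed
  show ?thesis
  proof (cases "m \<ge> 0")
    case False
    then have "vc (- m) (- (- m)) = vc 2 (- 2) / 6 * of_int ((- m) * ((- m)^2 - 1))" by (intro nonneg) simp
    then show ?thesis using vc_antisym[of m "- m"] by (simp add: algebra_simps)
  qed (rule nonneg)
qed

section \<open>The Virasoro vector and its norm\<close>

definition \<omega> :: 'h
  where "\<omega> = (1/2) *\<^sub>C (\<Sum>a\<in>UNIV. PSI a (- 2) (PSI a (- 1) \<Omega>))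
    + (1 / (2 * (of_nat level + g))) *\<^sub>C (\<Sum>a\<in>UNIV. XX a (- 1) (XX a (- 1) \<Omega>))"

lemma creation_T: "creation \<Omega> T = \<omega>"
proof -
  have vX: "vacuum_field \<Omega> (XX a)" and vP: "vacuum_field \<Omega> (PSI a)" for a
    by (simp_all add: vacuum_field_def XX_vacuum PSI_vacuum)
  have "field_prod 1 (- 2) (PSI a) (PSI a) (- 1) \<Omega> = PSI a (- 2) (PSI a (- 1) \<Omega>)"
    "field_prod 0 (- 1) (XX a) (XX a) (- 1) \<Omega> = XX a (- 1) (XX a (- 1) \<Omega>)" for a
    using field_prod_vacuum(2)[OF PSI_truncated PSI_truncated vP vP, where \<epsilon> = 1 and n = "- 2"]
      field_prod_vacuum(2)[OF XX_truncated XX_truncated vX vX, where \<epsilon> = 0 and n = "- 1"]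
    by (simp_all add: creation_def)
  then show ?thesis by (simp add: creation_def T_def fld_apply \<omega>_def)
qed

lemma L_minus_2_vacuum: "L (- 2) \<Omega> = \<omega>"
  using creation_T by (simp add: creation_def L_def)

text \<open>Writing \<omega> as L_(-2) \<Omega> and commuting the modes with L_(-2) avoids expanding
  the sums that define \<omega>.\<close>

lemma \<omega>_annihilation:
  "XX a 1 (XX a 1 \<omega>) = of_nat level *\<^sub>C \<Omega>" "PSI a 0 (PSI a 1 \<omega>) = (1/2) *\<^sub>C \<Omega>"
proof -
  have "XX a 1 \<omega> = XX a (- 1) \<Omega>"
    using L_XX[of "- 2" a 1 \<Omega>] by (simp add: L_minus_2_vacuum XX_vacuum L_simps cscale_one)
  then show "XX a 1 (XX a 1 \<omega>) = of_nat level *\<^sub>C \<Omega>"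
    using XX_commutator[of a 1 a "- 1" \<Omega>] by (simp add: XX_vacuum XX_simps)
  have "PSI a 1 \<omega> = (1/2) *\<^sub>C PSI a (- 1) \<Omega>"
    using L_PSI[of "- 2" a 1 \<Omega>] by (simp add: L_minus_2_vacuum PSI_vacuum L_simps)
  then show "PSI a 0 (PSI a 1 \<omega>) = (1/2) *\<^sub>C \<Omega>"
    using PSI_anticommutator[of a 0 a "- 1" \<Omega>] by (simp add: PSI_vacuum PSI_simps)
qed

text \<open>One copy of \<omega> is expanded and its modes are moved to the other copy, which leaves
  a multiple of \<Omega> for each basis index; hence the factor \<open>CARD('i)\<close>.\<close>

lemma central_charge_\<omega>:
  "central_charge \<omega> = of_nat CARD('i) / 2 + of_nat level * of_nat CARD('i) / (of_nat level + g)"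
proof -
  have P: "cinner (PSI a (- 2) (PSI a (- 1) \<Omega>)) \<omega> = 1/2" for a
    by (simp add: PSI_adjoint \<omega>_annihilation cinner_simps vacuum_unit)
  have X: "cinner (XX a (- 1) (XX a (- 1) \<Omega>)) \<omega> = of_nat level" for a
    by (simp add: XX_adjoint \<omega>_annihilation cinner_simps vacuum_unit)
  define L where "L = of_nat level + g"
  have L: "L \<noteq> 0" using level_shift by (simp add: L_def)
  have "cinner \<omega> \<omega> = (1/2) * (of_nat CARD('i) * (1/2)) + (1 / (2 * L)) * (of_nat CARD('i) * of_nat level)"
    by (subst (1) \<omega>_def) (simp add: cinner_simps P X L_def)
  then show ?thesis using L unfolding central_charge_def L_def[symmetric] by (simp add: field_simps)
qed

text \<open>The central term and the norm reduce to the same scalar, since L_2 \<omega> is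
  |\<omega>|^2 times \<Omega>. This identifies the constant left open by the recursion.\<close>

lemma vc_2: "vc 2 (- 2) = central_charge \<omega> / 2"
proof -
  have x: "L 2 (XX a (- 1) (XX a (- 1) \<Omega>)) = of_nat level *\<^sub>C \<Omega>" for a
    using XX_commutator[of a 1 a "- 1" \<Omega>] by (simp add: L_XX L_simps L_vacuum XX_vacuum XX_simps cscale_one)
  have p: "L 2 (PSI a (- 2) (PSI a (- 1) \<Omega>)) = (1/2) *\<^sub>C \<Omega>" for a
    using PSI_anticommutator[of a 0 a "- 1" \<Omega>] by (simp add: L_PSI L_simps L_vacuum PSI_vacuum PSI_simps)
  have "L 2 \<omega> = (central_charge \<omega> / 2) *\<^sub>C \<Omega>"
  proof -
    define s where "s = of_nat level + g"
    have s: "s \<noteq> 0" using level_shift by (simp add: s_def)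
    have "L 2 \<omega> = ((1/2) * (of_nat CARD('i) * (1/2)) + (1 / (2 * s)) * (of_nat CARD('i) * of_nat level)) *\<^sub>C \<Omega>"
      by (simp add: \<omega>_def L_simps x p cscale_add_left complex_vector.sum_constant_scale s_def)
    moreover have "(1/2) * (of_nat CARD('i) * (1/2)) + (1 / (2 * s)) * (of_nat CARD('i) * of_nat level) = central_charge \<omega> / 2"
      using s unfolding central_charge_\<omega> s_def[symmetric] by (simp add: field_simps)
    ultimately show ?thesis by (simp only:)
  qed
  moreover have "virasoro_defect 2 (- 2) \<Omega> = L 2 \<omega>"
    by (simp add: virasoro_defect_def L_minus_2_vacuum L_vacuum L_simps)
  ultimately show ?thesis by (intro vc_eqI) simp
qed

lemma virasoro_relation:
  "T (m + 1) (T (n + 1) v) - T (n + 1) (T (m + 1) v) = of_int (m - n) *\<^sub>C T (m + n + 1) v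
    + (if m + n = 0 then central_charge (creation \<Omega> T) / 12 * of_int (m * (m^2 - 1)) else 0) *\<^sub>C v"
proof -
  have "vc m n = (if m + n = 0 then central_charge \<omega> / 12 * of_int (m * (m^2 - 1)) else 0)"
  proof (cases "m + n = 0")
    case True
    then have "n = - m" by simp
    then show ?thesis using vc_diagonal[of m] vc_2 by simp
  qed (simp add: vc_off_diagonal)
  then show ?thesis
    using L_commutator[of m n v] by (simp add: L_def creation_T)
qed

section \<open>Transfer to the generating fields of the theorem\<close>

lemma generating_fields:
  assumes "(A, \<epsilon>) \<in> G"
  shows "vacuum_field \<Omega> A" "translation_covariant (T 0) A"
    "has_weight (T 1) (if \<epsilon> = 0 then 1 else 1/2) A"
proof -
  have vX: "vacuum_field \<Omega> (XX a)" and vP: "vacuum_field \<Omega> (PSI a)" for a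
    by (simp_all add: vacuum_field_def XX_vacuum PSI_vacuum)
  have tX: "translation_covariant (T 0) (XX a)" and tP: "translation_covariant (T 0) (PSI a)" for a
    by (simp_all add: translation_covariant_iff T_XX T_PSI)
  have wX: "has_weight (T 1) 1 (XX a)" and wP: "has_weight (T 1) (1/2) (PSI a)" for a
    by (simp_all add: has_weight_def T_XX T_PSI algebra_simps cscale_simps)
  have vS: "vacuum_field \<Omega> (S a)" for a
    using S_subspace[OF vacuum_field_subspace[of \<Omega>]] field_prod_vacuum(1)[OF PSI_truncated PSI_truncated vP vP] by simp
  have tS: "translation_covariant (T 0) (S a)" for a
    using S_subspace[OF translation_covariant_subspace[OF T_linear, of 0]]
      translation_covariant_prod[OF T_linear PSI_truncated PSI_truncated tP tP] by simp
  have "has_weight (T 1) 1 (field_prod 1 (- 1) (PSI a) (PSI b))" for a b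
    using has_weight_prod[OF T_linear PSI_truncated PSI_truncated wP wP, where n = "- 1" and \<epsilon> = 1] by simp
  then have wS: "has_weight (T 1) 1 (S a)" for a
    using S_subspace[OF has_weight_subspace[OF T_linear, of 1 1]] by simp
  have "vacuum_field \<Omega> (B a) \<and> translation_covariant (T 0) (B a) \<and> has_weight (T 1) 1 (B a)" for a
    using complex_vector.subspace_add[OF vacuum_field_subspace, of "XX a" \<Omega> "S a"]
      complex_vector.subspace_add[OF translation_covariant_subspace[OF T_linear], of "XX a" 0 "S a"]
      complex_vector.subspace_add[OF has_weight_subspace[OF T_linear], of "XX a" 1 1 "S a"] vX vS tX tS wX wS
    unfolding B_def by simp
  then show "vacuum_field \<Omega> A" "translation_covariant (T 0) A" "has_weight (T 1) (if \<epsilon> = 0 then 1 else 1/2) A"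
    using assms vP tP wP by (auto simp: G_def)
qed

lemma fields_irreducible: "acts_irreducibly {A n | A n. A \<in> generated_fields G}"
  unfolding acts_irreducibly_def
proof (intro conjI allI impI)
  show "(UNIV :: 'h set) \<noteq> {0}" using vacuum_nonzero by blast
  fix W :: "'h set"
  assume W: "csubspace W \<and> (\<forall>S\<in>{A n | A n. A \<in> generated_fields G}. S ` W \<subseteq> W)"
  then have "\<forall>S\<in>{XX a n | a n. True} \<union> {PSI a n | a n. True}. S ` W \<subseteq> W"
    using G_generated(1,3) generated_part_subset by (auto, blast+)
  then show "W = {0} \<or> W = UNIV"
    using W modes_irreducible unfolding acts_irreducibly_def by blast
qed

sublocale vertex_generators G \<Omega> T
proof
  show "truncated_generators G" by (rule G_truncated)
  show "pairwise_local G" by (rule G_local)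
  show "acts_irreducibly {A n | A n. A \<in> generated_fields G}" by (rule fields_irreducible)
  show "\<Omega> \<noteq> 0" by (rule vacuum_nonzero)
  show "T \<in> generated_part G 0" by (rule G_generated(4))
  show "vacuum_field \<Omega> A" "translation_covariant (T 0) A" if "(A, \<epsilon>) \<in> G" for A \<epsilon>
    using generating_fields[OF that] by blast+
  \<comment> \<open>Even generators have weight 1 + 0, odd ones 0 + 1/2.\<close>
  show "\<exists>k::int. has_weight (T 1) (of_int k + (if \<epsilon> = 0 then 0 else 1/2)) A" if "(A, \<epsilon>) \<in> G" for A \<epsilon>
    using generating_fields(3)[OF that] by (intro exI[of _ "if \<epsilon> = 0 then 1 else 0"]) (auto split: if_splits)
  show "cinner (T 1 u) v = cinner u (T 1 v)" for u v by (rule T1_symmetric)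
  have "word ls \<in> (\<Union>r\<in>half_naturals. {v. T 1 v = complex_of_real r *\<^sub>C v})" for ls
    using word_eigenvector word_energy_half_natural by blast
  then have "cspan (range word) \<subseteq> cspan (\<Union>r\<in>half_naturals. {v. T 1 v = complex_of_real r *\<^sub>C v})"
    by (intro complex_vector.span_mono) blast
  then show "cspan (\<Union>r\<in>half_naturals. {v. T 1 v = complex_of_real r *\<^sub>C v}) = UNIV"
    using words_span by blast
  show "\<exists>F. finite F \<and> {v. T 1 v = complex_of_real r *\<^sub>C v} \<subseteq> cspan F" for r
    using energy_space_words[of r] finite_imageI[OF finite_words[of r], of word] by blast
qed (rule virasoro_relation)

end

section \<open>The tensor product of the vacuum representations\<close>

definition adjoint_pair :: "('a::complex_prehilbert \<Rightarrow> 'a) \<Rightarrow> ('a \<Rightarrow> 'a) \<Rightarrow> bool"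
  where "adjoint_pair S S' \<longleftrightarrow> clinear S \<and> clinear S' \<and> (\<forall>u v. cinner (S u) v = cinner u (S' v))"

lemma adjoint_pair_sym: "adjoint_pair S S' \<Longrightarrow> adjoint_pair S' S"
  unfolding adjoint_pair_def by (metis cinner_commute)

lemma adjoint_pair_id: "adjoint_pair id id"
  by (simp add: adjoint_pair_def clinear_iff)

text \<open>For the unit vector \<open>vac_minus\<close>, and tensored with the identity, this
  becomes the projection onto the fermionic vacuum sector.\<close>

lemma adjoint_pair_projection: "adjoint_pair (\<lambda>f. cinner f e *\<^sub>C e) (\<lambda>f. cinner f e *\<^sub>C e)"
  unfolding adjoint_pair_def
proof (intro conjI allI)
  show "clinear (\<lambda>f. cinner f e *\<^sub>C e)" by (rule clinearI) (simp_all add: cinner_simps cscale_simps)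
  then show "clinear (\<lambda>f. cinner f e *\<^sub>C e)" .
  show "cinner (cinner u e *\<^sub>C e) v = cinner u (cinner v e *\<^sub>C e)" for u v
    by (simp add: cinner_simps cinner_commute[of v e])
qed

section \<open>Operators on the algebraic tensor product\<close>

context prehilbert_tensor
begin

lemmas tens_left_simps = clinear_simps[OF linear_left]
lemmas tens_right_simps = clinear_simps[OF linear_right]

lemma tensor_induct:
  assumes "csubspace {h. Q h}" "\<And>v f. Q (tens v f)"
  shows "Q h"
  by (rule cspan_UNIV_induct[where x = h, OF span_tens _ assms(1)]) (use assms(2) in blast)

lemma tensor_ext:
  assumes "clinear U" "clinear U'" "\<And>v f. U (tens v f) = U' (tens v f)"
  shows "U h = U' h"
  by (rule tensor_induct[where Q = "\<lambda>h. U h = U' h"])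
    (auto intro!: csubspace_Collect simp: clinear_simps[OF assms(1)] clinear_simps[OF assms(2)] assms(3))

lemma tensor_orthogonal: "(\<And>v f. cinner u (tens v f) = 0) \<Longrightarrow> u = 0"
  by (rule cinner_left_eq_0[OF span_tens]) blast

text \<open>Well-definedness comes from adjoints: the image of h is determined by its pairings with
  elementary tensors, which must be those of h with S' v \<otimes> T' f. Such a vector exists for
  elementary tensors h and, by linearity, for their span.\<close>

lemma
  assumes S: "adjoint_pair S S'" and T: "adjoint_pair T T'"
  shows tensor_op_linear: "clinear (tensor_op tens S T)"
    and tensor_op_tens: "tensor_op tens S T (tens v f) = tens (S v) (T f)"
proof -
  have S_adj: "cinner (S u) v = cinner u (S' v)" and T_adj: "cinner (T a) b = cinner a (T' b)" for u v a b
    using S T by (simp_all add: adjoint_pair_def)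
  have "\<exists>y. \<forall>v f. cinner y (tens v f) = cinner h (tens (S' v) (T' f))" for h
  proof (rule tensor_induct[where h = h])
    show "csubspace {h. \<exists>y. \<forall>v f. cinner y (tens v f) = cinner h (tens (S' v) (T' f))}"
    proof (rule csubspace_Collect)
      show "\<exists>y. \<forall>v f. cinner y (tens v f) = cinner 0 (tens (S' v) (T' f))"
        by (intro exI[of _ 0]) (simp add: cinner_simps)
    next
      fix x x' assume "\<exists>y. \<forall>v f. cinner y (tens v f) = cinner x (tens (S' v) (T' f))"
        "\<exists>y. \<forall>v f. cinner y (tens v f) = cinner x' (tens (S' v) (T' f))"
      then obtain y y' where "\<forall>v f. cinner y (tens v f) = cinner x (tens (S' v) (T' f))"
        "\<forall>v f. cinner y' (tens v f) = cinner x' (tens (S' v) (T' f))" by blast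
      then show "\<exists>y. \<forall>v f. cinner y (tens v f) = cinner (x + x') (tens (S' v) (T' f))"
        by (intro exI[of _ "y + y'"]) (simp add: cinner_simps)
    next
      fix c x assume "\<exists>y. \<forall>v f. cinner y (tens v f) = cinner x (tens (S' v) (T' f))"
      then obtain y where "\<forall>v f. cinner y (tens v f) = cinner x (tens (S' v) (T' f))" by blast
      then show "\<exists>y. \<forall>v f. cinner y (tens v f) = cinner (c *\<^sub>C x) (tens (S' v) (T' f))"
        by (intro exI[of _ "c *\<^sub>C y"]) (simp add: cinner_simps)
    qed
    show "\<exists>y. \<forall>v' f'. cinner y (tens v' f') = cinner (tens v f) (tens (S' v') (T' f'))" for v f
      by (intro exI[of _ "tens (S v) (T f)"]) (simp add: cinner_tens S_adj T_adj)
  qed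
  then have "\<forall>h. \<exists>y. \<forall>v f. cinner y (tens v f) = cinner h (tens (S' v) (T' f))" by blast
  from choice[OF this] obtain U where U: "\<And>h v f. cinner (U h) (tens v f) = cinner h (tens (S' v) (T' f))"
    by blast
  have eqI: "y = y'" if "\<And>v f. cinner y (tens v f) = cinner y' (tens v f)" for y y'
    using tensor_orthogonal[of "y - y'"] that by (simp add: cinner_simps)
  have "clinear U"
    by (rule clinearI; rule eqI) (simp_all add: U cinner_simps)
  moreover have "U (tens v f) = tens (S v) (T f)" for v f
    by (rule eqI) (simp add: U cinner_tens S_adj T_adj)
  ultimately have "\<exists>!U. clinear U \<and> (\<forall>v f. U (tens v f) = tens (S v) (T f))"
  proof (intro ex1I[of _ U])
    fix U' assume U': "clinear U' \<and> (\<forall>v f. U' (tens v f) = tens (S v) (T f))"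
    show "U' = U"
    proof (rule ext, rule tensor_ext[where U = U' and U' = U])
      show "clinear U'" "clinear U" using U' \<open>clinear U\<close> by blast+
      show "U' (tens v f) = U (tens v f)" for v f
        using U' \<open>\<And>v f. U (tens v f) = tens (S v) (T f)\<close> by simp
    qed
  qed blast
  from theI'[OF this] show "clinear (tensor_op tens S T)" "tensor_op tens S T (tens v f) = tens (S v) (T f)"
    unfolding tensor_op_def by blast+
qed

lemma tensor_op_adjoint:
  assumes S: "adjoint_pair S S'" and T: "adjoint_pair T T'"
  shows "cinner (tensor_op tens S T x) y = cinner x (tensor_op tens S' T' y)"
proof -
  note lin = tensor_op_linear[OF S T] tensor_op_linear[OF adjoint_pair_sym[OF S] adjoint_pair_sym[OF T]]
  have adj: "cinner (S u) v = cinner u (S' v)" "cinner (T a) b = cinner a (T' b)" for u v a b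
    using S T by (simp_all add: adjoint_pair_def)
  have 1: "cinner (tensor_op tens S T (tens v f)) y = cinner (tens v f) (tensor_op tens S' T' y)" for v f
    by (rule tensor_induct[where h = y])
      (auto intro!: csubspace_Collect simp: clinear_simps[OF lin(1)] clinear_simps[OF lin(2)] cinner_simps cinner_tens adj
        tensor_op_tens[OF S T] tensor_op_tens[OF adjoint_pair_sym[OF S] adjoint_pair_sym[OF T]])
  show ?thesis
    by (rule tensor_induct[where h = x])
      (auto intro!: csubspace_Collect simp: 1 clinear_simps[OF lin(1)] cinner_simps)
qed

end

section \<open>Currents and fermions acting on the tensor product\<close>

locale boson_fermion_tensor =
  boson: affine_vacuum_representation \<Gamma> level X vac_plus +
  fermion: neveu_schwarz_fermions \<psi> vac_minus +
  prehilbert_tensor tens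
  for \<Gamma> :: "'i::finite \<Rightarrow> 'i \<Rightarrow> 'i \<Rightarrow> real" and level :: nat
    and X :: "'i \<Rightarrow> int \<Rightarrow> 'v::complex_prehilbert \<Rightarrow> 'v" and vac_plus :: 'v
    and \<psi> :: "'i \<Rightarrow> rat \<Rightarrow> 'f::complex_prehilbert \<Rightarrow> 'f" and vac_minus :: 'f
    and tens :: "'v \<Rightarrow> 'f \<Rightarrow> 'h::complex_prehilbert"
begin

abbreviation XX :: "'i \<Rightarrow> 'h fld" where "XX \<equiv> boson_field tens X"
abbreviation PSI :: "'i \<Rightarrow> 'h fld" where "PSI \<equiv> fermion_field tens \<psi>"
abbreviation \<Omega> :: 'h where "\<Omega> \<equiv> tens vac_plus vac_minus"

abbreviation fmode :: "'i \<Rightarrow> int \<Rightarrow> 'f \<Rightarrow> 'f"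
  where "fmode a n \<equiv> \<psi> a (of_int n + 1/2)"

lemma half_integer: "of_int n + 1/2 \<in> half_integers"
  by (simp add: half_integers_def)

lemmas fmode_linear = fermion.psi_linear[OF half_integer]
lemmas fmode_simps = clinear_simps[OF fmode_linear]

lemma fmode_anticommutator:
  "fmode a m (fmode b n v) + fmode b n (fmode a m v) = (if a = b \<and> m + n + 1 = 0 then v else 0)"
proof -
  have "(of_int m + 1/2) + (of_int n + 1/2) = (of_int (m + n + 1) :: rat)" by simp
  then have "(of_int m + 1/2) + (of_int n + 1/2) = (0::rat) \<longleftrightarrow> m + n + 1 = 0"
    by (simp only: of_int_eq_0_iff)
  then show ?thesis
    using fermion.psi_anticommutator[OF half_integer half_integer, of a m b n v] by (simp only:)
qed

lemma fmode_adjoint: "cinner (fmode a n u) v = cinner u (fmode a (- n - 1) v)"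
proof -
  have "- (of_int n + 1/2) = (of_int (- n - 1) + 1/2 :: rat)" by simp
  then show ?thesis using fermion.psi_adjoint[OF half_integer, of a n u v] by (simp only:)
qed

lemma fmode_vacuum: "n \<ge> 0 \<Longrightarrow> fmode a n vac_minus = 0"
  by (rule fermion.psi_vac[OF half_integer]) (simp add: add_nonneg_pos)

lemma fmode_invariant_UNIV:
  assumes "csubspace W" "w \<in> W" "w \<noteq> 0" "\<And>a n f. f \<in> W \<Longrightarrow> fmode a n f \<in> W"
  shows "W = UNIV"
proof -
  have "\<psi> a m ` W \<subseteq> W" if m: "m \<in> half_integers" for a m
  proof -
    obtain n where "m - 1/2 = of_int n" using m by (auto simp: half_integers_def Ints_def)
    then have "m = of_int n + 1/2" by (simp add: algebra_simps)
    then show ?thesis using assms(4) by blast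
  qed
  then show ?thesis
    using fermion.psi_irreducible assms(1-3) unfolding acts_irreducibly_def by blast
qed

lemma X_vacuum: "n \<ge> 0 \<Longrightarrow> X a n vac_plus = 0"
proof -
  have "vac_plus \<in> cspan {vac_plus}" by (simp add: complex_vector.span_base)
  then show "n \<ge> 0 \<Longrightarrow> X a n vac_plus = 0"
    using boson.trivial[of a] unfolding boson.lowest_energy[symmetric] by (cases "n = 0") auto
qed

lemma X_adjoint_pair: "adjoint_pair (X a n) (X a (- n))"
  by (simp add: adjoint_pair_def boson.X_linear boson.X_adjoint)

lemma fmode_adjoint_pair: "adjoint_pair (fmode a n) (fmode a (- n - 1))"
  unfolding adjoint_pair_def using fmode_linear fmode_adjoint by blast

lemma XX_linear: "clinear (XX a n)" and XX_tens: "XX a n (tens v f) = tens (X a n v) f"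
  using tensor_op_linear[OF X_adjoint_pair adjoint_pair_id, of a n] tensor_op_tens[OF X_adjoint_pair adjoint_pair_id, of a n v f]
  by (simp_all add: boson_field_def)

lemma PSI_linear: "clinear (PSI a n)" and PSI_tens: "PSI a n (tens v f) = tens v (fmode a n f)"
  using tensor_op_linear[OF adjoint_pair_id fmode_adjoint_pair, of a n] tensor_op_tens[OF adjoint_pair_id fmode_adjoint_pair, of a n v f]
  by (simp_all add: fermion_field_def fermion_op_def)

lemmas XX_simps = clinear_simps[OF XX_linear]
lemmas PSI_simps = clinear_simps[OF PSI_linear]

lemma XX_adjoint: "cinner (XX a n u) v = cinner u (XX a (- n) v)"
  unfolding boson_field_def by (rule tensor_op_adjoint[OF X_adjoint_pair adjoint_pair_id])

lemma PSI_adjoint: "cinner (PSI a n u) v = cinner u (PSI a (- n - 1) v)"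
  unfolding fermion_field_def fermion_op_def by (rule tensor_op_adjoint[OF adjoint_pair_id fmode_adjoint_pair])

lemma XX_commutator: "XX a m (XX b n h) = XX b n (XX a m h) +
    \<i> *\<^sub>C (\<Sum>c\<in>UNIV. complex_of_real (\<Gamma> a b c) *\<^sub>C XX c (m + n) h)
    + (if a = b \<and> m + n = 0 then of_int m * of_nat level else 0) *\<^sub>C h"
proof -
  define s where "s = (if a = b \<and> m + n = 0 then of_int m * of_nat level else (0::complex))"
  have eq: "X a m (X b n v) = X b n (X a m v) + \<i> *\<^sub>C (\<Sum>c\<in>UNIV. complex_of_real (\<Gamma> a b c) *\<^sub>C X c (m + n) v) + s *\<^sub>C v" for v
    using boson.X_commutator[of a m b n v] unfolding s_def[symmetric] by (simp add: algebra_simps)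
  have "XX a m (XX b n h) = XX b n (XX a m h) + \<i> *\<^sub>C (\<Sum>c\<in>UNIV. complex_of_real (\<Gamma> a b c) *\<^sub>C XX c (m + n) h) + s *\<^sub>C h"
  proof (rule tensor_ext[where U = "\<lambda>h. XX a m (XX b n h)" and U' = "\<lambda>h. XX b n (XX a m h)
      + \<i> *\<^sub>C (\<Sum>c\<in>UNIV. complex_of_real (\<Gamma> a b c) *\<^sub>C XX c (m + n) h) + s *\<^sub>C h"])
    show "clinear (\<lambda>h. XX a m (XX b n h))" by (rule clinearI) (simp_all add: XX_simps)
    show "clinear (\<lambda>h. XX b n (XX a m h) + \<i> *\<^sub>C (\<Sum>c\<in>UNIV. complex_of_real (\<Gamma> a b c) *\<^sub>C XX c (m + n) h) + s *\<^sub>C h)"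
      by (rule clinearI)
        (simp_all add: XX_simps cscale_add_right cscale_cscale sum.distrib complex_vector.scale_sum_right mult.left_commute mult.commute)
    show "XX a m (XX b n (tens v f)) = XX b n (XX a m (tens v f))
        + \<i> *\<^sub>C (\<Sum>c\<in>UNIV. complex_of_real (\<Gamma> a b c) *\<^sub>C XX c (m + n) (tens v f)) + s *\<^sub>C tens v f" for v f
      unfolding XX_tens eq by (simp add: tens_left_simps)
  qed
  then show ?thesis by (simp only: s_def)
qed

lemma PSI_anticommutator: "PSI a m (PSI b n h) + PSI b n (PSI a m h) = (if a = b \<and> m + n + 1 = 0 then h else 0)"
proof (rule tensor_ext[where U = "\<lambda>h. PSI a m (PSI b n h) + PSI b n (PSI a m h)"
      and U' = "\<lambda>h. if a = b \<and> m + n + 1 = 0 then h else 0"])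
  show "clinear (\<lambda>h. PSI a m (PSI b n h) + PSI b n (PSI a m h))"
    "clinear (\<lambda>h. if a = b \<and> m + n + 1 = 0 then h else 0)"
    by (rule clinearI; simp add: PSI_simps cscale_add_right)+
  show "PSI a m (PSI b n (tens v f)) + PSI b n (PSI a m (tens v f)) = (if a = b \<and> m + n + 1 = 0 then tens v f else 0)" for v f
    unfolding PSI_tens tens_right_simps(1)[symmetric] fmode_anticommutator by (simp add: tens_right_simps)
qed

lemma XX_PSI: "XX a m (PSI b n h) = PSI b n (XX a m h)"
  by (rule tensor_induct[where h = h])
    (auto intro!: csubspace_Collect simp: XX_simps PSI_simps XX_tens PSI_tens)

section \<open>Fock vectors and the fermionic vacuum sector\<close>

inductive fock :: "'f \<Rightarrow> bool"
  where fock_vacuum: "fock vac_minus"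
  | fock_mode: "fock f \<Longrightarrow> n < 0 \<Longrightarrow> fock (fmode a n f)"

lemma vac_minus_nonzero: "vac_minus \<noteq> 0"
  using fermion.vac_unit by (auto simp: cinner_simps)

lemma fock_span: "cspan (Collect fock) = UNIV"
proof -
  have neg: "fmode a n f \<in> cspan (Collect fock)" if "f \<in> cspan (Collect fock)" "n < 0" for a n f
    using that(1)
  proof (rule cspan_induct)
    show "csubspace {f. fmode a n f \<in> cspan (Collect fock)}"
      by (rule csubspace_Collect) (simp_all add: fmode_simps complex_vector.span_zero complex_vector.span_add complex_vector.span_scale)
    show "fmode a n f \<in> cspan (Collect fock)" if "f \<in> Collect fock" for f
      using that \<open>n < 0\<close> by (intro complex_vector.span_base) (simp add: fock_mode)
  qed
  have "\<forall>a n. fmode a n f \<in> cspan (Collect fock)" if "fock f" for f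
    using that
  proof induction
    case fock_vacuum
    have "vac_minus \<in> cspan (Collect fock)"
      by (intro complex_vector.span_base) (simp add: fock.fock_vacuum)
    then show ?case
      using neg fmode_vacuum complex_vector.span_zero by (metis linorder_not_less)
  next
    case (fock_mode f n b)
    show ?case
    proof (intro allI)
      fix a m
      have "fmode a m (fmode b n f) = (if a = b \<and> m + n + 1 = 0 then f else 0) - fmode b n (fmode a m f)"
        using fmode_anticommutator[of a m b n f] by (simp only: eq_diff_eq)
      moreover have "f \<in> cspan (Collect fock)"
        using fock_mode.hyps(1) by (intro complex_vector.span_base) simp
      moreover have "fmode b n (fmode a m f) \<in> cspan (Collect fock)"
        using neg fock_mode by blast
      ultimately show "fmode a m (fmode b n f) \<in> cspan (Collect fock)"
        by (simp only:) (rule complex_vector.span_diff, simp_all add: complex_vector.span_zero)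
    qed
  qed
  then have inv: "fmode a n f \<in> cspan (Collect fock)" if "f \<in> cspan (Collect fock)" for a n f
    using that
    by (intro cspan_induct[where P = "\<lambda>f. fmode a n f \<in> cspan (Collect fock)", OF that])
      (auto intro!: csubspace_Collect simp: fmode_simps complex_vector.span_zero complex_vector.span_add complex_vector.span_scale)
  show ?thesis
    by (rule fmode_invariant_UNIV[OF _ _ vac_minus_nonzero inv])
      (auto intro: complex_vector.span_base fock.fock_vacuum)
qed

lemma PSI_truncated: "\<exists>N. \<forall>n\<ge>N. \<forall>a. PSI a n h = 0"
proof -
  have add: "\<exists>N. \<forall>n\<ge>N. \<forall>a. A a n (x + y) = 0"
    if xy: "\<exists>N. \<forall>n\<ge>N. \<forall>a. A a n x = 0" "\<exists>N. \<forall>n\<ge>N. \<forall>a. A a n y = 0" and lin: "\<And>a n. clinear (A a n)"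
    for A :: "'i \<Rightarrow> int \<Rightarrow> 'c::complex_vector \<Rightarrow> 'c" and x y
  proof -
    obtain N M where "\<forall>n\<ge>N. \<forall>a. A a n x = 0" "\<forall>n\<ge>M. \<forall>a. A a n y = 0" using xy by blast
    then show ?thesis by (intro exI[of _ "max N M"]) (simp add: clinear_add[OF lin])
  qed
  have "\<exists>N. \<forall>n\<ge>N. \<forall>a. fmode a n f = 0" for f
  proof (rule cspan_UNIV_induct[where x = f, OF fock_span])
    show "csubspace {f. \<exists>N. \<forall>n\<ge>N. \<forall>a. fmode a n f = 0}"
    proof (rule csubspace_Collect)
      show "\<exists>N. \<forall>n\<ge>N. \<forall>a. fmode a n (x + y) = 0"
        if "\<exists>N. \<forall>n\<ge>N. \<forall>a. fmode a n x = 0" "\<exists>N. \<forall>n\<ge>N. \<forall>a. fmode a n y = 0" for x y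
        by (rule add[OF that fmode_linear])
    qed (auto simp: fmode_simps)
    fix f assume "f \<in> Collect fock"
    then have "fock f" by simp
    then show "\<exists>N. \<forall>n\<ge>N. \<forall>a. fmode a n f = 0"
    proof induction
      case fock_vacuum
      then show ?case using fmode_vacuum by blast
    next
      case (fock_mode f m b)
      then obtain N where N: "\<And>n a. n \<ge> N \<Longrightarrow> fmode a n f = 0" by blast
      have "fmode a n (fmode b m f) = 0" if "n \<ge> max N (- m)" for a n
      proof -
        have "m + n + 1 \<noteq> 0" "n \<ge> N" using that by auto
        then show ?thesis
          using fmode_anticommutator[of a n b m f] N by (simp add: fmode_simps add.commute)
      qed
      then show ?case by blast
    qed
  qed
  note fin = this
  show ?thesis
  proof (rule tensor_induct[where h = h])
    show "csubspace {h. \<exists>N. \<forall>n\<ge>N. \<forall>a. PSI a n h = 0}"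
    proof (rule csubspace_Collect)
      show "\<exists>N. \<forall>n\<ge>N. \<forall>a. PSI a n (x + y) = 0"
        if "\<exists>N. \<forall>n\<ge>N. \<forall>a. PSI a n x = 0" "\<exists>N. \<forall>n\<ge>N. \<forall>a. PSI a n y = 0" for x y
        by (rule add[OF that PSI_linear])
    qed (auto simp: PSI_simps)
    show "\<exists>N. \<forall>n\<ge>N. \<forall>a. PSI a n (tens v f) = 0" for v f
      using fin[of f] by (simp add: PSI_tens) (metis tens_right_simps(3))
  qed
qed

text \<open>Let Q project onto the fermionic vacuum sector. The remainder w - Q w is killed by the
  annihilation modes, hence orthogonal to every Fock vector that begins with a creation mode; it is
  orthogonal to the vacuum sector because Q is symmetric. So it is zero.\<close>

lemma fermion_vacuum_vectors:
  assumes w: "\<And>a n. n \<ge> 0 \<Longrightarrow> PSI a n w = 0"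
  obtains v where "w = tens v vac_minus"
proof -
  define Q where "Q = tensor_op tens id (\<lambda>f. cinner f vac_minus *\<^sub>C vac_minus)"
  note Q_pair = adjoint_pair_id adjoint_pair_projection[of vac_minus]
  have Q_linear: "clinear Q" and Q_tens: "Q (tens v f) = cinner f vac_minus *\<^sub>C tens v vac_minus" for v f
    using tensor_op_linear[OF Q_pair] tensor_op_tens[OF Q_pair, of v f] by (simp_all add: Q_def tens_right_simps)
  have Q_range: "\<exists>v. Q h = tens v vac_minus" for h
  proof (rule tensor_induct[where h = h])
    show "csubspace {h. \<exists>v. Q h = tens v vac_minus}"
      by (rule csubspace_Collect)
        (auto simp: clinear_simps[OF Q_linear], metis tens_left_simps(3), metis tens_left_simps(1), metis tens_left_simps(2))
    show "\<exists>v'. Q (tens v f) = tens v' vac_minus" for v f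
      unfolding Q_tens by (metis tens_left_simps(2))
  qed
  define u where "u = w - Q w"
  have u: "PSI a n u = 0" if "n \<ge> 0" for a n
  proof -
    obtain v where "Q w = tens v vac_minus" using Q_range by blast
    then show ?thesis
      using that by (simp add: u_def PSI_simps w PSI_tens fmode_vacuum tens_right_simps)
  qed
  have "\<forall>v. cinner u (tens v f) = 0" for f
  proof (rule cspan_UNIV_induct[where x = f, OF fock_span])
    show "csubspace {f. \<forall>v. cinner u (tens v f) = 0}"
      by (rule csubspace_Collect) (auto simp: tens_right_simps cinner_simps)
    fix f assume "f \<in> Collect fock"
    then have "fock f" by simp
    then show "\<forall>v. cinner u (tens v f) = 0"
    proof cases
      case fock_vacuum
      have "cinner (Q w) (tens v vac_minus) = cinner w (tens v vac_minus)" for v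
        using tensor_op_adjoint[OF Q_pair, of w "tens v vac_minus"] Q_tens[of v vac_minus]
        by (simp add: Q_def fermion.vac_unit cscale_one)
      then show ?thesis by (simp add: fock_vacuum u_def cinner_simps)
    next
      case (fock_mode f' n a)
      have "cinner u (tens v f) = cinner (PSI a (- n - 1) u) (tens v f')" for v
        by (simp add: PSI_adjoint PSI_tens fock_mode(1))
      then show ?thesis using fock_mode(3) by (simp add: u cinner_simps)
    qed
  qed
  then have "u = 0" by (intro tensor_orthogonal) blast
  then show ?thesis using Q_range[of w] that by (auto simp: u_def)
qed

lemma tens_vac_minus_eq_0: "tens v vac_minus = 0 \<longleftrightarrow> v = 0"
proof
  assume "tens v vac_minus = 0"
  then have "cinner v v * cinner vac_minus vac_minus = 0"
    using cinner_tens[of v vac_minus v vac_minus] by (simp add: cinner_simps)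
  then show "v = 0" by (simp add: fermion.vac_unit cinner_eq_zero_iff)
qed (simp add: tens_left_simps)

lemma vacuum_unique:
  assumes "\<And>a n. n \<ge> 0 \<Longrightarrow> XX a n w = 0" "\<And>a n. n \<ge> 0 \<Longrightarrow> PSI a n w = 0"
  shows "w \<in> cspan {\<Omega>}"
proof -
  obtain v where v: "w = tens v vac_minus" using fermion_vacuum_vectors assms(2) by blast
  have "X a n v = 0" if "n > 0" for a n
    using assms(1)[of n a] that by (simp add: v XX_tens tens_vac_minus_eq_0)
  then have "v \<in> cspan {vac_plus}" using boson.lowest_energy by blast
  then obtain c where "v = c *\<^sub>C vac_plus" by (auto simp: complex_vector.span_singleton)
  then show ?thesis by (auto simp: v tens_left_simps complex_vector.span_singleton)
qed

text \<open>\<open>PSI a n \<circ> PSI a (-n-1)\<close> projects onto the kernel of \<open>PSI a n\<close> and fixes all pairings with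
  vectors of lowest fermionic energy.\<close>

lemma fermion_vacuum_in_invariant:
  assumes W: "\<And>a n w. w \<in> W \<Longrightarrow> PSI a n w \<in> W" and w: "w \<in> W" "cinner w (tens v vac_minus) \<noteq> 0"
  obtains w' where "w' \<in> W" "w' \<noteq> 0" "\<And>a n. n \<ge> 0 \<Longrightarrow> PSI a n w' = 0"
proof -
  obtain N where N: "\<And>n a. n \<ge> N \<Longrightarrow> PSI a n w = 0" using PSI_truncated[of w] by blast
  \<comment> \<open>Modes from N on already kill w, so finitely many pairs (a, n) remain and are
    treated one projection at a time; the nonzero pairing shows that the vector does not vanish on
    the way.\<close>
  have "\<exists>w'\<in>W. cinner w' (tens v vac_minus) \<noteq> 0 \<and> (\<forall>n a. n \<ge> 0 \<longrightarrow> n \<ge> N \<or> (a, n) \<in> A \<longrightarrow> PSI a n w' = 0)"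
    if "finite A" for A
    using that
  proof induction
    case empty
    then show ?case using w N by blast
  next
    case (insert p A)
    obtain b m where p: "p = (b, m)" by (cases p)
    from insert.IH obtain w' where w': "w' \<in> W" "cinner w' (tens v vac_minus) \<noteq> 0"
      "\<And>n a. n \<ge> 0 \<Longrightarrow> n \<ge> N \<or> (a, n) \<in> A \<Longrightarrow> PSI a n w' = 0" by blast
    show ?case
    proof (cases "m \<ge> 0")
      case True
      define w'' where "w'' = PSI b m (PSI b (- m - 1) w')"
      have anti: "PSI a n (PSI b k x) = (if a = b \<and> n + k + 1 = 0 then x else 0) - PSI b k (PSI a n x)" for a n k x
        using PSI_anticommutator[of a n b k x] by (simp only: eq_diff_eq)
      have sq: "PSI b m (PSI b m x) = 0" for x
      proof -
        have "PSI b m (PSI b m x) + PSI b m (PSI b m x) = 0"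
          using PSI_anticommutator[of b m b m x] True by simp
        then have "(2::complex) *\<^sub>C PSI b m (PSI b m x) = 0"
          by (metis cscale_add_left cscale_one one_add_one)
        then show ?thesis by simp
      qed
      have "w'' \<in> W" using W w' by (simp add: w''_def)
      moreover have "cinner w'' (tens v vac_minus) = cinner w' (tens v vac_minus)"
      proof -
        have "cinner w'' (tens v vac_minus) = cinner w' (PSI b m (PSI b (- m - 1) (tens v vac_minus)))"
          by (simp add: w''_def PSI_adjoint)
        also have "PSI b m (PSI b (- m - 1) (tens v vac_minus)) = tens v vac_minus"
          using True by (simp add: anti PSI_tens[of b m] fmode_vacuum tens_right_simps PSI_simps)
        finally show ?thesis .
      qed
      moreover have "PSI a n w'' = 0" if n: "n \<ge> 0" "n \<ge> N \<or> (a, n) \<in> insert p A" for n a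
      proof (cases "(a, n) = (b, m)")
        case False
        then have "PSI a n w' = 0" using w'(3) n p by blast
        then show ?thesis
          using False n True by (auto simp: w''_def anti[of a n] PSI_simps)
      qed (simp add: w''_def sq)
      ultimately show ?thesis using w'(2) by metis
    next
      case False
      then have "n \<ge> N \<or> (a, n) \<in> A" if "n \<ge> 0" "n \<ge> N \<or> (a, n) \<in> insert p A" for n a
        using that p by auto
      then show ?thesis using w' by blast
    qed
  qed
  from this[of "UNIV \<times> {0..N}"] obtain w' where "w' \<in> W" "cinner w' (tens v vac_minus) \<noteq> 0"
    "\<And>n a. n \<ge> 0 \<Longrightarrow> n \<ge> N \<or> n \<le> N \<Longrightarrow> PSI a n w' = 0" by auto
  then show ?thesis
    using that[of w'] by (metis cinner_zero_left linorder_linear)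
qed

text \<open>A nonzero invariant subspace meets the fermionic vacuum sector in some nonzero v0
  \<otimes> vac_minus. Irreducibility of the bosonic factor then fills that sector, and
  irreducibility of the fermionic factor fills the rest.\<close>

lemma modes_irreducible: "acts_irreducibly ({XX a n | a n. True} \<union> {PSI a n | a n. True})"
  unfolding acts_irreducibly_def
proof (intro conjI allI impI)
  have "vac_plus \<noteq> 0" using boson.vac_unit by (auto simp: cinner_simps)
  then have "\<Omega> \<noteq> 0" by (simp add: tens_vac_minus_eq_0)
  then show "(UNIV :: 'h set) \<noteq> {0}" by blast
  fix W :: "'h set"
  assume "csubspace W \<and> (\<forall>T\<in>{XX a n | a n. True} \<union> {PSI a n | a n. True}. T ` W \<subseteq> W)"
  then have W: "csubspace W" "\<And>a n w. w \<in> W \<Longrightarrow> XX a n w \<in> W" "\<And>a n w. w \<in> W \<Longrightarrow> PSI a n w \<in> W"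
    by blast+
  have "W = UNIV" if "W \<noteq> {0}"
  proof -
    have "\<exists>w\<in>W. w \<noteq> 0"
    proof (rule ccontr)
      assume "\<not> (\<exists>w\<in>W. w \<noteq> 0)"
      then have "W = {0}" using complex_vector.subspace_0[OF W(1)] by auto
      then show False using that by blast
    qed
    then obtain w where w: "w \<in> W" "w \<noteq> 0" by blast
    \<comment> \<open>Otherwise creation modes, moved onto W as annihilation modes, show that W is
      orthogonal to all tensors with a Fock vector, hence to everything.\<close>
    have "\<exists>w'\<in>W. \<exists>v. cinner w' (tens v vac_minus) \<noteq> 0"
    proof (rule ccontr)
      assume "\<not> ?thesis"
      then have vac: "cinner w' (tens v vac_minus) = 0" if "w' \<in> W" for w' v using that by blast
      have "\<forall>v. \<forall>w'\<in>W. cinner w' (tens v f) = 0" for f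
      proof (rule cspan_UNIV_induct[where x = f, OF fock_span])
        show "csubspace {f. \<forall>v. \<forall>w'\<in>W. cinner w' (tens v f) = 0}"
          by (rule csubspace_Collect) (auto simp: tens_right_simps cinner_simps)
        fix f assume "f \<in> Collect fock"
        then have "fock f" by simp
        then show "\<forall>v. \<forall>w'\<in>W. cinner w' (tens v f) = 0"
        proof induction
          case (fock_mode f n a)
          have "cinner w' (tens v (fmode a n f)) = cinner (PSI a (- n - 1) w') (tens v f)" for v w'
            by (simp add: PSI_adjoint PSI_tens)
          then show ?case using fock_mode W(3) by simp
        qed (use vac in blast)
      qed
      then have "w = 0" using w(1) by (intro tensor_orthogonal) blast
      then show False using w(2) by blast
    qed
    then obtain w' where w': "w' \<in> W" "w' \<noteq> 0" "\<And>a n. n \<ge> 0 \<Longrightarrow> PSI a n w' = 0"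
      using fermion_vacuum_in_invariant[of W] W(3) by metis
    then obtain v0 where v0: "w' = tens v0 vac_minus" using fermion_vacuum_vectors by blast
    have "{v. tens v vac_minus \<in> W} = UNIV"
    proof -
      have "csubspace {v. tens v vac_minus \<in> W}"
        using W(1) by (intro csubspace_Collect)
          (simp_all add: tens_left_simps complex_vector.subspace_0 complex_vector.subspace_add complex_vector.subspace_scale)
      moreover have "\<forall>T\<in>{X a n | a n. True}. T ` {v. tens v vac_minus \<in> W} \<subseteq> {v. tens v vac_minus \<in> W}"
        using W(2) by (auto simp: XX_tens[symmetric])
      moreover have "{v. tens v vac_minus \<in> W} \<noteq> {0}"
        using w' v0 by (auto simp: tens_vac_minus_eq_0)
      ultimately show ?thesis using boson.X_irreducible unfolding acts_irreducibly_def by blast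
    qed
    then have vac: "tens v vac_minus \<in> W" for v by blast
    have "{f. \<forall>v. tens v f \<in> W} = UNIV"
    proof (rule fmode_invariant_UNIV[OF _ _ vac_minus_nonzero])
      show "csubspace {f. \<forall>v. tens v f \<in> W}"
        using W(1) by (intro csubspace_Collect)
          (simp_all add: tens_right_simps complex_vector.subspace_0 complex_vector.subspace_add complex_vector.subspace_scale)
      show "vac_minus \<in> {f. \<forall>v. tens v f \<in> W}" using vac by blast
      show "fmode a n f \<in> {f. \<forall>v. tens v f \<in> W}" if "f \<in> {f. \<forall>v. tens v f \<in> W}" for a n f
        using that W(3) by (simp add: PSI_tens[symmetric])
    qed
    then have "tens v f \<in> W" for v f by blast
    then show "W = UNIV"
      using W(1) by (auto intro: tensor_induct)
  qed
  then show "W = {0} \<or> W = UNIV" by blast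
qed

lemma current_fermion_space:
  assumes "\<And>a b c. \<Gamma> a b c = - \<Gamma> b a c" "\<And>a b c. \<Gamma> a b c = - \<Gamma> a c b"
    and "\<And>b d. complex_of_real (\<Sum>a\<in>UNIV. \<Sum>c\<in>UNIV. \<Gamma> a b c * \<Gamma> a d c) = (if b = d then 2 * g else 0)"
    and "of_nat level + g \<noteq> 0"
  shows "current_fermion_space \<Gamma> level g XX PSI \<Omega>"
proof (rule current_fermion_space.intro)
  show "XX a n \<Omega> = 0" "PSI a n \<Omega> = 0" if "n \<ge> 0" for a n
    using that by (simp_all add: XX_tens PSI_tens X_vacuum fmode_vacuum tens_left_simps tens_right_simps)
  show "v \<in> cspan {\<Omega>}" if "\<And>a n. n \<ge> 0 \<Longrightarrow> XX a n v = 0" "\<And>a n. n \<ge> 0 \<Longrightarrow> PSI a n v = 0" for v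
    using that by (rule vacuum_unique)
  show "cinner \<Omega> \<Omega> = 1" by (simp add: cinner_tens boson.vac_unit fermion.vac_unit)
qed (fact XX_linear PSI_linear XX_commutator PSI_anticommutator XX_PSI XX_adjoint PSI_adjoint modes_irreducible
    assms)+

end

theorem corollary4p37:
  fixes br :: "'g::complex_vector \<Rightarrow> 'g \<Rightarrow> 'g"
    and \<kappa> :: "'g \<Rightarrow> 'g \<Rightarrow> complex"
    and \<hh> P :: "'g set"
    and \<theta> :: 'g
    and g :: complex
    and x :: "'i::finite \<Rightarrow> 'g"
    and \<Gamma> :: "'i \<Rightarrow> 'i \<Rightarrow> 'i \<Rightarrow> real"
    and level :: nat
    and X :: "'i \<Rightarrow> int \<Rightarrow> 'v::complex_prehilbert \<Rightarrow> 'v"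
    and vac_plus :: 'v
    and \<psi> :: "'i \<Rightarrow> rat \<Rightarrow> 'f::complex_prehilbert \<Rightarrow> 'f"
    and vac_minus :: 'f
    and tens :: "'v \<Rightarrow> 'f \<Rightarrow> 'h::complex_prehilbert"
    and XX PSI S B :: "'i \<Rightarrow> 'h fld"
    and G :: "('h fld \<times> bit) set"
    and V :: "'h \<Rightarrow> 'h fld"
    and \<Omega> \<omega> :: 'h
    and D :: nat
  assumes "simple_lie_algebra br"
    and "invariant_form br \<kappa>"
    and "cartan_subalgebra br \<hh>"
    and "positive_system (roots br \<kappa> \<hh>) P"
    and "highest_root (roots br \<kappa> \<hh>) P \<theta>"
    and "normalized_basis br \<kappa> \<theta> x \<Gamma>"
    and "g = dual_coxeter_number \<kappa> P \<theta>"
    and "D = complex_vector.dim (UNIV :: 'g set)"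
    and "affine_vacuum_representation \<Gamma> level X vac_plus"
    and "neveu_schwarz_fermions \<psi> vac_minus"
    and "prehilbert_tensor tens"
    and "\<Omega> = tens vac_plus vac_minus"
    and "XX = boson_field tens X"
    and "PSI = fermion_field tens \<psi>"
    and "S = fermion_current \<Gamma> PSI"
    and "B = (\<lambda>a. XX a + S a)"
    and "G = {(PSI a, 1) | a. True} \<union> {(B a, 0) | a. True}"
    and "V = inv_into (generated_fields G) (creation \<Omega>)"
    and "\<omega> =
      (1/2) *\<^sub>C (\<Sum>a\<in>UNIV. fermion_op tens \<psi> a (-3/2) (fermion_op tens \<psi> a (-1/2) \<Omega>))
      + (1 / (2 * (of_nat level + g))) *\<^sub>C (\<Sum>a\<in>UNIV. XX a (-1) (XX a (-1) \<Omega>))"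
  shows "(\<forall>a. S a \<in> generated_part G 0 \<and> XX a \<in> generated_part G 0 \<and> XX a = B a - S a) \<and>
    bij_betw (creation \<Omega>) (generated_fields G) UNIV \<and>
    vertex_operator_superalgebra (\<lambda>\<epsilon>. creation \<Omega> ` generated_part G \<epsilon>) V \<Omega> \<omega> \<and>
    central_charge \<omega> = of_nat D / 2 + of_nat level * of_nat D / (of_nat level + g) \<and>
    of_nat D / 2 + of_nat level * of_nat D / (of_nat level + g) =
      3/2 * ((of_nat level + g/3) / (of_nat level + g)) * of_nat D"
proof -
  note nb = assms(6)[unfolded normalized_basis_def]
  note casimir = structure_constants_casimir[OF assms(1-6), folded assms(7)]
  have D: "D = CARD('i)"
  proof -
    have "complex_vector.dim (UNIV :: 'g set) = card (range x)"
      using nb by (intro complex_vector.dim_eq_card[of "range x"]) simp_all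
    then show ?thesis using nb assms(8) by (simp add: card_image)
  qed
  \<comment> \<open>The level is a natural number and the real part of g is positive.\<close>
  have lg: "of_nat level + g \<noteq> 0"
  proof
    assume "of_nat level + g = 0"
    then have "Re (of_nat level + g) = 0" by simp
    then show False using casimir(2) by simp
  qed
  interpret bf: boson_fermion_tensor \<Gamma> level X vac_plus \<psi> vac_minus tens
    using assms(9-11) by (simp add: boson_fermion_tensor_def)
  interpret cf: current_fermion_space \<Gamma> level g XX PSI \<Omega>
    unfolding assms(12-14)
  proof (rule bf.current_fermion_space[OF _ _ casimir(1) lg])
    show "\<Gamma> a b c = - \<Gamma> b a c" "\<Gamma> a b c = - \<Gamma> a c b" for a b c using nb by blast+
  qed
  have SB: "cf.S = S" "cf.B = B" by (simp_all add: cf.S_def cf.B_def fun_eq_iff assms(15,16))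
  have G: "cf.G = G" by (simp add: cf.G_def SB assms(17))
  have V: "vertex_generators.V G \<Omega> = V" using cf.V_def unfolding G assms(18) by simp
  have \<omega>: "cf.\<omega> = \<omega>"
  proof -
    \<comment> \<open>Field modes and fermion indices differ by 1/2: -3/2 = -2 + 1/2 and -1/2 = -1 +
      1/2.\<close>
    have "fermion_op tens \<psi> a (- 3 / 2) = PSI a (- 2)" "fermion_op tens \<psi> a (- 1 / 2) = PSI a (- 1)" for a
      by (simp_all add: assms(14) fermion_field_def)
    then show ?thesis by (simp add: cf.\<omega>_def assms(19))
  qed
  have "of_nat D / 2 + of_nat level * of_nat D / (of_nat level + g) =
      3/2 * ((of_nat level + g/3) / (of_nat level + g)) * of_nat D"
  proof -
    define L where "L = of_nat level + g"
    have "L \<noteq> 0" using lg by (simp add: L_def)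
    moreover have l: "of_nat level = L - g" by (simp add: L_def)
    ultimately show ?thesis unfolding L_def[symmetric] l by (simp add: field_simps)
  qed
  moreover have "XX a = B a - S a" for a by (simp add: assms(16))
  ultimately show ?thesis
    using cf.G_generated(2,3) cf.creation_bij cf.vertex_operator_superalgebra cf.central_charge_\<omega>
    unfolding cf.creation_T G V \<omega> SB D by blast
qed

end
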